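(* The Parikh coverability problem is EXPTIME-complete for synchronous QDAS, and it is also EXPTIME-complete for synchronous concurrent QDAS.
   Context: A queue-dispatch asynchronous system (QDAS) $\mathcal A$ consists of: a finite data domain $\mathbb D$ with an initial value $d_0$; a finite set $\mathcal X$ of variables ranging over $\mathbb D$; disjoint finite sets $CQID$ (concurrent queues) and $SQID$ (serial queues); a finite set $\Gamma$ of blocks with a distinguished initial block $main$; and for each block $\gamma\in\Gamma$ a finite labelled transition system with state set $S_\gamma$, initial state $s^0_\gamma$, a distinguished final state $f_\gamma\in S_\gamma$, and transitions $\Delta_\gamma\subseteq S_\gamma\times\Sigma\times S_\gamma$. The state sets are pairwise disjoint and $S=\bigcup_\gamma S_\gamma$. The actions $\Sigma$ are: asynchronous dispatches $\mathrm{dispatch_a}(q,\gamma)$ and synchronous dispatches $\mathrm{dispatch_s}(q,\gamma)$ with $q\in CQID\cup SQID$, $\gamma\in\Gamma\setminus\{main\}$; guards (finite conjunctions of atoms $x=d$, $x\neq d$); and assignments $x\gets d$ ($x\in\mathcal X$, $d\in\mathbb D$). A configuration is a pair $(G,\mathbf d)$ of a valuation $\mathbf d:\mathcal X\to\mathbb D$ and a call-task graph $G$: a finite set of vertices, each being either a call vertex (a dispatched block waiting in a queue) or a task vertex (a running instance of a block), each labelled with a block $\lambda(v)$, the queue it was dispatched to (or a special identifier for $main$), and a state $state(v)\in S_{\lambda(v)}$ (call vertices carry the initial state of their block); the call vertices of each queue are ordered FIFO; and wait edges, where a wait edge $v\to w$ means $v$ is blocked until $w$ is removed. A task vertex is unblocked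 if it has no outgoing wait edge. The initial configuration has a single task vertex for $main$ in $s^0_{main}$ and all variables equal to $d_0$. Steps: an unblocked task vertex $v$ in state $s$ with $(s,a,s')\in\Delta_{\lambda(v)}$ moves to $s'$, where: a guard $a$ must be satisfied by $\mathbf d$; an assignment updates $\mathbf d$; $\mathrm{dispatch_a}(q,\gamma)$ appends a new call vertex for $\gamma$ at the end of queue $q$; $\mathrm{dispatch_s}(q,\gamma)$ does the same and adds a wait edge from $v$ to the new vertex. Scheduler steps: remove an unblocked task vertex $v$ with $state(v)=f_{\lambda(v)}$ (together with wait edges into it); turn the first call vertex of a concurrent queue into a task vertex; turn the first call vertex of a serial queue $q$ into a task vertex provided no task previously dequeued from $q$ is still present (so at most one task from a serial queue runs at a time). A configuration is reachable if it is obtained from the initial one by finitely many steps. The Parikh image $\mathrm{Parikh}(G):S\to\mathbb N$ maps $s$ to the number of vertices $v$ of $G$ with $state(v)=s$. The Parikh coverability problem: given a QDAS $\mathcal A$ and $f:S\to\mathbb N$, decide whether some reachable $(G,\mathbf d)$ satisfies $f(s)\le\mathrm{Parikh}(G)(s)$ for all $s\in S$. A QDAS is synchronous if no transition is labelled by an asynchronous dispatch; it is concurrent if $SQID=\emptyset$ and $CQID\neq\emptyset$. *)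

theory Defs
  imports Complex_Main "HOL-Computational_Algebra.Polynomial"
begin

section \<open>Queue-dispatch asynchronous systems\<close>

datatype ('x, 'd) atom = VarEq 'x 'd | VarNeq 'x 'd

text \<open>A guard is a finite conjunction, given by the list of its conjuncts.\<close>

datatype ('d, 'x, 'q, 'b) action =
    DispatchA 'q 'b
  | DispatchS 'q 'b
  | Guard "('x, 'd) atom list"
  | Assign 'x 'd

record ('d, 'x, 'q, 'b, 's) qdas =
  data_values :: "'d set"
  init_value :: 'd
  variables :: "'x set"
  cqid :: "'q set"
  sqid :: "'q set"
  blocks :: "'b set"
  main_block :: 'b
  block_states :: "'b \<Rightarrow> 's set"
  init_state :: "'b \<Rightarrow> 's"
  final_state :: "'b \<Rightarrow> 's"
  block_trans :: "'b \<Rightarrow> ('s \<times> ('d, 'x, 'q, 'b) action \<times> 's) set"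

definition all_states :: "('d, 'x, 'q, 'b, 's) qdas \<Rightarrow> 's set" where
  "all_states A = (\<Union>b\<in>blocks A. block_states A b)"

definition atoms :: "('d, 'x, 'q, 'b, 's) qdas \<Rightarrow> ('x, 'd) atom set" where
  "atoms A = {VarEq x d | x d. x \<in> variables A \<and> d \<in> data_values A} \<union>
             {VarNeq x d | x d. x \<in> variables A \<and> d \<in> data_values A}"

definition actions :: "('d, 'x, 'q, 'b, 's) qdas \<Rightarrow> ('d, 'x, 'q, 'b) action set" where
  "actions A =
     {DispatchA q b | q b. q \<in> cqid A \<union> sqid A \<and> b \<in> blocks A - {main_block A}} \<union>
     {DispatchS q b | q b. q \<in> cqid A \<union> sqid A \<and> b \<in> blocks A - {main_block A}} \<union>
     {Guard g | g. set g \<subseteq> atoms A} \<union>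
     {Assign x d | x d. x \<in> variables A \<and> d \<in> data_values A}"

definition is_qdas :: "('d, 'x, 'q, 'b, 's) qdas \<Rightarrow> bool" where
  "is_qdas A \<longleftrightarrow>
     finite (data_values A) \<and> init_value A \<in> data_values A \<and>
     finite (variables A) \<and>
     finite (cqid A) \<and> finite (sqid A) \<and> cqid A \<inter> sqid A = {} \<and>
     finite (blocks A) \<and> main_block A \<in> blocks A \<and>
     (\<forall>b\<in>blocks A.
        finite (block_states A b) \<and>
        init_state A b \<in> block_states A b \<and> final_state A b \<in> block_states A b \<and>
        finite (block_trans A b) \<and>
        block_trans A b \<subseteq> block_states A b \<times> actions A \<times> block_states A b) \<and>
     (\<forall>b\<in>blocks A. \<forall>b'\<in>blocks A. b \<noteq> b' \<longrightarrow> block_states A b \<inter> block_states A b' = {})"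

definition synchronous :: "('d, 'x, 'q, 'b, 's) qdas \<Rightarrow> bool" where
  "synchronous A \<longleftrightarrow> (\<forall>b\<in>blocks A. \<forall>s q b' s'. (s, DispatchA q b', s') \<notin> block_trans A b)"

definition concurrent :: "('d, 'x, 'q, 'b, 's) qdas \<Rightarrow> bool" where
  "concurrent A \<longleftrightarrow> sqid A = {} \<and> cqid A \<noteq> {}"


subsection \<open>Call-task graphs\<close>

text \<open>The call vertices are those occurring in some \<open>waiting\<close> list, whose head is the
  front of the queue. The queue label \<open>None\<close> is the special identifier carried by the task
  of the main block. The labels of non-vertices are irrelevant.\<close>

record ('q, 'b, 's) ctg =
  waiting :: "'q \<Rightarrow> nat list"
  tasks :: "nat set"
  block_of :: "nat \<Rightarrow> 'b"
  queue_of :: "nat \<Rightarrow> 'q option"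
  state_of :: "nat \<Rightarrow> 's"
  wait_edges :: "(nat \<times> nat) set"

definition calls :: "('q, 'b, 's) ctg \<Rightarrow> nat set" where
  "calls G = (\<Union>q. set (waiting G q))"

definition vertices :: "('q, 'b, 's) ctg \<Rightarrow> nat set" where
  "vertices G = calls G \<union> tasks G"

definition unblocked :: "('q, 'b, 's) ctg \<Rightarrow> nat \<Rightarrow> bool" where
  "unblocked G v \<longleftrightarrow> (\<forall>w. (v, w) \<notin> wait_edges G)"

definition parikh :: "('q, 'b, 's) ctg \<Rightarrow> 's \<Rightarrow> nat" where
  "parikh G s = card {v \<in> vertices G. state_of G v = s}"

definition set_state :: "nat \<Rightarrow> 's \<Rightarrow> ('q, 'b, 's) ctg \<Rightarrow> ('q, 'b, 's) ctg" where
  "set_state v s G = G\<lparr>state_of := (state_of G)(v := s)\<rparr>"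

definition add_call ::
  "('d, 'x, 'q, 'b, 's) qdas \<Rightarrow> nat \<Rightarrow> 'q \<Rightarrow> 'b \<Rightarrow> ('q, 'b, 's) ctg \<Rightarrow> ('q, 'b, 's) ctg" where
  "add_call A w q b G = G\<lparr>
     waiting := (waiting G)(q := waiting G q @ [w]),
     block_of := (block_of G)(w := b),
     queue_of := (queue_of G)(w := Some q),
     state_of := (state_of G)(w := init_state A b)\<rparr>"

definition add_wait :: "nat \<Rightarrow> nat \<Rightarrow> ('q, 'b, 's) ctg \<Rightarrow> ('q, 'b, 's) ctg" where
  "add_wait v w G = G\<lparr>wait_edges := insert (v, w) (wait_edges G)\<rparr>"

definition remove_task :: "nat \<Rightarrow> ('q, 'b, 's) ctg \<Rightarrow> ('q, 'b, 's) ctg" where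
  "remove_task v G = G\<lparr>
     tasks := tasks G - {v},
     wait_edges := {e \<in> wait_edges G. snd e \<noteq> v}\<rparr>"

definition dequeue :: "'q \<Rightarrow> ('q, 'b, 's) ctg \<Rightarrow> ('q, 'b, 's) ctg" where
  "dequeue q G = G\<lparr>
     waiting := (waiting G)(q := tl (waiting G q)),
     tasks := insert (hd (waiting G q)) (tasks G)\<rparr>"


subsection \<open>Configurations and steps\<close>

type_synonym ('d, 'x, 'q, 'b, 's) conf = "('q, 'b, 's) ctg \<times> ('x \<Rightarrow> 'd)"

primrec holds :: "('x \<Rightarrow> 'd) \<Rightarrow> ('x, 'd) atom \<Rightarrow> bool" where
  "holds \<rho> (VarEq x d) \<longleftrightarrow> \<rho> x = d"
| "holds \<rho> (VarNeq x d) \<longleftrightarrow> \<rho> x \<noteq> d"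

definition init_conf :: "('d, 'x, 'q, 'b, 's) qdas \<Rightarrow> ('d, 'x, 'q, 'b, 's) conf" where
  "init_conf A =
     (\<lparr>waiting = (\<lambda>q. []),
       tasks = {0},
       block_of = (\<lambda>v. main_block A),
       queue_of = (\<lambda>v. None),
       state_of = (\<lambda>v. init_state A (main_block A)),
       wait_edges = {}\<rparr>,
      \<lambda>x. init_value A)"

definition can_fire ::
  "('d, 'x, 'q, 'b, 's) qdas \<Rightarrow> ('q, 'b, 's) ctg \<Rightarrow> nat \<Rightarrow> ('d, 'x, 'q, 'b) action \<Rightarrow> 's \<Rightarrow> bool"
  where
  "can_fire A G v a s' \<longleftrightarrow>
     v \<in> tasks G \<and> unblocked G v \<and> (state_of G v, a, s') \<in> block_trans A (block_of G v)"

inductive qdas_step ::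
  "('d, 'x, 'q, 'b, 's) qdas \<Rightarrow> ('d, 'x, 'q, 'b, 's) conf \<Rightarrow> ('d, 'x, 'q, 'b, 's) conf \<Rightarrow> bool"
  for A where
  step_guard:
    "can_fire A G v (Guard g) s' \<Longrightarrow> (\<forall>a\<in>set g. holds \<rho> a) \<Longrightarrow>
     qdas_step A (G, \<rho>) (set_state v s' G, \<rho>)"
| step_assign:
    "can_fire A G v (Assign x d) s' \<Longrightarrow>
     qdas_step A (G, \<rho>) (set_state v s' G, \<rho>(x := d))"
| step_dispatch_async:
    "can_fire A G v (DispatchA q b) s' \<Longrightarrow> w \<notin> vertices G \<Longrightarrow>
     qdas_step A (G, \<rho>) (add_call A w q b (set_state v s' G), \<rho>)"
| step_dispatch_sync:
    "can_fire A G v (DispatchS q b) s' \<Longrightarrow> w \<notin> vertices G \<Longrightarrow>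
     qdas_step A (G, \<rho>) (add_wait v w (add_call A w q b (set_state v s' G)), \<rho>)"
| step_terminate:
    "v \<in> tasks G \<Longrightarrow> unblocked G v \<Longrightarrow> state_of G v = final_state A (block_of G v) \<Longrightarrow>
     qdas_step A (G, \<rho>) (remove_task v G, \<rho>)"
| step_dequeue_concurrent:
    "q \<in> cqid A \<Longrightarrow> waiting G q \<noteq> [] \<Longrightarrow>
     qdas_step A (G, \<rho>) (dequeue q G, \<rho>)"
| step_dequeue_serial:
    "q \<in> sqid A \<Longrightarrow> waiting G q \<noteq> [] \<Longrightarrow> (\<forall>u\<in>tasks G. queue_of G u \<noteq> Some q) \<Longrightarrow>
     qdas_step A (G, \<rho>) (dequeue q G, \<rho>)"

definition reachable ::
  "('d, 'x, 'q, 'b, 's) qdas \<Rightarrow> ('d, 'x, 'q, 'b, 's) conf \<Rightarrow> bool" where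
  "reachable A c \<longleftrightarrow> (qdas_step A)\<^sup>*\<^sup>* (init_conf A) c"

definition parikh_coverable :: "('d, 'x, 'q, 'b, 's) qdas \<Rightarrow> ('s \<Rightarrow> nat) \<Rightarrow> bool" where
  "parikh_coverable A f \<longleftrightarrow>
     (\<exists>G \<rho>. reachable A (G, \<rho>) \<and> (\<forall>s\<in>all_states A. f s \<le> parikh G s))"


section \<open>Deterministic multi-tape Turing machines and EXPTIME\<close>

text \<open>Tapes are infinite in both directions. States and tape symbols are initial segments of
  the natural numbers; state 0 is the start state, symbol 0 is the blank, and symbols 1 and 2
  represent the bits \<open>False\<close> and \<open>True\<close>.\<close>

datatype move = MoveLeft | Stay | MoveRight

record tm =
  num_tapes :: nat
  num_symbols :: nat
  num_states :: nat
  accept_state :: nat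
  reject_state :: nat
  delta :: "nat \<Rightarrow> nat list \<Rightarrow> nat \<times> (nat \<times> move) list"

definition is_tm :: "tm \<Rightarrow> bool" where
  "is_tm M \<longleftrightarrow>
     num_tapes M \<ge> 1 \<and> num_symbols M \<ge> 3 \<and> num_states M \<ge> 1 \<and>
     accept_state M < num_states M \<and> reject_state M < num_states M \<and>
     accept_state M \<noteq> reject_state M \<and>
     (\<forall>q < num_states M. \<forall>as. length as = num_tapes M \<and> set as \<subseteq> {..<num_symbols M} \<longrightarrow>
        fst (delta M q as) < num_states M \<and>
        length (snd (delta M q as)) = num_tapes M \<and>
        fst ` set (snd (delta M q as)) \<subseteq> {..<num_symbols M})"

type_synonym tape = "(int \<Rightarrow> nat) \<times> int"
type_synonym tm_conf = "nat \<times> tape list"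

definition scan :: "tape \<Rightarrow> nat" where
  "scan T = fst T (snd T)"

definition write_move :: "tape \<Rightarrow> nat \<times> move \<Rightarrow> tape" where
  "write_move T u =
     ((fst T)(snd T := fst u),
      snd T + (case snd u of MoveLeft \<Rightarrow> - 1 | Stay \<Rightarrow> 0 | MoveRight \<Rightarrow> 1))"

definition halted :: "tm \<Rightarrow> tm_conf \<Rightarrow> bool" where
  "halted M c \<longleftrightarrow> fst c = accept_state M \<or> fst c = reject_state M"

definition tm_step :: "tm \<Rightarrow> tm_conf \<Rightarrow> tm_conf" where
  "tm_step M c =
     (if halted M c then c
      else let (q', us) = delta M (fst c) (map scan (snd c))
           in (q', map2 write_move (snd c) us))"

definition word_cells :: "bool list \<Rightarrow> int \<Rightarrow> nat" where
  "word_cells w i =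
     (if 0 \<le> i \<and> i < int (length w) then (if w ! nat i then 2 else 1) else 0)"

definition tm_init :: "tm \<Rightarrow> bool list \<Rightarrow> tm_conf" where
  "tm_init M w = (0, (word_cells w, 0) # replicate (num_tapes M - 1) (word_cells [], 0))"

definition decides_in_time :: "tm \<Rightarrow> bool list set \<Rightarrow> (nat \<Rightarrow> nat) \<Rightarrow> bool" where
  "decides_in_time M L T \<longleftrightarrow>
     (\<forall>w. \<exists>t \<le> T (length w). let c = (tm_step M ^^ t) (tm_init M w)
            in halted M c \<and> (fst c = accept_state M \<longleftrightarrow> w \<in> L))"

text \<open>The output is read off the last tape, from cell 0 on.\<close>

definition computes_in_time :: "tm \<Rightarrow> (bool list \<Rightarrow> bool list) \<Rightarrow> (nat \<Rightarrow> nat) \<Rightarrow> bool" where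
  "computes_in_time M g T \<longleftrightarrow>
     (\<forall>w. \<exists>t \<le> T (length w). let c = (tm_step M ^^ t) (tm_init M w)
            in halted M c \<and> fst (last (snd c)) = word_cells (g w))"

definition EXPTIME :: "bool list set set" where
  "EXPTIME = {L. \<exists>M (p :: nat poly). is_tm M \<and> decides_in_time M L (\<lambda>n. 2 ^ poly p n)}"

definition polytime_computable :: "(bool list \<Rightarrow> bool list) \<Rightarrow> bool" where
  "polytime_computable g \<longleftrightarrow> (\<exists>M (p :: nat poly). is_tm M \<and> computes_in_time M g (poly p))"

definition polytime_reducible :: "bool list set \<Rightarrow> bool list set \<Rightarrow> bool" where
  "polytime_reducible L L' \<longleftrightarrow> (\<exists>g. polytime_computable g \<and> (\<forall>w. w \<in> L \<longleftrightarrow> g w \<in> L'))"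

definition EXPTIME_hard :: "bool list set \<Rightarrow> bool" where
  "EXPTIME_hard L \<longleftrightarrow> (\<forall>L'\<in>EXPTIME. polytime_reducible L' L)"

definition EXPTIME_complete :: "bool list set \<Rightarrow> bool" where
  "EXPTIME_complete L \<longleftrightarrow> L \<in> EXPTIME \<and> EXPTIME_hard L"


section \<open>Problem instances as bit strings\<close>

text \<open>Binary digits, least significant digit first, without superfluous leading zeros.\<close>

fun binary :: "nat \<Rightarrow> bool list" where
  "binary n = (if n < 2 then [odd n] else odd n # binary (n div 2))"

declare binary.simps [simp del]

datatype tree = Num nat | Node "tree list"

text \<open>Two bits per token: the pairs starting with \<open>False\<close> are binary digits, and two further
  tokens open a node and close a node or a numeral. Numerals have at least one digit, so that
  the code is uniquely decodable.\<close>

fun tree_bits :: "tree \<Rightarrow> bool list" where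
  "tree_bits (Num n) = concat (map (\<lambda>b. [False, b]) (binary n)) @ [True, False]"
| "tree_bits (Node ts) = [True, True] @ concat (map tree_bits ts) @ [True, False]"

primrec atom_tree :: "(nat, nat) atom \<Rightarrow> tree" where
  "atom_tree (VarEq x d) = Node [Num 0, Num x, Num d]"
| "atom_tree (VarNeq x d) = Node [Num 1, Num x, Num d]"

primrec action_tree :: "(nat, nat, nat, nat) action \<Rightarrow> tree" where
  "action_tree (DispatchA q b) = Node [Num 0, Num q, Num b]"
| "action_tree (DispatchS q b) = Node [Num 1, Num q, Num b]"
| "action_tree (Guard g) = Node [Num 2, Node (map atom_tree g)]"
| "action_tree (Assign x d) = Node [Num 3, Num x, Num d]"

definition lists_set :: "tree set \<Rightarrow> tree \<Rightarrow> bool" where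
  "lists_set X t \<longleftrightarrow> (\<exists>ts. set ts = X \<and> t = Node ts)"

text \<open>In an instance all identifiers are natural numbers; this is no restriction, since all the
  sets involved are finite. Each finite set is written out element by element, in any order,
  and the function \<open>f\<close> is written as its finite graph on the states, with values in binary.\<close>

type_synonym nat_qdas = "(nat, nat, nat, nat, nat) qdas"

definition encodes_instance :: "nat_qdas \<Rightarrow> (nat \<Rightarrow> nat) \<Rightarrow> bool list \<Rightarrow> bool" where
  "encodes_instance A f w \<longleftrightarrow>
     (\<exists>ts. list_all2 lists_set
        [Num ` data_values A,
         Num ` variables A,
         Num ` cqid A,
         Num ` sqid A,
         Num ` blocks A,
         {Node [Num b, Num s] | b s. b \<in> blocks A \<and> s \<in> block_states A b},
         {Node [Num b, Num (init_state A b)] | b. b \<in> blocks A},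
         {Node [Num b, Num (final_state A b)] | b. b \<in> blocks A},
         {Node [Num b, Num s, action_tree a, Num s'] | b s a s'.
            b \<in> blocks A \<and> (s, a, s') \<in> block_trans A b},
         {Node [Num s, Num (f s)] | s. s \<in> all_states A}] ts \<and>
      w = tree_bits (Node (Num (init_value A) # Num (main_block A) # ts)))"

text \<open>The Parikh coverability problem for the QDAS satisfying \<open>C\<close>, as a language.\<close>

definition parikh_coverability :: "(nat_qdas \<Rightarrow> bool) \<Rightarrow> bool list set" where
  "parikh_coverability C =
     {w. \<exists>A f. is_qdas A \<and> C A \<and> encodes_instance A f w \<and> parikh_coverable A f}"

end

theory Submission
  imports Defs "HOL-Library.Nat_Bijection"
begin

text \<open>The reachable call-task graphs of a synchronous QDAS are paths of wait edges, so such a system is a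
  pushdown system whose stack symbols are block states and whose control is the valuation together with
  the set of serial queues in use. Membership: the summaries of blocks and the reachable block entries,
  the latter paired with the part of \<open>f\<close> not yet covered by the stack below, are least fixed points
  in universes of exponential size. Hardness: the contents of a Turing machine configuration at time
  \<open>t + 1\<close> and offset \<open>d\<close> from the heads depend on those at time \<open>t\<close> and offsets \<open>0\<close> and
  \<open>d - 1\<close>, \<open>d\<close>, \<open>d + 1\<close>; a recursive program holding \<open>t\<close> and \<open>d\<close> in binary variables, and
  intermediate results in its stack, evaluates this recursion.\<close>

section \<open>A stack machine and its simulation by Turing machines\<close>

text \<open>\<open>EXPTIME\<close> and \<open>polytime_reducible\<close> refer to concrete
  multi-tape Turing machines, so every algorithm has to be compiled. A machine with five stacks is
  simulated step by step; its data are binary trees in prefix notation, and \<open>PT\<close>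
  collects the tree functions computed in polynomial time, with closure under case distinction,
  bounded iteration and list operations. Exponential time is reduced to this class: a
  polynomial-time function gets a unary fuel of exponential length as a second argument. In the
  membership part stacks are unbounded, but the uncovered part of \<open>f\<close> is truncated at 0
  and so takes at most exponentially many values, although \<open>f\<close> is given in binary.
  Occupied serial queues must be tracked because a call to one of them is counted in the Parikh
  image but never runs. In the hardness part a QDAS has no local variables: intermediate results are
  kept in the control state of the caller, which survives a call, and each procedure restores
  \<open>t\<close> and \<open>d\<close> before it returns. Offsets are measured from the head of
  each tape separately, so a single \<open>d\<close> serves all tapes, and negative offsets are
  represented modulo a power of two.\<close>

datatype sym = Lf | Nd | Mk
datatype reg = RI | RW | RB | RC | RA

text \<open>All jumps are relative, so that a code fragment behaves in the same way at every
  position of a larger program.\<close>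

datatype instr = Push reg sym | Pop reg | Jif bool reg "sym option" nat | Fwd nat | Back nat

type_synonym store = "reg \<Rightarrow> sym list"

definition peek :: "sym list \<Rightarrow> sym option" where
  "peek xs = (case xs of [] \<Rightarrow> None | a # _ \<Rightarrow> Some a)"

lemma peek_simps [simp]: "peek [] = None" "peek (a # xs) = Some a"
  by (simp_all add: peek_def)

fun exec1 :: "instr \<Rightarrow> nat \<times> store \<Rightarrow> nat \<times> store" where
  "exec1 (Push r a) (pc, s) = (Suc pc, s(r := a # s r))"
| "exec1 (Pop r) (pc, s) = (Suc pc, s(r := tl (s r)))"
| "exec1 (Jif b r x k) (pc, s) = ((if (peek (s r) = x) = b then Suc pc else Suc (pc + k)), s)"
| "exec1 (Fwd k) (pc, s) = (Suc (pc + k), s)"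
| "exec1 (Back k) (pc, s) = (pc - k, s)"

definition mstep :: "instr list \<Rightarrow> nat \<times> store \<Rightarrow> nat \<times> store" where
  "mstep P c = (if fst c < length P then exec1 (P ! fst c) c else c)"

fun ri :: "reg \<Rightarrow> nat" where
  "ri RI = 0" | "ri RW = 1" | "ri RB = 2" | "ri RC = 3" | "ri RA = 4"

text \<open>The values 1 and 2 are those of the bits in \<open>word_cells\<close>, so input and
  output words need no recoding. 0 remains the blank and thus marks an empty stack.\<close>

fun sv :: "sym \<Rightarrow> nat" where
  "sv Lf = 1" | "sv Nd = 2" | "sv Mk = 3"

fun ov :: "sym option \<Rightarrow> nat" where
  "ov None = 0" | "ov (Some a) = sv a"

text \<open>The stack on tape 0 grows to the left, so that the input word is already such a stack;
  the other stacks grow to the right from cell 0, so that the last tape can hold an output word.\<close>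

fun push_dir :: "reg \<Rightarrow> move" where "push_dir RI = MoveLeft" | "push_dir _ = MoveRight"
fun pop_dir :: "reg \<Rightarrow> move" where "pop_dir RI = MoveRight" | "pop_dir _ = MoveLeft"

text \<open>Odd machine states are program counters; the positive even ones are the second halves of
  pushes, and 0 is the start-up state. A counter equal to the program length accepts, and every
  larger counter is collapsed into the rejecting state, so a program rejects by jumping past its
  end.\<close>

definition pcst :: "instr list \<Rightarrow> nat \<Rightarrow> nat" where
  "pcst P pc = Suc (2 * min pc (Suc (length P)))"

definition keep :: "nat list \<Rightarrow> (nat \<times> move) list" where
  "keep as = map (\<lambda>a. (a, Stay)) as"

text \<open>A machine step writes before it moves, but a push has to reach the free cell before
  writing. A push therefore takes two steps, the second one given by \<open>write_delta\<close>. A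
  pop of an empty stack is recognised by the blank and leaves the head in place.\<close>

definition instr_delta :: "instr list \<Rightarrow> nat \<Rightarrow> nat list \<Rightarrow> nat \<times> (nat \<times> move) list" where
  "instr_delta P pc as = (case P ! pc of
     Push r a \<Rightarrow> (2 * pc + 2, (keep as)[ri r := (as ! ri r, push_dir r)])
   | Pop r \<Rightarrow> (pcst P (Suc pc), (keep as)[ri r := (0, if as ! ri r = 0 then Stay else pop_dir r)])
   | Jif b r x k \<Rightarrow> (pcst P (if (as ! ri r = ov x) = b then Suc pc else Suc (pc + k)), keep as)
   | Fwd k \<Rightarrow> (pcst P (Suc (pc + k)), keep as)
   | Back k \<Rightarrow> (pcst P (pc - k), keep as))"

definition write_delta :: "instr list \<Rightarrow> nat \<Rightarrow> nat list \<Rightarrow> nat \<times> (nat \<times> move) list" where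
  "write_delta P pc as = (case P ! pc of
     Push r a \<Rightarrow> (pcst P (Suc pc), (keep as)[ri r := (sv a, Stay)])
   | _ \<Rightarrow> (0, keep as))"

text \<open>The start state moves the heads of tapes 1 to 4 from cell 0 to cell -1, which is the
  head position of an empty stack that grows to the right from cell 0.\<close>

definition tm_of :: "instr list \<Rightarrow> tm" where
  "tm_of P = \<lparr>num_tapes = 5, num_symbols = 4, num_states = 2 * length P + 4,
     accept_state = pcst P (length P), reject_state = pcst P (Suc (length P)),
     delta = (\<lambda>q as.
       if q = 0 then (1, (as ! 0, Stay) # map (\<lambda>a. (a, MoveLeft)) (tl as))
       else if q \<ge> 2 * length P + 1 then (0, keep as)
       else if odd q then instr_delta P (q div 2) as
       else write_delta P (q div 2 - 1) as)\<rparr>"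

lemma sv_less [simp]: "sv a < 4" by (cases a) auto
lemma sv_pos [simp]: "sv a \<noteq> 0" "0 < sv a" by (cases a; simp)+
lemma sv_inj [simp]: "sv a = sv b \<longleftrightarrow> a = b" by (cases a; cases b) auto
lemma ov_inj [simp]: "ov a = ov b \<longleftrightarrow> a = b"
  by (cases a; cases b) (auto simp: less_imp_neq)
lemma ri_less [simp]: "ri r < 5" by (cases r) auto
lemma ri_inj [simp]: "ri r = ri r' \<longleftrightarrow> r = r'" by (cases r; cases r') auto
lemma length_keep [simp]: "length (keep as) = length as" by (simp add: keep_def)

lemma pcst_less: "pcst P pc < 2 * length P + 4"
  by (auto simp: pcst_def min_def)

lemma keep_update_symbols:
  assumes "set as \<subseteq> {..<4}" "x < 4"
  shows "fst ` set ((keep as)[j := (x, m)]) \<subseteq> {..<4::nat}" "fst ` set (keep as) \<subseteq> {..<4::nat}"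
proof -
  show *: "fst ` set (keep as) \<subseteq> {..<4::nat}" using assms by (auto simp: keep_def)
  show "fst ` set ((keep as)[j := (x, m)]) \<subseteq> {..<4::nat}"
    using set_update_subset_insert[of "keep as" j "(x, m)"] * assms(2) by fastforce
qed

lemma instr_delta_ok:
  assumes "length as = 5" "set as \<subseteq> {..<4}" "pc < length P"
  shows "fst (instr_delta P pc as) < 2 * length P + 4 \<and> length (snd (instr_delta P pc as)) = 5 \<and>
    fst ` set (snd (instr_delta P pc as)) \<subseteq> {..<4}"
proof -
  have "as ! ri r < 4" for r using assms(1,2) by (metis lessThan_iff nth_mem ri_less subsetD)
  then show ?thesis
    using assms keep_update_symbols(1)[OF assms(2)] keep_update_symbols(2)[OF assms(2), of 0]
    by (cases "P ! pc") (auto simp: instr_delta_def pcst_less)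
qed

lemma write_delta_ok:
  assumes "length as = 5" "set as \<subseteq> {..<4}"
  shows "fst (write_delta P pc as) < 2 * length P + 4 \<and> length (snd (write_delta P pc as)) = 5 \<and>
    fst ` set (snd (write_delta P pc as)) \<subseteq> {..<4}"
proof (cases "P ! pc")
  case (Push r a)
  then show ?thesis unfolding write_delta_def
    using keep_update_symbols(1)[OF assms(2), of "sv a"] assms by (auto simp: pcst_less)
qed (use keep_update_symbols(2)[OF assms(2), of 0] assms in \<open>auto simp: write_delta_def\<close>)

lemma is_tm_tm_of: "is_tm (tm_of P)"
proof -
  have start: "fst ` set ((as ! 0, Stay) # map (\<lambda>a. (a, MoveLeft)) (tl as)) \<subseteq> {..<4::nat} \<and>
      length ((as ! 0, Stay) # map (\<lambda>a. (a, MoveLeft)) (tl as)) = 5"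
    if "length as = 5" "set as \<subseteq> {..<4}" for as
    using that by (cases as) auto
  show ?thesis
    unfolding is_tm_def
  proof (intro conjI allI impI; (elim conjE)?)
    fix q as
    assume q: "q < num_states (tm_of P)" and as: "length as = num_tapes (tm_of P)"
      "set as \<subseteq> {..<num_symbols (tm_of P)}"
    have *: "fst (delta (tm_of P) q as) < num_states (tm_of P) \<and>
        length (snd (delta (tm_of P) q as)) = num_tapes (tm_of P) \<and>
        fst ` set (snd (delta (tm_of P) q as)) \<subseteq> {..<num_symbols (tm_of P)}"
    proof -
      have as': "length as = 5" "set as \<subseteq> {..<4}" using as by (simp_all add: tm_of_def)
      consider "q = 0" | "q > 0" "q \<ge> 2 * length P + 1" | "q > 0" "q < 2 * length P + 1" "odd q"
        | "q > 0" "q < 2 * length P + 1" "even q" by linarith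
      then show ?thesis
      proof cases
        case 1
        then show ?thesis using start[OF as'] by (simp add: tm_of_def)
      next
        case 2
        then show ?thesis using as' keep_update_symbols(2)[OF as'(2), of 0] by (simp add: tm_of_def)
      next
        case 3
        then have "q div 2 < length P" by presburger
        then show ?thesis using 3 instr_delta_ok[OF as'] by (simp add: tm_of_def)
      next
        case 4
        then show ?thesis using write_delta_ok[OF as'] by (simp add: tm_of_def)
      qed
    qed
    show "fst (delta (tm_of P) q as) < num_states (tm_of P)"
      "length (snd (delta (tm_of P) q as)) = num_tapes (tm_of P)"
      "fst ` set (snd (delta (tm_of P) q as)) \<subseteq> {..<num_symbols (tm_of P)}"
      using * by blast+
  qed (auto simp: tm_of_def pcst_def)
qed

text \<open>The whole tape is fixed and not only its stack part, because the output condition of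
  \<open>computes_in_time\<close> compares the complete last tape with
  \<open>word_cells\<close>.\<close>

fun trep :: "reg \<Rightarrow> tape \<Rightarrow> sym list \<Rightarrow> bool" where
  "trep RI (c, h) xs \<longleftrightarrow>
     c = (\<lambda>i. if h \<le> i \<and> nat (i - h) < length xs then sv (xs ! nat (i - h)) else 0)"
| "trep r (c, h) xs \<longleftrightarrow> h = int (length xs) - 1 \<and>
     c = (\<lambda>i. if 0 \<le> i \<and> i < int (length xs) then sv (rev xs ! nat i) else 0)"

lemma trep_scan: "trep r T xs \<Longrightarrow> scan T = ov (peek xs)"
  by (cases r; cases T; cases xs) (auto simp: scan_def nth_append)

lemma trep_push:
  assumes "trep r T xs"
  shows "trep r (write_move (write_move T (scan T, push_dir r)) (sv a, Stay)) (a # xs)"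
proof (cases T)
  case (Pair c h)
  show ?thesis
  proof (cases "r = RI")
    case True
    have c: "c = (\<lambda>i. if h \<le> i \<and> nat (i - h) < length xs then sv (xs ! nat (i - h)) else 0)"
      using assms Pair True by simp
    have "nat (i - (h - 1)) = Suc (nat (i - h))" if "h \<le> i" for i using that by linarith
    then show ?thesis
      unfolding Pair True
      by (auto simp: write_move_def scan_def c fun_eq_iff)
  next
    case False
    have c: "h = int (length xs) - 1"
      "c = (\<lambda>i. if 0 \<le> i \<and> i < int (length xs) then sv (rev xs ! nat i) else 0)"
      using assms Pair False by (cases r; simp)+
    have "trep r (write_move (write_move T (scan T, push_dir r)) (sv a, Stay)) (a # xs) \<longleftrightarrow>
       trep RA (write_move (write_move T (scan T, MoveRight)) (sv a, Stay)) (a # xs)"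
      using False by (cases r; cases "write_move (write_move T (scan T, MoveRight)) (sv a, Stay)") auto
    moreover have "\<dots>"
      unfolding Pair c by (auto simp: write_move_def scan_def fun_eq_iff nth_append)
    ultimately show ?thesis by simp
  qed
qed

lemma trep_pop:
  assumes "trep r T xs"
  shows "trep r (write_move T (0, if scan T = 0 then Stay else pop_dir r)) (tl xs)"
proof (cases xs)
  case Nil
  then have "write_move T (0, Stay) = T" "scan T = 0" using trep_scan[OF assms]
    by (cases T; auto simp: write_move_def scan_def fun_eq_iff)+
  then show ?thesis using Nil assms by simp
next
  case (Cons a ys)
  have sc: "scan T \<noteq> 0" using trep_scan[OF assms] Cons by simp
  obtain c h where Pair: "T = (c, h)" by (cases T)
  show ?thesis
  proof (cases "r = RI")
    case True
    have c: "c = (\<lambda>i. if h \<le> i \<and> nat (i - h) < length xs then sv (xs ! nat (i - h)) else 0)"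
      using assms Pair True by simp
    have "nat (i - h) = Suc (nat (i - (h + 1)))" if "h + 1 \<le> i" for i using that by linarith
    then show ?thesis
      unfolding True using sc
      by (auto simp: Pair write_move_def c fun_eq_iff Cons)
  next
    case False
    have c: "h = int (length xs) - 1"
      "c = (\<lambda>i. if 0 \<le> i \<and> i < int (length xs) then sv (rev xs ! nat i) else 0)"
      using assms Pair False by (cases r; simp)+
    have "trep r (write_move T (0, pop_dir r)) ys \<longleftrightarrow> trep RA (write_move T (0, MoveLeft)) ys"
      using False by (cases r; cases "write_move T (0, MoveLeft)") auto
    moreover have "\<dots>"
      unfolding Pair c by (auto simp: write_move_def fun_eq_iff nth_append Cons)
    ultimately show ?thesis using sc Cons by simp
  qed
qed

definition reps :: "tape list \<Rightarrow> store \<Rightarrow> bool" where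
  "reps ts s \<longleftrightarrow> length ts = 5 \<and> (\<forall>r. trep r (ts ! ri r) (s r))"

lemma reps_scan: "reps ts s \<Longrightarrow> map scan ts ! ri r = ov (peek (s r))"
  using trep_scan[of r "ts ! ri r" "s r"] by (auto simp: reps_def)

lemma write_move_stay [simp]: "write_move T (scan T, Stay) = T"
  by (cases T) (auto simp: write_move_def scan_def)

lemma map2_keep_update:
  assumes "length ts = 5"
  shows "map2 write_move ts ((keep (map scan ts))[ri r := u]) = ts[ri r := write_move (ts ! ri r) u]"
  using assms by (intro nth_equalityI) (auto simp: keep_def nth_list_update)

lemma map2_keep: "map2 write_move ts (keep (map scan ts)) = ts"
  by (intro nth_equalityI) (auto simp: keep_def)

lemma reps_update:
  assumes "reps ts s" "trep r T xs"
  shows "reps (ts[ri r := T]) (s(r := xs))"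
  using assms by (auto simp: reps_def nth_list_update)

lemma tm_of_step:
  assumes "pc < length P"
  shows "tm_step (tm_of P) (pcst P pc, ts) =
    (let (q, us) = instr_delta P pc (map scan ts) in (q, map2 write_move ts us))"
proof -
  have "pcst P pc = 2 * pc + 1" using assms by (simp add: pcst_def)
  then show ?thesis using assms by (simp add: tm_step_def halted_def tm_of_def pcst_def)
qed

lemma tm_of_step_write:
  assumes "pc < length P"
  shows "tm_step (tm_of P) (2 * pc + 2, ts) =
    (let (q, us) = write_delta P pc (map scan ts) in (q, map2 write_move ts us))"
proof -
  have "\<not> halted (tm_of P) (2 * pc + 2, ts)"
    by (simp add: tm_of_def pcst_def halted_def) presburger
  then show ?thesis using assms by (simp add: tm_step_def tm_of_def pcst_def)
qed

text \<open>Only a push needs the intermediate state, hence two machine steps at most; once the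
  counter has left the program nothing changes on either side and zero steps do.\<close>

lemma tm_simulates_step:
  assumes "reps ts s" "mstep P (pc, s) = (pc', s')"
  shows "\<exists>u \<le> 2. \<exists>ts'. (tm_step (tm_of P) ^^ u) (pcst P pc, ts) = (pcst P pc', ts') \<and> reps ts' s'"
proof (cases "pc < length P")
  case False
  then show ?thesis using assms by (intro exI[of _ 0]) (auto simp: mstep_def)
next
  case True
  have len: "length ts = 5" using assms(1) by (simp add: reps_def)
  have ex: "exec1 (P ! pc) (pc, s) = (pc', s')" using assms(2) True by (simp add: mstep_def)
  have sc: "map scan ts ! ri r = scan (ts ! ri r)" for r using len by simp
  have tr: "trep r (ts ! ri r) (s r)" for r using assms(1) by (simp add: reps_def)
  show ?thesis
  proof (cases "P ! pc")
    case (Push r a)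
    let ?T = "write_move (ts ! ri r) (scan (ts ! ri r), push_dir r)"
    let ?T' = "write_move ?T (sv a, Stay)"
    have 1: "tm_step (tm_of P) (pcst P pc, ts) = (2 * pc + 2, ts[ri r := ?T])"
      using True Push len map2_keep_update[OF len]
      by (simp add: tm_of_step instr_delta_def sc)
    have "tm_step (tm_of P) (2 * pc + 2, ts[ri r := ?T]) = (pcst P (Suc pc), ts[ri r := ?T'])"
      using tm_of_step_write[OF True, of "ts[ri r := ?T]"] True Push len map2_keep_update[of "ts[ri r := ?T]"]
      by (simp add: write_delta_def)
    then have "(tm_step (tm_of P) ^^ 2) (pcst P pc, ts) = (pcst P pc', ts[ri r := ?T'])"
      using 1 ex Push by (auto simp: numeral_2_eq_2)
    then show ?thesis using ex Push reps_update[OF assms(1) trep_push[OF tr]]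
      by (intro exI[of _ 2] conjI exI[of _ "ts[ri r := ?T']"]) auto
  next
    case (Pop r)
    let ?T = "write_move (ts ! ri r) (0, if scan (ts ! ri r) = 0 then Stay else pop_dir r)"
    have "tm_step (tm_of P) (pcst P pc, ts) = (pcst P (Suc pc), ts[ri r := ?T])"
      using True Pop map2_keep_update[OF len] by (simp add: tm_of_step instr_delta_def sc)
    then show ?thesis using ex Pop reps_update[OF assms(1) trep_pop[OF tr[of r]]]
      by (intro exI[of _ 1] conjI exI[of _ "ts[ri r := ?T]"]) auto
  next
    case (Jif b r x k)
    have "map scan ts ! ri r = ov x \<longleftrightarrow> peek (s r) = x" using reps_scan[OF assms(1)] by simp
    then show ?thesis using True ex Jif assms(1)
      by (intro exI[of _ 1]) (auto simp: tm_of_step instr_delta_def map2_keep)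
  qed (use True ex assms(1) in \<open>(intro exI[of _ 1], auto simp: tm_of_step instr_delta_def map2_keep)[1]\<close>)+
qed

lemma tm_simulates:
  assumes "reps ts s" "(mstep P ^^ t) (pc, s) = (pc', s')"
  shows "\<exists>u \<le> 2 * t. \<exists>ts'. (tm_step (tm_of P) ^^ u) (pcst P pc, ts) = (pcst P pc', ts') \<and> reps ts' s'"
  using assms(2)
proof (induction t arbitrary: pc' s')
  case 0
  then show ?case using assms(1) by auto
next
  case (Suc t)
  obtain pc1 s1 where 1: "(mstep P ^^ t) (pc, s) = (pc1, s1)" by fastforce
  then obtain u ts1 where u: "u \<le> 2 * t" "(tm_step (tm_of P) ^^ u) (pcst P pc, ts) = (pcst P pc1, ts1)"
    "reps ts1 s1" using Suc.IH by blast
  have "mstep P (pc1, s1) = (pc', s')" using Suc.prems 1 by simp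
  then obtain v ts2 where "v \<le> 2" "(tm_step (tm_of P) ^^ v) (pcst P pc1, ts1) = (pcst P pc', ts2)" "reps ts2 s'"
    using tm_simulates_step[OF u(3)] by blast
  then show ?case using u
    by (intro exI[of _ "v + u"]) (auto simp: funpow_add)
qed

definition bsym :: "bool \<Rightarrow> sym" where "bsym b = (if b then Nd else Lf)"

definition input_store :: "bool list \<Rightarrow> store" where
  "input_store w = (\<lambda>r. if r = RI then map bsym w else [])"

lemma tm_of_start:
  "\<exists>ts. tm_step (tm_of P) (tm_init (tm_of P) w) = (pcst P 0, ts) \<and> reps ts (input_store w)"
proof -
  let ?ts = "(word_cells w, 0) # replicate 4 (word_cells [], - 1)"
  have "tm_step (tm_of P) (tm_init (tm_of P) w) = (pcst P 0, ?ts)"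
    by (simp add: tm_step_def tm_init_def halted_def tm_of_def pcst_def scan_def write_move_def eval_nat_numeral)
  moreover have "trep r (?ts ! ri r) (input_store w r)" for r
  proof (cases "r = RI")
    case True
    have "word_cells w = (\<lambda>i. if 0 \<le> i \<and> nat (i - 0) < length (map bsym w)
        then sv (map bsym w ! nat (i - 0)) else 0)"
      by (auto simp: word_cells_def fun_eq_iff bsym_def)
    then show ?thesis using True by (simp add: input_store_def del: length_map)
  next
    case False
    then show ?thesis by (cases r) (auto simp: input_store_def word_cells_def fun_eq_iff eval_nat_numeral)
  qed
  ultimately show ?thesis by (auto simp: reps_def)
qed

lemma tm_of_run:
  assumes "(mstep P ^^ t) (0, input_store w) = (pc, s)"
  shows "\<exists>u \<le> 2 * t + 1. \<exists>ts. (tm_step (tm_of P) ^^ u) (tm_init (tm_of P) w) = (pcst P pc, ts) \<and> reps ts s"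
proof -
  obtain ts where ts: "tm_step (tm_of P) (tm_init (tm_of P) w) = (pcst P 0, ts)" "reps ts (input_store w)"
    using tm_of_start by blast
  obtain u ts' where u: "u \<le> 2 * t" "(tm_step (tm_of P) ^^ u) (pcst P 0, ts) = (pcst P pc, ts')" "reps ts' s"
    using tm_simulates[OF ts(2) assms] by blast
  then show ?thesis using ts(1)
    by (intro exI[of _ "Suc u"]) (auto simp: funpow_Suc_right simp del: funpow.simps)
qed

lemma computes_tm_of:
  assumes "\<And>w. \<exists>t \<le> T (length w). \<exists>s. (mstep P ^^ t) (0, input_store w) = (length P, s) \<and>
    s RA = rev (map bsym (g w))"
  shows "computes_in_time (tm_of P) g (\<lambda>n. 2 * T n + 1)"
  unfolding computes_in_time_def
proof
  fix w
  obtain t s where t: "t \<le> T (length w)" "(mstep P ^^ t) (0, input_store w) = (length P, s)"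
    "s RA = rev (map bsym (g w))" using assms by blast
  obtain u ts where u: "u \<le> 2 * t + 1" "(tm_step (tm_of P) ^^ u) (tm_init (tm_of P) w) = (pcst P (length P), ts)"
    "reps ts s" using tm_of_run[OF t(2)] by blast
  have "u \<le> 2 * T (length w) + 1" using u(1) t(1) by linarith
  moreover have "halted (tm_of P) (pcst P (length P), ts)" by (simp add: halted_def tm_of_def)
  moreover have "fst (last ts) = word_cells (g w)"
  proof -
    have "ts \<noteq> []" "last ts = ts ! 4" "trep RA (ts ! 4) (s RA)"
      using u(3) last_conv_nth[of ts] by (force simp: reps_def dest: spec[of _ RA])+
    then show ?thesis using t(3)
      by (cases "ts ! 4") (auto simp: fun_eq_iff word_cells_def bsym_def)
  qed
  ultimately show "\<exists>t\<le>2 * T (length w) + 1. let c = (tm_step (tm_of P) ^^ t) (tm_init (tm_of P) w)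
      in halted (tm_of P) c \<and> fst (last (snd c)) = word_cells (g w)"
    using u(2) by (intro exI[of _ u]) simp
qed

section \<open>Structured stack programs\<close>

text \<open>The step count \<open>t\<close> is chosen before the surrounding code \<open>A\<close>
  and \<open>B\<close>, so a fragment has one cost wherever it is placed. \<open>n\<close> is only
  an upper bound, which allows branches of different cost to be joined.\<close>

definition runs :: "instr list \<Rightarrow> store \<Rightarrow> nat \<Rightarrow> store \<Rightarrow> bool" where
  "runs P s n s' \<longleftrightarrow> (\<exists>t\<le>n. \<forall>A B. (mstep (A @ P @ B) ^^ t) (length A, s) = (length A + length P, s'))"

lemma runsI:
  "t \<le> n \<Longrightarrow> (\<And>A B. (mstep (A @ P @ B) ^^ t) (length A, s) = (length A + length P, s')) \<Longrightarrow> runs P s n s'"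
  unfolding runs_def by blast

lemma runs_mono: "runs P s n s' \<Longrightarrow> n \<le> m \<Longrightarrow> runs P s m s'"
  unfolding runs_def by (meson order_trans)

lemma runs_eq: "runs P s n s' \<Longrightarrow> s' = s'' \<Longrightarrow> n \<le> m \<Longrightarrow> runs P s m s''"
  using runs_mono by blast

lemma runs_Nil: "runs [] s 0 s"
  by (rule runsI[of 0]) auto

lemma runs_Nil_eq: "s = s' \<Longrightarrow> runs [] s 0 s'"
  using runs_Nil by simp

lemma runs_append:
  assumes "runs P s n s'" "runs Q s' m s''"
  shows "runs (P @ Q) s (n + m) s''"
proof -
  obtain t where t: "t \<le> n" "\<And>A B. (mstep (A @ P @ B) ^^ t) (length A, s) = (length A + length P, s')"
    using assms(1) unfolding runs_def by blast
  obtain u where u: "u \<le> m" "\<And>A B. (mstep (A @ Q @ B) ^^ u) (length A, s') = (length A + length Q, s'')"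
    using assms(2) unfolding runs_def by blast
  show ?thesis
  proof (rule runsI[of "u + t"])
    fix A B
    show "(mstep (A @ (P @ Q) @ B) ^^ (u + t)) (length A, s) = (length A + length (P @ Q), s'')"
      using t(2)[of A "Q @ B"] u(2)[of "A @ P" B] by (simp add: funpow_add add.assoc)
  qed (use t u in simp)
qed

lemma mstep_at: "mstep (A @ i # B) (length A, s) = exec1 i (length A, s)"
  by (simp add: mstep_def nth_append)

lemma runs_Push1: "runs [Push r a] s 1 (s(r := a # s r))"
  by (rule runsI[of 1]) (auto simp: mstep_at)

lemma runs_Pop1: "runs [Pop r] s 1 (s(r := tl (s r)))"
  by (rule runsI[of 1]) (auto simp: mstep_at)

lemma runs_Push: "runs P (s(r := a # s r)) n s' \<Longrightarrow> runs (Push r a # P) s (Suc n) s'"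
  using runs_append[OF runs_Push1] by simp

lemma runs_Pop: "runs P (s(r := tl (s r))) n s' \<Longrightarrow> runs (Pop r # P) s (Suc n) s'"
  using runs_append[OF runs_Pop1] by simp

definition ite :: "bool \<Rightarrow> reg \<Rightarrow> sym option \<Rightarrow> instr list \<Rightarrow> instr list \<Rightarrow> instr list" where
  "ite b r x P Q = Jif b r x (length P + 1) # P @ Fwd (length Q) # Q"

definition loop :: "bool \<Rightarrow> reg \<Rightarrow> sym option \<Rightarrow> instr list \<Rightarrow> instr list" where
  "loop b r x P = Jif b r x (length P + 1) # P @ [Back (length P + 1)]"

lemma runs_ite_true:
  assumes "(peek (s r) = x) = b" "runs P s n s'"
  shows "runs (ite b r x P Q) s (n + 2) s'"
proof -
  obtain t where t: "t \<le> n" "\<And>A B. (mstep (A @ P @ B) ^^ t) (length A, s) = (length A + length P, s')"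
    using assms(2) unfolding runs_def by blast
  show ?thesis
  proof (rule runsI[of "Suc (t + 1)"])
    fix A B
    let ?C = "A @ ite b r x P Q @ B"
    have 1: "mstep ?C (length A, s) = (Suc (length A), s)"
      using assms(1) by (simp add: ite_def mstep_at)
    have 2: "(mstep ?C ^^ t) (Suc (length A), s) = (Suc (length A + length P), s')"
      using t(2)[of "A @ [Jif b r x (length P + 1)]" "Fwd (length Q) # Q @ B"] by (simp add: ite_def)
    have 3: "mstep ?C (Suc (length A + length P), s') = (length A + length (ite b r x P Q), s')"
      using mstep_at[of "A @ Jif b r x (length P + 1) # P" "Fwd (length Q)" "Q @ B" s'] by (simp add: ite_def)
    show "(mstep ?C ^^ Suc (t + 1)) (length A, s) = (length A + length (ite b r x P Q), s')"
      unfolding funpow_Suc_right o_apply 1 using 2 3 by simp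
  qed (use t in simp)
qed

lemma runs_ite_false:
  assumes "(peek (s r) = x) \<noteq> b" "runs Q s n s'"
  shows "runs (ite b r x P Q) s (n + 2) s'"
proof -
  obtain t where t: "t \<le> n" "\<And>A B. (mstep (A @ Q @ B) ^^ t) (length A, s) = (length A + length Q, s')"
    using assms(2) unfolding runs_def by blast
  show ?thesis
  proof (rule runsI[of "Suc t"])
    fix A B
    let ?C = "A @ ite b r x P Q @ B"
    have 1: "mstep ?C (length A, s) = (length A + length P + 2, s)"
      using assms(1) by (simp add: ite_def mstep_at)
    have 2: "(mstep ?C ^^ t) (length A + length P + 2, s) = (length A + length (ite b r x P Q), s')"
      using t(2)[of "A @ Jif b r x (length P + 1) # P @ [Fwd (length Q)]" B] by (simp add: ite_def)
    show "(mstep ?C ^^ Suc t) (length A, s) = (length A + length (ite b r x P Q), s')"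
      unfolding funpow_Suc_right o_apply 1 using 2 by simp
  qed (use t in simp)
qed

lemma runs_loop_exit:
  assumes "(peek (s r) = x) \<noteq> b"
  shows "runs (loop b r x P) s 1 s"
  using assms by (intro runsI[of 1]) (auto simp: loop_def mstep_at)

lemma runs_loop_step:
  assumes "(peek (s r) = x) = b" "runs P s n s'" "runs (loop b r x P) s' m s''"
  shows "runs (loop b r x P) s (n + m + 2) s''"
proof -
  obtain t where t: "t \<le> n" "\<And>A B. (mstep (A @ P @ B) ^^ t) (length A, s) = (length A + length P, s')"
    using assms(2) unfolding runs_def by blast
  obtain u where u: "u \<le> m"
    "\<And>A B. (mstep (A @ loop b r x P @ B) ^^ u) (length A, s') = (length A + length (loop b r x P), s'')"
    using assms(3) unfolding runs_def by blast
  show ?thesis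
  proof (rule runsI[of "u + (1 + (t + 1))"])
    fix A B
    let ?C = "A @ loop b r x P @ B"
    have 1: "mstep ?C (length A, s) = (Suc (length A), s)"
      using assms(1) by (simp add: loop_def mstep_at)
    have 2: "(mstep ?C ^^ t) (Suc (length A), s) = (Suc (length A + length P), s')"
      using t(2)[of "A @ [Jif b r x (length P + 1)]" "Back (length P + 1) # B"] by (simp add: loop_def)
    have 3: "mstep ?C (Suc (length A + length P), s') = (length A, s')"
      using mstep_at[of "A @ Jif b r x (length P + 1) # P" "Back (length P + 1)" B s'] by (simp add: loop_def)
    show "(mstep ?C ^^ (u + (1 + (t + 1)))) (length A, s) = (length A + length (loop b r x P), s'')"
      by (simp only: funpow_add o_apply One_nat_def funpow.simps id_apply 1 2 3 u(2))
  qed (use t u in simp)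
qed

text \<open>An instruction pushes at most one symbol. This is the source of all later bounds of
  output sizes by running times.\<close>

lemma exec1_growth:
  "exec1 i (pc, s) = (pc', s') \<Longrightarrow> length (s' r) \<le> Suc (length (s r))"
  by (cases i) (auto simp: fun_upd_def)

lemma mstep_growth:
  "(mstep P ^^ t) (pc, s) = (pc', s') \<Longrightarrow> length (s' r) \<le> length (s r) + t"
proof (induction t arbitrary: pc' s')
  case (Suc t)
  obtain pc1 s1 where 1: "(mstep P ^^ t) (pc, s) = (pc1, s1)" by fastforce
  with Suc.prems have "mstep P (pc1, s1) = (pc', s')" by simp
  then have "length (s' r) \<le> Suc (length (s1 r))"
    using exec1_growth by (auto simp: mstep_def split: if_splits)
  then show ?case using Suc.IH[OF 1] by simp
qed simp

lemma runs_growth: "runs P s n s' \<Longrightarrow> length (s' r) \<le> length (s r) + n"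
  unfolding runs_def using mstep_growth by (metis (no_types) add_le_cancel_left order_trans)

section \<open>Binary trees on the work stack\<close>

datatype d = L | N d d

text \<open>Prefix notation is self-delimiting, so trees lie on a stack without separators. The root
  symbol is on top: taking a pair apart is one pop, and building it is one push.\<close>

primrec code :: "d \<Rightarrow> sym list" where
  "code L = [Lf]"
| "code (N a b) = Nd # code a @ code b"

primrec sz :: "d \<Rightarrow> nat" where
  "sz L = 1"
| "sz (N a b) = Suc (sz a + sz b)"

lemma length_code [simp]: "length (code x) = sz x"
  by (induction x) auto

lemma sz_pos [simp]: "0 < sz x" "Suc 0 \<le> sz x"
  by (cases x; simp)+

lemma Mk_notin_code: "Mk \<notin> set (code x)"
  by (induction x) auto

text \<open>Moves the topmost tree of stack \<open>r\<close>, reversed, to \<open>q\<close>; the number of trees still to be read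
  is kept in unary on the counter stack.\<close>

definition mv :: "reg \<Rightarrow> reg \<Rightarrow> instr list" where
  "mv r q = Push RC Mk # Push RC Lf # loop True RC (Some Lf)
     (ite True r (Some Nd) [Push q Nd, Push RC Lf, Pop r] [Push q Lf, Pop RC, Pop r]) @ [Pop RC]"

text \<open>Generalised to the list \<open>ds\<close> of trees still to be read: a node replaces one
  pending tree by two, a leaf removes one, and the remaining code shrinks by one symbol in both
  cases. A round costs 7 steps: three instructions, two for \<open>ite\<close> and two for
  \<open>loop\<close>.\<close>

lemma runs_mv_loop:
  assumes "r \<noteq> q" "r \<noteq> RC" "q \<noteq> RC"
  assumes "s r = concat (map code ds) @ w" "s RC = replicate (length ds) Lf @ Mk # c"
  shows "runs (loop True RC (Some Lf)
     (ite True r (Some Nd) [Push q Nd, Push RC Lf, Pop r] [Push q Lf, Pop RC, Pop r])) s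
     (7 * length (concat (map code ds)) + 1)
     (s(r := w, q := rev (concat (map code ds)) @ s q, RC := Mk # c))"
  using assms(4,5)
proof (induction "length (concat (map code ds))" arbitrary: ds s rule: less_induct)
  case less
  show ?case
  proof (cases ds)
    case Nil
    have "s(r := w, q := s q, RC := Mk # c) = s" using less.prems Nil by (auto simp: fun_eq_iff)
    then show ?thesis using runs_loop_exit[of s RC "Some Lf" True] less.prems Nil by simp
  next
    case (Cons x es)
    show ?thesis
    proof (cases x)
      case L
      let ?s = "s(q := Lf # s q, RC := replicate (length es) Lf @ Mk # c, r := concat (map code es) @ w)"
      have *: "runs [Push q Lf, Pop RC, Pop r] s 3 ?s"
        unfolding numeral_3_eq_3 using less.prems assms(1-3) Cons L
        by (intro runs_Push runs_Pop runs_Nil_eq) (auto simp: fun_eq_iff)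
      have "runs (ite True r (Some Nd) [Push q Nd, Push RC Lf, Pop r] [Push q Lf, Pop RC, Pop r]) s 5 ?s"
        using runs_ite_false[OF _ *, of r "Some Nd" True] less.prems Cons L by simp
      then show ?thesis
        using less.prems assms(1-3) Cons L
        by (intro runs_eq[OF runs_loop_step[OF _ _ less.hyps[of es ?s]]]) (auto simp: fun_eq_iff)
    next
      case (N a b)
      let ?s = "s(q := Nd # s q, RC := Lf # s RC, r := concat (map code (a # b # es)) @ w)"
      have *: "runs [Push q Nd, Push RC Lf, Pop r] s 3 ?s"
        unfolding numeral_3_eq_3 using less.prems assms(1-3) Cons N
        by (intro runs_Push runs_Pop runs_Nil_eq) (auto simp: fun_eq_iff)
      have "runs (ite True r (Some Nd) [Push q Nd, Push RC Lf, Pop r] [Push q Lf, Pop RC, Pop r]) s 5 ?s"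
        using runs_ite_true[OF _ *, of r "Some Nd" True] less.prems Cons N by simp
      then show ?thesis
        using less.prems assms(1-3) Cons N
        by (intro runs_eq[OF runs_loop_step[OF _ _ less.hyps[of "a # b # es" ?s]]]) (auto simp: fun_eq_iff)
    qed
  qed
qed

lemma runs_mv:
  assumes "r \<noteq> q" "r \<noteq> RC" "q \<noteq> RC" "s r = code x @ w"
  shows "runs (mv r q) s (7 * sz x + 4) (s(r := w, q := rev (code x) @ s q))"
proof -
  let ?s = "s(RC := Lf # Mk # s RC)"
  have 1: "runs [Push RC Mk, Push RC Lf] s 2 ?s"
    unfolding numeral_2_eq_2
    by (intro runs_Push runs_Nil_eq) (auto simp: fun_eq_iff)
  have 2: "runs [Pop RC] (s(r := w, q := rev (code x) @ s q, RC := Mk # s RC)) 1 (s(r := w, q := rev (code x) @ s q))"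
    using assms by (intro runs_eq[OF runs_Pop1]) (auto simp: fun_eq_iff)
  have "?s(r := w, q := rev (concat (map code [x])) @ ?s q, RC := Mk # s RC) =
      s(r := w, q := rev (code x) @ s q, RC := Mk # s RC)"
    using assms by (auto simp: fun_eq_iff)
  with runs_mv_loop[OF assms(1-3), of ?s "[x]" w "s RC"] assms
  have 3: "runs (loop True RC (Some Lf)
     (ite True r (Some Nd) [Push q Nd, Push RC Lf, Pop r] [Push q Lf, Pop RC, Pop r])) ?s
     (7 * sz x + 1) (s(r := w, q := rev (code x) @ s q, RC := Mk # s RC))"
    by simp
  show ?thesis
    using runs_mono[OF runs_append[OF 1 runs_append[OF 3 2]], of "7 * sz x + 4"] by (simp add: mv_def)
qed

definition copy_top :: "reg \<Rightarrow> reg list \<Rightarrow> instr list" where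
  "copy_top q rs = ite True q (Some Nd) (map (\<lambda>r. Push r Nd) rs @ [Pop q]) (map (\<lambda>r. Push r Lf) rs @ [Pop q])"

text \<open>The list of targets lets one routine serve three purposes: no target discards the marked
  segment, one target moves it back in its original order, two targets copy it.\<close>

definition mvb :: "reg \<Rightarrow> reg list \<Rightarrow> instr list" where
  "mvb q rs = loop False q (Some Mk) (copy_top q rs) @ [Pop q]"

lemma runs_pushes:
  "distinct rs \<Longrightarrow> runs (map (\<lambda>r. Push r a) rs) s (length rs) (\<lambda>r. if r \<in> set rs then a # s r else s r)"
proof (induction rs arbitrary: s)
  case Nil
  then show ?case by (simp add: runs_Nil)
next
  case (Cons q rs)
  have "runs (map (\<lambda>r. Push r a) rs) (s(q := a # s q)) (length rs)
      (\<lambda>r. if r \<in> set (q # rs) then a # s r else s r)"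
    using Cons.prems by (intro runs_eq[OF Cons.IH]) (auto simp: fun_eq_iff)
  from runs_Push[OF this] show ?case by simp
qed

lemma runs_copy_top:
  assumes "distinct rs" "q \<notin> set rs" "s q = a # w" "a \<noteq> Mk"
  shows "runs (copy_top q rs) s (length rs + 3)
    (\<lambda>r. if r \<in> set rs then a # s r else if r = q then w else s r)"
proof -
  let ?s = "\<lambda>r. if r \<in> set rs then a # s r else s r"
  have "runs [Pop q] ?s 1 (\<lambda>r. if r \<in> set rs then a # s r else if r = q then w else s r)"
    using assms by (intro runs_eq[OF runs_Pop1]) (auto simp: fun_eq_iff)
  with runs_pushes[OF assms(1), of a s]
  have "runs (map (\<lambda>r. Push r a) rs @ [Pop q]) s (length rs + 1)
      (\<lambda>r. if r \<in> set rs then a # s r else if r = q then w else s r)"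
    by (rule runs_append)
  then have *: "runs (map (\<lambda>r. Push r a) rs @ [Pop q]) s (Suc (length rs))
      (\<lambda>r. if r \<in> set rs then a # s r else if r = q then w else s r)" by simp
  show ?thesis
  proof (cases "a = Nd")
    case True
    then show ?thesis using runs_ite_true[OF _ *, of q "Some Nd" True] assms(3)
      by (simp add: copy_top_def numeral_3_eq_3)
  next
    case False
    then have "a = Lf" using assms(4) by (cases a) auto
    then show ?thesis using runs_ite_false[OF _ *, of q "Some Nd" True] assms(3)
      by (simp add: copy_top_def numeral_3_eq_3)
  qed
qed

lemma runs_mvb:
  assumes "distinct rs" "q \<notin> set rs" "s q = xs @ Mk # w" "Mk \<notin> set xs"
  shows "runs (mvb q rs) s ((length rs + 5) * length xs + 2)
    (\<lambda>r. if r \<in> set rs then rev xs @ s r else if r = q then w else s r)"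
proof -
  have "runs (loop False q (Some Mk) (copy_top q rs)) s ((length rs + 5) * length xs + 1)
    (\<lambda>r. if r \<in> set rs then rev xs @ s r else if r = q then Mk # w else s r)"
    using assms(3,4)
  proof (induction xs arbitrary: s)
    case Nil
    then have "(\<lambda>r. if r \<in> set rs then rev [] @ s r else if r = q then Mk # w else s r) = s"
      by (auto simp: fun_eq_iff)
    then show ?case using runs_loop_exit[of s q "Some Mk" False "copy_top q rs"] Nil by simp
  next
    case (Cons a xs)
    let ?s = "\<lambda>r. if r \<in> set rs then a # s r else if r = q then xs @ Mk # w else s r"
    have 1: "runs (copy_top q rs) s (length rs + 3) ?s"
      using runs_copy_top[OF assms(1,2)] Cons.prems by auto
    have 2: "runs (loop False q (Some Mk) (copy_top q rs)) ?s ((length rs + 5) * length xs + 1)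
        (\<lambda>r. if r \<in> set rs then rev (a # xs) @ s r else if r = q then Mk # w else s r)"
      using Cons.prems assms(2)
      by (intro runs_eq[OF Cons.IH]) (auto simp: fun_eq_iff)
    show ?case using Cons.prems
      by (intro runs_loop_step[OF _ 1 2, THEN runs_mono]) auto
  qed
  moreover have "runs [Pop q] (\<lambda>r. if r \<in> set rs then rev xs @ s r else if r = q then Mk # w else s r) 1
    (\<lambda>r. if r \<in> set rs then rev xs @ s r else if r = q then w else s r)"
    using assms by (intro runs_eq[OF runs_Pop1]) (auto simp: fun_eq_iff)
  ultimately show ?thesis
    unfolding mvb_def by (intro runs_append[THEN runs_mono]) auto
qed

text \<open>A Hoare triple for the topmost trees of \<open>RW\<close>. Whatever lies below is
  untouched and all other stacks end as they began, so the auxiliary stacks can be shared by all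
  programs and a frame rule holds by definition.\<close>

definition transforms :: "instr list \<Rightarrow> d list \<Rightarrow> d list \<Rightarrow> nat \<Rightarrow> bool" where
  "transforms P xs ys n \<longleftrightarrow>
     (\<forall>s w. s RW = concat (map code xs) @ w \<longrightarrow> runs P s n (s(RW := concat (map code ys) @ w)))"

lemma trans_Nil: "transforms [] xs xs 0"
  unfolding transforms_def by (metis fun_upd_triv runs_Nil)

lemma trans_append: "transforms P xs ys n \<Longrightarrow> transforms Q ys zs m \<Longrightarrow> transforms (P @ Q) xs zs (n + m)"
  unfolding transforms_def
  by (metis (no_types, lifting) fun_upd_same fun_upd_upd runs_append)

lemma trans_frame: "transforms P xs ys n \<Longrightarrow> transforms P (xs @ zs) (ys @ zs) n"
  unfolding transforms_def by simp

lemma trans_mono: "transforms P xs ys n \<Longrightarrow> n \<le> m \<Longrightarrow> transforms P xs ys m"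
  unfolding transforms_def using runs_mono by blast

lemma trans_ite_N:
  assumes "transforms P (N a b # xs) ys n"
  shows "transforms (ite True RW (Some Nd) P Q) (N a b # xs) ys (n + 2)"
  using assms unfolding transforms_def by (intro allI impI runs_ite_true) auto

lemma trans_ite_L:
  assumes "transforms Q (L # xs) ys n"
  shows "transforms (ite True RW (Some Nd) P Q) (L # xs) ys (n + 2)"
  using assms unfolding transforms_def by (intro allI impI runs_ite_false) auto

lemma trans_pop_N: "transforms [Pop RW] (N a b # xs) (a # b # xs) 1"
  unfolding transforms_def by (intro allI impI runs_eq[OF runs_Pop1]) (auto simp: fun_eq_iff)

lemma trans_cons: "transforms [Push RW Nd] (a # b # xs) (N a b # xs) 1"
  unfolding transforms_def by (intro allI impI runs_eq[OF runs_Push1]) (auto simp: fun_eq_iff)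

lemma runs_push_list: "runs (map (Push r) (rev xs)) s (length xs) (s(r := xs @ s r))"
proof (induction xs)
  case Nil
  then show ?case by (simp add: runs_Nil)
next
  case (Cons a xs)
  have "runs [Push r a] (s(r := xs @ s r)) 1 (s(r := (a # xs) @ s r))"
    by (intro runs_eq[OF runs_Push1]) auto
  from runs_append[OF Cons.IH this] show ?case by (simp only: rev.simps map_append list.map length_Cons Suc_eq_plus1)
qed

lemma trans_const: "transforms (map (Push RW) (rev (code c))) xs (c # xs) (sz c)"
  unfolding transforms_def
proof (intro allI impI)
  fix s :: store and w
  assume "s RW = concat (map code xs) @ w"
  then show "runs (map (Push RW) (rev (code c))) s (sz c) (s(RW := concat (map code (c # xs)) @ w))"
    using runs_push_list[of RW "code c" s] by simp
qed

text \<open>A transfer by \<open>mv\<close> reverses the code. Unloading \<open>RA\<close> onto both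
  \<open>RW\<close> and \<open>RB\<close> restores the orientation of two copies; the copy on
  \<open>RB\<close> has to pass through \<open>RA\<close> again, since a direct transfer would
  reverse it.\<close>

definition dup :: "instr list" where
  "dup = [Push RA Mk] @ mv RW RA @ mvb RA [RW, RB] @ [Push RA Mk] @ mv RB RA @ mvb RA [RW]"

lemma trans_dup: "transforms dup [x] [x, x] (27 * sz x + 14)"
  unfolding transforms_def
proof (intro allI impI)
  fix s :: store and w
  assume s: "s RW = concat (map code [x]) @ w"
  let ?s1 = "s(RA := Mk # s RA)"
  let ?s2 = "s(RA := rev (code x) @ Mk # s RA, RW := w)"
  let ?s3 = "s(RB := code x @ s RB)"
  let ?s4 = "s(RB := code x @ s RB, RA := Mk # s RA)"
  let ?s5 = "s(RA := rev (code x) @ Mk # s RA)"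
  let ?s6 = "s(RW := concat (map code [x, x]) @ w)"
  have 1: "runs [Push RA Mk] s 1 ?s1" by (rule runs_Push1)
  have 2: "runs (mv RW RA) ?s1 (7 * sz x + 4) ?s2"
    using s by (intro runs_eq[OF runs_mv[of RW RA _ x w]]) (auto simp: fun_eq_iff)
  have 3: "runs (mvb RA [RW, RB]) ?s2 (7 * sz x + 2) ?s3"
    using s Mk_notin_code[of x]
    by (intro runs_eq[OF runs_mvb[of "[RW, RB]" RA ?s2 "rev (code x)" "s RA"]]) (auto simp: fun_eq_iff)
  have 4: "runs [Push RA Mk] ?s3 1 ?s4"
    by (intro runs_eq[OF runs_Push1]) (auto simp: fun_eq_iff)
  have 5: "runs (mv RB RA) ?s4 (7 * sz x + 4) ?s5"
    using s by (intro runs_eq[OF runs_mv[of RB RA _ x "s RB"]]) (auto simp: fun_eq_iff)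
  have 6: "runs (mvb RA [RW]) ?s5 (6 * sz x + 2) ?s6"
    using s Mk_notin_code[of x]
    by (intro runs_eq[OF runs_mvb[of "[RW]" RA ?s5 "rev (code x)" "s RA"]]) (auto simp: fun_eq_iff)
  show "runs dup s (27 * sz x + 14) ?s6"
    unfolding dup_def
    by (rule runs_mono[OF runs_append[OF 1 runs_append[OF 2 runs_append[OF 3
          runs_append[OF 4 runs_append[OF 5 6]]]]]]) simp
qed

definition drop_top :: "instr list" where
  "drop_top = [Push RA Mk] @ mv RW RA @ mvb RA []"

lemma trans_drop: "transforms drop_top (x # xs) xs (12 * sz x + 7)"
  unfolding transforms_def
proof (intro allI impI)
  fix s :: store and w
  assume s: "s RW = concat (map code (x # xs)) @ w"
  let ?s1 = "s(RA := Mk # s RA)"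
  let ?s2 = "s(RA := rev (code x) @ Mk # s RA, RW := concat (map code xs) @ w)"
  let ?s3 = "s(RW := concat (map code xs) @ w)"
  have 1: "runs [Push RA Mk] s 1 ?s1" by (rule runs_Push1)
  have 2: "runs (mv RW RA) ?s1 (7 * sz x + 4) ?s2"
    using s by (intro runs_eq[OF runs_mv[of RW RA _ x "concat (map code xs) @ w"]])
      (auto simp: fun_eq_iff)
  have 3: "runs (mvb RA []) ?s2 (5 * sz x + 2) ?s3"
    using s Mk_notin_code[of x]
    by (intro runs_eq[OF runs_mvb[of "[]" RA ?s2 "rev (code x)" "s RA"]]) (auto simp: fun_eq_iff)
  show "runs drop_top s (12 * sz x + 7) ?s3"
    unfolding drop_top_def by (rule runs_mono[OF runs_append[OF 1 runs_append[OF 2 3]]]) simp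
qed

definition swap_top :: "instr list" where
  "swap_top = [Push RA Mk] @ mv RW RA @ [Push RB Mk] @ mv RW RB @ mvb RA [RW] @ mvb RB [RW]"

lemma trans_swap: "transforms swap_top (x # y # xs) (y # x # xs) (13 * (sz x + sz y) + 14)"
  unfolding transforms_def
proof (intro allI impI)
  fix s :: store and w
  assume s: "s RW = concat (map code (x # y # xs)) @ w"
  define v where "v = concat (map code xs) @ w"
  have s: "s RW = code x @ code y @ v" using s by (simp add: v_def)
  let ?s1 = "s(RA := Mk # s RA)"
  let ?s2 = "s(RA := rev (code x) @ Mk # s RA, RW := code y @ v)"
  let ?s3 = "s(RA := rev (code x) @ Mk # s RA, RW := code y @ v, RB := Mk # s RB)"
  let ?s4 = "s(RA := rev (code x) @ Mk # s RA, RW := v, RB := rev (code y) @ Mk # s RB)"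
  let ?s5 = "s(RW := code x @ v, RB := rev (code y) @ Mk # s RB)"
  let ?s6 = "s(RW := code y @ code x @ v)"
  have 1: "runs [Push RA Mk] s 1 ?s1" by (rule runs_Push1)
  have 2: "runs (mv RW RA) ?s1 (7 * sz x + 4) ?s2"
    using s by (intro runs_eq[OF runs_mv[of RW RA _ x "code y @ v"]]) (auto simp: fun_eq_iff)
  have 3: "runs [Push RB Mk] ?s2 1 ?s3"
    by (intro runs_eq[OF runs_Push1]) (auto simp: fun_eq_iff)
  have 4: "runs (mv RW RB) ?s3 (7 * sz y + 4) ?s4"
    using s by (intro runs_eq[OF runs_mv[of RW RB _ y v]]) (auto simp: fun_eq_iff)
  have 5: "runs (mvb RA [RW]) ?s4 (6 * sz x + 2) ?s5"
    using s Mk_notin_code[of x]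
    by (intro runs_eq[OF runs_mvb[of "[RW]" RA ?s4 "rev (code x)" "s RA"]]) (auto simp: fun_eq_iff)
  have 6: "runs (mvb RB [RW]) ?s5 (6 * sz y + 2) ?s6"
    using s Mk_notin_code[of y]
    by (intro runs_eq[OF runs_mvb[of "[RW]" RB ?s5 "rev (code y)" "s RB"]]) (auto simp: fun_eq_iff)
  have "runs swap_top s (13 * (sz x + sz y) + 14) ?s6"
    unfolding swap_top_def
    by (rule runs_mono[OF runs_append[OF 1 runs_append[OF 2 runs_append[OF 3
          runs_append[OF 4 runs_append[OF 5 6]]]]]]) simp
  then show "runs swap_top s (13 * (sz x + sz y) + 14) (s(RW := concat (map code (y # x # xs)) @ w))"
    by (simp add: v_def)
qed

fun dhd :: "d \<Rightarrow> d" where "dhd L = L" | "dhd (N a b) = a"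
fun dtl :: "d \<Rightarrow> d" where "dtl L = L" | "dtl (N a b) = b"

definition dtl_prog :: "instr list" where
  "dtl_prog = ite True RW (Some Nd) ([Pop RW] @ drop_top) []"

lemma trans_dtl: "transforms dtl_prog (x # xs) (dtl x # xs) (12 * sz x + 10)"
proof (cases x)
  case L
  then show ?thesis unfolding dtl_prog_def
    using trans_mono[OF trans_ite_L[OF trans_Nil]] by simp
next
  case (N a b)
  have "transforms dtl_prog (N a b # xs) (b # xs) (1 + (12 * sz a + 7) + 2)" unfolding dtl_prog_def
    by (intro trans_ite_N trans_append[OF trans_pop_N] trans_drop)
  then show ?thesis using N by (auto elim: trans_mono)
qed

definition dhd_prog :: "instr list" where
  "dhd_prog = ite True RW (Some Nd) ([Pop RW] @ swap_top @ drop_top) []"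

lemma trans_dhd: "transforms dhd_prog (x # xs) (dhd x # xs) (25 * sz x + 30)"
proof (cases x)
  case L
  then show ?thesis unfolding dhd_prog_def
    using trans_mono[OF trans_ite_L[OF trans_Nil]] by simp
next
  case (N a b)
  have "transforms dhd_prog (N a b # xs) (a # xs) (1 + (13 * (sz a + sz b) + 14 + (12 * sz b + 7)) + 2)"
    unfolding dhd_prog_def
    by (intro trans_ite_N trans_append[OF trans_pop_N] trans_append[OF trans_swap] trans_drop)
  then show ?thesis using N by (auto elim: trans_mono)
qed

primrec len :: "d \<Rightarrow> nat" where
  "len L = 0"
| "len (N a b) = Suc (len b)"

lemma len_le_sz: "len x \<le> sz x"
  by (induction x) auto

text \<open>The counter lies above the state of the iteration. A round shortens the counter, swaps
  the state to the top for \<open>P\<close>, and swaps back, so the number of rounds is the length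
  \<open>len\<close> of the right spine of the counter.\<close>

definition iter_body :: "instr list \<Rightarrow> instr list" where
  "iter_body P = loop True RW (Some Nd) (dtl_prog @ swap_top @ P @ swap_top)"

definition iter_prog :: "instr list \<Rightarrow> instr list" where
  "iter_prog P = ite True RW (Some Nd) ([Pop RW] @ iter_body P @ drop_top) []"

lemma trans_loop_exit: "transforms (loop True RW (Some Nd) P) (L # xs) (L # xs) 1"
  unfolding transforms_def
  by (intro allI impI runs_eq[OF runs_loop_exit]) (auto simp: fun_eq_iff)

lemma trans_loop_step:
  assumes "transforms P (N a b # xs) ys n" "transforms (loop True RW (Some Nd) P) ys zs m"
  shows "transforms (loop True RW (Some Nd) P) (N a b # xs) zs (n + m + 2)"
  unfolding transforms_def
proof (intro allI impI)
  fix s :: store and w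
  assume s: "s RW = concat (map code (N a b # xs)) @ w"
  let ?s = "s(RW := concat (map code ys) @ w)"
  have "runs P s n ?s" using assms(1) s unfolding transforms_def by blast
  moreover have "runs (loop True RW (Some Nd) P) ?s m (?s(RW := concat (map code zs) @ w))"
    using assms(2) unfolding transforms_def by (metis fun_upd_same)
  ultimately show "runs (loop True RW (Some Nd) P) s (n + m + 2) (s(RW := concat (map code zs) @ w))"
    using s by (intro runs_loop_step) auto
qed

text \<open>\<open>Y\<close> is an arbitrary sequence and not the iterates of one function, so that
  the induction on the counter can shift it by one. \<open>S\<close> enters the time bound because
  the state is swapped twice per round.\<close>

lemma trans_iter:
  assumes "\<And>i. i < len m \<Longrightarrow> transforms P [Y i] [Y (Suc i)] M"
  assumes "\<And>i. i \<le> len m \<Longrightarrow> sz (Y i) \<le> S"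
  shows "transforms (iter_prog P) [N m (Y 0)] [Y (len m)] (len m * (M + 40 * sz m + 26 * S + 40) + 30)"
proof -
  have "transforms (iter_body P) [m, Y 0] [L, Y (len m)] (len m * (M + 40 * sz m + 26 * S + 40) + 1)"
    using assms
  proof (induction m arbitrary: Y)
    case L
    then show ?case using trans_loop_exit by (simp add: iter_body_def)
  next
    case (N a m)
    have s0: "sz (Y 0) \<le> S" using N.prems(2)[of 0] by simp
    have s1: "sz (Y 1) \<le> S" using N.prems(2)[of 1] by simp
    have P: "transforms P [Y 0, m] [Y 1, m] M" using trans_frame[OF N.prems(1)[of 0], of "[m]"] by simp
    have IH: "transforms (iter_body P) [m, Y 1] [L, Y (Suc (len m))] (len m * (M + 40 * sz m + 26 * S + 40) + 1)"
      using N.IH(2)[of "\<lambda>i. Y (Suc i)"] N.prems by simp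
    have "transforms (dtl_prog @ swap_top @ P @ swap_top) [N a m, Y 0] [m, Y 1]
        ((12 * sz (N a m) + 10) + ((13 * (sz m + sz (Y 0)) + 14) + (M + (13 * (sz (Y 1) + sz m) + 14))))"
      using trans_dtl[of "N a m" "[Y 0]"]
      by (intro trans_append[OF _ trans_append[OF trans_swap trans_append[OF P trans_swap]]]) simp
    from trans_loop_step[OF this IH[unfolded iter_body_def]]
    have *: "transforms (iter_body P) [N a m, Y 0] [L, Y (Suc (len m))]
      (((12 * sz (N a m) + 10) + ((13 * (sz m + sz (Y 0)) + 14) + (M + (13 * (sz (Y 1) + sz m) + 14)))) +
        (len m * (M + 40 * sz m + 26 * S + 40) + 1) + 2)"
      by (simp add: iter_body_def)
    define K where "K = len m * (M + 40 * sz m + 26 * S + 40)"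
    define K' where "K' = len m * (M + 40 * sz (N a m) + 26 * S + 40)"
    have "K \<le> K'" unfolding K_def K'_def by (intro mult_le_mono) auto
    moreover have "len (N a m) * (M + 40 * sz (N a m) + 26 * S + 40) = M + 40 * sz (N a m) + 26 * S + 40 + K'"
      unfolding K'_def by (simp only: len.simps mult_Suc)
    ultimately have "transforms (iter_body P) [N a m, Y 0] [L, Y (Suc (len m))]
        (len (N a m) * (M + 40 * sz (N a m) + 26 * S + 40) + 1)"
      using s0 s1 by (intro trans_mono[OF *]) (simp add: K_def[symmetric])
    then show ?case by simp
  qed
  from trans_append[OF trans_pop_N trans_append[OF this trans_drop]]
  have "transforms ([Pop RW] @ iter_body P @ drop_top) [N m (Y 0)] [Y (len m)]
     (1 + (len m * (M + 40 * sz m + 26 * S + 40) + 1 + (12 * sz L + 7)))" .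
  from trans_ite_N[OF this] show ?thesis
    unfolding iter_prog_def by (rule trans_mono) simp
qed

section \<open>Polynomial-time functions on binary trees\<close>

text \<open>Polynomial growth with respect to a size measure \<open>m\<close>. The base is at least
  2, so constants, sums and products are absorbed by a larger exponent.\<close>

definition pbd :: "('a \<Rightarrow> nat) \<Rightarrow> ('a \<Rightarrow> nat) \<Rightarrow> bool" where
  "pbd m h \<longleftrightarrow> (\<exists>k. \<forall>x. h x \<le> (m x + 2) ^ k)"

lemma pbd_mono: "pbd m h \<Longrightarrow> (\<And>x. g x \<le> h x) \<Longrightarrow> pbd m g"
  unfolding pbd_def by (meson order_trans)

lemma pbd_self: "pbd m m"
  unfolding pbd_def by (intro exI[of _ 1]) simp

lemma pbd_const: "pbd m (\<lambda>x. c)"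
proof -
  have "c \<le> (m x + 2) ^ c" for x
    using less_exp[of c] power_mono[of 2 "m x + 2" c] by linarith
  then show ?thesis unfolding pbd_def by blast
qed

lemma pbd_add: "pbd m g \<Longrightarrow> pbd m h \<Longrightarrow> pbd m (\<lambda>x. g x + h x)"
proof -
  assume "pbd m g" "pbd m h"
  then obtain k l where kl: "\<And>x. g x \<le> (m x + 2) ^ k" "\<And>x. h x \<le> (m x + 2) ^ l"
    unfolding pbd_def by blast
  have "g x + h x \<le> (m x + 2) ^ Suc (k + l)" for x
  proof -
    have "(m x + 2) ^ k \<le> (m x + 2) ^ (k + l)" "(m x + 2) ^ l \<le> (m x + 2) ^ (k + l)"
      by (intro power_increasing; simp)+
    then have "g x + h x \<le> 2 * (m x + 2) ^ (k + l)" using kl[of x] by linarith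
    also have "\<dots> \<le> (m x + 2) * (m x + 2) ^ (k + l)" by (intro mult_le_mono) auto
    finally show ?thesis by simp
  qed
  then show ?thesis unfolding pbd_def by blast
qed

lemma pbd_mult: "pbd m g \<Longrightarrow> pbd m h \<Longrightarrow> pbd m (\<lambda>x. g x * h x)"
proof -
  assume "pbd m g" "pbd m h"
  then obtain k l where kl: "\<And>x. g x \<le> (m x + 2) ^ k" "\<And>x. h x \<le> (m x + 2) ^ l"
    unfolding pbd_def by blast
  have "g x * h x \<le> (m x + 2) ^ (k + l)" for x
    using mult_le_mono[OF kl] by (simp add: power_add)
  then show ?thesis unfolding pbd_def by blast
qed

lemma pbd_power: "pbd m g \<Longrightarrow> pbd m (\<lambda>x. g x ^ k)"
  by (induction k) (auto intro: pbd_const pbd_mult)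

lemma pbd_comp: "pbd m' h \<Longrightarrow> pbd m (\<lambda>x. m' (f x)) \<Longrightarrow> pbd m (\<lambda>x. h (f x))"
proof -
  assume "pbd m' h" and f: "pbd m (\<lambda>x. m' (f x))"
  then obtain k where *: "\<And>y. h y \<le> (m' y + 2) ^ k" unfolding pbd_def by blast
  show ?thesis by (rule pbd_mono[OF pbd_power[OF pbd_add[OF f pbd_const]] *])
qed

lemmas pbd_intros = pbd_self pbd_const pbd_add pbd_mult pbd_power

text \<open>\<open>ptime e f\<close>: some program turns the tree \<open>e x\<close> into \<open>f x\<close>, uniformly in \<open>x\<close>.
  Trees outside the range of \<open>e\<close> do not matter, so size bounds need only hold for encoded data.\<close>

definition ptime :: "('a \<Rightarrow> d) \<Rightarrow> ('a \<Rightarrow> d) \<Rightarrow> bool" where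
  "ptime e f \<longleftrightarrow> (\<exists>P T. pbd (\<lambda>x. sz (e x)) T \<and> (\<forall>x. transforms P [e x] [f x] (T x)))"

lemma ptimeI: "(\<And>x. transforms P [e x] [f x] (T x)) \<Longrightarrow> pbd (\<lambda>x. sz (e x)) T \<Longrightarrow> ptime e f"
  unfolding ptime_def by blast

lemma trans_growth:
  assumes "transforms P xs [y] n"
  shows "sz y \<le> length (concat (map code xs)) + n"
proof -
  let ?s = "\<lambda>r. if r = RW then concat (map code xs) else []"
  have "runs P ?s n (?s(RW := code y))"
    using assms unfolding transforms_def by (elim allE[of _ ?s] allE[of _ "[]"]) simp
  then show ?thesis using runs_growth[of P ?s n _ RW] by force
qed

text \<open>A program cannot write more symbols than it makes steps. Composition rests on this: the
  second program is polynomial in its own input, which is polynomial in the original one.\<close>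

lemma ptime_size:
  assumes "ptime e f"
  shows "pbd (\<lambda>x. sz (e x)) (\<lambda>x. sz (f x))"
proof -
  obtain P T where *: "pbd (\<lambda>x. sz (e x)) T" "\<And>x. transforms P [e x] [f x] (T x)"
    using assms unfolding ptime_def by blast
  show ?thesis
    by (rule pbd_mono[OF pbd_add[OF pbd_self *(1)]]) (use trans_growth[OF *(2)] in simp)
qed

lemma ptime_self: "ptime e e"
  using trans_Nil by (rule ptimeI) (rule pbd_const)

lemma ptime_reindex:
  assumes "ptime e f"
  shows "ptime (\<lambda>x. e (h x)) (\<lambda>x. f (h x))"
proof -
  obtain P T where P: "pbd (\<lambda>x. sz (e x)) T" "\<And>x. transforms P [e x] [f x] (T x)"
    using assms unfolding ptime_def by blast
  show ?thesis
    by (rule ptimeI[of P _ _ "\<lambda>x. T (h x)"], rule P(2)) (use P(1) in \<open>auto simp: pbd_def\<close>)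
qed

lemma ptime_trans:
  assumes "ptime e f" "ptime f g"
  shows "ptime e g"
proof -
  obtain P T where P: "pbd (\<lambda>x. sz (e x)) T" "\<And>x. transforms P [e x] [f x] (T x)"
    using assms(1) unfolding ptime_def by blast
  obtain Q U where Q: "pbd (\<lambda>x. sz (f x)) U" "\<And>x. transforms Q [f x] [g x] (U x)"
    using assms(2) unfolding ptime_def by blast
  have U: "pbd (\<lambda>x. sz (e x)) U"
    using pbd_comp[OF Q(1), of _ "\<lambda>x. x"] ptime_size[OF assms(1)] by simp
  show ?thesis
    using trans_append[OF P(2) Q(2)] by (rule ptimeI) (intro pbd_add P(1) U)
qed

lemma ptime_const: "ptime e (\<lambda>x. c)"
proof (rule ptimeI)
  show "transforms (map (Push RW) (rev (code c)) @ swap_top @ drop_top) [e x] [c]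
      (sz c + ((13 * (sz c + sz (e x)) + 14) + (12 * sz (e x) + 7)))" for x
    by (intro trans_append[OF trans_const] trans_append[OF trans_swap] trans_drop)
qed (intro pbd_intros)

lemma ptime_N:
  assumes "ptime e f" "ptime e g"
  shows "ptime e (\<lambda>x. N (f x) (g x))"
proof -
  obtain P T where P: "pbd (\<lambda>x. sz (e x)) T" "\<And>x. transforms P [e x] [f x] (T x)"
    using assms(1) unfolding ptime_def by blast
  obtain Q U where Q: "pbd (\<lambda>x. sz (e x)) U" "\<And>x. transforms Q [e x] [g x] (U x)"
    using assms(2) unfolding ptime_def by blast
  show ?thesis
  proof (rule ptimeI)
    fix x
    show "transforms (dup @ Q @ swap_top @ P @ [Push RW Nd]) [e x] [N (f x) (g x)]
      ((27 * sz (e x) + 14) + (U x + ((13 * (sz (g x) + sz (e x)) + 14) + (T x + 1))))"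
      using trans_frame[OF Q(2), of x "[e x]"] trans_frame[OF P(2), of x "[g x]"]
      by (intro trans_append[OF trans_dup]
          trans_append[OF _ trans_append[OF trans_swap trans_append[OF _ trans_cons]]]) simp_all
  qed (intro pbd_intros P(1) Q(1) ptime_size assms(2))
qed

lemma ptime_dhd: "ptime e f \<Longrightarrow> ptime e (\<lambda>x. dhd (f x))"
  by (erule ptime_trans, rule ptimeI[OF trans_dhd], intro pbd_intros)

lemma ptime_dtl: "ptime e f \<Longrightarrow> ptime e (\<lambda>x. dtl (f x))"
  by (erule ptime_trans, rule ptimeI[OF trans_dtl], intro pbd_intros)

text \<open>Each branch only has to work on the inputs that reach it; the index type of the
  computations is restricted accordingly by \<open>h\<close> and \<open>h'\<close>.\<close>

lemma ptime_if:
  assumes "ptime e c" "ptime e' f'" "ptime e'' g'"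
  assumes "\<And>x. c x = L \<Longrightarrow> \<exists>y. e' y = e x \<and> f' y = f x"
  assumes "\<And>x. c x \<noteq> L \<Longrightarrow> \<exists>y. e'' y = e x \<and> g' y = f x"
  shows "ptime e f"
proof -
  obtain R V where R: "pbd (\<lambda>x. sz (e x)) V" "\<And>x. transforms R [e x] [c x] (V x)"
    using assms(1) unfolding ptime_def by blast
  obtain P T where P: "pbd (\<lambda>x. sz (e' x)) T" "\<And>x. transforms P [e' x] [f' x] (T x)"
    using assms(2) unfolding ptime_def by blast
  obtain Q U where Q: "pbd (\<lambda>x. sz (e'' x)) U" "\<And>x. transforms Q [e'' x] [g' x] (U x)"
    using assms(3) unfolding ptime_def by blast
  obtain k where k: "\<And>y. T y \<le> (sz (e' y) + 2) ^ k" using P(1) unfolding pbd_def by blast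
  obtain l where l: "\<And>y. U y \<le> (sz (e'' y) + 2) ^ l" using Q(1) unfolding pbd_def by blast
  show ?thesis
  proof (rule ptimeI)
    fix x
    let ?S = "(sz (e x) + 2) ^ k + (sz (e x) + 2) ^ l"
    have 1: "transforms (dup @ R) [e x] [c x, e x] ((27 * sz (e x) + 14) + V x)"
      using trans_frame[OF R(2), of x "[e x]"] by (intro trans_append[OF trans_dup]) simp
    have 2: "transforms (ite True RW (Some Nd) (drop_top @ Q) (drop_top @ P)) [c x, e x]
        [f x] ((12 * sz (c x) + 7 + ?S) + 2)"
    proof (cases "c x")
      case L
      then obtain y where y: "e' y = e x" "f' y = f x" using assms(4) by blast
      have "transforms (drop_top @ P) [L, e x] [f x] (12 * sz (c x) + 7 + ?S)"
        by (rule trans_mono[OF trans_append[OF trans_drop P(2)[of y, unfolded y]]]) (use k[of y] y L in simp)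
      from trans_ite_L[OF this] show ?thesis using L by simp
    next
      case (N a b)
      then obtain y where y: "e'' y = e x" "g' y = f x" using assms(5)[of x] by auto
      have "transforms (drop_top @ Q) [N a b, e x] [f x] (12 * sz (c x) + 7 + ?S)"
        by (rule trans_mono[OF trans_append[OF trans_drop Q(2)[of y, unfolded y]]]) (use l[of y] y N in simp)
      from trans_ite_N[OF this] show ?thesis using N by simp
    qed
    show "transforms ((dup @ R) @ ite True RW (Some Nd) (drop_top @ Q) (drop_top @ P)) [e x] [f x]
        (((27 * sz (e x) + 14) + V x) + ((12 * sz (c x) + 7 + ?S) + 2))"
      by (rule trans_append[OF 1 2])
  qed (intro pbd_intros R(1) ptime_size assms)
qed

text \<open>Repeating a polynomial-time step may produce exponential sizes, so a bound
  \<open>B\<close> on all intermediate states has to be supplied. With it each round has a fixed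
  polynomial cost, and the number of rounds is the spine length of a tree that was itself computed
  in polynomial time.\<close>

lemma ptime_iter:
  assumes F: "ptime s (\<lambda>y. s (F y))" and G: "ptime e (\<lambda>x. N (m x) (s (y x)))"
  assumes B: "pbd (\<lambda>x. sz (e x)) B" "\<And>x i. i \<le> len (m x) \<Longrightarrow> sz (s ((F ^^ i) (y x))) \<le> B x"
  shows "ptime e (\<lambda>x. s ((F ^^ len (m x)) (y x)))"
proof -
  obtain P T where P: "pbd (\<lambda>y. sz (s y)) T" "\<And>y. transforms P [s y] [s (F y)] (T y)"
    using F unfolding ptime_def by blast
  obtain k where k: "\<And>y. T y \<le> (sz (s y) + 2) ^ k" using P(1) unfolding pbd_def by blast
  have "ptime e (\<lambda>x. m x)" using ptime_dhd[OF G] by simp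
  from ptime_size[OF this] have m: "pbd (\<lambda>x. sz (e x)) (\<lambda>x. sz (m x))" .
  obtain Q U where Q: "pbd (\<lambda>x. sz (e x)) U" "\<And>x. transforms Q [e x] [N (m x) (s (y x))] (U x)"
    using G unfolding ptime_def by blast
  show ?thesis
  proof (rule ptimeI)
    fix x
    have bd: "transforms P [s ((F ^^ i) (y x))] [s ((F ^^ Suc i) (y x))] ((B x + 2) ^ k)"
      if "i < len (m x)" for i
    proof -
      have "sz (s ((F ^^ i) (y x))) \<le> B x" using B(2) that by simp
      then have "(sz (s ((F ^^ i) (y x))) + 2) ^ k \<le> (B x + 2) ^ k" by (intro power_mono) auto
      then show ?thesis using trans_mono[OF P(2)[of "(F ^^ i) (y x)"]] k[of "(F ^^ i) (y x)"] by simp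
    qed
    have *: "transforms (iter_prog P) [N (m x) (s (y x))] [s ((F ^^ len (m x)) (y x))]
        (len (m x) * ((B x + 2) ^ k + 40 * sz (m x) + 26 * B x + 40) + 30)"
      using trans_iter[of "m x" P "\<lambda>i. s ((F ^^ i) (y x))", OF bd B(2)] by simp
    have "transforms (iter_prog P) [N (m x) (s (y x))] [s ((F ^^ len (m x)) (y x))]
        (sz (m x) * ((B x + 2) ^ k + 40 * sz (m x) + 26 * B x + 40) + 30)"
      by (rule trans_mono[OF *], intro add_le_mono mult_le_mono) (use len_le_sz[of "m x"] in auto)
    then show "transforms (Q @ iter_prog P) [e x] [s ((F ^^ len (m x)) (y x))]
        (U x + (sz (m x) * ((B x + 2) ^ k + 40 * sz (m x) + 26 * B x + 40) + 30))"
      by (rule trans_append[OF Q(2)])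
  qed (intro pbd_intros Q(1) m B(1))
qed

primrec unary :: "nat \<Rightarrow> d" where
  "unary 0 = L"
| "unary (Suc n) = N L (unary n)"

text \<open>Bounded iteration counts along a tree spine. Replacing each symbol of a code by one
  spine cell produces a clock as long as the size of the argument.\<close>

definition units_prog :: "instr list" where
  "units_prog = [Push RA Mk] @ mv RW RA @ [Push RW Lf] @
     loop False RA (Some Mk) [Push RW Lf, Push RW Nd, Pop RA] @ [Pop RA]"

lemma runs_units_loop:
  "s RA = xs @ Mk # w \<Longrightarrow> Mk \<notin> set xs \<Longrightarrow> s RW = code (unary n) @ v \<Longrightarrow>
   runs (loop False RA (Some Mk) [Push RW Lf, Push RW Nd, Pop RA]) s (5 * length xs + 1)
     (s(RA := Mk # w, RW := code (unary (length xs + n)) @ v))"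
proof (induction xs arbitrary: s n)
  case Nil
  then show ?case by (intro runs_eq[OF runs_loop_exit]) (auto simp: fun_eq_iff)
next
  case (Cons a xs)
  let ?s = "s(RA := xs @ Mk # w, RW := code (unary (Suc n)) @ v)"
  have 1: "runs [Push RW Lf, Push RW Nd, Pop RA] s (Suc (Suc (Suc 0))) ?s"
    using Cons.prems by (intro runs_Push runs_Pop runs_Nil_eq) (auto simp: fun_eq_iff)
  have 2: "runs (loop False RA (Some Mk) [Push RW Lf, Push RW Nd, Pop RA]) ?s (5 * length xs + 1)
     (s(RA := Mk # w, RW := code (unary (length (a # xs) + n)) @ v))"
    using Cons.prems by (intro runs_eq[OF Cons.IH[of _ "Suc n"]]) (auto simp: fun_eq_iff)
  show ?case by (intro runs_eq[OF runs_loop_step[OF _ 1 2]]) (use Cons.prems in auto)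
qed

lemma trans_units: "transforms units_prog [x] [unary (sz x)] (12 * sz x + 8)"
  unfolding transforms_def
proof (intro allI impI)
  fix s :: store and w
  assume s: "s RW = concat (map code [x]) @ w"
  let ?s1 = "s(RA := Mk # s RA)"
  let ?s2 = "s(RA := rev (code x) @ Mk # s RA, RW := w)"
  let ?s3 = "s(RA := rev (code x) @ Mk # s RA, RW := code (unary 0) @ w)"
  let ?s4 = "s(RA := Mk # s RA, RW := code (unary (sz x)) @ w)"
  let ?s5 = "s(RW := concat (map code [unary (sz x)]) @ w)"
  have 1: "runs [Push RA Mk] s 1 ?s1" by (rule runs_Push1)
  have 2: "runs (mv RW RA) ?s1 (7 * sz x + 4) ?s2"
    using s by (intro runs_eq[OF runs_mv[of RW RA _ x w]]) (auto simp: fun_eq_iff)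
  have 3: "runs [Push RW Lf] ?s2 1 ?s3"
    by (intro runs_eq[OF runs_Push1]) (auto simp: fun_eq_iff)
  have 4: "runs (loop False RA (Some Mk) [Push RW Lf, Push RW Nd, Pop RA]) ?s3 (5 * sz x + 1) ?s4"
    using Mk_notin_code[of x]
    by (intro runs_eq[OF runs_units_loop[of ?s3 "rev (code x)" "s RA" 0 w]]) (auto simp: fun_eq_iff)
  have 5: "runs [Pop RA] ?s4 1 ?s5"
    by (intro runs_eq[OF runs_Pop1]) (auto simp: fun_eq_iff)
  show "runs units_prog s (12 * sz x + 8) ?s5"
    unfolding units_prog_def
    by (rule runs_mono[OF runs_append[OF 1 runs_append[OF 2 runs_append[OF 3 runs_append[OF 4 5]]]]]) simp
qed

lemma ptime_units: "ptime e f \<Longrightarrow> ptime e (\<lambda>x. unary (sz (f x)))"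
  by (erule ptime_trans, rule ptimeI[OF trans_units], intro pbd_intros)

section \<open>From tree programs to Turing machines\<close>

fun encbl :: "bool list \<Rightarrow> d" where
  "encbl [] = L"
| "encbl (b # bs) = N (if b then N L L else L) (encbl bs)"

lemma sz_encbl: "sz (encbl w) \<le> 4 * length w + 1"
  by (induction w) auto

lemma length_le_sz_encbl: "length w \<le> sz (encbl w)"
  by (induction w) auto

text \<open>A list is built on a stack from its last element backwards, whereas the first input bit
  is on top of \<open>RI\<close>; moving the bits to \<open>RA\<close> puts the last one on
  top.\<close>

definition rev_input :: "instr list" where
  "rev_input = loop False RI None (ite True RI (Some Nd) [Push RA Nd, Pop RI] [Push RA Lf, Pop RI])"

lemma runs_rev_input:
  "s RI = map bsym w \<Longrightarrow>
   runs rev_input s (6 * length w + 1) (s(RI := [], RA := rev (map bsym w) @ s RA))"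
proof (induction w arbitrary: s)
  case Nil
  then show ?case unfolding rev_input_def by (intro runs_eq[OF runs_loop_exit]) (auto simp: fun_eq_iff)
next
  case (Cons b w)
  let ?s = "s(RI := map bsym w, RA := bsym b # s RA)"
  have body: "runs [Push RA a, Pop RI] s 2 ?s" if "a = bsym b" for a
    unfolding numeral_2_eq_2 using Cons.prems that
    by (intro runs_Push runs_Pop runs_Nil_eq) (auto simp: fun_eq_iff)
  have 1: "runs (ite True RI (Some Nd) [Push RA Nd, Pop RI] [Push RA Lf, Pop RI]) s 4 ?s"
  proof (cases b)
    case True
    then show ?thesis using Cons.prems by (intro runs_eq[OF runs_ite_true[OF _ body]]) (auto simp: bsym_def)
  next
    case False
    then show ?thesis using Cons.prems by (intro runs_eq[OF runs_ite_false[OF _ body]]) (auto simp: bsym_def)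
  qed
  have 2: "runs rev_input ?s (6 * length w + 1) (s(RI := [], RA := rev (map bsym (b # w)) @ s RA))"
    by (intro runs_eq[OF Cons.IH]) (auto simp: fun_eq_iff)
  show ?case unfolding rev_input_def
    by (intro runs_eq[OF runs_loop_step[OF _ 1 2[unfolded rev_input_def]]]) (use Cons.prems in auto)
qed

definition build_input :: "instr list" where
  "build_input = loop False RA None (ite True RA (Some Nd)
     [Push RW Lf, Push RW Lf, Push RW Nd, Push RW Nd, Pop RA] [Push RW Lf, Push RW Nd, Pop RA])"

lemma runs_build_input:
  "s RA = rev (map bsym w) \<Longrightarrow> s RW = code (encbl v) \<Longrightarrow>
   runs build_input s (9 * length w + 1) (s(RA := [], RW := code (encbl (w @ v))))"
proof (induction w arbitrary: s v rule: rev_induct)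
  case Nil
  then show ?case unfolding build_input_def by (intro runs_eq[OF runs_loop_exit]) (auto simp: fun_eq_iff)
next
  case (snoc b w)
  let ?s = "s(RA := rev (map bsym w), RW := code (encbl (b # v)))"
  have 1: "runs (ite True RA (Some Nd)
     [Push RW Lf, Push RW Lf, Push RW Nd, Push RW Nd, Pop RA] [Push RW Lf, Push RW Nd, Pop RA]) s 7 ?s"
  proof (cases b)
    case True
    have "runs [Push RW Lf, Push RW Lf, Push RW Nd, Push RW Nd, Pop RA] s (Suc (Suc (Suc (Suc (Suc 0))))) ?s"
      using snoc.prems True by (intro runs_Push runs_Pop runs_Nil_eq) (auto simp: fun_eq_iff)
    then show ?thesis by (rule runs_eq[OF runs_ite_true, rotated]) (use snoc.prems True in \<open>auto simp: bsym_def\<close>)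
  next
    case False
    have "runs [Push RW Lf, Push RW Nd, Pop RA] s (Suc (Suc (Suc 0))) ?s"
      using snoc.prems False by (intro runs_Push runs_Pop runs_Nil_eq) (auto simp: fun_eq_iff)
    then show ?thesis by (rule runs_eq[OF runs_ite_false, rotated]) (use snoc.prems False in \<open>auto simp: bsym_def\<close>)
  qed
  have 2: "runs build_input ?s (9 * length w + 1) (s(RA := [], RW := code (encbl ((w @ [b]) @ v))))"
    by (intro runs_eq[OF snoc.IH[of _ "b # v"]]) (auto simp: fun_eq_iff)
  show ?case unfolding build_input_def
    by (intro runs_eq[OF runs_loop_step[OF _ 1 2[unfolded build_input_def]]]) (use snoc.prems in auto)
qed

definition read_input :: "instr list" where
  "read_input = rev_input @ [Push RW Lf] @ build_input"

lemma runs_read_input: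
  "runs read_input (input_store w) (15 * length w + 3) (\<lambda>r. if r = RW then code (encbl w) else [])"
proof -
  have 1: "runs rev_input (input_store w) (6 * length w + 1) (\<lambda>r. if r = RA then rev (map bsym w) else [])"
    by (intro runs_eq[OF runs_rev_input[of _ w]]) (auto simp: input_store_def fun_eq_iff)
  have 2: "runs [Push RW Lf] (\<lambda>r. if r = RA then rev (map bsym w) else []) 1
      (\<lambda>r. if r = RA then rev (map bsym w) else if r = RW then [Lf] else [])"
    by (intro runs_eq[OF runs_Push1]) (auto simp: fun_eq_iff)
  have 3: "runs build_input (\<lambda>r. if r = RA then rev (map bsym w) else if r = RW then [Lf] else []) (9 * length w + 1)
      (\<lambda>r. if r = RW then code (encbl w) else [])"
    by (intro runs_eq[OF runs_build_input[of _ w "[]"]]) (auto simp: fun_eq_iff)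
  show ?thesis unfolding read_input_def
    by (rule runs_mono[OF runs_append[OF 1 runs_append[OF 2 3]]]) simp
qed

text \<open>A list cell is \<open>Nd\<close> followed by the code of its bit, which has one symbol
  for \<open>False\<close> and three for \<open>True\<close>. The bits are pushed in order onto the
  tape that grows rightwards from cell 0, where the output is read.\<close>

definition write_output :: "instr list" where
  "write_output = loop True RW (Some Nd)
     (Pop RW # ite True RW (Some Nd) [Pop RW, Pop RW, Pop RW, Push RA Nd] [Pop RW, Push RA Lf])"

lemma runs_write_output:
  "s RW = code (encbl v) \<Longrightarrow>
   runs write_output s (9 * length v + 1) (s(RW := [Lf], RA := rev (map bsym v) @ s RA))"
proof (induction v arbitrary: s)
  case Nil
  then show ?case unfolding write_output_def by (intro runs_eq[OF runs_loop_exit]) (auto simp: fun_eq_iff)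
next
  case (Cons b v)
  let ?s = "s(RW := code (encbl v), RA := bsym b # s RA)"
  have 1: "runs (Pop RW # ite True RW (Some Nd) [Pop RW, Pop RW, Pop RW, Push RA Nd] [Pop RW, Push RA Lf]) s 7 ?s"
  proof (cases b)
    case True
    let ?u = "s(RW := tl (s RW))"
    have "runs [Pop RW, Pop RW, Pop RW, Push RA Nd] ?u (Suc (Suc (Suc (Suc 0)))) ?s"
      using Cons.prems True by (intro runs_Push runs_Pop runs_Nil_eq) (auto simp: fun_eq_iff bsym_def)
    then have "runs (ite True RW (Some Nd) [Pop RW, Pop RW, Pop RW, Push RA Nd] [Pop RW, Push RA Lf]) ?u 6 ?s"
      by (rule runs_eq[OF runs_ite_true, rotated]) (use Cons.prems True in auto)
    from runs_Pop[OF this] show ?thesis by simp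
  next
    case False
    let ?u = "s(RW := tl (s RW))"
    have "runs [Pop RW, Push RA Lf] ?u (Suc (Suc 0)) ?s"
      using Cons.prems False by (intro runs_Push runs_Pop runs_Nil_eq) (auto simp: fun_eq_iff bsym_def)
    then have "runs (ite True RW (Some Nd) [Pop RW, Pop RW, Pop RW, Push RA Nd] [Pop RW, Push RA Lf]) ?u 6 ?s"
      by (rule runs_eq[OF runs_ite_false, rotated]) (use Cons.prems False in auto)
    from runs_Pop[OF this] show ?thesis by simp
  qed
  have 2: "runs write_output ?s (9 * length v + 1) (s(RW := [Lf], RA := rev (map bsym (b # v)) @ s RA))"
    by (intro runs_eq[OF Cons.IH]) (auto simp: fun_eq_iff)
  show ?case unfolding write_output_def
    by (intro runs_eq[OF runs_loop_step[OF _ 1 2[unfolded write_output_def]]]) (use Cons.prems in auto)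
qed

lemma poly_bound:
  assumes "pbd (length :: bool list \<Rightarrow> nat) h"
  shows "\<exists>p :: nat poly. \<forall>w. h w \<le> poly p (length w)"
proof -
  obtain k where "\<And>w. h w \<le> (length w + 2) ^ k" using assms unfolding pbd_def by blast
  then show ?thesis by (intro exI[of _ "[:2, 1:] ^ k"]) (simp add: poly_power)
qed

lemma runs_from_start:
  assumes "runs P s n s'"
  shows "\<exists>t\<le>n. (mstep (P @ B) ^^ t) (0, s) = (length P, s')"
proof -
  obtain t where "t \<le> n" "\<And>A B. (mstep (A @ P @ B) ^^ t) (length A, s) = (length A + length P, s')"
    using assms unfolding runs_def by blast
  from this(1) this(2)[of "[]"] show ?thesis by auto
qed

lemma pbd_encbl: "pbd (\<lambda>w. sz (encbl w)) h \<Longrightarrow> pbd length h"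
proof -
  have "pbd length (\<lambda>w. sz (encbl w))"
    by (rule pbd_mono[OF _ sz_encbl]) (intro pbd_intros)
  then show "pbd (\<lambda>w. sz (encbl w)) h \<Longrightarrow> pbd length h"
    using pbd_comp[of "\<lambda>w. sz (encbl w)" h length "\<lambda>w. w"] by simp
qed

theorem ptime_polytime_computable:
  assumes "ptime encbl (\<lambda>w. encbl (g w))"
  shows "polytime_computable g"
proof -
  obtain P T where P: "pbd (\<lambda>w. sz (encbl w)) T" "\<And>w. transforms P [encbl w] [encbl (g w)] (T w)"
    using assms unfolding ptime_def by blast
  define Q where "Q = read_input @ P @ write_output"
  define U where "U w = 15 * length w + 3 + (T w + (9 * sz (encbl (g w)) + 1))" for w
  have run: "\<exists>s. runs Q (input_store w) (U w) s \<and> s RA = rev (map bsym (g w))" for w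
  proof -
    let ?s = "\<lambda>r. if r = RW then code (encbl w) else []"
    let ?s' = "\<lambda>r. if r = RW then code (encbl (g w)) else []"
    have 2: "runs P ?s (T w) ?s'"
      by (rule runs_eq[OF P(2)[of w, unfolded transforms_def, rule_format, of ?s "[]"]]) auto
    have 3: "runs write_output ?s' (9 * sz (encbl (g w)) + 1) (?s'(RW := [Lf], RA := rev (map bsym (g w)) @ ?s' RA))"
      by (intro runs_eq[OF runs_write_output]) (use length_le_sz_encbl[of "g w"] in auto)
    show ?thesis
      using runs_append[OF runs_read_input runs_append[OF 2 3]] unfolding Q_def U_def
      by (intro exI conjI, assumption) simp
  qed
  have "pbd length U"
    unfolding U_def by (intro pbd_intros pbd_encbl P(1) ptime_size assms)
  from poly_bound[OF this] obtain p :: "nat poly" where p: "\<And>w. U w \<le> poly p (length w)" by blast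
  have "computes_in_time (tm_of Q) g (\<lambda>n. 2 * poly p n + 1)"
  proof (rule computes_tm_of)
    fix w
    obtain s where s: "runs Q (input_store w) (U w) s" "s RA = rev (map bsym (g w))" using run by blast
    obtain t where "t \<le> U w" "(mstep Q ^^ t) (0, input_store w) = (length Q, s)"
      using runs_from_start[OF s(1), of "[]"] by auto
    then show "\<exists>t\<le>poly p (length w). \<exists>s. (mstep Q ^^ t) (0, input_store w) = (length Q, s) \<and>
        s RA = rev (map bsym (g w))"
      using s(2) p[of w] by (meson order_trans)
  qed
  moreover have "(\<lambda>n. 2 * poly p n + 1) = poly ([:2:] * p + [:1:])" by (auto simp: fun_eq_iff)
  ultimately show ?thesis unfolding polytime_computable_def using is_tm_tm_of by metis
qed

text \<open>The exponential running time comes from \<open>H\<close>, which is iterated polynomially often to build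
  an exponentially long input for the polynomial-time function \<open>D\<close>.\<close>

theorem ptime_EXPTIME:
  assumes M: "ptime encbl M" and H: "ptime s (\<lambda>y. s (H y))" "\<And>y. sz (s (H y)) \<le> 2 * sz (s y)"
  assumes D: "ptime (\<lambda>w. N (encbl w) (s ((H ^^ len (M w)) y0))) (\<lambda>w. if w \<in> A then N L L else L)"
  shows "A \<in> EXPTIME"
proof -
  define c where "c = s y0"
  define fuel where "fuel w = s ((H ^^ len (M w)) y0)" for w
  obtain P1 T1 where P1: "pbd (\<lambda>w. sz (encbl w)) T1" "\<And>w. transforms P1 [encbl w] [M w] (T1 w)"
    using M unfolding ptime_def by blast
  obtain P2 T2 where P2: "pbd (\<lambda>y. sz (s y)) T2" "\<And>y. transforms P2 [s y] [s (H y)] (T2 y)"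
    using H(1) unfolding ptime_def by blast
  obtain P3 T3 where P3: "pbd (\<lambda>w. sz (N (encbl w) (fuel w))) T3"
      "\<And>w. transforms P3 [N (encbl w) (fuel w)] [if w \<in> A then N L L else L] (T3 w)"
    using D unfolding fuel_def ptime_def by blast
  obtain k2 where k2: "\<And>y. T2 y \<le> (sz (s y) + 2) ^ k2" using P2(1) unfolding pbd_def by blast
  obtain k3 where k3: "\<And>w. T3 w \<le> (sz (N (encbl w) (fuel w)) + 2) ^ k3" using P3(1) unfolding pbd_def by blast
  \<comment> \<open>\<open>H\<close> at most doubles the size, so after \<open>len (M w)\<close>
    rounds the fuel has size at most \<open>2 ^ len (M w) * sz c\<close>. \<open>E w\<close> bounds
    the fuel, the counter and the input at once, and the whole run is polynomial in it.\<close>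
  define E :: "bool list \<Rightarrow> nat" where "E w = 2 ^ (sz (M w) + sz (encbl w) + sz c)" for w
  have szH: "sz (s ((H ^^ i) y0)) \<le> E w" if "i \<le> len (M w)" for i w
  proof -
    have "sz (s ((H ^^ i) y0)) \<le> 2 ^ i * sz c"
    proof (induction i)
      case (Suc i)
      then show ?case using H(2)[of "(H ^^ i) y0"] by simp
    qed (simp add: c_def)
    also have "\<dots> \<le> 2 ^ i * 2 ^ sz c" using less_exp[of "sz c"] by simp
    also have "\<dots> \<le> E w"
      unfolding E_def power_add[symmetric] using that len_le_sz[of "M w"]
      by (intro power_increasing) auto
    finally show ?thesis .
  qed
  have szE: "sz (M w) \<le> E w" "sz (encbl w) \<le> E w" "sz c \<le> E w" for w
    unfolding E_def using less_exp[of "sz (M w) + sz (encbl w) + sz c"] by linarith+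
  define Q where "Q = (read_input @ dup @ P1 @ map (Push RW) (rev (code c)) @ swap_top @ [Push RW Nd] @
      iter_prog P2 @ swap_top @ [Push RW Nd] @ P3)"
  define U where "U w = 15 * E w + 3 + (27 * E w + 14 + (T1 w + (E w + ((26 * E w + 14) + (1 +
      ((E w * ((E w + 2) ^ k2 + 40 * E w + 26 * E w + 40) + 30) + ((26 * E w + 14) + (1 + (2 * E w + 3) ^ k3))))))))" for w
  have run: "runs Q (input_store w) (U w) (\<lambda>r. if r = RW then code (if w \<in> A then N L L else L) else [])" for w
  proof -
    let ?x = "encbl w" and ?s = "\<lambda>r. if r = RW then code (encbl w) else []"
    have bd: "transforms P2 [s ((H ^^ i) y0)] [s ((H ^^ Suc i) y0)] ((E w + 2) ^ k2)" if "i < len (M w)" for i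
    proof -
      have "sz (s ((H ^^ i) y0)) \<le> E w" using szH that by simp
      then have "(sz (s ((H ^^ i) y0)) + 2) ^ k2 \<le> (E w + 2) ^ k2" by (intro power_mono) auto
      then show ?thesis using trans_mono[OF P2(2)[of "(H ^^ i) y0"]] k2[of "(H ^^ i) y0"] by simp
    qed
    have it: "transforms (iter_prog P2) [N (M w) c, ?x] [fuel w, ?x]
        (E w * ((E w + 2) ^ k2 + 40 * E w + 26 * E w + 40) + 30)"
    proof -
      have *: "transforms (iter_prog P2) [N (M w) c] [fuel w]
          (len (M w) * ((E w + 2) ^ k2 + 40 * sz (M w) + 26 * E w + 40) + 30)"
        using trans_iter[of "M w" P2 "\<lambda>i. s ((H ^^ i) y0)", OF bd szH] by (simp add: fuel_def c_def)
      have "transforms (iter_prog P2) [N (M w) c] [fuel w]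
          (E w * ((E w + 2) ^ k2 + 40 * E w + 26 * E w + 40) + 30)"
        by (rule trans_mono[OF *], intro add_le_mono mult_le_mono)
           (use len_le_sz[of "M w"] szE[of w] in auto)
      from trans_frame[OF this, of "[?x]"] show ?thesis by simp
    qed
    have szf: "sz (fuel w) \<le> E w" unfolding fuel_def using szH[OF order_refl] .
    have "T3 w \<le> (sz (N ?x (fuel w)) + 2) ^ k3" by (rule k3)
    also have "\<dots> \<le> (2 * E w + 3) ^ k3" using szf szE(2)[of w] by (intro power_mono) auto
    finally have "transforms P3 [N ?x (fuel w)] [if w \<in> A then N L L else L] ((2 * E w + 3) ^ k3)"
      using trans_mono[OF P3(2)] by blast
    then have "transforms (dup @ P1 @ map (Push RW) (rev (code c)) @ swap_top @ [Push RW Nd] @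
      iter_prog P2 @ swap_top @ [Push RW Nd] @ P3) [?x] [if w \<in> A then N L L else L] (27 * E w + 14 + (T1 w + (E w + ((26 * E w + 14) + (1 +
      ((E w * ((E w + 2) ^ k2 + 40 * E w + 26 * E w + 40) + 30) + ((26 * E w + 14) + (1 + (2 * E w + 3) ^ k3))))))))"
      using trans_frame[OF P1(2)[of w], of "[?x]"] szE[of w] szf
      by (intro trans_append[OF trans_mono[OF trans_dup] trans_append[OF _ trans_append[OF trans_mono[OF trans_const]
         trans_append[OF trans_mono[OF trans_swap] trans_append[OF trans_cons trans_append[OF it
         trans_append[OF trans_mono[OF trans_swap] trans_append[OF trans_cons]]]]]]]]) auto
    from this[unfolded transforms_def, rule_format, of ?s "[]"]
    have tr: "runs (dup @ P1 @ map (Push RW) (rev (code c)) @ swap_top @ [Push RW Nd] @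
      iter_prog P2 @ swap_top @ [Push RW Nd] @ P3) ?s (27 * E w + 14 + (T1 w + (E w + ((26 * E w + 14) + (1 +
      ((E w * ((E w + 2) ^ k2 + 40 * E w + 26 * E w + 40) + 30) + ((26 * E w + 14) + (1 + (2 * E w + 3) ^ k3))))))))
      (?s(RW := code (if w \<in> A then N L L else L)))" by simp
    have 1: "runs read_input (input_store w) (15 * E w + 3) ?s"
      using szE(2)[of w] length_le_sz_encbl[of w] by (intro runs_eq[OF runs_read_input]) auto
    show ?thesis unfolding Q_def U_def
      by (rule runs_eq[OF runs_append[OF 1 tr]]) (auto simp: fun_eq_iff)
  qed
  \<comment> \<open>The answer tree is tested by its root. A node falls through to the end of the
    program and accepts; a leaf jumps one position too far and rejects.\<close>
  define Q' where "Q' = Q @ [Jif True RW (Some Nd) 1]"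
  have dec: "\<exists>t \<le> U w + 1. \<exists>pc s. (mstep Q' ^^ t) (0, input_store w) = (pc, s) \<and>
    (if w \<in> A then pc = length Q' else pc > length Q')" for w
  proof -
    let ?s = "\<lambda>r. if r = RW then code (if w \<in> A then N L L else L) else []"
    obtain t where t: "t \<le> U w" "(mstep Q' ^^ t) (0, input_store w) = (length Q, ?s)"
      using runs_from_start[OF run] unfolding Q'_def by blast
    have "mstep Q' (length Q, ?s) = (if w \<in> A then length Q' else Suc (length Q'), ?s)"
      unfolding Q'_def mstep_at by simp
    then show ?thesis using t by (intro exI[of _ "Suc t"]) auto
  qed
  define e where "e w = sz (M w) + sz (encbl w) + sz c" for w
  have pe: "pbd length e" unfolding e_def by (intro pbd_intros pbd_encbl ptime_size M)
  have pT1: "pbd length T1" by (intro pbd_encbl P1(1))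
  have "pbd E U"
  proof -
    have "pbd E T1"
    proof -
      obtain k where k: "\<And>w. T1 w \<le> (sz (encbl w) + 2) ^ k" using P1(1) unfolding pbd_def by blast
      have "T1 w \<le> (E w + 2) ^ k" for w
        using k[of w] power_mono[of "sz (encbl w) + 2" "E w + 2" k] szE(2)[of w] by linarith
      then show ?thesis unfolding pbd_def by blast
    qed
    then show ?thesis unfolding U_def by (intro pbd_intros)
  qed
  then have "pbd E (\<lambda>w. 2 * (U w + 1) + 1)" by (intro pbd_intros)
  then obtain k where k: "\<And>w. 2 * (U w + 1) + 1 \<le> (E w + 2) ^ k" unfolding pbd_def by blast
  \<comment> \<open>\<open>E w\<close> is \<open>2 ^ e w\<close>, hence \<open>E w + 2\<close> is at
    most \<open>2 ^ (e w + 2)\<close> and a power of it has the exponent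
    \<open>(e w + 2) * k\<close>, which is polynomial in the input length.\<close>
  have "pbd length (\<lambda>w. (e w + 2) * k)" by (intro pbd_intros pe)
  from poly_bound[OF this] obtain p :: "nat poly" where p: "\<And>w. (e w + 2) * k \<le> poly p (length w)" by blast
  have U2: "2 * (U w + 1) + 1 \<le> 2 ^ poly p (length w)" for w
  proof -
    have "1 \<le> (2 :: nat) ^ e w" by simp
    moreover have "2 ^ (e w + 2) = 4 * E w" "E w = 2 ^ e w" by (simp_all add: E_def e_def)
    ultimately have "E w + 2 \<le> 2 ^ (e w + 2)" by linarith
    then have "(E w + 2) ^ k \<le> (2 ^ (e w + 2)) ^ k" by (intro power_mono) auto
    also have "\<dots> = 2 ^ ((e w + 2) * k)" by (simp only: power_mult)
    also have "\<dots> \<le> 2 ^ poly p (length w)" by (intro power_increasing p) simp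
    finally show ?thesis using k[of w] by linarith
  qed
  have "decides_in_time (tm_of Q') A (\<lambda>n. 2 ^ poly p n)"
    unfolding decides_in_time_def
  proof
    fix w
    obtain t pc s where t: "t \<le> U w + 1" "(mstep Q' ^^ t) (0, input_store w) = (pc, s)"
      "if w \<in> A then pc = length Q' else pc > length Q'" using dec by blast
    obtain u ts where u: "u \<le> 2 * t + 1" "(tm_step (tm_of Q') ^^ u) (tm_init (tm_of Q') w) = (pcst Q' pc, ts)"
      using tm_of_run[OF t(2)] by blast
    have "2 * t + 1 \<le> 2 * (U w + 1) + 1" using t(1) by (intro add_mono mult_le_mono) auto
    with u(1) have "u \<le> 2 * (U w + 1) + 1" by (rule order_trans)
    then have "u \<le> 2 ^ poly p (length w)" using U2[of w] by (rule order_trans)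
    moreover have "halted (tm_of Q') (pcst Q' pc, ts) \<and> (pcst Q' pc = accept_state (tm_of Q') \<longleftrightarrow> w \<in> A)"
      using t(3) by (auto simp: halted_def tm_of_def pcst_def split: if_splits)
    ultimately show "\<exists>t\<le>2 ^ poly p (length w). let c = (tm_step (tm_of Q') ^^ t) (tm_init (tm_of Q') w)
        in halted (tm_of Q') c \<and> (fst c = accept_state (tm_of Q') \<longleftrightarrow> w \<in> A)"
      using u(2) by (intro exI[of _ u]) simp
  qed
  then show ?thesis unfolding EXPTIME_def using is_tm_tm_of by blast
qed

section \<open>Polynomial-time functions on encoded types\<close>

text \<open>Injectivity turns the comparison of codes into an equality test on the data
  themselves.\<close>

class enc =
  fixes enc :: "'a \<Rightarrow> d"
  assumes enc_eq [simp]: "enc x = enc y \<longleftrightarrow> x = y"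

abbreviation siz :: "'a :: enc \<Rightarrow> nat" where "siz x \<equiv> sz (enc x)"

instantiation d :: enc
begin
definition enc_d :: "d \<Rightarrow> d" where [simp]: "enc_d x = x"
instance by standard simp
end

instantiation unit :: enc
begin
definition enc_unit :: "unit \<Rightarrow> d" where [simp]: "enc_unit x = L"
instance by standard simp
end

instantiation bool :: enc
begin
definition enc_bool :: "bool \<Rightarrow> d" where "enc_bool b = (if b then N L L else L)"
instance by standard (auto simp: enc_bool_def)
end

instantiation prod :: (enc, enc) enc
begin
fun enc_prod :: "'a \<times> 'b \<Rightarrow> d" where "enc_prod (a, b) = N (enc a) (enc b)"
instance by standard auto
end

instantiation option :: (enc) enc
begin
fun enc_option :: "'a option \<Rightarrow> d" where
  "enc_option None = L"
| "enc_option (Some a) = N (enc a) L"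
instance
proof
  show "enc x = enc y \<longleftrightarrow> x = y" for x y :: "'a option" by (cases x; cases y) auto
qed
end

primrec enclist :: "d list \<Rightarrow> d" where
  "enclist [] = L"
| "enclist (x # xs) = N x (enclist xs)"

lemma enclist_eq [simp]: "enclist xs = enclist ys \<longleftrightarrow> xs = ys"
proof (induction xs arbitrary: ys)
  case Nil
  then show ?case by (cases ys) auto
next
  case (Cons x xs)
  then show ?case by (cases ys) auto
qed

instantiation list :: (enc) enc
begin
definition enc_list :: "'a list \<Rightarrow> d" where "enc_list xs = enclist (map enc xs)"
instance by standard (auto simp: enc_list_def inj_on_def)
end

lemma enc_list_simps [simp]: "enc [] = L" "enc (x # xs) = N (enc x) (enc xs)"
  by (simp_all add: enc_list_def)

lemma enc_bool_simps [simp]: "enc True = N L L" "enc False = L" "enc b = L \<longleftrightarrow> \<not> b"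
  by (simp_all add: enc_bool_def)

lemma encbl_eq_enc: "encbl w = enc w"
  by (induction w) (auto simp: enc_bool_def)

lemma len_enc [simp]: "len (enc (xs :: 'a :: enc list)) = length xs"
  by (induction xs) auto

lemma siz_list: "siz (xs :: 'a :: enc list) = 1 + (\<Sum>x\<leftarrow>xs. siz x + 1)"
  by (induction xs) auto

lemma siz_append: "siz (xs @ ys) + 1 = siz xs + siz (ys :: 'a :: enc list)"
  by (simp add: siz_list)

lemma siz_rev: "siz (rev xs) = siz (xs :: 'a :: enc list)"
  by (simp add: siz_list rev_map[symmetric] sum_list_rev)

lemma siz_elem: "x \<in> set xs \<Longrightarrow> siz x < siz (xs :: 'a :: enc list)"
  by (induction xs) auto

lemma length_le_siz: "length xs \<le> siz (xs :: 'a :: enc list)"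
  by (induction xs) auto

fun bits_val :: "bool list \<Rightarrow> nat" where
  "bits_val [] = 0"
| "bits_val (b # bs) = of_bool b + 2 * bits_val bs"

lemma binary_rec: "binary n = (if n < 2 then [odd n] else odd n # binary (n div 2))"
  by (rule binary.simps)

lemma bits_val_binary [simp]: "bits_val (binary n) = n"
proof (induction n rule: less_induct)
  case (less n)
  show ?case
  proof (cases "n < 2")
    case True
    then have "n = 0 \<or> n = 1" by linarith
    then show ?thesis by (auto simp: binary_rec[of 0] binary_rec[of "Suc 0"])
  next
    case False
    then show ?thesis using less[of "n div 2"] by (subst binary_rec) (auto simp: of_bool_def)
  qed
qed

lemma binary_eq [simp]: "binary m = binary n \<longleftrightarrow> m = n"
  by (metis bits_val_binary)

instantiation nat :: enc
begin
definition enc_nat :: "nat \<Rightarrow> d" where "enc_nat n = enc (binary n)"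
instance by standard (simp add: enc_nat_def)
end

primrec enc_tree_aux :: "tree \<Rightarrow> d" where
  "enc_tree_aux (Num n) = N L (enc n)"
| "enc_tree_aux (Node ts) = N (N L L) (enclist (map enc_tree_aux ts))"

lemma enc_tree_aux_eq: "enc_tree_aux s = enc_tree_aux t \<longleftrightarrow> s = t"
proof (induction s arbitrary: t)
  case (Num n)
  then show ?case by (cases t) auto
next
  case (Node ss)
  have "map enc_tree_aux ss = map enc_tree_aux ts \<longleftrightarrow> ss = ts" for ts
  proof (use Node in \<open>induction ss arbitrary: ts\<close>)
    case (Cons a ss)
    then show ?case by (cases ts) auto
  qed auto
  then show ?case by (cases t) auto
qed

instantiation tree :: enc
begin
definition enc_tree :: "tree \<Rightarrow> d" where "enc_tree t = enc_tree_aux t"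
instance by standard (simp add: enc_tree_def enc_tree_aux_eq)
end

lemma enc_tree_simps [simp]: "enc (Num n) = N L (enc n)" "enc (Node ts) = N (N L L) (enc ts)"
  by (simp_all add: enc_tree_def enc_list_def cong: map_cong)

definition PT :: "('a :: enc \<Rightarrow> 'b :: enc) \<Rightarrow> bool" where
  "PT f \<longleftrightarrow> ptime enc (\<lambda>x. enc (f x))"

lemma PT_size: "PT f \<Longrightarrow> pbd (\<lambda>x. siz x) (\<lambda>x. siz (f x))"
  unfolding PT_def by (rule ptime_size)

lemma PT_comp: "PT g \<Longrightarrow> PT f \<Longrightarrow> PT (\<lambda>x. g (f x))"
  unfolding PT_def using ptime_trans[OF _ ptime_reindex[of enc "\<lambda>x. enc (g x)" f]] by blast

named_theorems PT_intros

lemma PT_id [PT_intros]: "PT (\<lambda>x. x)"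
  unfolding PT_def by (rule ptime_self)

lemma PT_const [PT_intros]: "PT (\<lambda>x. c)"
  unfolding PT_def by (rule ptime_const)

lemma PT_Pair [PT_intros]: "PT f \<Longrightarrow> PT g \<Longrightarrow> PT (\<lambda>x. (f x, g x))"
  unfolding PT_def by (simp add: ptime_N)

lemma sz_neq_0 [simp]: "sz x \<noteq> 0" by (cases x) auto

lemma enc_fst: "enc (fst p) = dhd (enc p)" by (cases p) simp
lemma enc_snd: "enc (snd p) = dtl (enc p)" by (cases p) simp

lemma PT_fst [PT_intros]: "PT f \<Longrightarrow> PT (\<lambda>x. fst (f x))"
  unfolding PT_def enc_fst by (rule ptime_dhd)

lemma PT_snd [PT_intros]: "PT f \<Longrightarrow> PT (\<lambda>x. snd (f x))"
  unfolding PT_def enc_snd by (rule ptime_dtl)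

lemma PT_Cons [PT_intros]: "PT f \<Longrightarrow> PT g \<Longrightarrow> PT (\<lambda>x. f x # g x)"
  unfolding PT_def by (simp add: ptime_N)

lemma PT_Some [PT_intros]: "PT f \<Longrightarrow> PT (\<lambda>x. Some (f x))"
  unfolding PT_def by (simp add: ptime_N ptime_const)

lemma PT_Num [PT_intros]: "PT f \<Longrightarrow> PT (\<lambda>x. Num (f x))"
  unfolding PT_def by (simp add: ptime_N ptime_const)

lemma PT_Node [PT_intros]: "PT f \<Longrightarrow> PT (\<lambda>x. Node (f x))"
  unfolding PT_def by (simp add: ptime_N ptime_const)

lemma PT_enc: "PT f \<Longrightarrow> PT (\<lambda>x. enc (f x))"
  unfolding PT_def by simp

lemma PT_if [PT_intros]:
  assumes "PT c" "PT f" "PT g"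
  shows "PT (\<lambda>x. if c x then f x else g x)"
  unfolding PT_def
  by (rule ptime_if[OF assms(1,3,2)[unfolded PT_def]]) auto

text \<open>In every branch of a case distinction the scrutinee is replaced by its components.\<close>

lemma ptime_case:
  assumes "ptime e v" "ptime (\<lambda>x. N (e x) (v x)) (\<lambda>x. c x)"
  assumes "ptime e a" "ptime e'' g"
  assumes "\<And>x. c x = L \<Longrightarrow> a x = f x"
  assumes "\<And>x. c x \<noteq> L \<Longrightarrow> \<exists>y. e'' y = N (e x) (v x) \<and> g y = f x"
  shows "ptime e f"
proof (rule ptime_trans[OF ptime_N[OF ptime_self assms(1)]])
  have "ptime (\<lambda>x. N (e x) (v x)) e"
    using ptime_dhd[OF ptime_self, of "\<lambda>x. N (e x) (v x)"] by simp
  from ptime_trans[OF this assms(3)] have a: "ptime (\<lambda>x. N (e x) (v x)) a" .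
  show "ptime (\<lambda>x. N (e x) (v x)) f"
    by (rule ptime_if[OF assms(2) a assms(4)]) (use assms(5,6) in auto)
qed

lemma ptime_scrutinee: "ptime (\<lambda>x. N (e x) (v x)) v"
  using ptime_dtl[OF ptime_self, of "\<lambda>x. N (e x) (v x)"] by simp

lemma PT_case_list [PT_intros]:
  assumes "PT v" "PT a" "PT (\<lambda>p. b (fst p) (fst (snd p)) (snd (snd p)))"
  shows "PT (\<lambda>x. case v x of [] \<Rightarrow> a x | y # ys \<Rightarrow> b x y ys)"
  unfolding PT_def
proof (rule ptime_case[OF assms(1)[unfolded PT_def] ptime_scrutinee assms(2,3)[unfolded PT_def]])
  show "enc (v x) = L \<Longrightarrow> enc (a x) = enc (case v x of [] \<Rightarrow> a x | y # ys \<Rightarrow> b x y ys)" for x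
    by (cases "v x") auto
  show "\<exists>p. enc p = N (enc x) (enc (v x)) \<and>
      enc (b (fst p) (fst (snd p)) (snd (snd p))) = enc (case v x of [] \<Rightarrow> a x | y # ys \<Rightarrow> b x y ys)"
    if "enc (v x) \<noteq> L" for x
  proof (cases "v x")
    case (Cons y ys)
    then show ?thesis by (intro exI[of _ "(x, y, ys)"]) simp
  qed (use that in simp)
qed

lemma PT_case_option [PT_intros]:
  fixes v :: "'a :: enc \<Rightarrow> 'b :: enc option"
  assumes "PT v" "PT a" "PT (\<lambda>p. b (fst p) (snd p))"
  shows "PT (\<lambda>x. case v x of None \<Rightarrow> a x | Some y \<Rightarrow> b x y)"
proof -
  \<comment> \<open>\<open>Some y\<close> has the same code as the pair of \<open>y\<close> and
    \<open>()\<close>. In this form the branch fits \<open>ptime_case\<close>, where the scrutinee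
    is replaced by its components.\<close>
  have "PT (\<lambda>p :: 'a \<times> 'b \<times> unit. b (fst p) (fst (snd p)))"
    using PT_comp[OF assms(3), of "\<lambda>p :: 'a \<times> 'b \<times> unit. (fst p, fst (snd p))"]
    by (simp add: PT_intros)
  note b = this[unfolded PT_def]
  show ?thesis
    unfolding PT_def
  proof (rule ptime_case[OF assms(1)[unfolded PT_def] ptime_scrutinee assms(2)[unfolded PT_def] b])
    show "enc (v x) = L \<Longrightarrow> enc (a x) = enc (case v x of None \<Rightarrow> a x | Some y \<Rightarrow> b x y)" for x
      by (cases "v x") auto
    show "\<exists>p :: 'a \<times> 'b \<times> unit. enc p = N (enc x) (enc (v x)) \<and>
        enc (b (fst p) (fst (snd p))) = enc (case v x of None \<Rightarrow> a x | Some y \<Rightarrow> b x y)"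
      if "enc (v x) \<noteq> L" for x
    proof (cases "v x")
      case (Some y)
      then show ?thesis by (intro exI[of _ "(x, y, ())"]) simp
    qed (use that in simp)
  qed
qed

lemma PT_case_d:
  assumes "PT v" "PT a" "PT (\<lambda>p. b (fst p) (fst (snd p)) (snd (snd p)))"
  shows "PT (\<lambda>x. case v x of L \<Rightarrow> a x | N y z \<Rightarrow> b x y z)"
  unfolding PT_def
proof (rule ptime_case[OF assms(1)[unfolded PT_def] ptime_scrutinee assms(2,3)[unfolded PT_def]])
  show "enc (v x) = L \<Longrightarrow> enc (a x) = enc (case v x of L \<Rightarrow> a x | N y z \<Rightarrow> b x y z)" for x
    by (cases "v x") auto
  show "\<exists>p. enc p = N (enc x) (enc (v x)) \<and>
      enc (b (fst p) (fst (snd p)) (snd (snd p))) = enc (case v x of L \<Rightarrow> a x | N y z \<Rightarrow> b x y z)"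
    if "enc (v x) \<noteq> L" for x
  proof (cases "v x")
    case (N y z)
    then show ?thesis by (intro exI[of _ "(x, y, z)"]) simp
  qed (use that in simp)
qed

lemma PT_case_tree [PT_intros]:
  fixes v :: "'a :: enc \<Rightarrow> tree"
  assumes "PT v" "PT (\<lambda>p. a (fst p) (snd p))" "PT (\<lambda>p. b (fst p) (snd p))"
  shows "PT (\<lambda>x. case v x of Num n \<Rightarrow> a x n | Node ts \<Rightarrow> b x ts)"
proof -
  have v: "ptime enc (\<lambda>x. enc (v x))" using assms(1) by (simp add: PT_def)
  have e: "ptime enc (\<lambda>x. N (enc x) (dtl (enc (v x))))" by (intro ptime_N ptime_self ptime_dtl v)
  let ?f = "\<lambda>x. enc (case v x of Num n \<Rightarrow> a x n | Node ts \<Rightarrow> b x ts)"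
  let ?w = "\<lambda>x. N (dhd (enc (v x))) (N (enc x) (dtl (enc (v x))))"
  have w: "ptime enc ?w" by (intro ptime_N ptime_self ptime_dtl ptime_dhd v)
  have "ptime ?w ?f"
  proof (rule ptime_if[where c = "\<lambda>x. dhd (enc (v x))"])
    show "ptime ?w (\<lambda>x. dhd (enc (v x)))" using ptime_dhd[OF ptime_self, of ?w] by simp
    show "ptime (\<lambda>p. N L (enc p)) (\<lambda>p. enc (a (fst p) (snd p)))"
      by (rule ptime_trans[OF _ assms(2)[unfolded PT_def]])
        (use ptime_dtl[OF ptime_self, of "\<lambda>p :: 'a \<times> nat. N L (enc p)"] in simp)
    show "ptime (\<lambda>p. N (N L L) (enc p)) (\<lambda>p. enc (b (fst p) (snd p)))"
      by (rule ptime_trans[OF _ assms(3)[unfolded PT_def]])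
        (use ptime_dtl[OF ptime_self, of "\<lambda>p :: 'a \<times> tree list. N (N L L) (enc p)"] in simp)
    fix x
    show "\<exists>p. N L (enc p) = ?w x \<and> enc (a (fst p) (snd p)) = ?f x" if "dhd (enc (v x)) = L"
    proof (cases "v x")
      case (Num n)
      then show ?thesis by (intro exI[of _ "(x, n)"]) simp
    qed (use that in simp)
    show "\<exists>p. N (N L L) (enc p) = ?w x \<and> enc (b (fst p) (snd p)) = ?f x" if "dhd (enc (v x)) \<noteq> L"
    proof (cases "v x")
      case (Node ts)
      then show ?thesis by (intro exI[of _ "(x, ts)"]) simp
    qed (use that in simp)
  qed
  then show ?thesis unfolding PT_def by (rule ptime_trans[OF w])
qed

lemma PT_case_prod [PT_intros]:
  assumes "PT f" "PT (\<lambda>p. g (fst p) (fst (snd p)) (snd (snd p)))"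
  shows "PT (\<lambda>x. case f x of (a, b) \<Rightarrow> g x a b)"
  using PT_comp[OF assms(2) PT_Pair[OF PT_id assms(1)]] by (simp add: case_prod_beta)

lemma PT_let [PT_intros]:
  assumes "PT f" "PT (\<lambda>p. g (fst p) (snd p))"
  shows "PT (\<lambda>x. let y = f x in g x y)"
  using PT_comp[OF assms(2) PT_Pair[OF PT_id assms(1)]] by (simp add: Let_def)

lemma PT_not [PT_intros]:
  assumes "PT f"
  shows "PT (\<lambda>x. \<not> f x)"
proof -
  have "(\<lambda>x. \<not> f x) = (\<lambda>x. if f x then False else True)" by auto
  then show ?thesis by (simp only:) (intro PT_intros assms)
qed

lemma PT_conj [PT_intros]:
  assumes "PT f" "PT g"
  shows "PT (\<lambda>x. f x \<and> g x)"
proof -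
  have "(\<lambda>x. f x \<and> g x) = (\<lambda>x. if f x then g x else False)" by auto
  then show ?thesis by (simp only:) (intro PT_intros assms)
qed

lemma PT_disj [PT_intros]:
  assumes "PT f" "PT g"
  shows "PT (\<lambda>x. f x \<or> g x)"
proof -
  have "(\<lambda>x. f x \<or> g x) = (\<lambda>x. if f x then True else g x)" by auto
  then show ?thesis by (simp only:) (intro PT_intros assms)
qed

lemma PT_imp [PT_intros]:
  assumes "PT f" "PT g"
  shows "PT (\<lambda>x. f x \<longrightarrow> g x)"
proof -
  have "(\<lambda>x. f x \<longrightarrow> g x) = (\<lambda>x. if f x then g x else True)" by auto
  then show ?thesis by (simp only:) (intro PT_intros assms)
qed

text \<open>\<open>ptime_iter\<close> repeats one fixed function, so the parameter \<open>x\<close>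
  travels along in the state and is projected away at the end.\<close>

lemma PT_iter:
  fixes F :: "'a :: enc \<Rightarrow> 's :: enc \<Rightarrow> 's"
  assumes "PT (\<lambda>p. F (fst p) (snd p))" "PT n" "PT a"
  assumes B: "pbd (\<lambda>x. siz x) B" "\<And>x i. i \<le> length (n x) \<Longrightarrow> siz ((F x ^^ i) (a x)) \<le> B x"
  shows "PT (\<lambda>x. (F x ^^ length (n x)) (a x))"
proof -
  let ?F = "\<lambda>p. (fst p, F (fst p) (snd p))"
  have it: "(?F ^^ i) (x, s) = (x, (F x ^^ i) s)" for i x s
    by (induction i) auto
  have "ptime enc (\<lambda>x. enc ((?F ^^ len (enc (n x))) (x, a x)))"
  proof (rule ptime_iter[where B = "\<lambda>x. siz x + B x + 1"])
    show "ptime enc (\<lambda>p. enc (?F p))"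
      using PT_Pair[OF PT_fst[OF PT_id] assms(1)] unfolding PT_def .
    show "ptime enc (\<lambda>x. N (enc (n x)) (enc (x, a x)))"
      using PT_Pair[OF assms(2) PT_Pair[OF PT_id assms(3)]] unfolding PT_def by simp
    show "pbd (\<lambda>x. siz x) (\<lambda>x. siz x + B x + 1)" by (intro pbd_intros B(1))
    show "i \<le> len (enc (n x)) \<Longrightarrow> siz ((?F ^^ i) (x, a x)) \<le> siz x + B x + 1" for x i
      using B(2)[of i x] by (simp add: it)
  qed
  then have "ptime enc (\<lambda>x. enc (x, (F x ^^ length (n x)) (a x)))" by (simp add: it)
  from ptime_dtl[OF this] show ?thesis unfolding PT_def by simp
qed

lemma PT_fold:
  assumes "PT (\<lambda>p. h (fst p) (fst (snd p)) (snd (snd p)))" "PT v" "PT a"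
  assumes B: "pbd (\<lambda>x. siz x) B" "\<And>x i. siz (fold (h x) (take i (v x)) (a x)) \<le> B x"
  shows "PT (\<lambda>x. fold (h x) (v x) (a x))"
proof -
  let ?F = "\<lambda>x p. case fst p of [] \<Rightarrow> p | y # ys \<Rightarrow> (ys, h x y (snd p))"
  have it: "(?F x ^^ i) (xs, s) = (drop i xs, fold (h x) (take i xs) s)" for i x xs s
  proof (induction i arbitrary: xs s)
    case (Suc i)
    show ?case using Suc by (cases xs) (simp_all add: funpow_Suc_right del: funpow.simps(2))
  qed simp
  have "PT (\<lambda>x. (?F x ^^ length (v x)) (v x, a x))"
  proof (rule PT_iter[where B = "\<lambda>x. siz (v x) + B x + 1"])
    have "PT (\<lambda>p. h (fst (fst p)) (fst (snd p)) (snd (snd (fst p))))"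
      using PT_comp[OF assms(1), of "\<lambda>p. (fst (fst p), fst (snd p), snd (snd (fst p)))"]
      by (simp add: PT_intros)
    then show "PT (\<lambda>p. ?F (fst p) (snd p))" by (intro PT_intros)
    show "PT v" "PT (\<lambda>x. (v x, a x))" by (intro PT_intros assms)+
    show "pbd (\<lambda>x. siz x) (\<lambda>x. siz (v x) + B x + 1)" by (intro pbd_intros B(1) PT_size assms)
    show "siz ((?F x ^^ i) (v x, a x)) \<le> siz (v x) + B x + 1" for x i
    proof -
      have "siz (drop i (v x)) \<le> siz (v x)"
        using siz_append[of "take i (v x)" "drop i (v x)"] sz_pos[of "enc (take i (v x))"]
        by (simp del: sz_pos)
      then show ?thesis using B(2)[of x i] by (simp add: it)
    qed
  qed
  from PT_snd[OF this] show ?thesis by (simp add: it)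
qed

text \<open>Additive growth per element, with an increment bounded in terms of the parameter alone,
  keeps all intermediate results polynomial. This is the usual way to discharge the size condition
  of \<open>PT_fold\<close>.\<close>

lemma PT_fold_add:
  assumes "PT (\<lambda>p. h (fst p) (fst (snd p)) (snd (snd p)))" "PT v" "PT a"
  assumes B: "pbd (\<lambda>x. siz x) B" "\<And>x y s. y \<in> set (v x) \<Longrightarrow> siz (h x y s) \<le> siz s + B x"
  shows "PT (\<lambda>x. fold (h x) (v x) (a x))"
proof (rule PT_fold[where B = "\<lambda>x. siz (a x) + siz (v x) * B x"])
  show "pbd (\<lambda>x. siz x) (\<lambda>x. siz (a x) + siz (v x) * B x)"
    by (intro pbd_intros B(1) PT_size assms)
  fix x i
  have "siz (fold (h x) ys s) \<le> siz s + length ys * B x" if "set ys \<subseteq> set (v x)" for ys s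
    using that
  proof (induction ys arbitrary: s)
    case (Cons y ys)
    then have "siz (fold (h x) ys (h x y s)) \<le> siz (h x y s) + length ys * B x" by simp
    then show ?case using B(2)[of y x s] Cons.prems by simp
  qed simp
  from this[of "take i (v x)" "a x"]
  have "siz (fold (h x) (take i (v x)) (a x)) \<le> siz (a x) + length (take i (v x)) * B x"
    by (meson set_take_subset)
  also have "\<dots> \<le> siz (a x) + siz (v x) * B x"
    using length_le_siz[of "v x"] by (intro add_le_mono mult_le_mono) auto
  finally show "siz (fold (h x) (take i (v x)) (a x)) \<le> siz (a x) + siz (v x) * B x" .
qed (use assms in auto)

lemma PT_rev [PT_intros]: "PT f \<Longrightarrow> PT (\<lambda>x. rev (f x))"
proof -
  assume f: "PT f"
  have "PT (\<lambda>x. fold Cons (f x) [])"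
    by (rule PT_fold_add[where B = "\<lambda>x. siz (f x)"])
       (use siz_elem in \<open>(intro PT_intros f PT_size[OF f] | fastforce)+\<close>)
  then show ?thesis by (simp add: fold_Cons_rev)
qed

lemma pbd_siz_pair:
  assumes "PT (\<lambda>p. g (fst p) (snd p))" "PT v"
  obtains B where "pbd (\<lambda>x. siz x) B" "\<And>x y. y \<in> set (v x) \<Longrightarrow> siz (g x y) \<le> B x"
proof -
  obtain k where k: "\<And>p. siz (g (fst p) (snd p)) \<le> (siz p + 2) ^ k"
    using PT_size[OF assms(1)] unfolding pbd_def by blast
  show ?thesis
  proof (rule that[of "\<lambda>x. (siz x + siz (v x) + 3) ^ k"])
    show "pbd (\<lambda>x. siz x) (\<lambda>x. (siz x + siz (v x) + 3) ^ k)"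
      by (intro pbd_intros PT_size assms)
    fix x y assume "y \<in> set (v x)"
    then have "siz y \<le> siz (v x)" using siz_elem less_imp_le by blast
    then have "(siz (x, y) + 2) ^ k \<le> (siz x + siz (v x) + 3) ^ k"
      by (intro power_mono) auto
    then show "siz (g x y) \<le> (siz x + siz (v x) + 3) ^ k" using k[of "(x, y)"] by simp
  qed
qed

lemma PT_app3:
  assumes "PT (\<lambda>p. g (fst p) (fst (snd p)) (snd (snd p)))" "PT a" "PT b" "PT c"
  shows "PT (\<lambda>x. g (a x) (b x) (c x))"
  using PT_comp[OF assms(1) PT_Pair[OF assms(2) PT_Pair[OF assms(3,4)]]] by simp

lemma PT_app2:
  assumes "PT (\<lambda>p. g (fst p) (snd p))" "PT a" "PT b"
  shows "PT (\<lambda>x. g (a x) (b x))"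
  using PT_comp[OF assms(1) PT_Pair[OF assms(2,3)]] by simp

lemma PT_map [PT_intros]:
  assumes "PT (\<lambda>p. g (fst p) (snd p))" "PT v"
  shows "PT (\<lambda>x. map (g x) (v x))"
proof -
  obtain B where B: "pbd (\<lambda>x. siz x) B" "\<And>x y. y \<in> set (v x) \<Longrightarrow> siz (g x y) \<le> B x"
    using pbd_siz_pair[OF assms] by blast
  have "PT (\<lambda>x. rev (fold (\<lambda>y s. g x y # s) (v x) []))"
  proof (rule PT_rev, rule PT_fold_add[where B = "\<lambda>x. B x + 1"])
    show "y \<in> set (v x) \<Longrightarrow> siz (g x y # s) \<le> siz s + (B x + 1)" for x y s
      using B(2)[of y x] by simp
  qed (intro PT_intros pbd_intros assms(2) B PT_app2[OF assms(1)])+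
  moreover have "rev (fold (\<lambda>y s. g x y # s) ys s) = rev s @ map (g x) ys" for x ys s
    by (induction ys arbitrary: s) auto
  ultimately show ?thesis by simp
qed

lemma PT_filter [PT_intros]:
  assumes "PT (\<lambda>p. g (fst p) (snd p))" "PT v"
  shows "PT (\<lambda>x. filter (g x) (v x))"
proof -
  have "PT (\<lambda>x. rev (fold (\<lambda>y s. if g x y then y # s else s) (v x) []))"
  proof (rule PT_rev, rule PT_fold_add[where B = "\<lambda>x. siz (v x)"])
    show "y \<in> set (v x) \<Longrightarrow> siz (if g x y then y # s else s) \<le> siz s + siz (v x)" for x y s
      using siz_elem[of y "v x"] by simp
  qed (intro PT_intros PT_size assms(2) PT_app2[OF assms(1)])+
  moreover have "rev (fold (\<lambda>y s. if g x y then y # s else s) ys s) = rev s @ filter (g x) ys" for x ys s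
    by (induction ys arbitrary: s) auto
  ultimately show ?thesis by simp
qed

lemma PT_append [PT_intros]:
  assumes "PT f" "PT g"
  shows "PT (\<lambda>x. f x @ g x)"
proof -
  have "PT (\<lambda>x. fold Cons (rev (f x)) (g x))"
    by (rule PT_fold_add[where B = "\<lambda>x. siz (f x)"])
       (use siz_elem in \<open>(intro PT_intros assms PT_size | fastforce)+\<close>)
  then show ?thesis by (simp add: fold_Cons_rev)
qed

lemma PT_concat [PT_intros]:
  assumes "PT f"
  shows "PT (\<lambda>x. concat (f x))"
proof -
  have "PT (\<lambda>x. fold (\<lambda>y s. s @ y) (f x) [])"
  proof (rule PT_fold_add[where B = "\<lambda>x. siz (f x)"])
    show "siz (s @ y) \<le> siz s + siz (f x)" if "y \<in> set (f x)" for x y s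
      using siz_append[of s y] siz_elem[OF that] by linarith
  qed (intro PT_intros PT_size assms)+
  moreover have "fold (\<lambda>y s. s @ y) ys s = s @ concat ys" for ys and s :: "'b list"
    by (induction ys arbitrary: s) auto
  ultimately show ?thesis by simp
qed

section \<open>Unary clocks and equality of trees\<close>

abbreviation units :: "nat \<Rightarrow> unit list" where "units n \<equiv> replicate n ()"

lemma PT_units_siz: "PT f \<Longrightarrow> PT (\<lambda>x. units (siz (f x)))"
proof -
  have "unary n = enc (units n)" for n by (induction n) auto
  then show "PT f \<Longrightarrow> ?thesis" unfolding PT_def using ptime_units by fastforce
qed

lemma PT_units [PT_intros]: "PT f \<Longrightarrow> PT (\<lambda>x. units (length (f x)))"
proof -
  assume "PT f"
  then have "PT (\<lambda>x. map (\<lambda>_. ()) (f x))" by (intro PT_intros)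
  then show ?thesis by (simp add: map_replicate_const)
qed

text \<open>Equality of trees without recursion, by a work list of pairs still to be compared. A
  mismatch at the front blocks the list for ever, so it can only become empty when all pairs
  agree.\<close>

definition eqstep :: "(d \<times> d) list \<Rightarrow> (d \<times> d) list" where
  "eqstep ws = (case ws of [] \<Rightarrow> [] | p # vs \<Rightarrow>
     (case fst p of L \<Rightarrow> (case snd p of L \<Rightarrow> vs | N c e \<Rightarrow> ws)
      | N a b \<Rightarrow> (case snd p of L \<Rightarrow> ws | N c e \<Rightarrow> (a, c) # (b, e) # vs)))"

lemma eqstep_simps [simp]:
  "eqstep [] = []"
  "eqstep ((L, L) # vs) = vs"
  "eqstep ((L, N c e) # vs) = (L, N c e) # vs"
  "eqstep ((N a b, L) # vs) = (N a b, L) # vs"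
  "eqstep ((N a b, N c e) # vs) = (a, c) # (b, e) # vs"
  by (simp_all add: eqstep_def)

lemma eqstep_cases:
  obtains "ws = []" | vs where "ws = (L, L) # vs" | c e vs where "ws = (L, N c e) # vs"
  | a b vs where "ws = (N a b, L) # vs" | a b c e vs where "ws = (N a b, N c e) # vs"
  by (metis d.exhaust list.exhaust surj_pair)

lemma eqstep_unequal:
  "\<exists>p\<in>set ws. fst p \<noteq> snd p \<Longrightarrow> \<exists>p\<in>set (eqstep ws). fst p \<noteq> snd p"
  by (cases ws rule: eqstep_cases) auto

text \<open>As long as all pairs agree, a step lowers the total size of the first components by
  exactly one, so this size is a sufficient clock.\<close>

lemma eqstep_equal:
  "\<forall>p\<in>set ws. fst p = snd p \<Longrightarrow> (\<Sum>p\<leftarrow>ws. sz (fst p)) \<le> k \<Longrightarrow> (eqstep ^^ k) ws = []"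
proof (induction k arbitrary: ws)
  case 0
  then show ?case by (cases ws) (auto dest: gr0I)
next
  case (Suc k)
  have "\<forall>p\<in>set (eqstep ws). fst p = snd p" "(\<Sum>p\<leftarrow>eqstep ws. sz (fst p)) \<le> k"
    using Suc.prems by (cases ws rule: eqstep_cases; auto)+
  then show ?case using Suc.IH by (simp add: funpow_Suc_right del: funpow.simps)
qed

lemma eqstep_iff: "(eqstep ^^ sz a) [(a, b)] = [] \<longleftrightarrow> a = b"
proof (cases "a = b")
  case True
  then show ?thesis using eqstep_equal[of "[(a, b)]" "sz a"] by simp
next
  case False
  have "\<exists>p\<in>set ((eqstep ^^ k) [(a, b)]). fst p \<noteq> snd p" for k
    by (induction k) (use False eqstep_unequal in auto)
  then show ?thesis using False by (metis empty_iff list.set(1))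
qed

lemma siz_eqstep: "siz (eqstep ws) \<le> siz ws"
  by (cases ws rule: eqstep_cases) auto

lemma PT_null [PT_intros]: "PT f \<Longrightarrow> PT (\<lambda>x. f x = [])"
proof -
  assume "PT f"
  then have "PT (\<lambda>x. case f x of [] \<Rightarrow> True | y # ys \<Rightarrow> False)" by (intro PT_intros)
  moreover have "(case xs of [] \<Rightarrow> True | y # ys \<Rightarrow> False) = (xs = [])" for xs :: "'b list" by (cases xs) auto
  ultimately show ?thesis by simp
qed

lemma PT_eq [PT_intros]:
  assumes "PT f" "PT g"
  shows "PT (\<lambda>x. f x = g x)"
proof -
  have "PT (\<lambda>x. (eqstep ^^ length (units (siz (f x)))) [(enc (f x), enc (g x))])"
  proof (rule PT_iter[where B = "\<lambda>x. siz (f x) + siz (g x) + 3"])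
    show "PT (\<lambda>p :: 'a \<times> (d \<times> d) list. eqstep (snd p))"
      unfolding eqstep_def by (intro PT_intros PT_case_d)
    show "siz ((eqstep ^^ i) [(enc (f x), enc (g x))]) \<le> siz (f x) + siz (g x) + 3" for x i
    proof (induction i)
      case (Suc i)
      then show ?case using siz_eqstep[of "(eqstep ^^ i) [(enc (f x), enc (g x))]"] by simp
    qed simp
  qed (intro PT_intros PT_units_siz PT_enc pbd_intros PT_size assms)+
  from PT_null[OF this] show ?thesis by (simp add: eqstep_iff)
qed

lemma PT_Bex [PT_intros]:
  assumes "PT (\<lambda>p. g (fst p) (snd p))" "PT v"
  shows "PT (\<lambda>x. \<exists>y\<in>set (v x). g x y)"
proof -
  have "PT (\<lambda>x. fold (\<lambda>y s. s \<or> g x y) (v x) False)"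
    by (rule PT_fold[where B = "\<lambda>x. 3"])
       (intro PT_intros pbd_intros assms PT_app2[OF assms(1)] | simp add: enc_bool_def)+
  moreover have "fold (\<lambda>y s. s \<or> g x y) ys s = (s \<or> (\<exists>y\<in>set ys. g x y))" for x ys s
    by (induction ys arbitrary: s) auto
  ultimately show ?thesis by simp
qed

lemma PT_Ball [PT_intros]:
  assumes "PT (\<lambda>p. g (fst p) (snd p))" "PT v"
  shows "PT (\<lambda>x. \<forall>y\<in>set (v x). g x y)"
proof -
  have "PT (\<lambda>x. \<not> (\<exists>y\<in>set (v x). \<not> g x y))" by (intro PT_intros assms)
  then show ?thesis by simp
qed

lemma PT_member [PT_intros]: "PT f \<Longrightarrow> PT v \<Longrightarrow> PT (\<lambda>x. f x \<in> set (v x))"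
proof -
  assume "PT f" "PT v"
  then have "PT (\<lambda>x. \<exists>y\<in>set (v x). f x = y)" by (intro PT_intros PT_comp[of f fst])
  then show ?thesis by simp
qed

lemma PT_product [PT_intros]: "PT f \<Longrightarrow> PT g \<Longrightarrow> PT (\<lambda>x. List.product (f x) (g x))"
  unfolding product_concat_map by (intro PT_intros PT_comp[of g fst] PT_comp[of g "\<lambda>x. fst (fst x)"])

lemma PT_take [PT_intros]:
  assumes "PT u" "PT f"
  shows "PT (\<lambda>x. take (length (u x)) (f x))"
proof -
  let ?F = "\<lambda>p. case fst p of [] \<Rightarrow> p | y # ys \<Rightarrow> (ys, y # snd p)"
  have it: "(?F ^^ i) (xs, ys) = (drop i xs, rev (take i xs) @ ys)" for i and xs ys :: "'c list"
  proof (induction i arbitrary: xs ys)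
    case (Suc i)
    then show ?case by (cases xs) (simp_all add: funpow_Suc_right del: funpow.simps(2))
  qed simp
  have "PT (\<lambda>x. (?F ^^ length (u x)) (f x, []))"
  proof (rule PT_iter[where B = "\<lambda>x. siz (f x) + 2"])
    show "siz ((?F ^^ i) (f x, [])) \<le> siz (f x) + 2" for x i
      using siz_append[of "take i (f x)" "drop i (f x)"] by (simp add: it siz_rev)
  qed (intro PT_intros pbd_intros PT_size assms)+
  from PT_rev[OF PT_snd[OF this]] show ?thesis by (simp add: it)
qed

definition rdups :: "'a list \<Rightarrow> 'a list" where
  "rdups xs = fold (\<lambda>x s. if x \<in> set s then s else x # s) xs []"

lemma rdups: "set (rdups xs) = set xs" "distinct (rdups xs)" "length (rdups xs) \<le> length xs"
proof -
  have "set (fold (\<lambda>x s. if x \<in> set s then s else x # s) xs ys) = set xs \<union> set ys \<and>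
      (distinct ys \<longrightarrow> distinct (fold (\<lambda>x s. if x \<in> set s then s else x # s) xs ys)) \<and>
      length (fold (\<lambda>x s. if x \<in> set s then s else x # s) xs ys) \<le> length xs + length ys" for ys
  proof (induction xs arbitrary: ys)
    case (Cons x xs)
    show ?case using Cons[of ys] Cons[of "x # ys"] by (auto simp: insert_absorb)
  qed simp
  from this[of "[]"] show "set (rdups xs) = set xs" "distinct (rdups xs)" "length (rdups xs) \<le> length xs"
    by (auto simp: rdups_def)
qed

lemma PT_rdups [PT_intros]:
  assumes "PT f"
  shows "PT (\<lambda>x. rdups (f x))"
  unfolding rdups_def
proof (rule PT_fold_add[where B = "\<lambda>x. siz (f x)"])
  show "siz (if y \<in> set s then s else y # s) \<le> siz s + siz (f x)" if "y \<in> set (f x)" for x y s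
    using siz_elem[OF that] by simp
qed (intro PT_intros PT_size assms)+

text \<open>The fuel \<open>u\<close> keeps the intermediate results polynomial in the size of the arguments.\<close>

definition tprod :: "unit list \<Rightarrow> 'a list list \<Rightarrow> 'a list list" where
  "tprod u xss = fold (\<lambda>xs s. take (length u) (concat (map (\<lambda>x. map (\<lambda>ys. x # ys) s) xs))) (rev xss) [[]]"

text \<open>With enough fuel the truncation never takes effect: a partial product over
  \<open>j\<close> lists has at most \<open>c ^ j\<close> rows.\<close>

lemma tprod_eq:
  assumes "\<And>xs. xs \<in> set xss \<Longrightarrow> length xs \<le> c" "1 \<le> c" "c ^ length xss \<le> length u"
  shows "tprod u xss = product_lists xss"
  using assms(1,3)
proof (induction xss)
  case Nil
  then show ?case by (simp add: tprod_def)
next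
  case (Cons xs xss)
  have le: "c ^ length xss \<le> length u"
    using Cons.prems(2) assms(2) order_trans[OF power_increasing[of "length xss" "length (xs # xss)" c]] by auto
  then have IH: "tprod u xss = product_lists xss" using Cons by simp
  have "length (product_lists xss) \<le> c ^ length xss" if "\<And>ys. ys \<in> set xss \<Longrightarrow> length ys \<le> c" for xss :: "'a list list"
    using that by (induction xss) (auto simp: length_concat o_def sum_list_triv intro!: mult_le_mono)
  from this[of "xs # xss"] have "length (product_lists (xs # xss)) \<le> length u"
    using Cons.prems by fastforce
  then show ?case using IH by (simp add: tprod_def)
qed

lemma PT_tprod [PT_intros]:
  assumes "PT u" "PT f"
  shows "PT (\<lambda>x. tprod (u x) (f x))"
  unfolding tprod_def
proof (rule PT_fold[where B = "\<lambda>x. 1 + (siz (u x) + 1) * (siz (f x) + 1)"])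
  let ?h = "\<lambda>x xs s. take (length (u x)) (concat (map (\<lambda>x. map (\<lambda>ys. x # ys) s) xs))"
  show "PT (\<lambda>p. ?h (fst p) (fst (snd p)) (snd (snd p)))"
    by (intro PT_intros PT_comp[of u fst] assms)
  show "PT (\<lambda>x. rev (f x))" by (intro PT_intros assms)
  show "pbd (\<lambda>x. siz x) (\<lambda>x. 1 + (siz (u x) + 1) * (siz (f x) + 1))"
    by (intro pbd_intros PT_size assms)
  fix x i
  \<comment> \<open>Two invariants together bound the size: the fuel limits the number of rows, and
    a row grows by no more than the size of the list from which its new element is drawn.\<close>
  have inv: "length (fold (?h x) xss s) \<le> max (length s) (length (u x)) \<and>
      (\<forall>ys\<in>set (fold (?h x) xss s). siz ys \<le> b + (\<Sum>xs\<leftarrow>xss. siz xs + 1))"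
    if "\<forall>ys\<in>set s. siz ys \<le> b" for xss s b
    using that
  proof (induction xss arbitrary: s b)
    case (Cons xs xss)
    have "siz ys \<le> b + siz xs + 1" if "ys \<in> set (?h x xs s)" for ys
    proof -
      from that have "ys \<in> set (concat (map (\<lambda>x. map (\<lambda>ys. x # ys) s) xs))" by (rule in_set_takeD)
      then obtain z zs where "z \<in> set xs" "zs \<in> set s" "ys = z # zs" by auto
      then show ?thesis using Cons.prems siz_elem[of z xs] by fastforce
    qed
    from Cons.IH[of "?h x xs s" "b + siz xs + 1"] this show ?case
      by (auto simp: le_max_iff_disj add.assoc)
  qed auto
  let ?r = "fold (?h x) (take i (rev (f x))) [[]]"
  have "(\<Sum>xs\<leftarrow>take i (rev (f x)). siz xs + 1) \<le> (\<Sum>xs\<leftarrow>rev (f x). siz xs + 1)"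
    by (metis append_take_drop_id le_add1 map_append sum_list_append)
  also have "\<dots> < siz (f x)" by (simp add: siz_list rev_map[symmetric] sum_list_rev)
  finally have le: "ys \<in> set ?r \<Longrightarrow> siz ys + 1 \<le> siz (f x) + 1" for ys
    using inv[of "[[]]" 1 "take i (rev (f x))"] by fastforce
  have len: "length ?r \<le> siz (u x) + 1"
    using inv[of "[[]]" 1 "take i (rev (f x))"] length_le_siz[of "u x"] by (auto simp: le_max_iff_disj)
  have "(\<Sum>ys\<leftarrow>?r. siz ys + 1) \<le> length ?r * (siz (f x) + 1)"
    using sum_list_mono[of ?r "\<lambda>ys. siz ys + 1" "\<lambda>_. siz (f x) + 1"] le by (simp add: sum_list_triv)
  also have "\<dots> \<le> (siz (u x) + 1) * (siz (f x) + 1)" using len by (intro mult_le_mono) auto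
  finally show "siz ?r \<le> 1 + (siz (u x) + 1) * (siz (f x) + 1)" by (simp add: siz_list)
qed (intro PT_intros)

section \<open>Least fixed points inside a finite universe\<close>

definition lfp_list :: "'a list \<Rightarrow> ('a list \<Rightarrow> 'a \<Rightarrow> bool) \<Rightarrow> 'a list" where
  "lfp_list U P = ((\<lambda>S. filter (P S) U) ^^ length U) []"

lemma PT_lfp_list [PT_intros]:
  assumes "PT U" "PT (\<lambda>p. P (fst (fst p)) (snd (fst p)) (snd p))"
  shows "PT (\<lambda>x. lfp_list (U x) (P x))"
  unfolding lfp_list_def
proof (rule PT_iter[where B = "\<lambda>x. siz (U x) + 1"])
  show "PT (\<lambda>p. filter (P (fst p) (snd p)) (U (fst p)))"
    by (intro PT_intros PT_comp[of U fst] assms)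
  have "siz (filter Q xs) \<le> siz xs" for Q and xs :: "'b list" by (induction xs) auto
  then show "siz (((\<lambda>S. filter (P x S) (U x)) ^^ i) []) \<le> siz (U x) + 1" for x i
    by (cases i) (auto intro: le_SucI)
qed (intro PT_intros pbd_intros PT_size assms)+

text \<open>Monotonicity makes the iterates an increasing chain of subsets of \<open>U\<close>.
  Strict growth in each of the first \<open>length U + 1\<close> rounds would yield more elements
  than \<open>U\<close> has, so the chain is stationary after \<open>length U\<close>
  rounds.\<close>

lemma lfp_list:
  assumes mono: "\<And>S T u. set S \<subseteq> set T \<Longrightarrow> P S u \<Longrightarrow> P T u"
  shows lfp_list_closed: "u \<in> set U \<Longrightarrow> P (lfp_list U P) u \<Longrightarrow> u \<in> set (lfp_list U P)"
    and lfp_list_least: "(\<And>S u. set S \<subseteq> Z \<Longrightarrow> u \<in> set U \<Longrightarrow> P S u \<Longrightarrow> u \<in> Z) \<Longrightarrow> set (lfp_list U P) \<subseteq> Z"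
proof -
  let ?F = "\<lambda>S. filter (P S) U"
  define S where "S i = (?F ^^ i) []" for i
  have S_Suc: "S (Suc i) = ?F (S i)" for i by (simp add: S_def)
  have inc: "set (S i) \<subseteq> set (S (Suc i))" for i
  proof (induction i)
    case (Suc i)
    then show ?case using mono[OF Suc] by (auto simp: S_Suc)
  qed (simp add: S_def)
  have sub: "set (S i) \<subseteq> set U" for i by (cases i) (auto simp: S_def)
  have "\<exists>i\<le>length U. set (S (Suc i)) = set (S i)"
  proof (rule ccontr)
    assume neg: "\<not> ?thesis"
    have "i \<le> card (set (S i))" if "i \<le> Suc (length U)" for i
      using that
    proof (induction i)
      case (Suc i)
      then have "set (S i) \<subset> set (S (Suc i))" using neg inc[of i] by fastforce
      then have "card (set (S i)) < card (set (S (Suc i)))" by (simp add: psubset_card_mono)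
      then show ?case using Suc by simp
    qed simp
    from this[of "Suc (length U)"] have "Suc (length U) \<le> card (set U)"
      using card_mono[OF _ sub, of "Suc (length U)"] by simp
    then show False using card_length[of U] by simp
  qed
  then obtain i where i: "i \<le> length U" "set (S (Suc i)) = set (S i)" by blast
  \<comment> \<open>Used in both directions, monotonicity shows that \<open>P\<close> depends only
    on the set of its list argument; equal sets therefore produce equal filtered lists from then
    on.\<close>
  have stable: "set (S j) = set (S i) \<and> set (S (Suc j)) = set (S i)" if "i \<le> j" for j
    using that
  proof (induction rule: dec_induct)
    case (step j)
    then have "set (S j) = set (S (Suc j))" by simp
    then have "P (S j) u = P (S (Suc j)) u" for u
      using mono[of "S j" "S (Suc j)" u] mono[of "S (Suc j)" "S j" u] by auto
    then have "filter (P (S (Suc j))) U = filter (P (S j)) U" by (intro filter_cong) auto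
    then have "S (Suc (Suc j)) = S (Suc j)" by (simp only: S_Suc)
    with step show ?case by simp
  qed (use i in simp)
  have fin: "lfp_list U P = S (length U)" by (simp add: lfp_list_def S_def)
  show "u \<in> set U \<Longrightarrow> P (lfp_list U P) u \<Longrightarrow> u \<in> set (lfp_list U P)"
    using stable[OF i(1)] by (auto simp: fin S_Suc)
  show "set (lfp_list U P) \<subseteq> Z" if Z: "\<And>S u. set S \<subseteq> Z \<Longrightarrow> u \<in> set U \<Longrightarrow> P S u \<Longrightarrow> u \<in> Z"
  proof -
    have "set (S i) \<subseteq> Z" for i
    proof (induction i)
      case (Suc i)
      then show ?case using Z by (auto simp: S_Suc)
    qed (simp add: S_def)
    then show ?thesis by (simp add: fin)
  qed
qed

section \<open>Arithmetic on binary and unary numbers\<close>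

lemma PT_binary_iff: "PT (\<lambda>x. binary (f x)) \<longleftrightarrow> PT f"
  by (simp add: PT_def enc_nat_def)

lemma PT_binary [PT_intros]: "PT f \<Longrightarrow> PT (\<lambda>x. binary (f x))"
  by (simp add: PT_binary_iff)

fun bits_inc :: "bool list \<Rightarrow> bool list" where
  "bits_inc [] = [True]"
| "bits_inc (b # bs) = (if b then False # bits_inc bs else True # bs)"

lemma binary_0_1: "binary 0 = [False]" "binary (Suc 0) = [True]"
  by (simp_all add: binary_rec[of 0] binary_rec[of "Suc 0"])

lemma binary_double:
  "binary (2 * n) = (if n = 0 then [False] else False # binary n)"
  "binary (Suc (2 * n)) = (if n = 0 then [True] else True # binary n)"
  by (simp_all add: binary_0_1 binary_rec[of "2 * n"] binary_rec[of "Suc (2 * n)"])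

lemma binary_Suc: "binary (Suc n) = bits_inc (binary n)"
proof (induction n rule: less_induct)
  case (less n)
  obtain m where m: "n = 2 * m \<or> n = Suc (2 * m)" by (metis oddE evenE Suc_eq_plus1)
  show ?case
  proof (cases "n = 2 * m")
    case True
    then show ?thesis using binary_double by simp
  next
    case False
    then have n: "n = Suc (2 * m)" using m by simp
    then have "binary (Suc n) = binary (2 * Suc m)" by simp
    also have "\<dots> = False # binary (Suc m)" using binary_double(1)[of "Suc m"] by simp
    also have "\<dots> = bits_inc (binary n)"
      using less[of m] n binary_double(2)[of m] by (cases "m = 0") (auto simp: binary_0_1)
    finally show ?thesis .
  qed
qed

lemma PT_Suc [PT_intros]:
  assumes "PT f"
  shows "PT (\<lambda>x. Suc (f x))"
proof -
  \<comment> \<open>One ripple-carry pass, least significant digit first: the state consists of the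
    carry and the digits produced so far, the latest in front.\<close>
  let ?h = "\<lambda>b p. (fst p \<and> b, (b \<noteq> fst p) # snd p)"
  have *: "(let p = fold ?h bs (c, r) in rev (if fst p then True # snd p else snd p)) =
      rev r @ (if c then bits_inc bs else bs)" for bs c r
    by (induction bs arbitrary: c r) (auto simp: Let_def)
  have "PT (\<lambda>x. fold ?h (binary (f x)) (True, []))"
  proof (rule PT_fold[where B = "\<lambda>x. 8 + 4 * siz (binary (f x))"])
    show "siz (fold ?h (take i (binary (f x))) (True, [])) \<le> 8 + 4 * siz (binary (f x))" for x i
    proof -
      have "siz (fst (fold ?h bs p)) \<le> 3 \<and> siz (snd (fold ?h bs p)) \<le> siz (snd p) + 4 * length bs" for bs p
      proof (induction bs arbitrary: p)
        case (Cons b bs)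
        show ?case using Cons[of "?h b p"] by (auto simp: enc_bool_def split: if_splits)
      qed (simp add: enc_bool_def)
      from this[of "take i (binary (f x))" "(True, [])"] length_le_siz[of "binary (f x)"] show ?thesis
        by (cases "fold ?h (take i (binary (f x))) (True, [])") (auto simp: min_def split: if_splits)
    qed
  qed (intro PT_intros pbd_intros PT_size assms | simp add: PT_binary_iff assms)+
  then have "PT (\<lambda>x. let p = fold ?h (binary (f x)) (True, []) in rev (if fst p then True # snd p else snd p))"
    by (intro PT_intros)
  then have "PT (\<lambda>x. bits_inc (binary (f x)))" by (simp only: *) simp
  then show ?thesis by (simp add: binary_Suc[symmetric] PT_binary_iff)
qed

lemma PT_double [PT_intros]:
  fixes f :: "'a :: enc \<Rightarrow> nat"
  assumes "PT f"
  shows "PT (\<lambda>x. 2 * f x)"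
proof -
  have "PT (\<lambda>x. if f x = 0 then [False] else False # binary (f x))" by (intro PT_intros assms)
  then show ?thesis by (simp add: binary_double(1)[symmetric] PT_binary_iff)
qed

definition canonical :: "bool list \<Rightarrow> bool" where
  "canonical bs \<longleftrightarrow> (case rev bs of [] \<Rightarrow> False | b # r \<Rightarrow> b \<or> r = [])"

lemma canonical_iff: "canonical bs \<longleftrightarrow> bs \<noteq> [] \<and> (last bs \<or> length bs = 1)"
  by (cases bs rule: rev_cases) (auto simp: canonical_def)

lemma canonical_binary: "canonical (binary n)"
proof (induction n rule: less_induct)
  case (less n)
  show ?case
  proof (cases "n < 2")
    case True
    then have "n = 0 \<or> n = Suc 0" by linarith
    then show ?thesis by (auto simp: binary_0_1 canonical_iff)
  next
    case False
    have "binary n = odd n # binary (n div 2)" using False binary_rec by simp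
    moreover have "canonical (binary (n div 2))" using less False by simp
    moreover have "binary (n div 2) \<noteq> [False]" using False binary_eq[of "n div 2" 0] by (simp add: binary_0_1)
    ultimately show ?thesis by (cases "binary (n div 2)") (auto simp: canonical_iff)
  qed
qed

lemma binary_bits_val: "canonical bs \<Longrightarrow> binary (bits_val bs) = bs"
proof (induction bs)
  case (Cons b bs)
  show ?case
  proof (cases "bs = []")
    case True
    then show ?thesis by (cases b) (simp_all add: binary_0_1)
  next
    case False
    then have last: "last bs" using Cons.prems by (cases bs) (auto simp: canonical_iff)
    then have "canonical bs" using False by (simp add: canonical_iff)
    moreover have "bits_val bs \<noteq> 0" using last False by (induction bs) (auto split: if_splits)
    ultimately show ?thesis using Cons.IH binary_double[of "bits_val bs"] by (cases b) auto
  qed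
qed (simp add: canonical_def)

text \<open>Numbers are stored by their canonical digits, so on canonical words the conversion
  merely copies them. The value 0 elsewhere makes the function total without normalising leading
  zeros.\<close>

definition nat_of_bits :: "bool list \<Rightarrow> nat" where
  "nat_of_bits bs = (if canonical bs then bits_val bs else 0)"

lemma PT_nat_of_bits [PT_intros]:
  assumes "PT f"
  shows "PT (\<lambda>x. nat_of_bits (f x))"
proof -
  have "PT (\<lambda>x. if canonical (f x) then f x else [False])"
    unfolding canonical_def by (intro PT_intros assms)
  moreover have "(if canonical bs then bs else [False]) = binary (nat_of_bits bs)" for bs
    by (simp add: nat_of_bits_def binary_bits_val binary_0_1)
  ultimately show ?thesis by (simp add: PT_binary_iff)
qed

lemma siz_nat: "siz (n :: nat) \<le> 4 * n + 5"
proof -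
  have "length (binary n) \<le> Suc n"
  proof (induction n rule: less_induct)
    case (less n)
    show ?case
    proof (cases "n < 2")
      case False
      then have "length (binary (n div 2)) \<le> Suc (n div 2)" "Suc (n div 2) \<le> n" using less by simp_all
      then show ?thesis using False by (subst binary_rec) simp
    qed (subst binary_rec, simp)
  qed
  then show ?thesis using sz_encbl[of "binary n"] by (simp add: enc_nat_def encbl_eq_enc)
qed

lemma PT_upt [PT_intros]:
  assumes "PT f"
  shows "PT (\<lambda>x. [0..<length (f x)])"
proof -
  let ?h = "\<lambda>y p. (Suc (fst p), fst p # snd p)"
  have fold: "fold ?h ys (0, []) = (length ys, rev [0..<length ys])" for ys :: "'c list"
    by (induction ys rule: rev_induct) auto
  have "PT (\<lambda>x. fold ?h (f x) (0, []))"
  proof (rule PT_fold[where B = "\<lambda>x. (4 * siz (f x) + 6) * (siz (f x) + 2)"])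
    fix x i
    have len: "length (take i (f x)) \<le> siz (f x)" using length_le_siz[of "f x"] by simp
    have s: "siz (rev [0..<n]) \<le> 1 + n * (4 * n + 6)" for n
    proof -
      have "(\<Sum>k\<leftarrow>[0..<n]. siz k + 1) \<le> (\<Sum>k\<leftarrow>[0..<n]. 4 * n + 6)"
        by (intro sum_list_mono) (use siz_nat in \<open>fastforce intro: order_trans\<close>)
      then show ?thesis by (simp only: siz_rev) (simp add: siz_list sum_list_triv)
    qed
    define n where "n = length (take i (f x))"
    have "siz (n, rev [0..<n]) \<le> (4 * n + 6) * (n + 2)"
      using s[of n] siz_nat[of n] by (simp add: algebra_simps)
    also have "\<dots> \<le> (4 * siz (f x) + 6) * (siz (f x) + 2)"
      using len unfolding n_def by (intro mult_le_mono) auto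
    finally show "siz (fold ?h (take i (f x)) (0, [])) \<le> (4 * siz (f x) + 6) * (siz (f x) + 2)"
      by (simp add: fold n_def)
  qed (intro PT_intros pbd_intros PT_size assms)+
  from PT_rev[OF PT_snd[OF this]] show ?thesis by (simp add: fold)
qed

text \<open>Horner's scheme from the most significant digit on. Cutting every intermediate value to
  the length of \<open>u\<close> prevents the exponential growth that an unbounded conversion to
  unary would have.\<close>

definition unary_of :: "unit list \<Rightarrow> nat \<Rightarrow> unit list" where
  "unary_of u n = fold (\<lambda>b v. take (length u) (v @ v @ (if b then [()] else []))) (rev (binary n)) []"

lemma unary_of: "n \<le> length u \<Longrightarrow> unary_of u n = units n"
proof -
  have "fold (\<lambda>b v. take (length u) (v @ v @ (if b then [()] else []))) (rev bs) [] = units (bits_val bs)"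
    if "bits_val bs \<le> length u" for bs
    using that
  proof (induction bs)
    case (Cons b bs)
    then have "fold (\<lambda>b v. take (length u) (v @ v @ (if b then [()] else []))) (rev bs) [] = units (bits_val bs)"
      by auto
    then show ?case using Cons.prems
      by (auto simp: replicate_add[symmetric] replicate_append_same mult_2 simp flip: replicate_Suc)
  qed simp
  from this[of "binary n"] show "n \<le> length u \<Longrightarrow> ?thesis" by (simp add: unary_of_def)
qed

lemma siz_units: "siz (v :: unit list) = 2 * length v + 1"
  by (induction v) auto

lemma PT_unary_of [PT_intros]:
  assumes "PT u" "PT f"
  shows "PT (\<lambda>x. unary_of (u x) (f x))"
  unfolding unary_of_def
proof (rule PT_fold[where B = "\<lambda>x. 2 * siz (u x) + 1"])
  show "siz (fold (\<lambda>b v. take (length (u x)) (v @ v @ (if b then [()] else []))) (take i (rev (binary (f x)))) [])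
      \<le> 2 * siz (u x) + 1" for x i
  proof -
    have "length v \<le> length (u x) \<Longrightarrow>
       length (fold (\<lambda>b v. take (length (u x)) (v @ v @ (if b then [()] else []))) bs v) \<le> length (u x)" for bs v
      by (induction bs arbitrary: v) auto
    from this[of "[]" "take i (rev (binary (f x)))"] length_le_siz[of "u x"] show ?thesis
      unfolding siz_units by simp
  qed
qed (intro PT_intros pbd_intros PT_size assms PT_comp[of u fst])+

theorem PT_polytime_computable: "PT g \<Longrightarrow> polytime_computable g"
  by (rule ptime_polytime_computable) (simp add: PT_def encbl_eq_enc[abs_def])

text \<open>The fuel is grown by repeated self-concatenation of a one-element list, which at most
  doubles the size of the code in each round, as \<open>ptime_EXPTIME\<close> requires.\<close>

theorem PT_EXPTIME:
  assumes "PT m" "PT (\<lambda>p. f (fst p) (snd p))"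
  assumes "\<And>w. f w (units (2 ^ length (m w))) \<longleftrightarrow> w \<in> A"
  shows "A \<in> EXPTIME"
proof -
  let ?H = "\<lambda>u :: unit list. u @ u"
  have H: "(?H ^^ n) [()] = units (2 ^ n)" for n
  proof (induction n)
    case (Suc n)
    then show ?case by (simp add: replicate_add[symmetric] mult_2)
  qed simp
  show ?thesis
  proof (rule ptime_EXPTIME[where M = "\<lambda>w. enc (m w)" and s = enc and H = ?H and ?y0.0 = "[()]"])
    show "ptime encbl (\<lambda>w. enc (m w))" using assms(1) by (simp add: PT_def encbl_eq_enc[abs_def])
    have "PT ?H" by (intro PT_intros)
    then show "ptime enc (\<lambda>y. enc (?H y))" by (simp add: PT_def)
    show "siz (?H y) \<le> 2 * siz y" for y using siz_append[of y y] by simp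
    have "ptime (\<lambda>w. enc (w, units (2 ^ length (m w)))) (\<lambda>w. enc (w \<in> A))"
      using ptime_reindex[OF assms(2)[unfolded PT_def], of "\<lambda>w. (w, units (2 ^ length (m w)))"]
      by (simp add: assms(3))
    then show "ptime (\<lambda>w. N (encbl w) (enc ((?H ^^ len (enc (m w))) [()]))) (\<lambda>w. if w \<in> A then N L L else L)"
      by (simp add: H encbl_eq_enc enc_bool_def)
  qed
qed

section \<open>Synchronous QDAS as pushdown systems\<close>

text \<open>The vertices of a reachable call-task graph of a synchronous QDAS form a path of wait edges,
  that is, a call stack. Only the serial queues occupied by the stack restrict what its top can
  do; they form the parameter \<open>U\<close> of the summary relation.\<close>

definition okq :: "('d, 'x, 'q, 'b, 's) qdas \<Rightarrow> 'q set \<Rightarrow> 'q \<Rightarrow> bool" where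
  "okq A U q \<longleftrightarrow> q \<in> cqid A \<or> q \<in> sqid A \<and> q \<notin> U"

definition addq :: "('d, 'x, 'q, 'b, 's) qdas \<Rightarrow> 'q set \<Rightarrow> 'q \<Rightarrow> 'q set" where
  "addq A U q = (if q \<in> sqid A then insert q U else U)"

text \<open>What a block can do on top of the stack whenever everything it has called has returned;
  a call enters only by its complete effect. \<open>U\<close> contains the serial queues occupied by
  the block itself and by all frames below.\<close>

inductive summ :: "('d, 'x, 'q, 'b, 's) qdas \<Rightarrow> 'q set \<Rightarrow> 'b \<Rightarrow> ('x \<Rightarrow> 'd) \<Rightarrow> 's \<Rightarrow> ('x \<Rightarrow> 'd) \<Rightarrow> bool"
  for A where
  summ_init: "summ A U b \<rho> (init_state A b) \<rho>"
| summ_guard: "summ A U b \<rho>0 s \<rho> \<Longrightarrow> (s, Guard g, s') \<in> block_trans A b \<Longrightarrow> (\<forall>a\<in>set g. holds \<rho> a) \<Longrightarrow>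
    summ A U b \<rho>0 s' \<rho>"
| summ_assign: "summ A U b \<rho>0 s \<rho> \<Longrightarrow> (s, Assign x d, s') \<in> block_trans A b \<Longrightarrow>
    summ A U b \<rho>0 s' (\<rho>(x := d))"
| summ_call: "summ A U b \<rho>0 s \<rho> \<Longrightarrow> (s, DispatchS q b', s') \<in> block_trans A b \<Longrightarrow> okq A U q \<Longrightarrow>
    summ A (addq A U q) b' \<rho> (final_state A b') \<rho>' \<Longrightarrow> summ A U b \<rho>0 s' \<rho>'"

text \<open>A frame holds the state after its dispatch, because the dispatching step moves the
  caller at once. The frames are kept in full: their states count in the Parikh image and their
  queue labels determine \<open>U\<close>.\<close>

inductive entry :: "('d, 'x, 'q, 'b, 's) qdas \<Rightarrow> 'b \<Rightarrow> 'q option \<Rightarrow> ('x \<Rightarrow> 'd) \<Rightarrow> 'q set \<Rightarrow>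
    ('b \<times> 's \<times> 'q option) list \<Rightarrow> bool" for A where
  entry_main: "entry A (main_block A) None (\<lambda>_. init_value A) {} []"
| entry_call: "entry A b p \<rho>0 U fr \<Longrightarrow> summ A U b \<rho>0 s \<rho> \<Longrightarrow> (s, DispatchS q b', s') \<in> block_trans A b \<Longrightarrow>
    okq A U q \<Longrightarrow> entry A b' (Some q) \<rho> (addq A U q) ((b, s', p) # fr)"

definition lab :: "('q, 'b, 's) ctg \<Rightarrow> nat \<Rightarrow> 'b \<times> 's \<times> 'q option" where
  "lab G v = (block_of G v, state_of G v, queue_of G v)"

text \<open>\<open>vs\<close> is the call stack with the running task first. Each vertex waits for
  its left neighbour in \<open>vs\<close>, hence the shift in the \<open>zip\<close>.\<close>

definition task_rep :: "('q, 'b, 's) ctg \<Rightarrow> nat list \<Rightarrow> ('b \<times> 's \<times> 'q option) list \<Rightarrow> bool" where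
  "task_rep G vs fs \<longleftrightarrow> distinct vs \<and> map (lab G) vs = fs \<and> wait_edges G = set (zip (tl vs) vs) \<and>
     waiting G = (\<lambda>_. []) \<and> tasks G = set vs"

definition call_rep :: "('q, 'b, 's) ctg \<Rightarrow> nat \<Rightarrow> nat list \<Rightarrow> 'q \<Rightarrow> ('b \<times> 's \<times> 'q option) list \<Rightarrow> bool" where
  "call_rep G v vs q fs \<longleftrightarrow> distinct (v # vs) \<and> map (lab G) (v # vs) = fs \<and>
     wait_edges G = set (zip vs (v # vs)) \<and> waiting G = (\<lambda>_. [])(q := [v]) \<and> tasks G = set vs"

definition cnt :: "('b \<times> 's \<times> 'q option) list \<Rightarrow> 's \<Rightarrow> nat" where
  "cnt fs s = length (filter (\<lambda>f. fst (snd f) = s) fs)"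

lemma cnt_simps [simp]: "cnt [] t = 0" "cnt ((b, s, p) # fs) t = of_bool (s = t) + cnt fs t"
  by (simp_all add: cnt_def)

lemma vertices_task_rep: "task_rep G vs fs \<Longrightarrow> vertices G = set vs"
  by (auto simp: task_rep_def vertices_def calls_def)

lemma vertices_call_rep: "call_rep G v vs q fs \<Longrightarrow> vertices G = set (v # vs)"
  by (auto simp: call_rep_def vertices_def calls_def)

lemma card_lab:
  assumes "distinct vs"
  shows "card {v \<in> set vs. state_of G v = s} = cnt (map (lab G) vs) s"
proof -
  have "card (set (filter (\<lambda>v. state_of G v = s) vs)) = length (filter (\<lambda>v. state_of G v = s) vs)"
    using assms by (intro distinct_card) simp
  then show ?thesis by (simp add: cnt_def filter_map o_def lab_def)
qed

lemma parikh_task_rep: "task_rep G vs fs \<Longrightarrow> parikh G s = cnt fs s"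
  using card_lab[of vs G s] by (simp add: parikh_def vertices_task_rep) (simp add: task_rep_def)

lemma parikh_call_rep: "call_rep G v vs q fs \<Longrightarrow> parikh G s = cnt fs s"
  using card_lab[of "v # vs" G s] unfolding parikh_def vertices_call_rep by (simp only: call_rep_def)

lemma lab_cong:
  "v \<notin> set vs \<Longrightarrow> (\<And>u. u \<noteq> v \<Longrightarrow> lab H u = lab G u) \<Longrightarrow> map (lab H) vs = map (lab G) vs"
  by (metis (no_types, lifting) map_eq_conv)

lemma task_rep_set_state:
  assumes "task_rep G (v # vs) ((b, s, p) # fr)"
  shows "task_rep (set_state v s' G) (v # vs) ((b, s', p) # fr)"
proof -
  have "map (lab (set_state v s' G)) vs = map (lab G) vs"
    using assms by (intro lab_cong[of v]) (auto simp: task_rep_def lab_def set_state_def)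
  then show ?thesis using assms by (auto simp: task_rep_def lab_def set_state_def)
qed

lemma call_rep_dispatch:
  assumes "task_rep G (v # vs) ((b, s, p) # fr)" "w \<notin> set (v # vs)"
  shows "call_rep (add_wait v w (add_call A w q b' (set_state v s' G))) w (v # vs) q
    ((b', init_state A b', Some q) # (b, s', p) # fr)"
proof -
  let ?G = "set_state v s' G" and ?H = "add_wait v w (add_call A w q b' (set_state v s' G))"
  have G: "task_rep ?G (v # vs) ((b, s', p) # fr)" using task_rep_set_state[OF assms(1)] .
  have "map (lab ?H) (v # vs) = map (lab ?G) (v # vs)"
    using assms(2) by (intro lab_cong[of w]) (auto simp: lab_def add_wait_def add_call_def)
  moreover have "map (lab ?G) (v # vs) = (b, s', p) # fr" using G unfolding task_rep_def by blast
  moreover have "lab ?H w = (b', init_state A b', Some q)" by (simp add: lab_def add_wait_def add_call_def)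
  ultimately have "map (lab ?H) (w # v # vs) = (b', init_state A b', Some q) # (b, s', p) # fr"
    by (simp only: list.map)
  moreover have "wait_edges ?H = set (zip (v # vs) (w # v # vs))" "waiting ?H = (\<lambda>_. [])(q := [w])"
    "tasks ?H = set (v # vs)" "distinct (w # v # vs)"
    using G assms(2) by (auto simp: task_rep_def add_wait_def add_call_def)
  ultimately show ?thesis unfolding call_rep_def by blast
qed

lemma task_rep_dequeue: "call_rep G v vs q fs \<Longrightarrow> task_rep (dequeue q G) (v # vs) fs"
  by (auto simp: call_rep_def task_rep_def dequeue_def lab_def)

lemma task_rep_remove:
  assumes "task_rep G (w # vs) (f # fs)"
  shows "task_rep (remove_task w G) vs fs"
proof -
  have "{e \<in> set (zip vs (w # vs)). snd e \<noteq> w} = set (zip (tl vs) vs)"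
  proof (cases vs)
    case (Cons v us)
    then have "w \<notin> set (v # us)" using assms by (simp add: task_rep_def)
    then show ?thesis using Cons by (auto dest: set_zip_rightD)
  qed simp
  then show ?thesis using assms by (auto simp: task_rep_def remove_task_def lab_def)
qed

text \<open>Every vertex except the first has an outgoing wait edge. The scheduler has thus no
  choice among the tasks, and the graph behaves like a stack.\<close>

lemma task_rep_unblocked:
  assumes "task_rep G (v # vs) fs"
  shows "unblocked G v" "u \<in> tasks G \<Longrightarrow> unblocked G u \<Longrightarrow> u = v"
proof -
  have w: "wait_edges G = set (zip vs (v # vs))" using assms by (simp add: task_rep_def)
  have out: "\<exists>x. (u, x) \<in> set (zip us xs)" if "u \<in> set us" "length us \<le> length xs" for us xs :: "nat list" and u
    using that
  proof (induction us arbitrary: xs)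
    case (Cons a us)
    then show ?case by (cases xs) auto
  qed simp
  show "unblocked G v"
    unfolding unblocked_def w using assms by (auto simp: task_rep_def dest: set_zip_leftD)
  show "u \<in> tasks G \<Longrightarrow> unblocked G u \<Longrightarrow> u = v"
    using out[of u vs "v # vs"] assms unfolding unblocked_def w by (auto simp: task_rep_def)
qed

lemma call_rep_blocked:
  assumes "call_rep G v vs q fs" "u \<in> tasks G"
  shows "\<not> unblocked G u"
proof -
  have w: "wait_edges G = set (zip vs (v # vs))" using assms by (simp add: call_rep_def)
  have out: "\<exists>x. (u, x) \<in> set (zip us xs)" if "u \<in> set us" "length us \<le> length xs" for us xs :: "nat list" and u
    using that
  proof (induction us arbitrary: xs)
    case (Cons a us)
    then show ?case by (cases xs) auto
  qed simp
  show ?thesis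
    using out[of u vs "v # vs"] assms unfolding unblocked_def w by (auto simp: call_rep_def)
qed

definition usedq :: "('d, 'x, 'q, 'b, 's) qdas \<Rightarrow> ('b \<times> 's \<times> 'q option) list \<Rightarrow> 'q set" where
  "usedq A fs = {q \<in> sqid A. Some q \<in> (\<lambda>f. snd (snd f)) ` set fs}"

lemma usedq_Cons: "usedq A ((b, s, Some q) # fs) = addq A (usedq A fs) q"
  by (auto simp: usedq_def addq_def)

lemma usedq_state: "usedq A ((b, s, p) # fs) = usedq A ((b', s', p) # fs)"
  by (auto simp: usedq_def)

text \<open>The abstract parameter \<open>U\<close> agrees with what the serial dequeue rule
  inspects, namely the queue labels of all tasks present, including the topmost one.\<close>

lemma entry_usedq: "entry A b p \<rho>0 U fr \<Longrightarrow> U = usedq A ((b, s, p) # fr)"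
proof (induction arbitrary: s rule: entry.induct)
  case entry_main
  then show ?case by (auto simp: usedq_def)
next
  case (entry_call b p \<rho>0 U fr s1 \<rho> q b' s')
  show ?case by (simp only: usedq_Cons entry_call.IH[of s', symmetric])
qed

lemma trans_in_actions:
  "is_qdas A \<Longrightarrow> b \<in> blocks A \<Longrightarrow> (s, a, s') \<in> block_trans A b \<Longrightarrow> a \<in> actions A"
  unfolding is_qdas_def by blast

lemma entry_block: "entry A b p \<rho>0 U fr \<Longrightarrow> is_qdas A \<Longrightarrow> b \<in> blocks A"
proof (induction rule: entry.induct)
  case entry_main
  then show ?case by (simp add: is_qdas_def)
next
  case (entry_call b p \<rho>0 U fr s \<rho> q b' s')
  then show ?case using trans_in_actions[of A b s "DispatchS q b'" s'] by (auto simp: actions_def)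
qed

text \<open>The three cases are a running task on top, a call that has been dispatched but not yet
  dequeued, and the empty graph after the termination of main. The second case may persist for ever,
  if the queue is serial and occupied further down.\<close>

definition stack_inv :: "('d, 'x, 'q, 'b, 's) qdas \<Rightarrow> ('d, 'x, 'q, 'b, 's) conf \<Rightarrow> bool" where
  "stack_inv A c \<longleftrightarrow>
     (\<exists>v vs b s p fr \<rho>0 U. task_rep (fst c) (v # vs) ((b, s, p) # fr) \<and> entry A b p \<rho>0 U fr \<and>
        summ A U b \<rho>0 s (snd c)) \<or>
     (\<exists>w v vs b s s' p fr q b' \<rho>0 U. call_rep (fst c) w (v # vs) q ((b', init_state A b', Some q) # (b, s', p) # fr) \<and>
        entry A b p \<rho>0 U fr \<and> summ A U b \<rho>0 s (snd c) \<and> (s, DispatchS q b', s') \<in> block_trans A b) \<or>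
     task_rep (fst c) [] []"

lemma stack_inv_task:
  "task_rep G (v # vs) ((b, s, p) # fr) \<Longrightarrow> entry A b p \<rho>0 U fr \<Longrightarrow> summ A U b \<rho>0 s \<rho> \<Longrightarrow> stack_inv A (G, \<rho>)"
  unfolding stack_inv_def fst_conv snd_conv by (intro disjI1 exI conjI)

lemma stack_inv_call:
  "call_rep G w (v # vs) q ((b', init_state A b', Some q) # (b, s', p) # fr) \<Longrightarrow> entry A b p \<rho>0 U fr \<Longrightarrow>
   summ A U b \<rho>0 s \<rho> \<Longrightarrow> (s, DispatchS q b', s') \<in> block_trans A b \<Longrightarrow> stack_inv A (G, \<rho>)"
  unfolding stack_inv_def fst_conv snd_conv by (rule disjI2, rule disjI1, intro exI conjI)

lemma stack_inv_empty: "task_rep G [] [] \<Longrightarrow> stack_inv A (G, \<rho>)"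
  unfolding stack_inv_def by simp

lemma stack_inv_init: "stack_inv A (init_conf A)"
proof -
  have "task_rep (fst (init_conf A)) [0] [(main_block A, init_state A (main_block A), None)]"
    by (auto simp: task_rep_def init_conf_def lab_def)
  from stack_inv_task[OF this entry_main summ_init] show ?thesis by (simp add: init_conf_def)
qed

lemma stack_inv_step:
  assumes A: "is_qdas A" "synchronous A" and inv: "stack_inv A (G, \<rho>)" and step: "qdas_step A (G, \<rho>) c"
  shows "stack_inv A c"
proof -
  consider (task) v vs b s p fr \<rho>0 U where "task_rep G (v # vs) ((b, s, p) # fr)" "entry A b p \<rho>0 U fr"
      "summ A U b \<rho>0 s \<rho>"
    | (call) w v vs b s s' p fr q b' \<rho>0 U where
      "call_rep G w (v # vs) q ((b', init_state A b', Some q) # (b, s', p) # fr)"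
      "entry A b p \<rho>0 U fr" "summ A U b \<rho>0 s \<rho>" "(s, DispatchS q b', s') \<in> block_trans A b"
    | (empty) "task_rep G [] []"
    using inv unfolding stack_inv_def by auto
  then show ?thesis
  proof cases
    case task
    have lab: "lab G v = (b, s, p)" and t: "tasks G = set (v # vs)" and wt: "waiting G = (\<lambda>_. [])"
      using task(1) by (auto simp: task_rep_def)
    have fire: "u = v \<and> (s, a, s') \<in> block_trans A b" if "can_fire A G u a s'" for u a s'
      using that task_rep_unblocked(2)[OF task(1), of u] lab by (auto simp: can_fire_def lab_def)
    note new = stack_inv_task[OF task_rep_set_state[OF task(1)] task(2)]
    show ?thesis using step
    proof cases
      case (step_guard u g s')
      then show ?thesis using fire new summ_guard[OF task(3)] by blast
    next
      case (step_assign u x d s')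
      then show ?thesis using fire new summ_assign[OF task(3)] by blast
    next
      case (step_dispatch_async u q b' s' w)
      then show ?thesis using fire A(2) entry_block[OF task(2) A(1)] unfolding synchronous_def by blast
    next
      case (step_dispatch_sync u q b' s' w)
      then have "u = v" "(s, DispatchS q b', s') \<in> block_trans A b" "w \<notin> set (v # vs)"
        using fire vertices_task_rep[OF task(1)] by blast+
      then show ?thesis
        using stack_inv_call[OF call_rep_dispatch[OF task(1)] task(2,3)] step_dispatch_sync(1) by simp
    next
      case (step_terminate u)
      then have u: "u = v" using task_rep_unblocked(2)[OF task(1)] by blast
      then have s: "s = final_state A b" using step_terminate(4) lab by (auto simp: lab_def)
      have rem: "task_rep (remove_task v G) vs fr" using task_rep_remove[OF task(1)] .
      from task(2) show ?thesis
      proof cases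
        case entry_main
        then have "vs = []" using task(1) by (simp add: task_rep_def)
        then show ?thesis using rem entry_main u step_terminate(1) stack_inv_empty by simp
      next
        case (entry_call b1 p1 \<rho>1 U1 fr1 s1 q s1')
        from rem entry_call(3) obtain v1 vs1 where "vs = v1 # vs1" by (auto simp: task_rep_def)
        \<comment> \<open>When the callee returns, its own summary becomes the premise of
          \<open>summ_call\<close> for its caller; the caller already stands in the state after the
          dispatch.\<close>
        moreover have "summ A U1 b1 \<rho>1 s1' \<rho>"
          using summ_call[OF entry_call(5-7)] task(3) s entry_call by simp
        ultimately show ?thesis
          using stack_inv_task[of "remove_task v G" v1 vs1 b1 s1' p1 fr1 A \<rho>1 U1 \<rho>]
            rem entry_call(3,4) u step_terminate(1) by simp
      qed
    qed (use wt in auto)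
  next
    case call
    have t: "tasks G = set (v # vs)" and wt: "waiting G = (\<lambda>_. [])(q := [w])"
      using call(1) by (auto simp: call_rep_def)
    have deq: "stack_inv A (dequeue q G, \<rho>)" if "okq A U q"
      by (rule stack_inv_task[OF task_rep_dequeue[OF call(1)] entry_call[OF call(2-4) that] summ_init])
    show ?thesis using step
    proof cases
      case (step_dequeue_concurrent q')
      then have "q' = q" using wt by (auto split: if_splits)
      then show ?thesis using step_dequeue_concurrent deq by (auto simp: okq_def)
    next
      case (step_dequeue_serial q')
      then have q: "q' = q" using wt by (auto split: if_splits)
      have "q \<notin> U"
      proof
        assume "q \<in> U"
        then have "Some q \<in> (\<lambda>f. snd (snd f)) ` set ((b, s', p) # fr)"
          using entry_usedq[OF call(2), of s'] by (simp add: usedq_def)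
        moreover have "(b, s', p) # fr = map (lab G) (v # vs)" using call(1) by (simp add: call_rep_def)
        ultimately have "\<exists>u\<in>tasks G. queue_of G u = Some q"
          unfolding t by (simp add: lab_def image_image) (metis (no_types) image_iff)
        then show False using step_dequeue_serial q by blast
      qed
      then show ?thesis using q step_dequeue_serial deq by (auto simp: okq_def)
    qed (use call_rep_blocked[OF call(1)] in \<open>auto simp: can_fire_def\<close>)
  next
    case empty
    then have e: "tasks G = {}" "waiting G = (\<lambda>_. [])" by (auto simp: task_rep_def)
    from step show ?thesis by cases (use e in \<open>auto simp: can_fire_def\<close>)
  qed
qed

lemma reachable_stack_inv:
  assumes "is_qdas A" "synchronous A" "reachable A c"
  shows "stack_inv A c"
  using assms(3) unfolding reachable_def
proof (induction rule: rtranclp_induct)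
  case (step c c')
  then show ?case using stack_inv_step[OF assms(1,2), of "fst c" "snd c" c'] by simp
qed (rule stack_inv_init)

lemma can_fire_top:
  "task_rep G (v # vs) ((b, s, p) # fr) \<Longrightarrow> (s, a, s') \<in> block_trans A b \<Longrightarrow> can_fire A G v a s'"
  using task_rep_unblocked(1)[of G v vs] by (auto simp: can_fire_def task_rep_def lab_def)

lemma dispatch_reachable:
  assumes "task_rep G (v # vs) ((b, s, p) # fr)" "(s, DispatchS q b', s') \<in> block_trans A b"
  shows "\<exists>G' w. qdas_step A (G, \<rho>) (G', \<rho>) \<and> call_rep G' w (v # vs) q ((b', init_state A b', Some q) # (b, s', p) # fr)"
proof -
  obtain w where w: "w \<notin> set (v # vs)" using ex_new_if_finite[OF infinite_UNIV_nat finite_set] by blast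
  then have "w \<notin> vertices G" using vertices_task_rep[OF assms(1)] by simp
  from step_dispatch_sync[OF can_fire_top[OF assms] this] show ?thesis
    using call_rep_dispatch[OF assms(1) w] by blast
qed

lemma dequeue_reachable:
  assumes "call_rep G w vs q ((b', s', Some q) # fr)" "okq A (usedq A fr) q"
  shows "qdas_step A (G, \<rho>) (dequeue q G, \<rho>)"
proof -
  have w: "waiting G q \<noteq> []" using assms(1) by (simp add: call_rep_def)
  show ?thesis
  proof (cases "q \<in> cqid A")
    case True
    then show ?thesis using w by (rule step_dequeue_concurrent)
  next
    case False
    then have q: "q \<in> sqid A" "q \<notin> usedq A fr" using assms(2) by (auto simp: okq_def)
    have "\<forall>u\<in>tasks G. queue_of G u \<noteq> Some q"
      using assms(1) q by (force simp: call_rep_def usedq_def lab_def)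
    then show ?thesis using q(1) w by (intro step_dequeue_serial)
  qed
qed

text \<open>The stack below is arbitrary and returns unchanged; it restricts the run only through
  its occupied queues, which is why the condition on \<open>U\<close> suffices.\<close>

lemma summ_reachable:
  assumes "summ A U b \<rho>0 s \<rho>" "task_rep G (v # vs) ((b, init_state A b, p) # fr)"
    "U = usedq A ((b, init_state A b, p) # fr)"
  shows "\<exists>G'. (qdas_step A)\<^sup>*\<^sup>* (G, \<rho>0) (G', \<rho>) \<and> task_rep G' (v # vs) ((b, s, p) # fr)"
  using assms
proof (induction arbitrary: G v vs p fr rule: summ.induct)
  case (summ_init U b \<rho>)
  then show ?case by blast
next
  case (summ_guard U b \<rho>0 s \<rho> g s')
  then obtain G' where G': "(qdas_step A)\<^sup>*\<^sup>* (G, \<rho>0) (G', \<rho>)" "task_rep G' (v # vs) ((b, s, p) # fr)" by blast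
  have "qdas_step A (G', \<rho>) (set_state v s' G', \<rho>)"
    by (rule step_guard[OF can_fire_top[OF G'(2) summ_guard.hyps(2)] summ_guard.hyps(3)])
  then show ?case using G' task_rep_set_state[OF G'(2)] by (meson rtranclp.rtrancl_into_rtrancl)
next
  case (summ_assign U b \<rho>0 s \<rho> x d s')
  then obtain G' where G': "(qdas_step A)\<^sup>*\<^sup>* (G, \<rho>0) (G', \<rho>)" "task_rep G' (v # vs) ((b, s, p) # fr)" by blast
  have "qdas_step A (G', \<rho>) (set_state v s' G', \<rho>(x := d))"
    by (rule step_assign[OF can_fire_top[OF G'(2) summ_assign.hyps(2)]])
  then show ?case using G' task_rep_set_state[OF G'(2)] by (meson rtranclp.rtrancl_into_rtrancl)
next
  case (summ_call U b \<rho>0 s \<rho> q b' s' \<rho>')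
  obtain G1 where G1: "(qdas_step A)\<^sup>*\<^sup>* (G, \<rho>0) (G1, \<rho>)" "task_rep G1 (v # vs) ((b, s, p) # fr)"
    using summ_call.IH(1)[OF summ_call.prems] by blast
  obtain G2 w where G2: "qdas_step A (G1, \<rho>) (G2, \<rho>)"
    "call_rep G2 w (v # vs) q ((b', init_state A b', Some q) # (b, s', p) # fr)"
    using dispatch_reachable[OF G1(2) summ_call.hyps(2)] by blast
  have U: "U = usedq A ((b, s', p) # fr)" using summ_call.prems(2) usedq_state by metis
  have G3: "qdas_step A (G2, \<rho>) (dequeue q G2, \<rho>)"
    using dequeue_reachable[OF G2(2)] summ_call.hyps(3) U by blast
  obtain G4 where G4: "(qdas_step A)\<^sup>*\<^sup>* (dequeue q G2, \<rho>) (G4, \<rho>')"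
    "task_rep G4 (w # v # vs) ((b', final_state A b', Some q) # (b, s', p) # fr)"
    using summ_call.IH(2)[OF task_rep_dequeue[OF G2(2)]] U by (auto simp: usedq_Cons)
  have "qdas_step A (G4, \<rho>') (remove_task w G4, \<rho>')"
    using G4(2) task_rep_unblocked(1)[OF G4(2)]
    by (intro step_terminate) (auto simp: task_rep_def lab_def)
  moreover have "task_rep (remove_task w G4) (v # vs) ((b, s', p) # fr)" by (rule task_rep_remove[OF G4(2)])
  ultimately show ?case using G1(1) G2(1) G3 G4(1)
    by (meson rtranclp.rtrancl_into_rtrancl rtranclp_trans)
qed

lemma entry_reachable:
  assumes "entry A b p \<rho>0 U fr"
  shows "\<exists>G v vs. reachable A (G, \<rho>0) \<and> task_rep G (v # vs) ((b, init_state A b, p) # fr)"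
  using assms
proof (induction rule: entry.induct)
  case entry_main
  have "task_rep (fst (init_conf A)) [0] [(main_block A, init_state A (main_block A), None)]"
    by (auto simp: task_rep_def init_conf_def lab_def)
  moreover have "init_conf A = (fst (init_conf A), \<lambda>_. init_value A)" by (simp add: init_conf_def)
  ultimately show ?case unfolding reachable_def by (metis rtranclp.rtrancl_refl)
next
  case (entry_call b p \<rho>0 U fr s \<rho> q b' s')
  obtain G v vs where G: "reachable A (G, \<rho>0)" "task_rep G (v # vs) ((b, init_state A b, p) # fr)"
    using entry_call.IH by blast
  obtain G1 where G1: "(qdas_step A)\<^sup>*\<^sup>* (G, \<rho>0) (G1, \<rho>)" "task_rep G1 (v # vs) ((b, s, p) # fr)"
    using summ_reachable[OF entry_call.hyps(2) G(2) entry_usedq[OF entry_call.hyps(1)]] by blast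
  obtain G2 w where G2: "qdas_step A (G1, \<rho>) (G2, \<rho>)"
    "call_rep G2 w (v # vs) q ((b', init_state A b', Some q) # (b, s', p) # fr)"
    using dispatch_reachable[OF G1(2) entry_call.hyps(3)] by blast
  have "qdas_step A (G2, \<rho>) (dequeue q G2, \<rho>)"
    using dequeue_reachable[OF G2(2)] entry_call.hyps(4) entry_usedq[OF entry_call.hyps(1), of s'] by blast
  then have "reachable A (dequeue q G2, \<rho>)" using G(1) G1(1) G2(1) unfolding reachable_def
    by (meson rtranclp.rtrancl_into_rtrancl rtranclp_trans)
  then show ?case using task_rep_dequeue[OF G2(2)] by blast
qed

text \<open>The second alternative is a call vertex still waiting in its queue. It is listed
  separately because the queue may be occupied: such a vertex counts in the Parikh image but never
  becomes an \<open>entry\<close>.\<close>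

theorem parikh_coverable_iff:
  assumes "is_qdas A" "synchronous A"
  shows "parikh_coverable A f \<longleftrightarrow> (\<exists>b p \<rho>0 U fr s \<rho>. entry A b p \<rho>0 U fr \<and> summ A U b \<rho>0 s \<rho> \<and>
    ((\<forall>t\<in>all_states A. f t \<le> cnt ((b, s, p) # fr) t) \<or>
     (\<exists>q b' s'. (s, DispatchS q b', s') \<in> block_trans A b \<and>
        (\<forall>t\<in>all_states A. f t \<le> cnt ((b', init_state A b', Some q) # (b, s', p) # fr) t))))"
  (is "_ \<longleftrightarrow> ?R")
proof
  assume "parikh_coverable A f"
  then obtain G \<rho> where G: "reachable A (G, \<rho>)" "\<forall>s\<in>all_states A. f s \<le> parikh G s"
    unfolding parikh_coverable_def by blast
  from reachable_stack_inv[OF assms G(1)]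
  consider (task) v vs b s p fr \<rho>0 U where "task_rep G (v # vs) ((b, s, p) # fr)" "entry A b p \<rho>0 U fr"
      "summ A U b \<rho>0 s \<rho>"
    | (call) w v vs b s s' p fr q b' \<rho>0 U where
      "call_rep G w (v # vs) q ((b', init_state A b', Some q) # (b, s', p) # fr)"
      "entry A b p \<rho>0 U fr" "summ A U b \<rho>0 s \<rho>" "(s, DispatchS q b', s') \<in> block_trans A b"
    | (empty) "task_rep G [] []"
    unfolding stack_inv_def by auto
  then show ?R
  proof cases
    case task
    then show ?thesis using G(2) parikh_task_rep[OF task(1)] by metis
  next
    case call
    then show ?thesis using G(2) parikh_call_rep[OF call(1)] by metis
  next
    case empty
    \<comment> \<open>A graph without vertices covers only the zero function, and that is covered by
      the initial configuration as well.\<close>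
    then have "\<forall>s\<in>all_states A. f s = 0" using G(2) parikh_task_rep[OF empty] by simp
    then show ?thesis using entry_main[of A] summ_init[of A "{}" "main_block A"] by (metis zero_le)
  qed
next
  assume ?R
  then obtain b p \<rho>0 U fr s \<rho> where e: "entry A b p \<rho>0 U fr" "summ A U b \<rho>0 s \<rho>"
    and f: "(\<forall>t\<in>all_states A. f t \<le> cnt ((b, s, p) # fr) t) \<or>
     (\<exists>q b' s'. (s, DispatchS q b', s') \<in> block_trans A b \<and>
        (\<forall>t\<in>all_states A. f t \<le> cnt ((b', init_state A b', Some q) # (b, s', p) # fr) t))" by blast
  obtain G v vs where G: "reachable A (G, \<rho>0)" "task_rep G (v # vs) ((b, init_state A b, p) # fr)"
    using entry_reachable[OF e(1)] by blast
  obtain G1 where G1: "(qdas_step A)\<^sup>*\<^sup>* (G, \<rho>0) (G1, \<rho>)" "task_rep G1 (v # vs) ((b, s, p) # fr)"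
    using summ_reachable[OF e(2) G(2) entry_usedq[OF e(1)]] by blast
  have r: "reachable A (G1, \<rho>)" using G(1) G1(1) unfolding reachable_def by (rule rtranclp_trans)
  from f show "parikh_coverable A f"
  proof (elim disjE exE conjE)
    assume "\<forall>t\<in>all_states A. f t \<le> cnt ((b, s, p) # fr) t"
    then show ?thesis unfolding parikh_coverable_def using r parikh_task_rep[OF G1(2)] by metis
  next
    fix q b' s'
    assume t: "(s, DispatchS q b', s') \<in> block_trans A b"
      and f: "\<forall>t\<in>all_states A. f t \<le> cnt ((b', init_state A b', Some q) # (b, s', p) # fr) t"
    obtain G2 w where G2: "qdas_step A (G1, \<rho>) (G2, \<rho>)"
      "call_rep G2 w (v # vs) q ((b', init_state A b', Some q) # (b, s', p) # fr)"
      using dispatch_reachable[OF G1(2) t] by blast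
    have "reachable A (G2, \<rho>)" using r G2(1) unfolding reachable_def by (rule rtranclp.rtrancl_into_rtrancl)
    then show ?thesis unfolding parikh_coverable_def using f parikh_call_rep[OF G2(2)] by metis
  qed
qed

section \<open>Parsing problem instances\<close>

type_synonym pstate = "(bool list \<times> tree list list) option"

text \<open>The state holds the digits of an unfinished numeral and the children found so far of all
  open nodes, both most recent first. A step consumes one token, that is, two bits.\<close>

definition ptok :: "bool \<Rightarrow> bool \<Rightarrow> bool list \<Rightarrow> tree list list \<Rightarrow> pstate" where
  "ptok a b cur st =
     (if \<not> a then Some (b # cur, st)
      else if b then (if cur = [] then Some ([], [] # st) else None)
      else (case st of [] \<Rightarrow> None | tp # st' \<Rightarrow>
        (if cur = [] then (case st' of [] \<Rightarrow> None | tp' # st'' \<Rightarrow> Some ([], (Node (rev tp) # tp') # st''))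
         else if canonical (rev cur) then Some ([], (Num (nat_of_bits (rev cur)) # tp) # st') else None)))"

definition pstep :: "bool list \<times> pstate \<Rightarrow> bool list \<times> pstate" where
  "pstep p = (case fst p of [] \<Rightarrow> p | a # w \<Rightarrow> (case w of [] \<Rightarrow> ([], None) | b # w' \<Rightarrow>
     (w', case snd p of None \<Rightarrow> None | Some q \<Rightarrow> ptok a b (fst q) (snd q))))"

definition parse :: "bool list \<Rightarrow> tree option" where
  "parse w = (case snd ((pstep ^^ length w) (w, Some ([], [[]]))) of None \<Rightarrow> None | Some q \<Rightarrow>
     (if fst q = [] then (case snd q of [] \<Rightarrow> None | tp # st \<Rightarrow>
        (if st = [] then (case tp of [] \<Rightarrow> None | t # ts \<Rightarrow> (if ts = [] then Some t else None)) else None))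
      else None))"

text \<open>The recursive form of iterated \<open>pstep\<close>, suited to induction; a single
  leftover bit is an error because tokens have two bits.\<close>

fun pbits :: "bool list \<Rightarrow> pstate \<Rightarrow> pstate" where
  "pbits [] p = p"
| "pbits [a] p = None"
| "pbits (a # b # w) p = pbits w (case p of None \<Rightarrow> None | Some q \<Rightarrow> ptok a b (fst q) (snd q))"

lemma pstep_pbits: "length w \<le> n \<Longrightarrow> (pstep ^^ n) (w, p) = ([], pbits w p)"
proof (induction n arbitrary: w p)
  case (Suc n)
  have step: "pstep ([], q) = ([], q)" "pstep ([a], q) = ([], None)"
    "pstep (a # b # v, q) = (v, case q of None \<Rightarrow> None | Some z \<Rightarrow> ptok a b (fst z) (snd z))" for a b v q
    by (simp_all add: pstep_def)
  have stop: "(pstep ^^ k) ([], q) = ([], q)" for k q by (induction k) (simp_all add: step)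
  consider "w = []" | a where "w = [a]" | a b v where "w = a # b # v"
    by (metis neq_Nil_conv)
  then show ?case
  proof cases
    case 3
    then show ?thesis using Suc by (simp add: funpow_Suc_right step del: funpow.simps)
  qed (simp_all add: funpow_Suc_right step stop del: funpow.simps)
qed simp

abbreviation dbits :: "bool list \<Rightarrow> bool list" where
  "dbits bs \<equiv> concat (map (\<lambda>b. [False, b]) bs)"

lemma pbits_digits: "pbits (dbits bs @ w) (Some (cur, st)) = pbits w (Some (rev bs @ cur, st))"
  by (induction bs arbitrary: cur) (auto simp: ptok_def)

lemma binary_not_Nil [simp]: "binary n \<noteq> []"
  by (subst binary_rec) simp

lemma pbits_tree: "pbits (tree_bits t @ w) (Some ([], tp # st)) = pbits w (Some ([], (t # tp) # st))"
proof (induction t arbitrary: w tp st)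
  case (Num n)
  then show ?case using canonical_binary[of n] by (simp add: pbits_digits ptok_def nat_of_bits_def)
next
  case (Node ts)
  have "pbits (concat (map tree_bits us) @ w) (Some ([], vs # st)) = pbits w (Some ([], (rev us @ vs) # st))"
    if "set us \<subseteq> set ts" for us vs w st
    using that
  proof (induction us arbitrary: vs)
    case (Cons u us)
    then show ?case using Node.IH[of u] by simp
  qed simp
  then show ?case by (simp add: ptok_def)
qed

lemma parse_tree_bits: "parse (tree_bits t) = Some t"
  using pbits_tree[of t "[]" "[]" "[]"] by (simp add: parse_def pstep_pbits)

text \<open>The input consumed so far, recomputed from the parser state. The bottom list gets no
  opening token, since it belongs to no node. Preserving this word along the run shows that every
  accepted word is the code of its result.\<close>

fun stack_bits :: "tree list list \<Rightarrow> bool list" where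
  "stack_bits [] = []"
| "stack_bits (tp # st) = stack_bits st @ (if st = [] then [] else [True, True]) @ concat (map tree_bits (rev tp))"

lemma ptok_bits:
  assumes "ptok a b cur st = Some (cur', st')" "st \<noteq> []"
  shows "st' \<noteq> [] \<and> stack_bits st' @ dbits (rev cur') = (stack_bits st @ dbits (rev cur)) @ [a, b]"
  using assms
  by (auto simp: ptok_def nat_of_bits_def binary_bits_val split: if_splits list.splits)

lemma pbits_stack_bits:
  assumes "pbits w (Some (cur, st)) = Some (cur', st')" "st \<noteq> []"
  shows "st' \<noteq> [] \<and> stack_bits st' @ dbits (rev cur') = (stack_bits st @ dbits (rev cur)) @ w"
  using assms
proof (induction w "Some (cur, st)" arbitrary: cur st rule: pbits.induct)
  case (3 a b w)
  have none: "pbits u None = None" for u by (induction u "None :: pstate" rule: pbits.induct) auto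
  from 3(2) none obtain cur1 st1 where 1: "ptok a b cur st = Some (cur1, st1)"
    by (cases "ptok a b cur st") auto
  have "st1 \<noteq> []" "stack_bits st1 @ dbits (rev cur1) = (stack_bits st @ dbits (rev cur)) @ [a, b]"
    using ptok_bits[OF 1 3(3)] by auto
  moreover have "pbits w (Some (cur1, st1)) = Some (cur', st')" using 3(2) 1 by simp
  ultimately show ?case using 3(1)[of cur1 st1] 1 by simp
qed auto

lemma parse_sound: "parse w = Some t \<Longrightarrow> tree_bits t = w"
proof -
  assume "parse w = Some t"
  then have "pbits w (Some ([], [[]])) = Some ([], [[t]])"
    by (auto simp: parse_def pstep_pbits split: option.splits if_splits list.splits)
  from pbits_stack_bits[OF this] show ?thesis by simp
qed

lemma siz_Num_of_bits: "canonical bs \<Longrightarrow> siz (Num (nat_of_bits bs)) = siz bs + 2"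
  by (simp add: nat_of_bits_def enc_nat_def binary_bits_val)

text \<open>Closing a numeral or a node only moves material between the components of the state,
  since a number is stored by its digits. A token thus costs an additive constant, and the whole
  parse stays linear in size.\<close>

lemma siz_ptok: "siz (ptok a b cur st) \<le> siz cur + siz st + 10"
  by (auto simp: ptok_def siz_rev siz_Num_of_bits enc_bool_def split: list.splits simp del: enc_tree_simps(1))

lemma siz_pstep: "siz (pstep p) \<le> siz p + 10"
proof -
  obtain w q where p: "p = (w, q)" by (cases p)
  have t: "siz (ptok a b (fst r) (snd r)) \<le> siz r + 10" for a b r
    using siz_ptok[of a b "fst r" "snd r"] by (cases r) simp
  show ?thesis
  proof (cases q)
    case (Some r)
    then show ?thesis unfolding p
      by (auto simp: pstep_def split: list.splits) (use t[of _ _ r] in \<open>fastforce intro: order_trans\<close>)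
  qed (auto simp: p pstep_def split: list.splits)
qed

lemma PT_parse [PT_intros]:
  assumes "PT f"
  shows "PT (\<lambda>x. parse (f x))"
proof -
  have "PT (\<lambda>x. (pstep ^^ length (f x)) (f x, Some ([], [[]])))"
  proof (rule PT_iter[where B = "\<lambda>x. siz (f x, Some ([] :: bool list, [[]] :: tree list list)) + 10 * siz (f x)"])
    show "PT (\<lambda>p :: 'a \<times> bool list \<times> pstate. pstep (snd p))"
      unfolding pstep_def ptok_def canonical_def by (intro PT_intros)
    show "siz ((pstep ^^ i) (f x, Some ([], [[]]))) \<le>
        siz (f x, Some ([] :: bool list, [[]] :: tree list list)) + 10 * siz (f x)"
      if "i \<le> length (f x)" for x i
    proof -
      have "siz ((pstep ^^ i) q) \<le> siz q + 10 * i" for q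
      proof (induction i)
        case (Suc i)
        then show ?case using siz_pstep[of "(pstep ^^ i) q"] by simp
      qed simp
      moreover have "i \<le> siz (f x)" using that length_le_siz[of "f x"] by simp
      ultimately show ?thesis by (meson add_le_cancel_left mult_le_mono2 order_trans)
    qed
    show "pbd (\<lambda>x. siz x) (\<lambda>x. siz (f x, Some ([] :: bool list, [[]] :: tree list list)) + 10 * siz (f x))"
      by (intro pbd_intros PT_size PT_intros assms)
  qed (intro PT_intros assms)+
  then show ?thesis unfolding parse_def by (intro PT_intros)
qed

section \<open>Well-formed instances\<close>

definition num :: "tree \<Rightarrow> nat" where "num t = (case t of Num n \<Rightarrow> n | Node ts \<Rightarrow> 0)"
definition kids :: "tree \<Rightarrow> tree list" where "kids t = (case t of Num n \<Rightarrow> [] | Node ts \<Rightarrow> ts)"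

primrec lnth :: "nat \<Rightarrow> tree list \<Rightarrow> tree" where
  "lnth 0 ts = (case ts of [] \<Rightarrow> Num 0 | t # us \<Rightarrow> t)"
| "lnth (Suc k) ts = (case ts of [] \<Rightarrow> Num 0 | t # us \<Rightarrow> lnth k us)"

abbreviation kid :: "nat \<Rightarrow> tree \<Rightarrow> tree" where "kid k t \<equiv> lnth k (kids t)"

lemma num_simps [simp]: "num (Num n) = n" by (simp add: num_def)
lemma kids_simps [simp]: "kids (Node ts) = ts" by (simp add: kids_def)

lemma PT_num [PT_intros]: "PT f \<Longrightarrow> PT (\<lambda>x. num (f x))"
  unfolding num_def by (intro PT_intros)

lemma PT_kids [PT_intros]: "PT f \<Longrightarrow> PT (\<lambda>x. kids (f x))"
  unfolding kids_def by (intro PT_intros)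

lemma PT_lnth [PT_intros]: "PT f \<Longrightarrow> PT (\<lambda>x. lnth k (f x))"
proof -
  have "PT (\<lambda>ts. lnth k ts)"
  proof (induction k)
    case 0
    show ?case unfolding lnth.simps by (intro PT_intros)
  next
    case (Suc k)
    show ?case unfolding lnth.simps by (intro PT_intros PT_comp[OF Suc])
  qed
  then show "PT f \<Longrightarrow> ?thesis" by (rule PT_comp)
qed

definition nums :: "nat \<Rightarrow> tree \<Rightarrow> nat list" where "nums k t = rdups (map num (kids (kid k t)))"

definition pairs :: "nat \<Rightarrow> tree \<Rightarrow> (nat \<times> nat) list" where
  "pairs k t = rdups (map (\<lambda>x. (num (kid 0 x), num (kid 1 x))) (kids (kid k t)))"

text \<open>Actions are left as undecoded trees; the tests below compare them with the codes of
  candidate actions.\<close>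

definition rules :: "tree \<Rightarrow> (nat \<times> nat \<times> tree \<times> nat) list" where
  "rules t = map (\<lambda>x. (num (kid 0 x), num (kid 1 x), kid 2 x, num (kid 3 x))) (kids (kid 10 t))"

lemma PT_nums [PT_intros]: "PT f \<Longrightarrow> PT (\<lambda>x. nums k (f x))"
  unfolding nums_def by (intro PT_intros)

lemma PT_pairs [PT_intros]: "PT f \<Longrightarrow> PT (\<lambda>x. pairs k (f x))"
  unfolding pairs_def by (intro PT_intros)

lemma PT_rules [PT_intros]: "PT f \<Longrightarrow> PT (\<lambda>x. rules (f x))"
  unfolding rules_def by (intro PT_intros)

abbreviation "iIV t \<equiv> num (kid 0 t)"
abbreviation "iMB t \<equiv> num (kid 1 t)"
abbreviation "iD t \<equiv> nums 2 t"
abbreviation "iX t \<equiv> nums 3 t"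
abbreviation "iCQ t \<equiv> nums 4 t"
abbreviation "iSQ t \<equiv> nums 5 t"
abbreviation "iB t \<equiv> nums 6 t"
abbreviation "iBS t \<equiv> pairs 7 t"
abbreviation "iIS t \<equiv> pairs 8 t"
abbreviation "iFS t \<equiv> pairs 9 t"
abbreviation "iF t \<equiv> pairs 11 t"

text \<open>Node and numeral shapes are checked by rebuilding the tree from its parts.\<close>

definition shape :: "tree \<Rightarrow> bool" where
  "shape t \<longleftrightarrow> t = Node [Num (iIV t), Num (iMB t), Node (kids (kid 2 t)), Node (kids (kid 3 t)),
       Node (kids (kid 4 t)), Node (kids (kid 5 t)), Node (kids (kid 6 t)), Node (kids (kid 7 t)),
       Node (kids (kid 8 t)), Node (kids (kid 9 t)), Node (kids (kid 10 t)), Node (kids (kid 11 t))] \<and>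
     (\<forall>x\<in>set (kids (kid 2 t) @ kids (kid 3 t) @ kids (kid 4 t) @ kids (kid 5 t) @ kids (kid 6 t)). x = Num (num x)) \<and>
     (\<forall>x\<in>set (kids (kid 7 t) @ kids (kid 8 t) @ kids (kid 9 t) @ kids (kid 11 t)).
        x = Node [Num (num (kid 0 x)), Num (num (kid 1 x))]) \<and>
     (\<forall>x\<in>set (kids (kid 10 t)). x = Node [Num (num (kid 0 x)), Num (num (kid 1 x)), kid 2 x, Num (num (kid 3 x))])"

text \<open>The code 0 of asynchronous dispatches is missing among the alternatives, so the
  well-formedness test also enforces that the system is synchronous.\<close>

definition sync_action :: "tree \<Rightarrow> tree \<Rightarrow> bool" where
  "sync_action t a \<longleftrightarrow>
     (\<exists>q\<in>set (iCQ t @ iSQ t). \<exists>b\<in>set (iB t). b \<noteq> iMB t \<and> a = Node [Num 1, Num q, Num b]) \<or>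
     (\<exists>x\<in>set (iX t). \<exists>v\<in>set (iD t). a = Node [Num 3, Num x, Num v]) \<or>
     (a = Node [Num 2, Node (kids (kid 1 a))] \<and>
      (\<forall>c\<in>set (kids (kid 1 a)). \<exists>x\<in>set (iX t). \<exists>v\<in>set (iD t).
         c = Node [Num 0, Num x, Num v] \<or> c = Node [Num 1, Num x, Num v]))"

definition functional_on :: "nat list \<Rightarrow> (nat \<times> nat) list \<Rightarrow> bool" where
  "functional_on xs r \<longleftrightarrow> (\<forall>x\<in>set xs. \<exists>p\<in>set r. fst p = x) \<and>
     (\<forall>p\<in>set r. fst p \<in> set xs \<and> (\<forall>q\<in>set r. fst q = fst p \<longrightarrow> snd q = snd p))"

definition wf_instance :: "tree \<Rightarrow> bool" where
  "wf_instance t \<longleftrightarrow> shape t \<and> iIV t \<in> set (iD t) \<and> iMB t \<in> set (iB t) \<and>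
     (\<forall>q\<in>set (iCQ t). q \<notin> set (iSQ t)) \<and>
     (\<forall>p\<in>set (iBS t). fst p \<in> set (iB t) \<and> (\<forall>p'\<in>set (iBS t). snd p' = snd p \<longrightarrow> fst p' = fst p)) \<and>
     functional_on (iB t) (iIS t) \<and> (\<forall>p\<in>set (iIS t). p \<in> set (iBS t)) \<and>
     functional_on (iB t) (iFS t) \<and> (\<forall>p\<in>set (iFS t). p \<in> set (iBS t)) \<and>
     (\<forall>r\<in>set (rules t). (fst r, fst (snd r)) \<in> set (iBS t) \<and> (fst r, snd (snd (snd r))) \<in> set (iBS t) \<and>
        sync_action t (fst (snd (snd r)))) \<and>
     functional_on (map snd (iBS t)) (iF t)"

lemma PT_wf_instance [PT_intros]:
  assumes "PT f"
  shows "PT (\<lambda>x. wf_instance (f x))"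
proof -
  have 1: "PT shape" unfolding shape_def by (intro PT_intros)
  have 2: "PT (\<lambda>p. sync_action (fst p) (snd p))" unfolding sync_action_def by (intro PT_intros)
  have 3: "PT (\<lambda>p. functional_on (fst p) (snd p))" unfolding functional_on_def by (intro PT_intros)
  have "PT wf_instance" unfolding wf_instance_def by (intro PT_intros PT_comp[OF 1] PT_app2[OF 2] PT_app2[OF 3])
  then show ?thesis using assms by (rule PT_comp)
qed

text \<open>The interface through which the decision procedure sees a system. It leaves open the
  values of \<open>A\<close> and \<open>f\<close> outside the blocks and states, which the code of
  an instance does not determine either.\<close>

definition view :: "tree \<Rightarrow> nat_qdas \<Rightarrow> (nat \<Rightarrow> nat) \<Rightarrow> bool" where
  "view t A f \<longleftrightarrow> iIV t = init_value A \<and> iMB t = main_block A \<and> set (iD t) = data_values A \<and>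
     set (iX t) = variables A \<and> set (iCQ t) = cqid A \<and> set (iSQ t) = sqid A \<and> set (iB t) = blocks A \<and>
     set (iBS t) = {(b, s). b \<in> blocks A \<and> s \<in> block_states A b} \<and>
     set (iIS t) = {(b, s). b \<in> blocks A \<and> s = init_state A b} \<and>
     set (iFS t) = {(b, s). b \<in> blocks A \<and> s = final_state A b} \<and>
     set (rules t) = {(b, s, a, s'). b \<in> blocks A \<and> (\<exists>c. a = action_tree c \<and> (s, c, s') \<in> block_trans A b)} \<and>
     set (iF t) = {(s, n). s \<in> all_states A \<and> n = f s}"

lemma atom_tree_inj: "atom_tree a = atom_tree b \<longleftrightarrow> a = b"
  by (cases a; cases b) auto

lemma action_tree_inj: "action_tree a = action_tree b \<longleftrightarrow> a = b"
proof -
  have "inj atom_tree" using atom_tree_inj by (auto simp: inj_def)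
  then show ?thesis by (cases a; cases b) (auto simp: inj_map_eq_map)
qed

lemma all_states_iff: "s \<in> all_states A \<longleftrightarrow> (\<exists>b\<in>blocks A. s \<in> block_states A b)"
  by (auto simp: all_states_def)

lemma view_encodes:
  assumes "encodes_instance A f w"
  obtains t where "w = tree_bits t" "shape t" "view t A f"
proof -
  let ?Xs = "[Num ` data_values A, Num ` variables A, Num ` cqid A, Num ` sqid A, Num ` blocks A,
         {Node [Num b, Num s] | b s. b \<in> blocks A \<and> s \<in> block_states A b},
         {Node [Num b, Num (init_state A b)] | b. b \<in> blocks A},
         {Node [Num b, Num (final_state A b)] | b. b \<in> blocks A},
         {Node [Num b, Num s, action_tree a, Num s'] | b s a s'. b \<in> blocks A \<and> (s, a, s') \<in> block_trans A b},
         {Node [Num s, Num (f s)] | s. s \<in> all_states A}]"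
  obtain ts where ts: "list_all2 lists_set ?Xs ts"
    and w: "w = tree_bits (Node (Num (init_value A) # Num (main_block A) # ts))"
    using assms unfolding encodes_instance_def by blast
  obtain l1 l2 l3 l4 l5 l6 l7 l8 l9 l10 where
    l: "ts = [Node l1, Node l2, Node l3, Node l4, Node l5, Node l6, Node l7, Node l8, Node l9, Node l10]"
    "set l1 = Num ` data_values A" "set l2 = Num ` variables A" "set l3 = Num ` cqid A"
    "set l4 = Num ` sqid A" "set l5 = Num ` blocks A"
    "set l6 = {Node [Num b, Num s] | b s. b \<in> blocks A \<and> s \<in> block_states A b}"
    "set l7 = {Node [Num b, Num (init_state A b)] | b. b \<in> blocks A}"
    "set l8 = {Node [Num b, Num (final_state A b)] | b. b \<in> blocks A}"
    "set l9 = {Node [Num b, Num s, action_tree a, Num s'] | b s a s'. b \<in> blocks A \<and> (s, a, s') \<in> block_trans A b}"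
    "set l10 = {Node [Num s, Num (f s)] | s. s \<in> all_states A}"
    using ts unfolding list_all2_Cons1 list_all2_Nil lists_set_def by (elim exE conjE) auto
  let ?t = "Node (Num (init_value A) # Num (main_block A) # ts)"
  have "shape ?t" unfolding shape_def l(1)
    by (simp add: eval_nat_numeral) (auto simp: l(2-))
  moreover have "view ?t A f"
    unfolding view_def nums_def pairs_def rules_def l(1)
    by (simp add: eval_nat_numeral rdups image_image l(2-)) (auto simp: image_iff; force)
  ultimately show ?thesis using that w by blast
qed

lemma wf_of_view:
  assumes "shape t" "view t A f" "is_qdas A" "synchronous A"
  shows "wf_instance t"
proof -
  note v = assms(2)[unfolded view_def] and q = assms(3)[unfolded is_qdas_def]
  have img: "set (map snd (iBS t)) = all_states A" using v by (force simp: all_states_iff image_iff)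
  have fn: "functional_on (iB t) (iIS t)" "functional_on (iB t) (iFS t)" "functional_on (map snd (iBS t)) (iF t)"
    unfolding functional_on_def img using v by auto
  have act: "sync_action t (action_tree c)" if "b \<in> blocks A" "(s, c, s') \<in> block_trans A b" for b s c s'
  proof -
    have c: "c \<in> actions A" using trans_in_actions[OF assms(3) that] .
    show ?thesis
    proof (cases c)
      case (DispatchA q b')
      then show ?thesis using that assms(4) by (auto simp: synchronous_def)
    next
      case (Guard g)
      then have "set g \<subseteq> atoms A" using c by (auto simp: actions_def)
      then have gA: "set g \<subseteq> atoms A" .
      have "\<forall>z\<in>set (map atom_tree g). \<exists>x\<in>set (iX t). \<exists>v\<in>set (iD t).
          z = Node [Num 0, Num x, Num v] \<or> z = Node [Num 1, Num x, Num v]"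
      proof (rule ballI)
        fix z assume "z \<in> set (map atom_tree g)"
        then obtain y where y: "y \<in> atoms A" "z = atom_tree y" using gA by auto
        have "set (iX t) = variables A" "set (iD t) = data_values A" using v by blast+
        then show "\<exists>x\<in>set (iX t). \<exists>v\<in>set (iD t). z = Node [Num 0, Num x, Num v] \<or> z = Node [Num 1, Num x, Num v]"
          using y by (cases y) (simp_all add: atoms_def)
      qed
      then show ?thesis unfolding sync_action_def by (intro disjI2) (simp add: Guard)
    qed (use c v in \<open>auto simp: actions_def sync_action_def\<close>)
  qed
  show ?thesis
    unfolding wf_instance_def using assms(1) v q fn act by (auto 0 3 simp del: One_nat_def)
qed

lemma shape_sets:
  assumes "shape t"
  shows "t = Node [Num (iIV t), Num (iMB t), Node (kids (kid 2 t)), Node (kids (kid 3 t)),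
       Node (kids (kid 4 t)), Node (kids (kid 5 t)), Node (kids (kid 6 t)), Node (kids (kid 7 t)),
       Node (kids (kid 8 t)), Node (kids (kid 9 t)), Node (kids (kid 10 t)), Node (kids (kid 11 t))]"
    and "k \<in> {2, 3, 4, 5, 6} \<Longrightarrow> set (kids (kid k t)) = Num ` set (nums k t)"
    and "k \<in> {7, 8, 9, 11} \<Longrightarrow> set (kids (kid k t)) = (\<lambda>p. Node [Num (fst p), Num (snd p)]) ` set (pairs k t)"
    and "set (kids (kid 10 t)) = (\<lambda>r. Node [Num (fst r), Num (fst (snd r)), fst (snd (snd r)), Num (snd (snd (snd r)))]) ` set (rules t)"
proof -
  have *: "set xs = g ` set (map h xs)" if "\<forall>x\<in>set xs. x = g (h x)" for xs and g :: "'b \<Rightarrow> 'c" and h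
    using that by force
  note s = assms[unfolded shape_def]
  show "t = Node [Num (iIV t), Num (iMB t), Node (kids (kid 2 t)), Node (kids (kid 3 t)),
       Node (kids (kid 4 t)), Node (kids (kid 5 t)), Node (kids (kid 6 t)), Node (kids (kid 7 t)),
       Node (kids (kid 8 t)), Node (kids (kid 9 t)), Node (kids (kid 10 t)), Node (kids (kid 11 t))]"
    using s by blast
  show "k \<in> {2, 3, 4, 5, 6} \<Longrightarrow> set (kids (kid k t)) = Num ` set (nums k t)"
    unfolding nums_def rdups by (rule *) (use s in \<open>auto simp del: One_nat_def\<close>)
  show "k \<in> {7, 8, 9, 11} \<Longrightarrow> set (kids (kid k t)) = (\<lambda>p. Node [Num (fst p), Num (snd p)]) ` set (pairs k t)"
    unfolding pairs_def rdups by (rule *) (use s in \<open>auto simp del: One_nat_def\<close>)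
  show "set (kids (kid 10 t)) = (\<lambda>r. Node [Num (fst r), Num (fst (snd r)), fst (snd (snd r)), Num (snd (snd (snd r)))]) ` set (rules t)"
    unfolding rules_def by (rule *) (use s in \<open>auto simp del: One_nat_def\<close>)
qed

lemma functional_onD:
  assumes "functional_on xs r"
  obtains g where "set r = {(x, y). x \<in> set xs \<and> y = g x}"
proof -
  define g where "g x = (SOME y. (x, y) \<in> set r)" for x
  have ex: "\<exists>y. (x, y) \<in> set r" if "x \<in> set xs" for x
    using assms that unfolding functional_on_def by (metis prod.collapse)
  have un: "y = y'" if "(x, y) \<in> set r" "(x, y') \<in> set r" for x y y'
    using assms that unfolding functional_on_def by fastforce
  have dom: "x \<in> set xs" if "(x, y) \<in> set r" for x y
    using assms that unfolding functional_on_def by fastforce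
  have g: "(x, g x) \<in> set r" if "x \<in> set xs" for x
    using someI_ex[OF ex[OF that]] by (simp add: g_def)
  have "set r = {(x, y). x \<in> set xs \<and> y = g x}"
  proof (intro set_eqI)
    fix p
    show "p \<in> set r \<longleftrightarrow> p \<in> {(x, y). x \<in> set xs \<and> y = g x}"
    proof (cases p)
      case (Pair x y)
      have "y = g x" if "(x, y) \<in> set r" using un[OF that g[OF dom[OF that]]] .
      then have "(x, y) \<in> set r \<longleftrightarrow> x \<in> set xs \<and> y = g x" using dom[of x y] g[of x] by metis
      then show ?thesis unfolding Pair by simp
    qed
  qed
  then show ?thesis by (rule that[of g])
qed

lemma map_preimage: "set xs \<subseteq> f ` S \<Longrightarrow> \<exists>ys. set ys \<subseteq> S \<and> xs = map f ys"
proof (induction xs)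
  case (Cons x xs)
  then obtain y ys where "y \<in> S" "x = f y" "set ys \<subseteq> S" "xs = map f ys" by auto
  then show ?case by (intro exI[of _ "y # ys"]) simp
qed simp

lemma wf_instance_view:
  assumes "wf_instance t"
  obtains A f where "is_qdas A" "synchronous A" "encodes_instance A f (tree_bits t)" "view t A f"
proof -
  note w = assms[unfolded wf_instance_def]
  have fn: "functional_on (iB t) (iIS t)" "functional_on (iB t) (iFS t)" "functional_on (map snd (iBS t)) (iF t)"
    using w by blast+
  obtain gi where gi: "set (iIS t) = {(x, y). x \<in> set (iB t) \<and> y = gi x}" using fn(1) by (rule functional_onD)
  obtain gf where gf: "set (iFS t) = {(x, y). x \<in> set (iB t) \<and> y = gf x}" using fn(2) by (rule functional_onD)
  obtain f where f: "set (iF t) = {(x, y). x \<in> set (map snd (iBS t)) \<and> y = f x}" using fn(3) by (rule functional_onD)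
  have wBS: "b \<in> set (iB t)" "(b', s) \<in> set (iBS t) \<Longrightarrow> b' = b" if "(b, s) \<in> set (iBS t)" for b b' s
    using w that by fastforce+
  have wI: "(b, gi b) \<in> set (iBS t)" "(b, gf b) \<in> set (iBS t)" if "b \<in> set (iB t)" for b
    using w gi gf that by blast+
  have wR: "(b, s) \<in> set (iBS t)" "(b, s') \<in> set (iBS t)" "sync_action t a" if "(b, s, a, s') \<in> set (rules t)" for b s a s'
    using w that by fastforce+
  have w0: "iIV t \<in> set (iD t)" "iMB t \<in> set (iB t)" "\<forall>q\<in>set (iCQ t). q \<notin> set (iSQ t)" "shape t"
    using w by blast+
  define A :: nat_qdas where "A = \<lparr>data_values = set (iD t), init_value = iIV t, variables = set (iX t),
    cqid = set (iCQ t), sqid = set (iSQ t), blocks = set (iB t), main_block = iMB t,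
    block_states = (\<lambda>b. {s. (b, s) \<in> set (iBS t)}), init_state = gi, final_state = gf,
    block_trans = (\<lambda>b. {(s, a, s'). (b, s, action_tree a, s') \<in> set (rules t)})\<rparr>"
  have act: "\<exists>c\<in>actions A. a = action_tree c \<and> (\<forall>q b. c \<noteq> DispatchA q b)" if "sync_action t a" for a
    using that unfolding sync_action_def
  proof (elim disjE bexE conjE)
    fix q b assume "q \<in> set (iCQ t @ iSQ t)" "b \<in> set (iB t)" "b \<noteq> iMB t" "a = Node [Num 1, Num q, Num b]"
    then show ?thesis by (intro bexI[of _ "DispatchS q b"]) (auto simp: actions_def A_def)
  next
    fix x v assume "x \<in> set (iX t)" "v \<in> set (iD t)" "a = Node [Num 3, Num x, Num v]"
    then show ?thesis by (intro bexI[of _ "Assign x v"]) (auto simp: actions_def A_def)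
  next
    assume a: "a = Node [Num 2, Node (kids (kid 1 a))]" and
      c: "\<forall>c\<in>set (kids (kid 1 a)). \<exists>x\<in>set (iX t). \<exists>v\<in>set (iD t).
         c = Node [Num 0, Num x, Num v] \<or> c = Node [Num 1, Num x, Num v]"
    have "\<exists>y\<in>atoms A. z = atom_tree y" if z: "z \<in> set (kids (kid 1 a))" for z
    proof -
      obtain x v where xv: "x \<in> set (iX t)" "v \<in> set (iD t)" "z = Node [Num 0, Num x, Num v] \<or> z = Node [Num 1, Num x, Num v]"
        using c z by blast
      have "VarEq x v \<in> atoms A" "VarNeq x v \<in> atoms A" using xv(1,2) by (auto simp: atoms_def A_def)
      then show ?thesis using xv(3) by (metis atom_tree.simps)
    qed
    then have "set (kids (kid 1 a)) \<subseteq> atom_tree ` atoms A" by blast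
    from map_preimage[OF this] obtain g where g: "set g \<subseteq> atoms A" "kids (kid 1 a) = map atom_tree g"
      by blast
    then show ?thesis using a by (intro bexI[of _ "Guard g"]) (auto simp: actions_def)
  qed
  have rules: "set (rules t) = {(b, s, a, s'). b \<in> blocks A \<and> (\<exists>c. a = action_tree c \<and> (s, c, s') \<in> block_trans A b)}"
  proof (intro set_eqI iffI)
    fix r assume r: "r \<in> set (rules t)"
    obtain b s a s' where [simp]: "r = (b, s, a, s')" by (metis prod.collapse)
    have "sync_action t a" "b \<in> blocks A" using wR[of b s a s'] wBS(1) r by (auto simp: A_def)
    then show "r \<in> {(b, s, a, s'). b \<in> blocks A \<and> (\<exists>c. a = action_tree c \<and> (s, c, s') \<in> block_trans A b)}"
      using act r by (auto simp: A_def)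
  qed (auto simp: A_def)
  have states: "all_states A = set (map snd (iBS t))"
  proof (intro set_eqI)
    fix s
    have "s \<in> all_states A \<longleftrightarrow> (\<exists>b. (b, s) \<in> set (iBS t))"
      by (simp add: all_states_iff A_def) (metis wBS(1))
    then show "s \<in> all_states A \<longleftrightarrow> s \<in> set (map snd (iBS t))" by force
  qed
  have v: "view t A f"
    unfolding view_def rules gi gf f states using wBS(1) by (auto simp: A_def)
  have fin: "finite (block_trans A b)" for b
  proof -
    have "(\<lambda>(s, a, s'). (b, s, action_tree a, s')) ` block_trans A b \<subseteq> set (rules t)" by (auto simp: A_def)
    moreover have "inj_on (\<lambda>(s, a, s'). (b, s, action_tree a, s')) (block_trans A b)"
      by (auto simp: inj_on_def action_tree_inj)
    ultimately show ?thesis by (meson finite_set finite_subset inj_on_finite)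
  qed
  have fin2: "finite {s. (b, s) \<in> set (iBS t)}" for b
    by (rule finite_subset[of _ "snd ` set (iBS t)"]) force+
  have trans: "s \<in> block_states A b \<and> a \<in> actions A \<and> s' \<in> block_states A b \<and> (\<forall>q b. a \<noteq> DispatchA q b)"
    if "(s, a, s') \<in> block_trans A b" for b s a s'
  proof -
    have r: "(b, s, action_tree a, s') \<in> set (rules t)" using that by (simp add: A_def)
    from wR[OF r] show ?thesis using act[of "action_tree a"] by (auto simp: A_def action_tree_inj)
  qed
  have q: "is_qdas A"
    unfolding is_qdas_def
  proof (intro conjI ballI impI)
    fix b assume b: "b \<in> blocks A"
    show "finite (block_states A b)" using fin2 by (simp add: A_def)
    show "finite (block_trans A b)" by (rule fin)
    show "init_state A b \<in> block_states A b" "final_state A b \<in> block_states A b" using b wI by (auto simp: A_def)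
    show "block_trans A b \<subseteq> block_states A b \<times> actions A \<times> block_states A b" using trans by auto
    fix b' assume "b \<noteq> b'"
    then show "block_states A b \<inter> block_states A b' = {}" using wBS(2) by (auto simp: A_def)
  qed (use w0 in \<open>auto simp: A_def\<close>)
  have s: "synchronous A" unfolding synchronous_def using trans by blast
  note sh = w0(4)
  have "encodes_instance A f (tree_bits t)"
    unfolding encodes_instance_def
  proof (rule exI, rule conjI)
    have l: "lists_set X (Node us)" if "set us = X" for X us using that by (auto simp: lists_set_def)
    let ?ts = "map (\<lambda>k. Node (kids (kid k t))) [2, 3, 4, 5, 6, 7, 8, 9, 10, 11]"
    show "tree_bits t = tree_bits (Node (Num (init_value A) # Num (main_block A) # ?ts))"
      using shape_sets(1)[OF sh] by (simp add: A_def)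
    show "list_all2 lists_set
        [Num ` data_values A, Num ` variables A, Num ` cqid A, Num ` sqid A, Num ` blocks A,
         {Node [Num b, Num s] | b s. b \<in> blocks A \<and> s \<in> block_states A b},
         {Node [Num b, Num (init_state A b)] | b. b \<in> blocks A},
         {Node [Num b, Num (final_state A b)] | b. b \<in> blocks A},
         {Node [Num b, Num s, action_tree a, Num s'] | b s a s'. b \<in> blocks A \<and> (s, a, s') \<in> block_trans A b},
         {Node [Num s, Num (f s)] | s. s \<in> all_states A}] ?ts"
      unfolding list.map list_all2_Cons list_all2_Nil
    proof (intro conjI TrueI l)
      note vs = v[unfolded view_def]
      show "set (kids (kid 2 t)) = Num ` data_values A" "set (kids (kid 3 t)) = Num ` variables A"
        "set (kids (kid 4 t)) = Num ` cqid A" "set (kids (kid 5 t)) = Num ` sqid A" "set (kids (kid 6 t)) = Num ` blocks A"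
        using shape_sets(2)[OF sh, of 2] shape_sets(2)[OF sh, of 3] shape_sets(2)[OF sh, of 4]
          shape_sets(2)[OF sh, of 5] shape_sets(2)[OF sh, of 6] vs by simp_all
      have p: "set (kids (kid 7 t)) = (\<lambda>p. Node [Num (fst p), Num (snd p)]) ` {(b, s). b \<in> blocks A \<and> s \<in> block_states A b}"
        "set (kids (kid 8 t)) = (\<lambda>p. Node [Num (fst p), Num (snd p)]) ` {(b, s). b \<in> blocks A \<and> s = init_state A b}"
        "set (kids (kid 9 t)) = (\<lambda>p. Node [Num (fst p), Num (snd p)]) ` {(b, s). b \<in> blocks A \<and> s = final_state A b}"
        "set (kids (kid 11 t)) = (\<lambda>p. Node [Num (fst p), Num (snd p)]) ` {(s, n). s \<in> all_states A \<and> n = f s}"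
        using shape_sets(3)[OF sh, of 7] shape_sets(3)[OF sh, of 8] shape_sets(3)[OF sh, of 9]
          shape_sets(3)[OF sh, of 11] vs by simp_all
      show "set (kids (kid 7 t)) = {Node [Num b, Num s] | b s. b \<in> blocks A \<and> s \<in> block_states A b}" unfolding p by force
      show "set (kids (kid 8 t)) = {Node [Num b, Num (init_state A b)] | b. b \<in> blocks A}" unfolding p by force
      show "set (kids (kid 9 t)) = {Node [Num b, Num (final_state A b)] | b. b \<in> blocks A}" unfolding p by force
      show "set (kids (kid 11 t)) = {Node [Num s, Num (f s)] | s. s \<in> all_states A}" unfolding p by force
      show "set (kids (kid 10 t)) =
        {Node [Num b, Num s, action_tree a, Num s'] | b s a s'. b \<in> blocks A \<and> (s, a, s') \<in> block_trans A b}"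
        unfolding shape_sets(4)[OF sh] rules by force
    qed simp
  qed
  then show ?thesis using that q s v by blast
qed

section \<open>Deciding coverability in exponential time\<close>

text \<open>Functions on a finite set of keys are represented by their graphs, listed in a fixed order.\<close>

definition graph :: "'k list \<Rightarrow> ('k \<Rightarrow> 'v) \<Rightarrow> ('k \<times> 'v) list" where
  "graph K g = map (\<lambda>k. (k, g k)) K"

definition upd :: "('k \<times> 'v) list \<Rightarrow> 'k \<Rightarrow> 'v \<Rightarrow> ('k \<times> 'v) list" where
  "upd l k v = map (\<lambda>p. if fst p = k then (fst p, v) else p) l"

lemma upd_graph: "upd (graph K g) k v = graph K (g(k := v))"
  by (simp add: upd_def graph_def)

lemma set_graph: "set (graph K g) = {(k, g k) | k. k \<in> set K}"
  by (auto simp: graph_def)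

lemma graph_eq_iff: "graph K g = graph K h \<longleftrightarrow> (\<forall>k\<in>set K. g k = h k)"
  by (auto simp: graph_def)

lemma set_product_graphs:
  assumes "distinct K"
  shows "set (product_lists (map (\<lambda>k. map (Pair k) (R k)) K)) = {graph K g | g. \<forall>k\<in>set K. g k \<in> set (R k)}"
  using assms
proof (induction K)
  case Nil
  then show ?case by (auto simp: graph_def)
next
  case (Cons k K)
  show ?case
  proof (intro set_eqI iffI)
    fix l assume "l \<in> set (product_lists (map (\<lambda>k. map (Pair k) (R k)) (k # K)))"
    then obtain v g where v: "v \<in> set (R k)" "\<forall>k\<in>set K. g k \<in> set (R k)" "l = (k, v) # graph K g"
      using Cons by auto
    have "l = graph (k # K) (g(k := v))" using v(3) Cons.prems by (auto simp: graph_def)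
    then show "l \<in> {graph (k # K) g | g. \<forall>k\<in>set (k # K). g k \<in> set (R k)}"
      using v by (intro CollectI exI[of _ "g(k := v)"]) auto
  next
    fix l assume "l \<in> {graph (k # K) g | g. \<forall>k\<in>set (k # K). g k \<in> set (R k)}"
    then obtain g where "\<forall>k\<in>set (k # K). g k \<in> set (R k)" "l = (k, g k) # graph K g" by (auto simp: graph_def)
    then show "l \<in> set (product_lists (map (\<lambda>k. map (Pair k) (R k)) (k # K)))" using Cons by auto
  qed
qed

lemma PT_upd [PT_intros]:
  assumes "PT l" "PT k" "PT v"
  shows "PT (\<lambda>x. upd (l x) (k x) (v x))"
proof -
  have "PT (\<lambda>p. upd (fst p) (fst (snd p)) (snd (snd p)))" unfolding upd_def by (intro PT_intros)
  then show ?thesis by (rule PT_app3[OF _ assms])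
qed

type_synonym ulist = "(nat \<times> bool) list"
type_synonym vlist = "(nat \<times> nat) list"
type_synonym clist = "(nat \<times> unit list) list"
type_synonym sfact = "ulist \<times> nat \<times> vlist \<times> nat \<times> vlist"
type_synonym efact = "nat \<times> vlist \<times> ulist \<times> clist"

definition guard_ok :: "tree \<Rightarrow> tree \<Rightarrow> vlist \<Rightarrow> bool" where
  "guard_ok t a \<sigma> \<longleftrightarrow> a = Node [Num 2, Node (kids (kid 1 a))] \<and>
     (\<forall>c\<in>set (kids (kid 1 a)). \<exists>p\<in>set \<sigma>. c = Node [Num 0, Num (fst p), Num (snd p)] \<or>
        (\<exists>v\<in>set (iD t). v \<noteq> snd p \<and> c = Node [Num 1, Num (fst p), Num v]))"

definition queue_ok :: "tree \<Rightarrow> ulist \<Rightarrow> nat \<Rightarrow> bool" where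
  "queue_ok t U q \<longleftrightarrow> q \<in> set (iCQ t) \<or> (q, False) \<in> set U"

text \<open>The candidates for a rule action \<open>a\<close> are enumerated instead of taking \<open>a\<close> apart.\<close>

definition derive_summ :: "tree \<Rightarrow> sfact list \<Rightarrow> sfact \<Rightarrow> bool" where
  "derive_summ t S u = (case u of (U, b, \<rho>0, s, \<rho>) \<Rightarrow>
     (b, s) \<in> set (iIS t) \<and> \<rho> = \<rho>0 \<or>
     (\<exists>u1\<in>set S. case u1 of (U1, b1, \<rho>1, s1, \<sigma>) \<Rightarrow> U1 = U \<and> b1 = b \<and> \<rho>1 = \<rho>0 \<and>
        (\<exists>r\<in>set (rules t). case r of (b2, s2, a, s') \<Rightarrow> b2 = b \<and> s2 = s1 \<and> s' = s \<and>
           (guard_ok t a \<sigma> \<and> \<rho> = \<sigma> \<or>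
            (\<exists>x\<in>set (iX t). \<exists>v\<in>set (iD t). a = Node [Num 3, Num x, Num v] \<and> \<rho> = upd \<sigma> x v) \<or>
            (\<exists>q\<in>set (iCQ t @ iSQ t). \<exists>b'\<in>set (iB t). a = Node [Num 1, Num q, Num b'] \<and> queue_ok t U q \<and>
               (\<exists>u3\<in>set S. case u3 of (U3, b3, \<rho>3, s3, \<sigma>3) \<Rightarrow>
                  U3 = upd U q True \<and> b3 = b' \<and> \<rho>3 = \<sigma> \<and> (b', s3) \<in> set (iFS t) \<and> \<sigma>3 = \<rho>))))))"

definition vals :: "tree \<Rightarrow> unit list \<Rightarrow> vlist list" where
  "vals t n = tprod n (map (\<lambda>x. map (Pair x) (iD t)) (iX t))"

definition usets :: "tree \<Rightarrow> unit list \<Rightarrow> ulist list" where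
  "usets t n = tprod n (map (\<lambda>q. map (Pair q) [False, True]) (iSQ t))"

text \<open>Values of \<open>f\<close> may be exponential in the input length, and the fuel makes
  their unary form available. The additional \<open>()\<close> makes the range end at
  \<open>f s\<close> itself.\<close>

definition needs :: "tree \<Rightarrow> unit list \<Rightarrow> clist list" where
  "needs t n = tprod n (map (\<lambda>p. map (\<lambda>k. (fst p, unary_of n k)) [0..<length (() # unary_of n (snd p))]) (iF t))"

definition summ_list :: "tree \<Rightarrow> unit list \<Rightarrow> sfact list" where
  "summ_list t n = lfp_list (List.product (usets t n) (List.product (iB t) (List.product (vals t n)
     (List.product (map snd (iBS t)) (vals t n))))) (derive_summ t)"

text \<open>Truncated subtraction of one: dropping from an empty list changes nothing, so a surplus
  of vertices in one state is forgotten.\<close>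

definition dec :: "clist \<Rightarrow> nat \<Rightarrow> clist" where
  "dec c s = map (\<lambda>p. if fst p = s then (fst p, drop 1 (snd p)) else p) c"

definition derive_entry :: "tree \<Rightarrow> unit list \<Rightarrow> sfact list \<Rightarrow> efact list \<Rightarrow> efact \<Rightarrow> bool" where
  "derive_entry t n S E u = (case u of (b, \<rho>, U, c) \<Rightarrow>
     b = iMB t \<and> \<rho> = map (\<lambda>x. (x, iIV t)) (iX t) \<and> U = map (\<lambda>q. (q, False)) (iSQ t) \<and>
       c = map (\<lambda>p. (fst p, unary_of n (snd p))) (iF t) \<or>
     (\<exists>u0\<in>set E. case u0 of (b0, \<rho>0, U0, c0) \<Rightarrow>
        (\<exists>u1\<in>set S. case u1 of (U1, b1, \<rho>1, s1, \<sigma>) \<Rightarrow> U1 = U0 \<and> b1 = b0 \<and> \<rho>1 = \<rho>0 \<and> \<sigma> = \<rho> \<and>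
           (\<exists>r\<in>set (rules t). case r of (b2, s2, a, s') \<Rightarrow> b2 = b0 \<and> s2 = s1 \<and>
              (\<exists>q\<in>set (iCQ t @ iSQ t). a = Node [Num 1, Num q, Num b] \<and> queue_ok t U0 q \<and>
                 U = upd U0 q True \<and> c = dec c0 s')))))"

definition entry_list :: "tree \<Rightarrow> unit list \<Rightarrow> efact list" where
  "entry_list t n = lfp_list (List.product (iB t) (List.product (vals t n)
     (List.product (usets t n) (needs t n)))) (derive_entry t n (summ_list t n))"

definition covered :: "clist \<Rightarrow> bool" where
  "covered c \<longleftrightarrow> (\<forall>p\<in>set c. snd p = [])"

text \<open>The two tests at the end are the two alternatives of
  \<open>parikh_coverable_iff\<close>: the top of the stack is a running task, or it is a call that
  still waits above its caller.\<close>

definition decide :: "tree \<Rightarrow> unit list \<Rightarrow> bool" where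
  "decide t n \<longleftrightarrow> (\<exists>u0\<in>set (entry_list t n). case u0 of (b0, \<rho>0, U0, c0) \<Rightarrow>
     (\<exists>u1\<in>set (summ_list t n). case u1 of (U1, b1, \<rho>1, s1, \<sigma>) \<Rightarrow> U1 = U0 \<and> b1 = b0 \<and> \<rho>1 = \<rho>0 \<and>
        (covered (dec c0 s1) \<or>
         (\<exists>r\<in>set (rules t). case r of (b2, s2, a, s') \<Rightarrow> b2 = b0 \<and> s2 = s1 \<and>
            (\<exists>q\<in>set (iCQ t @ iSQ t). \<exists>p\<in>set (iIS t). a = Node [Num 1, Num q, Num (fst p)] \<and>
               covered (dec (dec c0 s') (snd p)))))))"

lemma PT_derive_summ: "PT (\<lambda>p. derive_summ (fst p) (fst (snd p)) (snd (snd p)))"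
proof -
  have 1: "PT (\<lambda>p. guard_ok (fst p) (fst (snd p)) (snd (snd p)))" unfolding guard_ok_def by (intro PT_intros)
  have 2: "PT (\<lambda>p. queue_ok (fst p) (fst (snd p)) (snd (snd p)))" unfolding queue_ok_def by (intro PT_intros)
  show ?thesis unfolding derive_summ_def by (intro PT_intros PT_app3[OF 1] PT_app3[OF 2])
qed

lemma PT_drop1: "PT f \<Longrightarrow> PT (\<lambda>x. drop 1 (f x))"
proof -
  assume "PT f"
  then have "PT (\<lambda>x. case f x of [] \<Rightarrow> [] | y # ys \<Rightarrow> ys)" by (intro PT_intros)
  moreover have "(case ys of [] \<Rightarrow> [] | y # ys \<Rightarrow> ys) = drop 1 ys" for ys :: "'b list" by (cases ys) auto
  ultimately show ?thesis by simp
qed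

lemma PT_dec: "PT (\<lambda>p. dec (fst p) (snd p))"
  unfolding dec_def by (intro PT_intros PT_drop1)

lemma PT_derive_entry:
  "PT (\<lambda>p. derive_entry (fst (fst p)) (snd (fst p)) (fst (snd p)) (fst (snd (snd p))) (snd (snd (snd p))))"
proof -
  have 2: "PT (\<lambda>p. queue_ok (fst p) (fst (snd p)) (snd (snd p)))" unfolding queue_ok_def by (intro PT_intros)
  show ?thesis unfolding derive_entry_def by (intro PT_intros PT_app2[OF PT_dec] PT_app3[OF 2])
qed

lemma PT_vals: "PT (\<lambda>p. vals (fst p) (snd p))" unfolding vals_def by (intro PT_intros)
lemma PT_usets: "PT (\<lambda>p. usets (fst p) (snd p))" unfolding usets_def by (intro PT_intros)
lemma PT_needs: "PT (\<lambda>p. needs (fst p) (snd p))" unfolding needs_def by (intro PT_intros)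

lemma PT_summ_list: "PT (\<lambda>p. summ_list (fst p) (snd p))"
  unfolding summ_list_def
  by (intro PT_intros PT_app2[OF PT_vals] PT_app2[OF PT_usets] PT_app3[OF PT_derive_summ])

lemma PT_entry_list: "PT (\<lambda>p. entry_list (fst p) (snd p))"
proof -
  have "PT (\<lambda>p. derive_entry (fst (fst (fst p))) (snd (fst (fst p)))
      (summ_list (fst (fst (fst p))) (snd (fst (fst p)))) (snd (fst p)) (snd p))"
    using PT_comp[OF PT_derive_entry, of "\<lambda>p. (fst (fst p), summ_list (fst (fst (fst p))) (snd (fst (fst p))), snd (fst p), snd p)"]
    by (simp add: PT_intros PT_app2[OF PT_summ_list])
  then show ?thesis
    unfolding entry_list_def
    by (intro PT_intros PT_app2[OF PT_vals] PT_app2[OF PT_usets] PT_app2[OF PT_needs])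
qed

lemma PT_decide: "PT (\<lambda>p. decide (fst p) (snd p))"
proof -
  have c: "PT covered" unfolding covered_def by (intro PT_intros)
  show ?thesis
    unfolding decide_def
    by (intro PT_intros PT_app2[OF PT_entry_list] PT_app2[OF PT_summ_list] PT_comp[OF c] PT_app2[OF PT_dec])
qed

section \<open>Correctness of the decision procedure\<close>

lemma lfp_list_eqI:
  assumes mono: "\<And>S T u. set S \<subseteq> set T \<Longrightarrow> P S u \<Longrightarrow> P T u"
    and sound: "\<And>S u. set S \<subseteq> Z \<Longrightarrow> u \<in> set U \<Longrightarrow> P S u \<Longrightarrow> u \<in> Z"
    and complete: "\<And>S. (\<And>u. u \<in> set U \<Longrightarrow> P S u \<Longrightarrow> u \<in> set S) \<Longrightarrow> Z \<subseteq> set S"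
  shows "set (lfp_list U P) = Z"
proof
  show "set (lfp_list U P) \<subseteq> Z" by (rule lfp_list_least[of P Z U, OF mono sound])
  show "Z \<subseteq> set (lfp_list U P)" by (rule complete, rule lfp_list_closed[of P, OF mono])
qed

lemma bex_imp: "A \<subseteq> B \<Longrightarrow> (\<And>x. P x \<longrightarrow> Q x) \<Longrightarrow> (\<exists>x\<in>A. P x) \<longrightarrow> (\<exists>x\<in>B. Q x)"
  by blast

lemma case_prod_imp: "(\<And>x y. P x y \<longrightarrow> Q x y) \<Longrightarrow> (case p of (x, y) \<Rightarrow> P x y) \<longrightarrow> (case p of (x, y) \<Rightarrow> Q x y)"
  by (cases p) simp

lemma bex4E:
  assumes "\<exists>x\<in>A. case x of (a, b, c, d) \<Rightarrow> P a b c d"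
  obtains a b c d where "(a, b, c, d) \<in> A" "P a b c d"
  using assms by auto

lemma bex5E:
  assumes "\<exists>x\<in>A. case x of (a, b, c, d, e) \<Rightarrow> P a b c d e"
  obtains a b c d e where "(a, b, c, d, e) \<in> A" "P a b c d e"
  using assms by auto

text \<open>At most \<open>m\<close> keys with at most \<open>2 ^ m\<close> values each admit at
  most \<open>(2 ^ m) ^ m = 2 ^ (m * m)\<close> functions. This is the fuel that lets
  \<open>tprod\<close> list all valuations, queue sets and needs.\<close>

locale instance_view =
  fixes t :: tree and A :: nat_qdas and f :: "nat \<Rightarrow> nat" and n :: "unit list" and m :: nat
  assumes qdas: "is_qdas A" and sync: "synchronous A" and view: "view t A f"
    and lens: "length (iX t) \<le> m" "length (iSQ t) \<le> m" "length (iF t) \<le> m"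
    and large: "length (iD t) \<le> 2 ^ m" "2 \<le> (2 :: nat) ^ m" "\<And>s. s \<in> all_states A \<Longrightarrow> f s + 1 \<le> 2 ^ m"
    and fuel: "length n = 2 ^ (m * m)"
begin

lemma sets: "iIV t = init_value A" "iMB t = main_block A" "set (iD t) = data_values A"
   "set (iX t) = variables A" "set (iCQ t) = cqid A" "set (iSQ t) = sqid A" "set (iB t) = blocks A"
   "(b, s) \<in> set (iBS t) \<longleftrightarrow> b \<in> blocks A \<and> s \<in> block_states A b"
   "(b, s) \<in> set (iIS t) \<longleftrightarrow> b \<in> blocks A \<and> s = init_state A b"
   "(b, s) \<in> set (iFS t) \<longleftrightarrow> b \<in> blocks A \<and> s = final_state A b"
   "(b, s, a, s') \<in> set (rules t) \<longleftrightarrow> b \<in> blocks A \<and> (\<exists>c. a = action_tree c \<and> (s, c, s') \<in> block_trans A b)"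
   "(s, k) \<in> set (iF t) \<longleftrightarrow> s \<in> all_states A \<and> k = f s"
  using view unfolding view_def by auto

lemma fuel_power: "k \<le> m \<Longrightarrow> (2 ^ m) ^ k \<le> length n"
  using fuel by (simp add: power_mult[symmetric] power_increasing)

text \<open>The second condition pins a valuation down outside the variables of the system, which
  makes its representation by the list \<open>gX\<close> injective.\<close>

definition valid :: "(nat \<Rightarrow> nat) \<Rightarrow> bool" where
  "valid \<rho> \<longleftrightarrow> (\<forall>x\<in>variables A. \<rho> x \<in> data_values A) \<and> (\<forall>x. x \<notin> variables A \<longrightarrow> \<rho> x = init_value A)"

definition gX :: "(nat \<Rightarrow> nat) \<Rightarrow> vlist" where "gX = graph (iX t)"
definition gU :: "nat set \<Rightarrow> ulist" where "gU U = graph (iSQ t) (\<lambda>q. q \<in> U)"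
definition gC :: "(nat \<Rightarrow> nat) \<Rightarrow> clist" where "gC g = graph (map fst (iF t)) (\<lambda>s. units (g s))"

lemma set_vals: "set (vals t n) = {gX \<rho> | \<rho>. valid \<rho>}"
proof -
  have "vals t n = product_lists (map (\<lambda>x. map (Pair x) (iD t)) (iX t))"
    unfolding vals_def using large(1) lens(1) fuel_power[OF lens(1)] by (intro tprod_eq[of _ "2 ^ m"]) auto
  also have "set \<dots> = {graph (iX t) g | g. \<forall>x\<in>set (iX t). g x \<in> set (iD t)}"
    by (rule set_product_graphs) (simp add: nums_def rdups)
  also have "\<dots> = {gX \<rho> | \<rho>. valid \<rho>}"
  proof (intro set_eqI iffI)
    fix l assume "l \<in> {graph (iX t) g | g. \<forall>x\<in>set (iX t). g x \<in> set (iD t)}"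
    then obtain g where g: "l = graph (iX t) g" "\<forall>x\<in>set (iX t). g x \<in> set (iD t)" by blast
    let ?\<rho> = "\<lambda>x. if x \<in> variables A then g x else init_value A"
    have "l = gX ?\<rho>" "valid ?\<rho>" using g by (auto simp: gX_def graph_eq_iff sets valid_def)
    then show "l \<in> {gX \<rho> | \<rho>. valid \<rho>}" by blast
  qed (auto simp: gX_def valid_def sets)
  finally show ?thesis .
qed

lemma set_usets: "set (usets t n) = {gU U | U. U \<subseteq> sqid A}"
proof -
  have "usets t n = product_lists (map (\<lambda>q. map (Pair q) [False, True]) (iSQ t))"
    unfolding usets_def using large(2) lens(2) fuel_power[OF lens(2)] by (intro tprod_eq[of _ "2 ^ m"]) auto
  also have "set \<dots> = {graph (iSQ t) g | g. \<forall>q\<in>set (iSQ t). g q \<in> set [False, True]}"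
    by (rule set_product_graphs) (simp add: nums_def rdups)
  also have "\<dots> = {gU U | U. U \<subseteq> sqid A}"
  proof (intro set_eqI iffI)
    fix l assume "l \<in> {graph (iSQ t) g | g. \<forall>q\<in>set (iSQ t). g q \<in> set [False, True]}"
    then obtain g where g: "l = graph (iSQ t) g" by blast
    then have "l = gU {q \<in> sqid A. g q}" by (auto simp: gU_def graph_eq_iff sets)
    then show "l \<in> {gU U | U. U \<subseteq> sqid A}" by blast
  qed (auto simp: gU_def)
  finally show ?thesis .
qed

lemma keys_F: "distinct (map fst (iF t))" "set (map fst (iF t)) = all_states A"
proof -
  have "inj_on fst (set (iF t))" by (auto simp: inj_on_def sets)
  then show "distinct (map fst (iF t))" by (simp add: distinct_map pairs_def rdups)
  show "set (map fst (iF t)) = all_states A"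
  proof (intro set_eqI iffI)
    fix s assume "s \<in> all_states A"
    then have "(s, f s) \<in> set (iF t)" by (simp add: sets)
    then show "s \<in> set (map fst (iF t))" unfolding set_map by (rule image_eqI[rotated]) simp
  qed (auto simp: sets)
qed

lemma le_fuel: "s \<in> all_states A \<Longrightarrow> f s \<le> length n"
proof -
  assume s: "s \<in> all_states A"
  then have "(s, f s) \<in> set (iF t)" by (simp add: sets)
  then have "length (iF t) > 0" by (rule length_pos_if_in_set)
  then have "m \<noteq> 0" using lens(3) by linarith
  then have "(2 :: nat) ^ m \<le> 2 ^ (m * m)" by (intro power_increasing) auto
  then show ?thesis using large(3)[OF s] fuel by linarith
qed

lemma set_needs: "set (needs t n) = {gC g | g. \<forall>s\<in>all_states A. g s \<le> f s}"
proof -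
  let ?R = "\<lambda>s. map units [0..<Suc (f s)]"
  have "map (\<lambda>k. (fst p, unary_of n k)) [0..<length (() # unary_of n (snd p))] = map (Pair (fst p)) (?R (fst p))"
    if "p \<in> set (iF t)" for p
  proof -
    have q: "fst p \<in> all_states A" "snd p = f (fst p)" using that sets(12)[of "fst p" "snd p"] by simp_all
    then show ?thesis using le_fuel[OF q(1)] by (auto simp: unary_of)
  qed
  then have eq: "map (\<lambda>p. map (\<lambda>k. (fst p, unary_of n k)) [0..<length (() # unary_of n (snd p))]) (iF t) =
      map (\<lambda>s. map (Pair s) (?R s)) (map fst (iF t))" by (simp del: upt_Suc)
  have le: "Suc (f s) \<le> 2 ^ m" if "(s, k) \<in> set (iF t)" for s k using large(3)[of s] that[unfolded sets] by simp
  have "needs t n = product_lists (map (\<lambda>s. map (Pair s) (?R s)) (map fst (iF t)))"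
    unfolding needs_def eq
    using large(2) le lens(3) fuel_power[OF lens(3)]
    by (intro tprod_eq[of _ "2 ^ m"]) (auto simp del: upt_Suc)
  also have "set \<dots> = {graph (map fst (iF t)) g | g. \<forall>s\<in>set (map fst (iF t)). g s \<in> set (?R s)}"
    by (rule set_product_graphs[OF keys_F(1)])
  also have "\<dots> = {gC g | g. \<forall>s\<in>all_states A. g s \<le> f s}"
  proof (intro set_eqI iffI)
    fix l assume "l \<in> {graph (map fst (iF t)) g | g. \<forall>s\<in>set (map fst (iF t)). g s \<in> set (?R s)}"
    then obtain g where g: "l = graph (map fst (iF t)) g" "\<forall>s\<in>all_states A. g s \<in> set (?R s)"
      unfolding keys_F(2) by blast
    have u: "g s = units (length (g s)) \<and> length (g s) \<le> f s" if "s \<in> all_states A" for s using g(2) that by auto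
    have "l = gC (\<lambda>s. length (g s))" unfolding gC_def g(1) graph_eq_iff keys_F(2) using u by blast
    moreover have "\<forall>s\<in>all_states A. length (g s) \<le> f s" using u by blast
    ultimately have "l = gC (\<lambda>s. length (g s))" "\<forall>s\<in>all_states A. length (g s) \<le> f s" .
    then show "l \<in> {gC g | g. \<forall>s\<in>all_states A. g s \<le> f s}" by blast
  next
    fix l assume "l \<in> {gC g | g. \<forall>s\<in>all_states A. g s \<le> f s}"
    then obtain g where g: "l = gC g" "\<forall>s\<in>all_states A. g s \<le> f s" by blast
    have "units (g s) \<in> set (?R s)" if "s \<in> all_states A" for s
      unfolding set_map set_upt using g(2)[rule_format, OF that] by (intro imageI) simp
    then show "l \<in> {graph (map fst (iF t)) g | g. \<forall>s\<in>set (map fst (iF t)). g s \<in> set (?R s)}"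
      unfolding keys_F(2) g(1) gC_def by blast
  qed
  finally show ?thesis .
qed

lemma gX_inj: "valid \<rho> \<Longrightarrow> valid \<sigma> \<Longrightarrow> gX \<rho> = gX \<sigma> \<longleftrightarrow> \<rho> = \<sigma>"
  unfolding gX_def graph_eq_iff by (auto simp: valid_def sets fun_eq_iff)

lemma gU_inj: "U \<subseteq> sqid A \<Longrightarrow> V \<subseteq> sqid A \<Longrightarrow> gU U = gU V \<longleftrightarrow> U = V"
  unfolding gU_def graph_eq_iff sets by blast

lemma upd_gX: "upd (gX \<rho>) x v = gX (\<rho>(x := v))"
  by (simp add: gX_def upd_graph)

lemma upd_gU: "upd (gU U) q True = gU (addq A U q)"
  by (auto simp: gU_def upd_graph graph_eq_iff sets addq_def)

lemma addq_sub: "U \<subseteq> sqid A \<Longrightarrow> addq A U q \<subseteq> sqid A"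
  by (auto simp: addq_def)

lemma queue_ok_iff: "queue_ok t (gU U) q \<longleftrightarrow> okq A U q"
  by (auto simp: queue_ok_def okq_def gU_def set_graph sets)

lemma dec_gC: "dec (gC g) s = gC (g(s := g s - 1))"
  by (simp add: gC_def dec_def graph_def)

lemma covered_gC: "covered (gC g) \<longleftrightarrow> (\<forall>s\<in>all_states A. g s = 0)"
  unfolding covered_def gC_def set_graph keys_F(2) by auto

lemma trans_ok:
  assumes "b \<in> blocks A" "(s, c, s') \<in> block_trans A b"
  shows "s \<in> block_states A b" "s' \<in> block_states A b" "c \<in> actions A"
  using assms qdas unfolding is_qdas_def by blast+

lemma guard_ok_iff:
  assumes "b \<in> blocks A" "(s, Guard g, s') \<in> block_trans A b" "valid \<rho>"
  shows "guard_ok t (action_tree (Guard g)) (gX \<rho>) \<longleftrightarrow> (\<forall>a\<in>set g. holds \<rho> a)"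
proof -
  have "(\<exists>p\<in>set (gX \<rho>). atom_tree a = Node [Num 0, Num (fst p), Num (snd p)] \<or>
        (\<exists>v\<in>set (iD t). v \<noteq> snd p \<and> atom_tree a = Node [Num 1, Num (fst p), Num v])) \<longleftrightarrow> holds \<rho> a"
    if "a \<in> set g" for a
  proof -
    have "a \<in> atoms A" using trans_ok(3)[OF assms(1,2)] that by (auto simp: actions_def)
    then show ?thesis by (cases a) (auto simp: gX_def set_graph sets atoms_def)
  qed
  then show ?thesis by (simp add: guard_ok_def)
qed

lemma guard_ok_Guard: "guard_ok t (action_tree c) \<sigma> \<Longrightarrow> \<exists>g. c = Guard g"
  by (cases c) (auto simp: guard_ok_def)

lemma valid_init: "valid (\<lambda>_. init_value A)"
  using qdas by (auto simp: valid_def is_qdas_def)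

lemma summ_valid: "summ A U b \<rho>0 s \<rho> \<Longrightarrow> b \<in> blocks A \<Longrightarrow> valid \<rho>0 \<Longrightarrow> valid \<rho> \<and> s \<in> block_states A b"
proof (induction rule: summ.induct)
  case (summ_init U b \<rho>)
  then show ?case using qdas by (auto simp: is_qdas_def)
next
  case (summ_guard U b \<rho>0 s \<rho> g s')
  then show ?case using trans_ok(2) by blast
next
  case (summ_assign U b \<rho>0 s \<rho> x d s')
  then have "x \<in> variables A" "d \<in> data_values A" using trans_ok(3) by (fastforce simp: actions_def)+
  then show ?case using summ_assign trans_ok(2) by (auto simp: valid_def)
next
  case (summ_call U b \<rho>0 s \<rho> q b' s' \<rho>')
  have "b' \<in> blocks A" using trans_ok(3)[OF summ_call.prems(1) summ_call.hyps(2)] by (auto simp: actions_def)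
  then show ?case using summ_call trans_ok(2) by blast
qed

definition summs :: "sfact set" where
  "summs = {(gU U, b, gX \<rho>0, s, gX \<rho>) | U b \<rho>0 s \<rho>. U \<subseteq> sqid A \<and> b \<in> blocks A \<and> valid \<rho>0 \<and> summ A U b \<rho>0 s \<rho>}"

lemma summs_cases:
  assumes "u \<in> summs"
  obtains U b \<rho>0 s \<rho> where "u = (gU U, b, gX \<rho>0, s, gX \<rho>)" "U \<subseteq> sqid A" "b \<in> blocks A" "valid \<rho>0" "valid \<rho>"
    "summ A U b \<rho>0 s \<rho>"
  using assms summ_valid unfolding summs_def by blast

lemma derive_summ_mono:
  assumes "set S \<subseteq> set T" "derive_summ t S u"
  shows "derive_summ t T u"
proof -
  have "derive_summ t S u \<longrightarrow> derive_summ t T u" unfolding derive_summ_def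
    by (intro case_prod_imp bex_imp conj_mono disj_mono imp_refl subset_refl assms(1))
  then show ?thesis using assms(2) by blast
qed

lemma derive_summ_sound:
  assumes S: "set S \<subseteq> summs" and u: "u = (gU U, b, gX \<rho>0, s, gX \<rho>)" "U \<subseteq> sqid A" "b \<in> blocks A" "valid \<rho>0" "valid \<rho>"
    and der: "derive_summ t S u"
  shows "summ A U b \<rho>0 s \<rho>"
proof -
  from der[unfolded derive_summ_def u(1) prod.case]
  show ?thesis
  proof (elim disjE bexE)
    assume "(b, s) \<in> set (iIS t) \<and> gX \<rho> = gX \<rho>0"
    then show ?thesis using gX_inj[OF u(5,4)] summ_init by (auto simp: sets)
  next
    fix u1 assume "u1 \<in> set S" and d: "case u1 of (U1, b1, \<rho>1, s1, \<sigma>) \<Rightarrow> U1 = gU U \<and> b1 = b \<and> \<rho>1 = gX \<rho>0 \<and>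
        (\<exists>r\<in>set (rules t). case r of (b2, s2, a, s') \<Rightarrow> b2 = b \<and> s2 = s1 \<and> s' = s \<and>
           (guard_ok t a \<sigma> \<and> gX \<rho> = \<sigma> \<or>
            (\<exists>x\<in>set (iX t). \<exists>v\<in>set (iD t). a = Node [Num 3, Num x, Num v] \<and> gX \<rho> = upd \<sigma> x v) \<or>
            (\<exists>q\<in>set (iCQ t @ iSQ t). \<exists>b'\<in>set (iB t). a = Node [Num 1, Num q, Num b'] \<and> queue_ok t (gU U) q \<and>
               (\<exists>u3\<in>set S. case u3 of (U3, b3, \<rho>3, s3, \<sigma>3) \<Rightarrow>
                  U3 = upd (gU U) q True \<and> b3 = b' \<and> \<rho>3 = \<sigma> \<and> (b', s3) \<in> set (iFS t) \<and> \<sigma>3 = gX \<rho>))))"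
    then have "u1 \<in> summs" using S by blast
    then obtain U1 b1 \<rho>1 s1 \<sigma> where u1: "u1 = (gU U1, b1, gX \<rho>1, s1, gX \<sigma>)" "U1 \<subseteq> sqid A" "valid \<rho>1" "valid \<sigma>"
      "summ A U1 b1 \<rho>1 s1 \<sigma>" by (rule summs_cases)
    from d[unfolded u1(1) prod.case] have "gU U1 = gU U" "b1 = b" "gX \<rho>1 = gX \<rho>0" by blast+
    then have s1: "summ A U b \<rho>0 s1 \<sigma>" using u1 u gU_inj gX_inj by metis
    from d[unfolded u1(1) prod.case] obtain a where a: "(b, s1, a, s) \<in> set (rules t)" and
      d: "guard_ok t a (gX \<sigma>) \<and> gX \<rho> = gX \<sigma> \<or>
            (\<exists>x\<in>set (iX t). \<exists>v\<in>set (iD t). a = Node [Num 3, Num x, Num v] \<and> gX \<rho> = upd (gX \<sigma>) x v) \<or>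
            (\<exists>q\<in>set (iCQ t @ iSQ t). \<exists>b'\<in>set (iB t). a = Node [Num 1, Num q, Num b'] \<and> queue_ok t (gU U) q \<and>
               (\<exists>u3\<in>set S. case u3 of (U3, b3, \<rho>3, s3, \<sigma>3) \<Rightarrow>
                  U3 = upd (gU U) q True \<and> b3 = b' \<and> \<rho>3 = gX \<sigma> \<and> (b', s3) \<in> set (iFS t) \<and> \<sigma>3 = gX \<rho>))"
      by - ((erule conjE)+, erule bex4E, (erule conjE)+, blast)
    obtain c where c: "a = action_tree c" "(s1, c, s) \<in> block_trans A b" using a by (auto simp: sets)
    from d show ?thesis
    proof (elim disjE bexE conjE)
      assume g: "guard_ok t a (gX \<sigma>)" "gX \<rho> = gX \<sigma>"
      then obtain g where "c = Guard g" using guard_ok_Guard c(1) by blast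
      then show ?thesis using g c guard_ok_iff[OF u(3) _ u1(4)] summ_guard[OF s1] gX_inj[OF u(5) u1(4)] by blast
    next
      fix x v assume x: "x \<in> set (iX t)" "v \<in> set (iD t)" "a = Node [Num 3, Num x, Num v]" "gX \<rho> = upd (gX \<sigma>) x v"
      then have "c = Assign x v" using c(1) action_tree_inj[of c "Assign x v"] by simp
      moreover have "valid (\<sigma>(x := v))" using x u1(4) by (auto simp: valid_def sets)
      then have "\<rho> = \<sigma>(x := v)" using x(4) gX_inj[OF u(5)] by (simp add: upd_gX)
      ultimately show ?thesis using summ_assign[OF s1] c(2) by blast
    next
      fix q b' u3
      assume q: "a = Node [Num 1, Num q, Num b']" "b' \<in> set (iB t)" "queue_ok t (gU U) q" "u3 \<in> set S" and
        d3: "case u3 of (U3, b3, \<rho>3, s3, \<sigma>3) \<Rightarrow>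
                  U3 = upd (gU U) q True \<and> b3 = b' \<and> \<rho>3 = gX \<sigma> \<and> (b', s3) \<in> set (iFS t) \<and> \<sigma>3 = gX \<rho>"
      have c3: "c = DispatchS q b'" using c(1) q(1) action_tree_inj[of c "DispatchS q b'"] by simp
      have "u3 \<in> summs" using S q(4) by blast
      then obtain U3 b3 \<rho>3 s3 \<sigma>3 where u3: "u3 = (gU U3, b3, gX \<rho>3, s3, gX \<sigma>3)" "U3 \<subseteq> sqid A" "valid \<rho>3" "valid \<sigma>3"
        "summ A U3 b3 \<rho>3 s3 \<sigma>3" by (rule summs_cases)
      from d3[unfolded u3(1) prod.case upd_gU] have "U3 = addq A U q" "b3 = b'" "\<rho>3 = \<sigma>" "s3 = final_state A b'" "\<sigma>3 = \<rho>"
        using gU_inj[OF u3(2) addq_sub[OF u(2)]] gX_inj[OF u3(3) u1(4)] gX_inj[OF u3(4) u(5)] by (auto simp: sets)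
      then show ?thesis using summ_call[OF s1 c(2)[unfolded c3]] q(3) u3(5) by (simp add: queue_ok_iff)
    qed
  qed
qed

lemma rules_dispatch:
  "(b, s, Node [Num 1, Num q, Num b'], s') \<in> set (rules t) \<longleftrightarrow> b \<in> blocks A \<and> (s, DispatchS q b', s') \<in> block_trans A b"
  unfolding sets(11) action_tree.simps(2)[symmetric] action_tree_inj by blast

lemma summ_step_complete:
  assumes closed: "\<And>u. fst (snd u) \<in> blocks A \<Longrightarrow> fst u \<in> set (usets t n) \<Longrightarrow> fst (snd (snd u)) \<in> set (vals t n) \<Longrightarrow>
      fst (snd (snd (snd u))) \<in> set (map snd (iBS t)) \<Longrightarrow> snd (snd (snd (snd u))) \<in> set (vals t n) \<Longrightarrow>
      derive_summ t S u \<Longrightarrow> u \<in> set S"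
    and "summ A U b \<rho>0 s \<rho>" "U \<subseteq> sqid A" "b \<in> blocks A" "valid \<rho>0"
  shows "(gU U, b, gX \<rho>0, s, gX \<rho>) \<in> set S"
proof -
  have cl: "(gU U, b, gX \<rho>0, s, gX \<rho>) \<in> set S"
    if "U \<subseteq> sqid A" "b \<in> blocks A" "valid \<rho>0" "summ A U b \<rho>0 s \<rho>" "derive_summ t S (gU U, b, gX \<rho>0, s, gX \<rho>)" for U b \<rho>0 s \<rho>
  proof -
    have "valid \<rho>" "(b, s) \<in> set (iBS t)" using summ_valid[OF that(4,2,3)] that(2) by (auto simp: sets)
    then have "s \<in> set (map snd (iBS t))" "gU U \<in> set (usets t n)" "gX \<rho>0 \<in> set (vals t n)" "gX \<rho> \<in> set (vals t n)"
      unfolding set_usets set_vals set_map using that by (auto intro: image_eqI[of _ _ "(b, s)"])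
    then show ?thesis using closed[of "(gU U, b, gX \<rho>0, s, gX \<rho>)", unfolded fst_conv snd_conv] that(2,5) by blast
  qed
  show ?thesis
    using assms(2-)
  proof (induction rule: summ.induct)
    case (summ_init U b \<rho>)
    then show ?case by (intro cl summ.summ_init) (auto simp: derive_summ_def sets)
  next
    case (summ_guard U b \<rho>0 s \<rho> g s')
    have v: "valid \<rho>" using summ_valid summ_guard by blast
    have 1: "(gU U, b, gX \<rho>0, s, gX \<rho>) \<in> set S" using summ_guard by blast
    have 2: "(b, s, action_tree (Guard g), s') \<in> set (rules t)" using summ_guard sets(11) by blast
    have 3: "guard_ok t (action_tree (Guard g)) (gX \<rho>)" using guard_ok_iff[OF _ _ v] summ_guard by blast
    have "derive_summ t S (gU U, b, gX \<rho>0, s', gX \<rho>)"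
      unfolding derive_summ_def prod.case
      by (intro disjI2 bexI[OF _ 1], unfold prod.case, intro conjI refl bexI[OF _ 2], unfold prod.case,
          intro conjI refl disjI1 3)
    then show ?case using summ_guard by (intro cl summ.summ_guard[OF summ_guard.hyps])
  next
    case (summ_assign U b \<rho>0 s \<rho> x d s')
    have 1: "(gU U, b, gX \<rho>0, s, gX \<rho>) \<in> set S" using summ_assign by blast
    have 2: "(b, s, Node [Num 3, Num x, Num d], s') \<in> set (rules t)"
      using summ_assign sets(11) unfolding action_tree.simps(4)[symmetric] by blast
    have 3: "x \<in> set (iX t)" "d \<in> set (iD t)"
      using trans_ok(3)[OF summ_assign.prems(2) summ_assign.hyps(2)] by (auto simp: actions_def sets)
    have "derive_summ t S (gU U, b, gX \<rho>0, s', gX (\<rho>(x := d)))"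
      unfolding derive_summ_def prod.case
      by (intro disjI2 bexI[OF _ 1], unfold prod.case, intro conjI refl bexI[OF _ 2], unfold prod.case,
          intro conjI refl, rule disjI2, rule disjI1, intro bexI[OF _ 3(1)] bexI[OF _ 3(2)] conjI refl upd_gX[symmetric])
    then show ?case using summ_assign by (intro cl summ.summ_assign[OF summ_assign.hyps])
  next
    case (summ_call U b \<rho>0 s \<rho> q b' s' \<rho>')
    have qb: "q \<in> set (iCQ t @ iSQ t)" "b' \<in> blocks A"
      using trans_ok(3)[OF summ_call.prems(2) summ_call.hyps(2)] by (auto simp: actions_def sets)
    have v: "valid \<rho>" using summ_valid summ_call by blast
    have 1: "(gU U, b, gX \<rho>0, s, gX \<rho>) \<in> set S" using summ_call by blast
    have 2: "(gU (addq A U q), b', gX \<rho>, final_state A b', gX \<rho>') \<in> set S"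
      using summ_call.IH(2)[OF addq_sub[OF summ_call.prems(1)] qb(2) v] .
    have 3: "(b, s, Node [Num 1, Num q, Num b'], s') \<in> set (rules t)"
      using rules_dispatch summ_call by blast
    have ex: "\<exists>u3\<in>set S. case u3 of (U3, b3, \<rho>3, s3, \<sigma>3) \<Rightarrow>
          U3 = upd (gU U) q True \<and> b3 = b' \<and> \<rho>3 = gX \<rho> \<and> (b', s3) \<in> set (iFS t) \<and> \<sigma>3 = gX \<rho>'"
      using 2 qb(2) by (intro bexI[OF _ 2]) (simp add: upd_gU sets)
    have "derive_summ t S (gU U, b, gX \<rho>0, s', gX \<rho>')"
      unfolding derive_summ_def prod.case
    proof (intro disjI2 bexI[OF _ 1], unfold prod.case, intro conjI refl bexI[OF _ 3], unfold prod.case, intro conjI refl disjI2)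
      show "\<exists>q'\<in>set (iCQ t @ iSQ t). \<exists>b''\<in>set (iB t). Node [Num 1, Num q, Num b'] = Node [Num 1, Num q', Num b''] \<and>
         queue_ok t (gU U) q' \<and> (\<exists>u3\<in>set S. case u3 of (U3, b3, \<rho>3, s3, \<sigma>3) \<Rightarrow>
          U3 = upd (gU U) q' True \<and> b3 = b'' \<and> \<rho>3 = gX \<rho> \<and> (b'', s3) \<in> set (iFS t) \<and> \<sigma>3 = gX \<rho>')"
        using qb ex summ_call.hyps(3) by (intro bexI[of _ q] bexI[of _ b'] conjI refl) (auto simp: queue_ok_iff sets)
    qed
    then show ?case using summ_call by (intro cl summ.summ_call[OF summ_call.hyps])
  qed
qed

lemma set_summ_list: "set (summ_list t n) = summs"
  unfolding summ_list_def
proof (rule lfp_list_eqI)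
  show "set S \<subseteq> set T \<Longrightarrow> derive_summ t S u \<Longrightarrow> derive_summ t T u" for S T u by (rule derive_summ_mono)
  fix S
  let ?U = "List.product (usets t n) (List.product (iB t) (List.product (vals t n) (List.product (map snd (iBS t)) (vals t n))))"
  show "u \<in> summs" if S: "set S \<subseteq> summs" and u: "u \<in> set ?U" "derive_summ t S u" for u
  proof -
    obtain Ul b vl s wl where u': "u = (Ul, b, vl, s, wl)" by (metis prod.collapse)
    have "Ul \<in> set (usets t n)" "b \<in> set (iB t)" "vl \<in> set (vals t n)" "wl \<in> set (vals t n)"
      using u(1) by (auto simp: u')
    then obtain U \<rho>0 \<rho> where u'': "u = (gU U, b, gX \<rho>0, s, gX \<rho>)" "U \<subseteq> sqid A" "b \<in> blocks A" "valid \<rho>0" "valid \<rho>"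
      unfolding u' set_usets set_vals sets by blast
    from derive_summ_sound[OF S this u(2)] show ?thesis using u'' unfolding summs_def by blast
  qed
  show "summs \<subseteq> set S" if "\<And>u. u \<in> set ?U \<Longrightarrow> derive_summ t S u \<Longrightarrow> u \<in> set S"
  proof
    fix u assume "u \<in> summs"
    then obtain U b \<rho>0 s \<rho> where u: "u = (gU U, b, gX \<rho>0, s, gX \<rho>)" "U \<subseteq> sqid A" "b \<in> blocks A" "valid \<rho>0"
      "summ A U b \<rho>0 s \<rho>" unfolding summs_def by blast
    show "u \<in> set S" unfolding u(1)
      by (rule summ_step_complete[OF _ u(5,2-4)], rule that) (auto simp: sets mem_Times_iff)
  qed
qed

definition entries :: "efact set" where
  "entries = {(b, gX \<rho>0, gU U, gC (\<lambda>s. f s - cnt fr s)) | b p \<rho>0 U fr. entry A b p \<rho>0 U fr}"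

lemma entry_valid: "entry A b p \<rho>0 U fr \<Longrightarrow> valid \<rho>0 \<and> U \<subseteq> sqid A \<and> b \<in> blocks A"
proof (induction rule: entry.induct)
  case entry_main
  then show ?case using valid_init qdas by (simp add: is_qdas_def)
next
  case (entry_call b p \<rho>0 U fr s \<rho> q b' s')
  then show ?case using summ_valid[OF entry_call.hyps(2)] addq_sub trans_ok(3)[of b s "DispatchS q b'" s']
    by (auto simp: actions_def)
qed

lemma entries_cases:
  assumes "u \<in> entries"
  obtains b p \<rho>0 U fr where "u = (b, gX \<rho>0, gU U, gC (\<lambda>s. f s - cnt fr s))" "entry A b p \<rho>0 U fr"
    "valid \<rho>0" "U \<subseteq> sqid A" "b \<in> blocks A"
  using assms entry_valid unfolding entries_def by blast

text \<open>Truncated subtractions compose: \<open>(x - k) - 1 = x - (k + 1)\<close>. The need above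
  a longer stack can therefore be computed from the previous need, without knowing the
  stack.\<close>

lemma dec_need: "dec (gC (\<lambda>s. f s - cnt fr s)) s' = gC (\<lambda>s. f s - cnt ((b, s', p) # fr) s)"
  unfolding dec_gC by (rule arg_cong[of _ _ gC]) (auto simp: fun_eq_iff)

lemma initial_lists:
  "map (\<lambda>x. (x, iIV t)) (iX t) = gX (\<lambda>_. init_value A)" "map (\<lambda>q. (q, False)) (iSQ t) = gU {}"
  "map (\<lambda>p. (fst p, unary_of n (snd p))) (iF t) = gC (\<lambda>s. f s - cnt [] s)"
proof -
  have "unary_of n (snd p) = units (f (fst p))" if "p \<in> set (iF t)" for p
    using that sets(12)[of "fst p" "snd p"] unary_of[OF le_fuel] by simp
  then show "map (\<lambda>p. (fst p, unary_of n (snd p))) (iF t) = gC (\<lambda>s. f s - cnt [] s)"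
    by (simp add: gC_def graph_def)
  show "map (\<lambda>x. (x, iIV t)) (iX t) = gX (\<lambda>_. init_value A)" unfolding gX_def graph_def sets(1) by (rule refl)
  show "map (\<lambda>q. (q, False)) (iSQ t) = gU {}" by (simp add: gU_def graph_def)
qed

lemma derive_entry_mono:
  assumes "set E \<subseteq> set E'" "derive_entry t n S E u"
  shows "derive_entry t n S E' u"
proof -
  have "derive_entry t n S E u \<longrightarrow> derive_entry t n S E' u" unfolding derive_entry_def
    by (intro case_prod_imp bex_imp conj_mono disj_mono imp_refl subset_refl assms(1))
  then show ?thesis using assms(2) by blast
qed

lemma derive_entryI:
  assumes "entry A b p \<rho>0 U fr" "summ A U b \<rho>0 s \<rho>" "(s, DispatchS q b', s') \<in> block_trans A b" "okq A U q"
    and "(b, gX \<rho>0, gU U, gC (\<lambda>s. f s - cnt fr s)) \<in> set E"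
  shows "derive_entry t n (summ_list t n) E (b', gX \<rho>, gU (addq A U q), gC (\<lambda>s. f s - cnt ((b, s', p) # fr) s))"
proof -
  note ev = entry_valid[OF assms(1)]
  have 1: "(gU U, b, gX \<rho>0, s, gX \<rho>) \<in> set (summ_list t n)"
    unfolding set_summ_list summs_def using ev assms(2) by blast
  have 2: "(b, s, Node [Num 1, Num q, Num b'], s') \<in> set (rules t)"
    using assms(3) ev rules_dispatch by blast
  have 3: "q \<in> set (iCQ t @ iSQ t)"
    using trans_ok(3)[OF _ assms(3)] ev by (auto simp: actions_def sets)
  show ?thesis
    unfolding derive_entry_def prod.case
  proof (intro disjI2 bexI[OF _ assms(5)], unfold prod.case, intro bexI[OF _ 1], unfold prod.case,
      intro conjI refl bexI[OF _ 2], unfold prod.case, intro conjI refl bexI[OF _ 3])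
    show "queue_ok t (gU U) q" using assms(4) by (simp add: queue_ok_iff)
    show "gU (addq A U q) = upd (gU U) q True" by (simp add: upd_gU)
    show "gC (\<lambda>s. f s - cnt ((b, s', p) # fr) s) = dec (gC (\<lambda>s. f s - cnt fr s)) s'" by (rule dec_need[symmetric])
  qed
qed

lemma summ_listD:
  assumes "(gU U, b, gX \<rho>0, s, l) \<in> set (summ_list t n)" "U \<subseteq> sqid A" "valid \<rho>0"
  obtains \<rho> where "l = gX \<rho>" "valid \<rho>" "summ A U b \<rho>0 s \<rho>" "b \<in> blocks A"
proof -
  have "(gU U, b, gX \<rho>0, s, l) \<in> summs" using assms(1) set_summ_list by simp
  then obtain U1 b1 \<rho>1 s1 \<sigma> where *: "(gU U, b, gX \<rho>0, s, l) = (gU U1, b1, gX \<rho>1, s1, gX \<sigma>)" "U1 \<subseteq> sqid A"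
    "b1 \<in> blocks A" "valid \<rho>1" "valid \<sigma>" "summ A U1 b1 \<rho>1 s1 \<sigma>" by (rule summs_cases)
  have "U = U1" "\<rho>0 = \<rho>1" using * assms gU_inj gX_inj by auto
  then show ?thesis using that[of \<sigma>] * by simp
qed

lemma set_entry_list: "set (entry_list t n) = entries"
  unfolding entry_list_def
proof (rule lfp_list_eqI)
  show "set E \<subseteq> set E' \<Longrightarrow> derive_entry t n (summ_list t n) E u \<Longrightarrow> derive_entry t n (summ_list t n) E' u" for E E' u
    by (rule derive_entry_mono)
  fix E
  let ?U = "List.product (iB t) (List.product (vals t n) (List.product (usets t n) (needs t n)))"
  show "u \<in> entries" if E: "set E \<subseteq> entries" and "u \<in> set ?U" and der: "derive_entry t n (summ_list t n) E u" for u
  proof -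
    obtain b \<rho>l Ul cl where u: "u = (b, \<rho>l, Ul, cl)" by (metis prod.collapse)
    from der[unfolded derive_entry_def u prod.case] show ?thesis
    proof (elim disjE)
      assume "b = iMB t \<and> \<rho>l = map (\<lambda>x. (x, iIV t)) (iX t) \<and> Ul = map (\<lambda>q. (q, False)) (iSQ t) \<and>
        cl = map (\<lambda>p. (fst p, unary_of n (snd p))) (iF t)"
      then have "u = (main_block A, gX (\<lambda>_. init_value A), gU {}, gC (\<lambda>s. f s - cnt [] s))"
        using u sets(2) initial_lists by metis
      then show ?thesis unfolding entries_def using entry_main by blast
    next
      assume "\<exists>u0\<in>set E. case u0 of (b0, \<rho>0, U0, c0) \<Rightarrow>
        (\<exists>u1\<in>set (summ_list t n). case u1 of (U1, b1, \<rho>1, s1, \<sigma>) \<Rightarrow> U1 = U0 \<and> b1 = b0 \<and> \<rho>1 = \<rho>0 \<and> \<sigma> = \<rho>l \<and>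
           (\<exists>r\<in>set (rules t). case r of (b2, s2, a, s') \<Rightarrow> b2 = b0 \<and> s2 = s1 \<and>
              (\<exists>q\<in>set (iCQ t @ iSQ t). a = Node [Num 1, Num q, Num b] \<and> queue_ok t U0 q \<and>
                 Ul = upd U0 q True \<and> cl = dec c0 s')))"
      then obtain b0 v0 U0 c0 s1 q s' where d: "(b0, v0, U0, c0) \<in> set E" "(U0, b0, v0, s1, \<rho>l) \<in> set (summ_list t n)"
        "(b0, s1, Node [Num 1, Num q, Num b], s') \<in> set (rules t)" "queue_ok t U0 q" "Ul = upd U0 q True" "cl = dec c0 s'"
        by - (erule bex4E, erule bex5E, (erule conjE)+, erule bex4E, (erule conjE)+, erule bexE, (erule conjE)+, blast)
      from d(1) E have "(b0, v0, U0, c0) \<in> entries" by blast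
      then obtain p \<rho>0 U fr where e: "v0 = gX \<rho>0" "U0 = gU U" "c0 = gC (\<lambda>s. f s - cnt fr s)" "entry A b0 p \<rho>0 U fr"
        "valid \<rho>0" "U \<subseteq> sqid A" by (elim entries_cases) blast
      obtain \<rho> where r: "\<rho>l = gX \<rho>" "summ A U b0 \<rho>0 s1 \<rho>" using d(2) e(5,6) unfolding e(1,2) by (elim summ_listD)
      have "entry A b (Some q) \<rho> (addq A U q) ((b0, s', p) # fr)"
        using entry_call[OF e(4) r(2)] d(3) rules_dispatch d(4)[unfolded e(2) queue_ok_iff] by blast
      moreover have "u = (b, gX \<rho>, gU (addq A U q), gC (\<lambda>s. f s - cnt ((b0, s', p) # fr) s))"
        unfolding u d(5,6) e(2,3) r(1) upd_gU dec_need[of fr s' b0 p] by (rule refl)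
      ultimately show ?thesis unfolding entries_def by blast
    qed
  qed
  show "entries \<subseteq> set E" if cl: "\<And>u. u \<in> set ?U \<Longrightarrow> derive_entry t n (summ_list t n) E u \<Longrightarrow> u \<in> set E"
  proof -
    have univ: "(b, gX \<rho>0, gU U, gC (\<lambda>s. f s - cnt fr s)) \<in> set ?U" if "entry A b p \<rho>0 U fr" for b p \<rho>0 U fr
    proof -
      note v = entry_valid[OF that]
      have "gX \<rho>0 \<in> set (vals t n)" "gU U \<in> set (usets t n)" unfolding set_vals set_usets using v by blast+
      moreover have "gC (\<lambda>s. f s - cnt fr s) \<in> set (needs t n)"
        unfolding set_needs by (intro CollectI exI[of _ "\<lambda>s. f s - cnt fr s"]) simp
      ultimately show ?thesis using v by (simp add: sets(7))
    qed
    have "(b, gX \<rho>0, gU U, gC (\<lambda>s. f s - cnt fr s)) \<in> set E" if "entry A b p \<rho>0 U fr" for b p \<rho>0 U fr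
      using that
    proof (induction rule: entry.induct)
      case entry_main
      show ?case
        by (rule cl[OF univ[OF entry.entry_main]])
          (unfold derive_entry_def prod.case, intro disjI1 conjI sets(2)[symmetric] initial_lists[symmetric])
    next
      case (entry_call b p \<rho>0 U fr s \<rho> q b' s')
      show ?case
        by (rule cl[OF univ[OF entry.entry_call[OF entry_call.hyps]] derive_entryI[OF entry_call.hyps entry_call.IH]])
    qed
    then show ?thesis unfolding entries_def by blast
  qed
qed

lemma covered_need: "covered (gC (\<lambda>s. f s - cnt fr s)) \<longleftrightarrow> (\<forall>s\<in>all_states A. f s \<le> cnt fr s)"
  by (simp add: covered_gC)

theorem decide_iff: "decide t n \<longleftrightarrow> parikh_coverable A f"
proof
  assume "decide t n"
  then obtain b0 v0 U0 c0 s1 \<sigma> where d: "(b0, v0, U0, c0) \<in> entries" "(U0, b0, v0, s1, \<sigma>) \<in> set (summ_list t n)"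
    and acc: "covered (dec c0 s1) \<or> (\<exists>r\<in>set (rules t). case r of (b2, s2, a, s') \<Rightarrow> b2 = b0 \<and> s2 = s1 \<and>
            (\<exists>q\<in>set (iCQ t @ iSQ t). \<exists>p\<in>set (iIS t). a = Node [Num 1, Num q, Num (fst p)] \<and>
               covered (dec (dec c0 s') (snd p))))"
    unfolding decide_def set_entry_list by - (erule bex4E, erule bex5E, (erule conjE)+, blast)
  from d(1) obtain p \<rho>0 U fr where e: "v0 = gX \<rho>0" "U0 = gU U" "c0 = gC (\<lambda>s. f s - cnt fr s)" "entry A b0 p \<rho>0 U fr"
    "valid \<rho>0" "U \<subseteq> sqid A" by (elim entries_cases) blast
  obtain \<rho> where r: "summ A U b0 \<rho>0 s1 \<rho>" using d(2) e(5,6) unfolding e(1,2) by (elim summ_listD)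
  from acc show "parikh_coverable A f"
  proof
    assume "covered (dec c0 s1)"
    then have "\<forall>s\<in>all_states A. f s \<le> cnt ((b0, s1, p) # fr) s"
      unfolding e(3) dec_need[of fr s1 b0 p] covered_need .
    then show ?thesis unfolding parikh_coverable_iff[OF qdas sync] using e(4) r by blast
  next
    assume "\<exists>r\<in>set (rules t). case r of (b2, s2, a, s') \<Rightarrow> b2 = b0 \<and> s2 = s1 \<and>
            (\<exists>q\<in>set (iCQ t @ iSQ t). \<exists>p\<in>set (iIS t). a = Node [Num 1, Num q, Num (fst p)] \<and>
               covered (dec (dec c0 s') (snd p)))"
    then obtain q x s' where "(b0, s1, Node [Num 1, Num q, Num (fst x)], s') \<in> set (rules t)" "x \<in> set (iIS t)"
      "covered (dec (dec c0 s') (snd x))" by - (erule bex4E, (erule conjE)+, elim bexE conjE, blast)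
    moreover obtain b' i where "x = (b', i)" by (cases x)
    ultimately have q: "(b0, s1, Node [Num 1, Num q, Num b'], s') \<in> set (rules t)" "(b', i) \<in> set (iIS t)"
      "covered (dec (dec c0 s') i)" by simp_all
    have "\<forall>s\<in>all_states A. f s \<le> cnt ((b', i, Some q) # (b0, s', p) # fr) s"
      using q(3) unfolding e(3) dec_need[of fr s' b0 p] dec_need[of _ i b' "Some q"] covered_need .
    moreover have "i = init_state A b'" using q(2) by (simp add: sets)
    ultimately show ?thesis unfolding parikh_coverable_iff[OF qdas sync]
      using e(4) r q(1)[unfolded rules_dispatch] by blast
  qed
next
  assume "parikh_coverable A f"
  then obtain b p \<rho>0 U fr s \<rho> where e: "entry A b p \<rho>0 U fr" and r: "summ A U b \<rho>0 s \<rho>" and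
    acc: "(\<forall>u\<in>all_states A. f u \<le> cnt ((b, s, p) # fr) u) \<or>
     (\<exists>q b' s'. (s, DispatchS q b', s') \<in> block_trans A b \<and>
        (\<forall>u\<in>all_states A. f u \<le> cnt ((b', init_state A b', Some q) # (b, s', p) # fr) u))"
    unfolding parikh_coverable_iff[OF qdas sync] by blast
  note ev = entry_valid[OF e]
  have 0: "(b, gX \<rho>0, gU U, gC (\<lambda>s. f s - cnt fr s)) \<in> set (entry_list t n)"
    unfolding set_entry_list entries_def using e by blast
  have 1: "(gU U, b, gX \<rho>0, s, gX \<rho>) \<in> set (summ_list t n)"
    unfolding set_summ_list summs_def using ev r by blast
  show "decide t n"
    unfolding decide_def
  proof (intro bexI[OF _ 0], unfold prod.case, intro bexI[OF _ 1], unfold prod.case, intro conjI refl)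
    from acc show "covered (dec (gC (\<lambda>s. f s - cnt fr s)) s) \<or> (\<exists>r\<in>set (rules t). case r of (b2, s2, a, s') \<Rightarrow> b2 = b \<and> s2 = s \<and>
            (\<exists>q\<in>set (iCQ t @ iSQ t). \<exists>p\<in>set (iIS t). a = Node [Num 1, Num q, Num (fst p)] \<and>
               covered (dec (dec (gC (\<lambda>s. f s - cnt fr s)) s') (snd p))))"
    proof
      assume "\<forall>u\<in>all_states A. f u \<le> cnt ((b, s, p) # fr) u"
      then show ?thesis unfolding dec_need[of fr s b p] covered_need by blast
    next
      assume "\<exists>q b' s'. (s, DispatchS q b', s') \<in> block_trans A b \<and>
        (\<forall>u\<in>all_states A. f u \<le> cnt ((b', init_state A b', Some q) # (b, s', p) # fr) u)"
      then obtain q b' s' where q: "(s, DispatchS q b', s') \<in> block_trans A b"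
        "\<forall>u\<in>all_states A. f u \<le> cnt ((b', init_state A b', Some q) # (b, s', p) # fr) u" by blast
      have 2: "(b, s, Node [Num 1, Num q, Num b'], s') \<in> set (rules t)"
        using q(1) ev rules_dispatch by blast
      have 3: "q \<in> set (iCQ t @ iSQ t)" "(b', init_state A b') \<in> set (iIS t)"
        using trans_ok(3)[OF _ q(1)] ev by (auto simp: actions_def sets)
      have "covered (dec (dec (gC (\<lambda>s. f s - cnt fr s)) s') (init_state A b'))"
        unfolding dec_need[of fr s' b p] dec_need[of _ "init_state A b'" b' "Some q"] covered_need by (rule q(2))
      then show ?thesis
        by (intro disjI2 bexI[OF _ 2], unfold prod.case, intro conjI refl bexI[OF _ 3(1)] bexI[OF _ 3(2)]) simp_all
    qed
  qed
qed

end

section \<open>Size bounds for instance trees\<close>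

lemma tree_bits_kid:
  assumes "x \<in> set (kids t)"
  shows "length (tree_bits x) < length (tree_bits t)"
proof (cases t)
  case (Node ts)
  have "length (tree_bits x) \<le> length (concat (map tree_bits ts))" if "x \<in> set ts" for ts using that by (induction ts) auto
  then show ?thesis using Node assms by fastforce
qed (use assms in \<open>simp add: kids_def\<close>)

lemma tree_bits_pos: "2 \<le> length (tree_bits t)"
  by (cases t) auto

lemma length_kids: "length (kids t) \<le> length (tree_bits t)"
proof (cases t)
  case (Node ts)
  have "length ts \<le> length (concat (map tree_bits ts))"
  proof (induction ts)
    case (Cons t ts)
    then show ?case using tree_bits_pos[of t] by simp
  qed simp
  then show ?thesis using Node by simp
qed (simp add: kids_def)

lemma bits_val_less: "bits_val bs < 2 ^ length bs"
  by (induction bs) auto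

lemma num_less: "Suc (num t) \<le> 2 ^ length (tree_bits t)"
proof (cases t)
  case (Num k)
  have "k < 2 ^ length (binary k)" using bits_val_less[of "binary k"] by simp
  also have "\<dots> \<le> 2 ^ length (tree_bits t)" unfolding Num
    by (intro power_increasing) (auto simp: length_concat o_def sum_list_triv)
  finally show ?thesis using Num by simp
qed (simp add: num_def)

text \<open>The length of the code serves as \<open>m\<close>: every list entry takes up at least
  two bits, and a numeral has a value below 2 to the length of its code.\<close>

lemma instance_view_tree:
  assumes "is_qdas A" "synchronous A" "shape t" "view t A f"
  shows "instance_view t A f (units (2 ^ (length (tree_bits t) * length (tree_bits t)))) (length (tree_bits t))"
proof
  let ?m = "length (tree_bits t)"
  have kid: "kid k t \<in> set (kids t)" if "k < 12" for k
  proof -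
    have "lnth j us \<in> set us" if "j < length us" for j us
      using that by (induction j arbitrary: us) (auto split: list.splits)
    moreover have "length (kids t) = 12" by (subst shape_sets(1)[OF assms(3)]) simp
    ultimately show ?thesis using that by simp
  qed
  have len: "length (kids (kid k t)) \<le> ?m" if "k < 12" for k
    using length_kids[of "kid k t"] tree_bits_kid[OF kid[OF that]] by simp
  have lens: "length (nums k t) \<le> ?m" "length (pairs k t) \<le> ?m" if "k < 12" for k
    using len[OF that] rdups(3) unfolding nums_def pairs_def by (metis length_map order_trans)+
  show "is_qdas A" "synchronous A" "view t A f" by (rule assms)+
  show "length (iX t) \<le> ?m" "length (iSQ t) \<le> ?m" "length (iF t) \<le> ?m" using lens by simp_all
  show "length (iD t) \<le> 2 ^ ?m" by (rule order_trans[OF lens(1) less_imp_le[OF less_exp]]) simp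
  show "2 \<le> (2 :: nat) ^ ?m" using power_increasing[of 1 ?m "2 :: nat"] tree_bits_pos[of t] by simp
  show "f s + 1 \<le> 2 ^ ?m" if "s \<in> all_states A" for s
  proof -
    have "(s, f s) \<in> set (iF t)" using that assms(4) by (simp add: view_def)
    then obtain x where x: "x \<in> set (kids (kid 11 t))" "f s = num (kid 1 x)" by (auto simp: pairs_def rdups)
    have "x = Node [Num (num (kid 0 x)), Num (num (kid 1 x))]" using x(1) assms(3) unfolding shape_def by auto
    then have "kid 1 x \<in> set (kids x)" by (metis One_nat_def kids_simps list.set_intros list.simps(5) lnth.simps)
    then have "length (tree_bits (kid 1 x)) \<le> ?m"
      using tree_bits_kid[of "kid 1 x" x] tree_bits_kid[OF x(1)] tree_bits_kid[OF kid[of 11]] by simp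
    then have "(2 :: nat) ^ length (tree_bits (kid 1 x)) \<le> 2 ^ ?m" by (intro power_increasing) auto
    then show ?thesis using num_less[of "kid 1 x"] unfolding x(2) by linarith
  qed
qed simp

text \<open>\<open>C\<close> is a further restriction on the systems, decided by \<open>C'\<close>
  on the tree. The quadratic exponent of the fuel is produced as the length of a product
  list.\<close>

lemma parikh_coverability_EXPTIME:
  assumes C: "PT C'" and CC: "\<And>t A f. view t A f \<Longrightarrow> C' t \<longleftrightarrow> C A"
  shows "parikh_coverability (\<lambda>A. synchronous A \<and> C A) \<in> EXPTIME"
proof (rule PT_EXPTIME)
  show "PT (\<lambda>w :: bool list. units (length (List.product w w)))" by (intro PT_intros)
  show "PT (\<lambda>p. case parse (fst p) of None \<Rightarrow> False | Some t \<Rightarrow> wf_instance t \<and> C' t \<and> decide t (snd p))"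
    by (intro PT_intros PT_comp[OF C] PT_app2[OF PT_decide])
  fix w
  show "(case parse w of None \<Rightarrow> False | Some t \<Rightarrow> wf_instance t \<and> C' t \<and>
      decide t (units (2 ^ length (units (length (List.product w w)))))) \<longleftrightarrow>
      w \<in> parikh_coverability (\<lambda>A. synchronous A \<and> C A)" (is "?l \<longleftrightarrow> ?r")
  proof
    assume ?l
    then obtain t where t: "parse w = Some t" "wf_instance t" "C' t" "decide t (units (2 ^ (length w * length w)))"
      by (auto split: option.splits)
    have w: "tree_bits t = w" by (rule parse_sound[OF t(1)])
    obtain A f where A: "is_qdas A" "synchronous A" "encodes_instance A f w" "view t A f"
      using wf_instance_view[OF t(2)] w by metis
    interpret instance_view t A f "units (2 ^ (length w * length w))" "length w"
      using instance_view_tree[OF A(1,2) _ A(4)] t(2) w unfolding wf_instance_def by simp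
    show ?r unfolding parikh_coverability_def using A t(4) decide_iff CC[OF A(4)] t(3) by blast
  next
    assume ?r
    then obtain A f where A: "is_qdas A" "synchronous A" "C A" "encodes_instance A f w" "parikh_coverable A f"
      unfolding parikh_coverability_def by blast
    obtain t where t: "w = tree_bits t" "shape t" "view t A f" using view_encodes[OF A(4)] by blast
    interpret instance_view t A f "units (2 ^ (length w * length w))" "length w"
      using instance_view_tree[OF A(1,2) t(2,3)] t(1) by simp
    have "wf_instance t" using wf_of_view[OF t(2,3) A(1,2)] .
    then show ?l using parse_tree_bits[of t] t(1) decide_iff A(5) CC[OF t(3)] A(3) by simp
  qed
qed

theorem synchronous_EXPTIME: "parikh_coverability synchronous \<in> EXPTIME"
  using parikh_coverability_EXPTIME[of "\<lambda>_. True" "\<lambda>_. True"] by (simp add: PT_const)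

theorem synchronous_concurrent_EXPTIME: "parikh_coverability (\<lambda>A. synchronous A \<and> concurrent A) \<in> EXPTIME"
proof (rule parikh_coverability_EXPTIME[of "\<lambda>t. iSQ t = [] \<and> iCQ t \<noteq> []"])
  show "PT (\<lambda>t. iSQ t = [] \<and> iCQ t \<noteq> [])" by (intro PT_intros)
  show "(iSQ t = [] \<and> iCQ t \<noteq> []) \<longleftrightarrow> concurrent A" if "view t A f" for t A f
    using that by (auto simp: view_def concurrent_def simp flip: set_empty)
qed

section \<open>Deterministic synchronous programs\<close>

type_synonym edge = "(nat, nat, nat, nat) action \<times> nat"

definition callc :: "nat \<Rightarrow> nat \<Rightarrow> edge list" where "callc b s = [(DispatchS 0 b, s)]"
definition setc :: "nat \<Rightarrow> nat \<Rightarrow> nat \<Rightarrow> edge list" where "setc x v s = [(Assign x v, s)]"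
definition switchc :: "nat \<Rightarrow> (nat \<times> nat) list \<Rightarrow> edge list" where
  "switchc x vs = map (\<lambda>p. (Guard [VarEq x (fst p)], snd p)) vs"
definition testz :: "nat list \<Rightarrow> nat \<Rightarrow> nat \<Rightarrow> edge list" where
  "testz xs s s' = (Guard (map (\<lambda>x. VarEq x 0) xs), s) # map (\<lambda>x. (Guard [VarNeq x 0], s')) xs"

text \<open>Guards may overlap when they lead to the same state. This is required by
  \<open>testz\<close>: guards are conjunctions, so the disjunction of all inequalities is spread
  over parallel edges.\<close>

definition det_edges :: "edge list \<Rightarrow> bool" where
  "det_edges es \<longleftrightarrow> (\<forall>(a1, s1)\<in>set es. \<forall>(a2, s2)\<in>set es. (a1, s1) = (a2, s2) \<or>
     (\<exists>g1 g2. a1 = Guard g1 \<and> a2 = Guard g2 \<and>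
        (s1 = s2 \<or> (\<forall>\<rho>. \<not> ((\<forall>a\<in>set g1. holds \<rho> a) \<and> (\<forall>a\<in>set g2. holds \<rho> a))))))"

lemma det_edges [simp]:
  "det_edges []" "det_edges (callc b s)" "det_edges (setc x v s)" "det_edges (testz xs s s')"
  by (auto simp: det_edges_def callc_def setc_def testz_def)

lemma det_edges_switchc: "distinct (map fst vs) \<Longrightarrow> det_edges (switchc x vs)"
  by (auto simp: det_edges_def switchc_def eq_key_imp_eq_value)

text \<open>Big-step runs up to the final state of a block. No set of occupied queues is carried
  along, as these systems have one queue and it is concurrent.\<close>

inductive exec :: "nat_qdas \<Rightarrow> nat \<Rightarrow> nat \<Rightarrow> (nat \<Rightarrow> nat) \<Rightarrow> (nat \<Rightarrow> nat) \<Rightarrow> bool" for A where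
  exec_final: "s = final_state A b \<Longrightarrow> exec A b s \<rho> \<rho>"
| exec_guard: "(s, Guard g, s') \<in> block_trans A b \<Longrightarrow> (\<forall>a\<in>set g. holds \<rho> a) \<Longrightarrow> exec A b s' \<rho> \<rho>' \<Longrightarrow>
    exec A b s \<rho> \<rho>'"
| exec_assign: "(s, Assign x d, s') \<in> block_trans A b \<Longrightarrow> exec A b s' (\<rho>(x := d)) \<rho>' \<Longrightarrow> exec A b s \<rho> \<rho>'"
| exec_call: "(s, DispatchS q b', s') \<in> block_trans A b \<Longrightarrow> exec A b' (init_state A b') \<rho> \<rho>1 \<Longrightarrow>
    exec A b s' \<rho>1 \<rho>' \<Longrightarrow> exec A b s \<rho> \<rho>'"

locale det_qdas =
  fixes A :: nat_qdas
  assumes queues: "sqid A = {}" "cqid A = {0}"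
    and queue0: "\<And>b s q b' s'. (s, DispatchS q b', s') \<in> block_trans A b \<Longrightarrow> q = 0"
    and sync_trans: "\<And>b s q b' s'. (s, DispatchA q b', s') \<notin> block_trans A b"
    and final: "\<And>b a s'. (final_state A b, a, s') \<notin> block_trans A b"
    and det: "\<And>b s a1 s1 a2 s2. (s, a1, s1) \<in> block_trans A b \<Longrightarrow> (s, a2, s2) \<in> block_trans A b \<Longrightarrow>
      (a1, s1) = (a2, s2) \<or> (\<exists>g1 g2. a1 = Guard g1 \<and> a2 = Guard g2 \<and>
        (s1 = s2 \<or> (\<forall>\<rho>. \<not> ((\<forall>a\<in>set g1. holds \<rho> a) \<and> (\<forall>a\<in>set g2. holds \<rho> a)))))"
begin

lemma okq_0: "okq A U 0" by (simp add: okq_def queues)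
lemma addq_id: "addq A U q = U" by (simp add: addq_def queues)

text \<open>Uniqueness of the result turns the single run constructed later into a statement about
  every run, and so excludes spurious coverage.\<close>

lemma exec_det: "exec A b s \<rho> \<rho>1 \<Longrightarrow> exec A b s \<rho> \<rho>2 \<Longrightarrow> \<rho>1 = \<rho>2"
proof (induction arbitrary: \<rho>2 rule: exec.induct)
  case (exec_final s b \<rho>)
  from exec_final.prems show ?case by cases (use exec_final.hyps final in auto)
next
  case (exec_guard s g s' b \<rho> \<rho>')
  from exec_guard.prems show ?case
  proof cases
    case exec_final
    then show ?thesis using exec_guard.hyps(1) final by auto
  next
    case (exec_guard g2 s2)
    then show ?thesis using det[OF exec_guard(1) exec_guard.hyps(1)] exec_guard.hyps(2) exec_guard.IH by auto
  qed (use det[OF exec_guard.hyps(1)] in blast)+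
next
  case (exec_assign s x d s' b \<rho> \<rho>')
  from exec_assign.prems show ?case
  proof cases
    case exec_final
    then show ?thesis using exec_assign.hyps(1) final by auto
  next
    case (exec_assign x2 d2 s2)
    have "x2 = x" "d2 = d" "s2 = s'" using det[OF exec_assign(1) exec_assign.hyps(1)] by auto
    then show ?thesis using exec_assign.IH exec_assign(2) by blast
  qed (use det[OF exec_assign.hyps(1)] in blast)+
next
  case (exec_call s q b' s' b \<rho> \<rho>1 \<rho>')
  from exec_call.prems show ?case
  proof cases
    case exec_final
    then show ?thesis using exec_call.hyps(1) final by auto
  next
    case (exec_call q2 b2 s2 \<rho>3)
    then show ?thesis using det[OF exec_call(1) exec_call.hyps(1)] exec_call.IH by auto
  qed (use det[OF exec_call.hyps(1)] in blast)+
qed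

text \<open>\<open>exec\<close> grows at its front and \<open>summ\<close> at its end. The assumed
  continuation to \<open>\<rho>'\<close> reconciles them: each summary step is prepended to what
  remains of the run.\<close>

lemma summ_exec_pre: "summ A U b \<rho>0 s \<rho> \<Longrightarrow> exec A b s \<rho> \<rho>' \<Longrightarrow> exec A b (init_state A b) \<rho>0 \<rho>'"
proof (induction arbitrary: \<rho>' rule: summ.induct)
  case (summ_call U b \<rho>0 s \<rho> q b' s' \<rho>1)
  have "exec A b' (init_state A b') \<rho> \<rho>1" using summ_call.IH(2) exec_final by blast
  then show ?case using summ_call.IH(1) exec_call[OF summ_call.hyps(2)] summ_call.prems by blast
qed (auto intro: exec.intros)

lemma summ_exec: "summ A U b \<rho>0 (final_state A b) \<rho> \<Longrightarrow> exec A b (init_state A b) \<rho>0 \<rho>"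
  using summ_exec_pre exec_final by blast

lemma exec_summ_post: "exec A b s \<rho> \<rho>' \<Longrightarrow> summ A U b \<rho>0 s \<rho> \<Longrightarrow> summ A U b \<rho>0 (final_state A b) \<rho>'"
proof (induction arbitrary: \<rho>0 rule: exec.induct)
  case (exec_call s q b' s' b \<rho> \<rho>1 \<rho>')
  have "summ A U b' \<rho> (final_state A b') \<rho>1" by (rule exec_call.IH(1)[OF summ_init])
  then have "summ A U b \<rho>0 s' \<rho>1"
    using summ_call[OF exec_call.prems exec_call.hyps(1)] queue0[OF exec_call.hyps(1)] okq_0 by (simp add: addq_id)
  then show ?case by (rule exec_call.IH(2))
qed (auto intro: summ.intros)

end

section \<open>A recursive program simulating a Turing machine\<close>

text \<open>Labels of the program locations. Registers 0 and 1 hold an offset \<open>d\<close> and a time \<open>t\<close> in \<open>m\<close> bits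
  each; variable 0 holds the result. \<open>Cnt c\<close> changes register \<open>c mod 2\<close> by one, upwards iff \<open>c < 2\<close>.\<close>

datatype lbl = MainS nat | AS "nat list" | ZS nat | Cnt nat nat nat | LookS nat nat

text \<open>The residue modulo 8 tells the constructors apart. The index \<open>l\<close>, which
  ranges with the input, enters only through doublings and additions of constants, so the codes can
  be written in polynomial time; \<open>prod_encode\<close> and \<open>list_encode\<close> are
  applied to values that do not depend on the input.\<close>

fun lcode :: "lbl \<Rightarrow> nat" where
  "lcode (MainS j) = 2 * (2 * (2 * j))"
| "lcode (AS xs) = Suc (2 * (2 * (2 * list_encode xs)))"
| "lcode (ZS j) = Suc (Suc (2 * (2 * (2 * j))))"
| "lcode (Cnt c j l) = Suc (Suc (Suc (2 * (2 * (2 * (prod_encode (min c 4, min j 4) + 64 * l))))))"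
| "lcode (LookS l j) = Suc (Suc (Suc (Suc (2 * (2 * (2 * (min j 7 + 8 * l)))))))"

fun lok :: "lbl \<Rightarrow> bool" where
  "lok (Cnt c j l) \<longleftrightarrow> c < 4 \<and> j < 3" | "lok (LookS l j) \<longleftrightarrow> j < 8" | "lok _ \<longleftrightarrow> True"

lemma prod_encode_small: "c \<le> 4 \<Longrightarrow> j \<le> 4 \<Longrightarrow> prod_encode (c, j) < 64"
proof -
  assume a: "c \<le> 4" "j \<le> 4"
  have "triangle (c + j) \<le> triangle 8"
  proof -
    have "(c + j) * Suc (c + j) \<le> 8 * Suc 8" using a by (intro mult_le_mono) auto
    then show ?thesis unfolding triangle_def by (rule div_le_mono)
  qed
  then show ?thesis using a by (simp add: prod_encode_def triangle_def)
qed

lemma lcode_inj: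
  assumes "lok x" "lok y" "lcode x = lcode y"
  shows "x = y"
proof -
  have mod: "lcode z mod 8 = (case z of MainS _ \<Rightarrow> 0 | AS _ \<Rightarrow> 1 | ZS _ \<Rightarrow> 2 | Cnt _ _ _ \<Rightarrow> 3 | LookS _ _ \<Rightarrow> 4)" for z
    by (cases z) (simp_all, presburger+)
  have "lcode x mod 8 = lcode y mod 8" using assms(3) by simp
  then show ?thesis unfolding mod using assms
  proof (cases x; cases y)
    fix c j l c' j' l' assume x: "x = Cnt c j l" and y: "y = Cnt c' j' l'"
    let ?p = "prod_encode (c, j)" and ?p' = "prod_encode (c', j')"
    have "?p + 64 * l = ?p' + 64 * l'" using assms x y by (simp add: min_def)
    moreover have "?p < 64" "?p' < 64" using assms x y by (auto intro!: prod_encode_small)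
    ultimately have "?p = ?p'" "l = l'" by presburger+
    then show "x = y" using x y by (simp add: prod_encode_eq)
  next
    fix l j l' j' assume x: "x = LookS l j" and y: "y = LookS l' j'"
    have "j + 8 * l = j' + 8 * l'" "j < 8" "j' < 8" using assms x y by (auto simp: min_def)
    then have "j = j' \<and> l = l'" by presburger
    then show "x = y" using x y by simp
  qed (auto simp: list_encode_eq)
qed

declare lcode.simps [simp del]

lemma lcode_MainS [simp]: "lcode (MainS i) = lcode (MainS j) \<longleftrightarrow> i = j"
  using lcode_inj[of "MainS i" "MainS j"] by auto

fun lblk :: "lbl \<Rightarrow> nat" where
  "lblk (MainS j) = 0"
| "lblk (AS xs) = 1"
| "lblk (ZS j) = 2"
| "lblk (Cnt c j l) = 3 + c"
| "lblk (LookS l j) = Suc (Suc (Suc (Suc (Suc (Suc (Suc l))))))"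

definition linit :: "nat \<Rightarrow> nat" where
  "linit b = lcode (if b = 0 then MainS 0 else if b = 1 then AS [0] else if b = 2 then ZS 0
     else if b < 7 then Cnt (b - 3) 0 0 else LookS (b - 7) 0)"

definition lfinal :: "nat \<Rightarrow> nat \<Rightarrow> nat" where
  "lfinal m b = lcode (if b = 0 then MainS 3 else if b = 1 then AS [15] else if b = 2 then ZS 5
     else if b < 7 then Cnt (b - 3) 0 m else LookS (b - 7) 5)"

definition var :: "nat \<Rightarrow> nat \<Rightarrow> nat" where "var c l = Suc (c + 2 * l)"

text \<open>\<open>K\<close> bounds the results, \<open>acc\<close> lists the accepting ones, \<open>tab\<close> holds the results for time 0 and
  the first offsets, \<open>bl\<close> the result for all other offsets.\<close>

record prog =
  pm :: nat
  pK :: nat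
  pacc :: "nat list"
  pcomb :: "nat \<Rightarrow> nat \<Rightarrow> nat \<Rightarrow> nat \<Rightarrow> nat"
  ptab :: "nat list"
  pbl :: nat

text \<open>Block 1 evaluates the recursion at time \<open>t\<close> and offset \<open>d\<close>;
  the values \<open>a\<close>, \<open>b\<close>, \<open>c\<close> found so far are part of its
  location and thus survive the nested calls. Block 2 does the same at offset 0 for any current
  \<open>d\<close>: it counts \<open>d\<close> up until it wraps round to 0, and every frame counts
  down once on return, so the stack itself restores \<open>d\<close>. The blocks from 7 on count
  \<open>d\<close> down in the same manner while their index counts up, and read the table when
  \<open>d\<close> is 0.\<close>

fun E :: "prog \<Rightarrow> lbl \<Rightarrow> edge list" where
  "E P (MainS j) = (if j = 0 then setc (var 1 (pm P - 1)) 1 (lcode (MainS 1))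
     else if j = 1 then callc 1 (lcode (MainS 2))
     else if j = 2 then switchc 0 (map (\<lambda>v. (v, lcode (MainS 3))) (pacc P)) else [])"
| "E P (ZS j) = (if j = 0 then testz (map (var 0) [0..<pm P]) (lcode (ZS 1)) (lcode (ZS 2))
     else if j = 1 then callc 1 (lcode (ZS 5)) else if j = 2 then callc 3 (lcode (ZS 3))
     else if j = 3 then callc 2 (lcode (ZS 4)) else if j = 4 then callc 5 (lcode (ZS 5)) else [])"
| "E P (Cnt c j l) = (if l \<notin> {0..<pm P} then []
     else if j = 0 then switchc (var (c mod 2) l) [(0, lcode (Cnt c 1 l)), (1, lcode (Cnt c 2 l))]
     else if j = 1 then setc (var (c mod 2) l) 1 (lcode (Cnt c 0 (if c < 2 then pm P else Suc l)))
     else setc (var (c mod 2) l) 0 (lcode (Cnt c 0 (if c < 2 then Suc l else pm P))))"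
| "E P (LookS l j) = (if l \<notin> {0..<length (ptab P)} then (if j = 0 then setc 0 (pbl P) (lcode (LookS l 5)) else [])
     else if j = 0 then testz (map (var 0) [0..<pm P]) (lcode (LookS l 1)) (lcode (LookS l 2))
     else if j = 1 then setc 0 (ptab P ! l) (lcode (LookS l 5))
     else if j = 2 then callc 5 (lcode (LookS l 3)) else if j = 3 then callc (lblk (LookS (Suc l) 0)) (lcode (LookS l 4))
     else if j = 4 then callc 3 (lcode (LookS l 5)) else [])"
| "E P (AS xs) = (case xs of
       [k] \<Rightarrow> if k = 0 then testz (map (var 1) [0..<pm P]) (lcode (AS [1])) (lcode (AS [2]))
              else if k = 1 then callc 7 (lcode (AS [15])) else if k = 2 then callc 6 (lcode (AS [3]))
              else if k = 3 then callc 2 (lcode (AS [4]))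
              else if k = 4 then switchc 0 (map (\<lambda>a. (a, lcode (AS [5, a]))) [0..<pK P]) else []
     | [k, a] \<Rightarrow> if k = 5 then callc 5 (lcode (AS [6, a])) else if k = 6 then callc 1 (lcode (AS [7, a]))
              else if k = 7 then switchc 0 (map (\<lambda>b. (b, lcode (AS [8, a, b]))) [0..<pK P])
              else if k = 14 then callc 5 (lcode (AS [16, a])) else if k = 16 then callc 4 (lcode (AS [17, a]))
              else if k = 17 then setc 0 a (lcode (AS [15])) else []
     | [k, a, b] \<Rightarrow> if k = 8 then callc 3 (lcode (AS [9, a, b])) else if k = 9 then callc 1 (lcode (AS [10, a, b]))
              else if k = 10 then switchc 0 (map (\<lambda>c. (c, lcode (AS [11, a, b, c]))) [0..<pK P]) else []
     | [k, a, b, c] \<Rightarrow> if k = 11 then callc 3 (lcode (AS [12, a, b, c])) else if k = 12 then callc 1 (lcode (AS [13, a, b, c]))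
              else if k = 13 then switchc 0 (map (\<lambda>e. (e, lcode (AS [14, pcomb P a b c e]))) [0..<pK P]) else []
     | _ \<Rightarrow> [])"

definition a_labels :: "nat \<Rightarrow> lbl list" where
  "a_labels K = map (\<lambda>k. AS [k]) [0, 1, 2, 3, 4, 15] @
     concat (map (\<lambda>a. map (\<lambda>k. AS [k, a]) [5, 6, 7, 14, 16, 17]) [0..<K]) @
     concat (map (\<lambda>a. concat (map (\<lambda>b. map (\<lambda>k. AS [k, a, b]) [8, 9, 10]) [0..<K])) [0..<K]) @
     concat (map (\<lambda>a. concat (map (\<lambda>b. concat (map (\<lambda>c. map (\<lambda>k. AS [k, a, b, c]) [11, 12, 13]) [0..<K])) [0..<K])) [0..<K])"

definition labels :: "prog \<Rightarrow> lbl list" where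
  "labels P = map MainS [0..<4] @ map ZS [0..<6] @ a_labels (pK P) @
     concat (map (\<lambda>c. concat (map (\<lambda>j. map (\<lambda>l. Cnt c j l) [0..<Suc (pm P)]) [0..<3])) [0..<4]) @
     concat (map (\<lambda>j. map (\<lambda>l. LookS l j) [0..<Suc (length (ptab P))]) [0..<6])"

definition blks :: "prog \<Rightarrow> nat list" where
  "blks P = [0, 1, 2, 3, 4, 5, 6] @ map (\<lambda>l. lblk (LookS l 0)) [0..<Suc (length (ptab P))]"

definition the_qdas :: "prog \<Rightarrow> nat_qdas" where
  "the_qdas P = \<lparr>data_values = {0..<pK P}, init_value = 0,
     variables = {0} \<union> var 0 ` {0..<pm P} \<union> var 1 ` {0..<pm P}, cqid = {0}, sqid = {},
     blocks = set (blks P), main_block = 0,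
     block_states = (\<lambda>b. lcode ` {x \<in> set (labels P). lblk x = b}),
     init_state = linit, final_state = lfinal (pm P),
     block_trans = (\<lambda>b. {(lcode x, a, s') | x a s'. x \<in> set (labels P) \<and> lblk x = b \<and> (a, s') \<in> set (E P x)})\<rparr>"

text \<open>One vertex is requested in the final location of main, which the program enters only
  with a result listed in \<open>pacc\<close>.\<close>

definition the_goal :: "nat \<Rightarrow> nat" where "the_goal s = of_bool (s = lcode (MainS 3))"

definition wf_prog :: "prog \<Rightarrow> bool" where
  "wf_prog P \<longleftrightarrow> 0 < pm P \<and> 2 \<le> pK P \<and> set (pacc P) \<subseteq> {0..<pK P} \<and> distinct (pacc P) \<and>
     (\<forall>a<pK P. \<forall>b<pK P. \<forall>c<pK P. \<forall>e<pK P. pcomb P a b c e < pK P) \<and> set (ptab P) \<subseteq> {0..<pK P} \<and> pbl P < pK P \<and>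
     length (ptab P) < 2 ^ pm P"

text \<open>The valuation for register contents \<open>v\<close> and result \<open>r\<close>.
  Positions from \<open>m\<close> on are 0, in agreement with the initial value that variables
  outside the system keep.\<close>

definition mk :: "nat \<Rightarrow> (nat \<Rightarrow> nat) \<Rightarrow> nat \<Rightarrow> nat \<Rightarrow> nat" where
  "mk m v r = (\<lambda>x. if x = 0 then r else of_bool ((x - 1) div 2 < m \<and> bit (v ((x - 1) mod 2)) ((x - 1) div 2)))"

lemma mk_var: "c < 2 \<Longrightarrow> mk m v r (var c l) = of_bool (l < m \<and> bit (v c) l)"
  by (simp add: mk_def var_def)

lemma mk_0 [simp]: "mk m v r 0 = r" by (simp add: mk_def)

lemma mk_upd_0 [simp]: "(mk m v r)(0 := r') = mk m v r'"
  by (auto simp: mk_def)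

lemma bit_update:
  "\<not> bit (n :: nat) l \<Longrightarrow> bit (n + 2 ^ l) k \<longleftrightarrow> k = l \<or> bit n k"
  "bit (n :: nat) l \<Longrightarrow> bit (n - 2 ^ l) k \<longleftrightarrow> k \<noteq> l \<and> bit n k"
proof -
  have 1: "bit (n + 2 ^ l) k \<longleftrightarrow> k = l \<or> bit n k" if "\<not> bit n l" for n k :: nat
  proof -
    have "set_bit l n = n + 2 ^ l" using that by (simp add: set_bit_eq)
    then show ?thesis using bit_set_bit_iff[of l n k] by auto
  qed
  then show "\<not> bit n l \<Longrightarrow> bit (n + 2 ^ l) k \<longleftrightarrow> k = l \<or> bit n k" .
  assume b: "bit n l"
  have u: "bit (unset_bit l n) i \<longleftrightarrow> i \<noteq> l \<and> bit n i" for i by (auto simp: bit_unset_bit_iff)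
  have "unset_bit l n + 2 ^ l = n" using b u 1 by (intro bit_eqI) auto
  then have "n - 2 ^ l = unset_bit l n" by linarith
  then show "bit (n - 2 ^ l) k \<longleftrightarrow> k \<noteq> l \<and> bit n k" using u by simp
qed

lemma var_eq_iff: "c < 2 \<Longrightarrow> x = var c l \<longleftrightarrow> x \<noteq> 0 \<and> (x - 1) mod 2 = c \<and> (x - 1) div 2 = l"
proof -
  assume c: "c < 2"
  have "y = c + 2 * l \<longleftrightarrow> y mod 2 = c \<and> y div 2 = l" for y
    using c mult_div_mod_eq[of 2 y] by auto
  then show ?thesis by (cases x) (simp_all add: var_def)
qed

lemma mk_set:
  assumes "c < 2" "l < m"
  shows "\<not> bit (v c) l \<Longrightarrow> (mk m v r)(var c l := 1) = mk m (v(c := v c + 2 ^ l)) r"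
    and "bit (v c) l \<Longrightarrow> (mk m v r)(var c l := 0) = mk m (v(c := v c - 2 ^ l)) r"
proof -
  have *: "(mk m v r)(var c l := of_bool b) = mk m (v(c := n)) r"
    if "\<And>k. bit n k \<longleftrightarrow> (if k = l then b else bit (v c) k)" for n b
  proof
    fix x
    show "((mk m v r)(var c l := of_bool b)) x = mk m (v(c := n)) r x"
      using that[of "(x - 1) div 2"] assms by (auto simp: mk_def var_eq_iff)
  qed
  show "\<not> bit (v c) l \<Longrightarrow> (mk m v r)(var c l := 1) = mk m (v(c := v c + 2 ^ l)) r"
    using *[of "v c + 2 ^ l" True] bit_update(1)[of "v c" l] by auto
  show "bit (v c) l \<Longrightarrow> (mk m v r)(var c l := 0) = mk m (v(c := v c - 2 ^ l)) r"
    using *[of "v c - 2 ^ l" False] bit_update(2)[of "v c" l] by auto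
qed

lemma zero_bits: "n < 2 ^ m \<Longrightarrow> (\<forall>l<m. \<not> bit (n :: nat) l) \<longleftrightarrow> n = 0"
  by (metis bit_0_eq bot_apply bot_bool_def bit_eq_iff bit_take_bit_iff take_bit_nat_eq_self)

section \<open>The program as a synchronous concurrent QDAS\<close>

locale tm_prog =
  fixes P :: prog
  assumes wf: "wf_prog P"
begin

abbreviation "A \<equiv> the_qdas P"
abbreviation "m \<equiv> pm P"
abbreviation "K \<equiv> pK P"

lemma labels_lok: "x \<in> set (labels P) \<Longrightarrow> lok x"
  by (auto simp: labels_def a_labels_def)

lemma lcode_eq: "x \<in> set (labels P) \<Longrightarrow> y \<in> set (labels P) \<Longrightarrow> lcode x = lcode y \<longleftrightarrow> x = y"
  using lcode_inj labels_lok by blast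

lemma trans_iff: "x \<in> set (labels P) \<Longrightarrow> (lcode x, a, s') \<in> block_trans A (lblk x) \<longleftrightarrow> (a, s') \<in> set (E P x)"
  using lcode_eq by (auto simp: the_qdas_def)

lemma transE:
  assumes "(s, a, s') \<in> block_trans A b"
  obtains x where "s = lcode x" "x \<in> set (labels P)" "lblk x = b" "(a, s') \<in> set (E P x)"
  using assms by (auto simp: the_qdas_def)

lemma label_mem:
  "j < 4 \<Longrightarrow> MainS j \<in> set (labels P)" "j < 6 \<Longrightarrow> ZS j \<in> set (labels P)"
  "c < 4 \<Longrightarrow> j < 3 \<Longrightarrow> l \<le> m \<Longrightarrow> Cnt c j l \<in> set (labels P)"
  "j < 6 \<Longrightarrow> l \<le> length (ptab P) \<Longrightarrow> LookS l j \<in> set (labels P)"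
  "k \<in> {0, 1, 2, 3, 4, 15} \<Longrightarrow> AS [k] \<in> set (labels P)"
  "k \<in> {5, 6, 7, 14, 16, 17} \<Longrightarrow> a < K \<Longrightarrow> AS [k, a] \<in> set (labels P)"
  "k \<in> {8, 9, 10} \<Longrightarrow> a < K \<Longrightarrow> b < K \<Longrightarrow> AS [k, a, b] \<in> set (labels P)"
  "k \<in> {11, 12, 13} \<Longrightarrow> a < K \<Longrightarrow> b < K \<Longrightarrow> c' < K \<Longrightarrow> AS [k, a, b, c'] \<in> set (labels P)"
proof -
  have cI: "y \<in> set (concat (map g xs))" if "x \<in> set xs" "y \<in> set (g x)" for g :: "nat \<Rightarrow> lbl list" and x y xs
    using that by auto
  show "j < 4 \<Longrightarrow> MainS j \<in> set (labels P)" "j < 6 \<Longrightarrow> ZS j \<in> set (labels P)"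
    by (auto simp: labels_def simp del: upt_Suc)
  show "Cnt c j l \<in> set (labels P)" if "c < 4" "j < 3" "l \<le> m"
    unfolding labels_def set_append
    by (rule UnI2, rule UnI2, rule UnI2, rule UnI1, rule cI[of c], use that in simp, rule cI[of j]) (use that in \<open>auto simp del: upt_Suc\<close>)
  show "LookS l j \<in> set (labels P)" if "j < 6" "l \<le> length (ptab P)"
    unfolding labels_def set_append
    by (rule UnI2, rule UnI2, rule UnI2, rule UnI2, rule cI[of j]) (use that in \<open>auto simp del: upt_Suc\<close>)
  show "k \<in> {0, 1, 2, 3, 4, 15} \<Longrightarrow> AS [k] \<in> set (labels P)"
    "k \<in> {5, 6, 7, 14, 16, 17} \<Longrightarrow> a < K \<Longrightarrow> AS [k, a] \<in> set (labels P)"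
    "k \<in> {8, 9, 10} \<Longrightarrow> a < K \<Longrightarrow> b < K \<Longrightarrow> AS [k, a, b] \<in> set (labels P)"
    "k \<in> {11, 12, 13} \<Longrightarrow> a < K \<Longrightarrow> b < K \<Longrightarrow> c' < K \<Longrightarrow> AS [k, a, b, c'] \<in> set (labels P)"
    by (auto simp: labels_def a_labels_def simp del: upt_Suc)
qed

lemma label_cases:
  assumes "x \<in> set (labels P)"
  obtains j where "x = MainS j" "j < 4" | j where "x = ZS j" "j < 6"
  | c j l where "x = Cnt c j l" "c < 4" "j < 3" "l \<le> m"
  | j l where "x = LookS l j" "j < 6" "l \<le> length (ptab P)"
  | k where "x = AS [k]" "k \<in> {0, 1, 2, 3, 4, 15}"
  | k a where "x = AS [k, a]" "k \<in> {5, 6, 7, 14, 16, 17}" "a < K"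
  | k a b where "x = AS [k, a, b]" "k \<in> {8, 9, 10}" "a < K" "b < K"
  | k a b c where "x = AS [k, a, b, c]" "k \<in> {11, 12, 13}" "a < K" "b < K" "c < K"
  using assms that by (auto simp: labels_def a_labels_def simp del: upt_Suc; fastforce)

lemma E_det:
  assumes "x \<in> set (labels P)"
  shows "det_edges (E P x)"
  using assms
proof (cases rule: label_cases)
qed (use wf in \<open>auto simp: wf_prog_def o_def intro!: det_edges_switchc\<close>)

lemma edge_ok:
  assumes "x \<in> set (labels P)" "(a, s') \<in> set (E P x)"
  shows "(\<exists>y\<in>set (labels P). s' = lcode y \<and> lblk y = lblk x) \<and> a \<in> actions A \<and> (\<forall>q b. a \<noteq> DispatchA q b) \<and>
    (\<forall>q b. a = DispatchS q b \<longrightarrow> q = 0)"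
proof -
  have v: "0 \<in> variables A" "l < m \<Longrightarrow> c < 2 \<Longrightarrow> var c l \<in> variables A" for c l
    by (auto simp: the_qdas_def less_2_cases_iff)
  have d: "i < K \<Longrightarrow> i \<in> data_values A" "0 \<in> data_values A" "Suc 0 \<in> data_values A" for i
    using wf by (auto simp: the_qdas_def wf_prog_def)
  have bl: "i \<in> set (blks P)" if "i \<le> 7 + length (ptab P)" for i
  proof (cases "i < 7")
    case True
    then have "i \<in> {0, 1, 2, 3, 4, 5, 6}" by auto
    then show ?thesis unfolding blks_def set_append by (intro UnI1) simp
  next
    case False
    then have "i = lblk (LookS (i - 7) 0)" "i - 7 \<in> set [0..<Suc (length (ptab P))]" using that by auto
    then have "i \<in> set (map (\<lambda>l. lblk (LookS l 0)) [0..<Suc (length (ptab P))])" unfolding set_map by (rule image_eqI)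
    then show ?thesis unfolding blks_def set_append by (rule UnI2)
  qed
  have "0 \<in> cqid A" "main_block A = 0" "blocks A = set (blks P)" by (simp_all add: the_qdas_def)
  then have c: "i \<noteq> 0 \<Longrightarrow> i \<le> 7 + length (ptab P) \<Longrightarrow> DispatchS 0 i \<in> actions A"
    "y \<in> variables A \<Longrightarrow> i \<in> data_values A \<Longrightarrow> Assign y i \<in> actions A"
    "y \<in> variables A \<Longrightarrow> i \<in> data_values A \<Longrightarrow> Guard [VarEq y i] \<in> actions A"
    "y \<in> variables A \<Longrightarrow> i \<in> data_values A \<Longrightarrow> Guard [VarNeq y i] \<in> actions A"
    "(\<And>y. y \<in> set ys \<Longrightarrow> y \<in> variables A) \<Longrightarrow> Guard (map (\<lambda>x. VarEq x 0) ys) \<in> actions A" for i y ys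
    using bl d(2) by (auto simp: actions_def atoms_def)
  have g: "Guard (map ((\<lambda>x. VarEq x 0) \<circ> var k) [0..<m]) \<in> actions A" if "k < 2" for k
    unfolding map_map[symmetric] using v(2) that by (intro c(5)) auto
  have w: "set (pacc P) \<subseteq> {0..<K}" "0 < m" "pbl P < K" "set (ptab P) \<subseteq> {0..<K}"
    "\<forall>a<K. \<forall>b<K. \<forall>c<K. \<forall>e<K. pcomb P a b c e < K" using wf unfolding wf_prog_def by blast+
  have t: "ptab P ! l < K" if "l < length (ptab P)" for l using subsetD[OF w(4) nth_mem[OF that]] by simp
  note defs = callc_def setc_def switchc_def testz_def
  have A: "a \<in> actions A"
    using assms(1)
  proof (cases rule: label_cases)
  qed (use assms(2) w(1-3) t in \<open>auto simp: defs simp del: upt_Suc split: if_splits intro!: c g v d\<close>)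
  have lI: "\<exists>y'\<in>set (labels P). lcode y = lcode y' \<and> lblk y' = n" if "y \<in> set (labels P)" "lblk y = n" for y n
    using that by blast
  have T: "\<exists>y\<in>set (labels P). s' = lcode y \<and> lblk y = lblk x"
    using assms(1)
  proof (cases rule: label_cases)
  qed (use assms(2) w(2,5) in \<open>auto simp: defs simp del: upt_Suc split: if_splits intro!: lI label_mem\<close>)
  have Q: "(\<forall>q b. a \<noteq> DispatchA q b) \<and> (\<forall>q b. a = DispatchS q b \<longrightarrow> q = 0)"
    using assms(1)
  proof (cases rule: label_cases)
  qed (use assms(2) in \<open>auto simp: defs simp del: upt_Suc split: if_splits\<close>)
  from A T Q show ?thesis by blast
qed

lemma lblk_in: "x \<in> set (labels P) \<Longrightarrow> lblk x \<in> set (blks P)"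
proof -
  have c: "c < 4 \<Longrightarrow> 3 + c \<in> {3, 4, 5, 6 :: nat}" for c by auto
  assume "x \<in> set (labels P)"
  then show ?thesis
    by (cases rule: label_cases) (use c in \<open>auto simp: blks_def simp del: upt_Suc\<close>)
qed

lemma init_final_mem:
  assumes "b \<in> set (blks P)"
  shows "\<exists>x\<in>set (labels P). linit b = lcode x \<and> lblk x = b" "\<exists>x\<in>set (labels P). lfinal m b = lcode x \<and> lblk x = b \<and> E P x = []"
proof -
  have "b \<in> {0, 1, 2, 3, 4, 5, 6} \<or> (\<exists>l\<le>length (ptab P). b = lblk (LookS l 0))"
    using assms unfolding blks_def by (auto simp: less_Suc_eq_le simp del: upt_Suc lblk.simps)
  moreover have "\<exists>c<4. b = 3 + c" if "b \<in> {3, 4, 5, 6}" using that by (intro exI[of _ "b - 3"]) auto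
  ultimately have "b = 0 \<or> b = 1 \<or> b = 2 \<or> (\<exists>c<4. b = 3 + c) \<or> (\<exists>l\<le>length (ptab P). b = lblk (LookS l 0))"
    by blast
  then consider "b = 0" | "b = 1" | "b = 2" | c where "c < 4" "b = 3 + c" | l where "l \<le> length (ptab P)" "b = lblk (LookS l 0)"
    by blast
  note cases = this
  from cases show "\<exists>x\<in>set (labels P). linit b = lcode x \<and> lblk x = b"
  proof cases
    case (4 c)
    then show ?thesis by (intro bexI[OF _ label_mem(3)[of c 0 0]]) (auto simp: linit_def)
  next
    case (5 l)
    then show ?thesis by (intro bexI[OF _ label_mem(4)[of 0 l]]) (auto simp: linit_def)
  qed (auto simp: linit_def intro: bexI[OF _ label_mem(1)[of 0]] bexI[OF _ label_mem(2)[of 0]] bexI[OF _ label_mem(5)[of 0]])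
  from cases show "\<exists>x\<in>set (labels P). lfinal m b = lcode x \<and> lblk x = b \<and> E P x = []"
  proof cases
    case (4 c)
    then show ?thesis by (intro bexI[OF _ label_mem(3)[of c 0 m]]) (auto simp: lfinal_def)
  next
    case (5 l)
    then show ?thesis by (intro bexI[OF _ label_mem(4)[of 5 l]]) (auto simp: lfinal_def)
  qed (auto simp: lfinal_def intro: bexI[OF _ label_mem(1)[of 3]] bexI[OF _ label_mem(2)[of 5]] bexI[OF _ label_mem(5)[of 15]])
qed

lemma is_qdas: "is_qdas A"
proof -
  have fin: "finite (block_trans A b)" for b
  proof -
    have "block_trans A b \<subseteq> (\<Union>x\<in>set (labels P). (\<lambda>(a, s'). (lcode x, a, s')) ` set (E P x))"
      by (auto simp: the_qdas_def)
    then show ?thesis by (rule finite_subset) simp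
  qed
  have sub: "block_trans A b \<subseteq> block_states A b \<times> actions A \<times> block_states A b" for b
  proof
    fix r assume "r \<in> block_trans A b"
    then obtain x a s' where r: "r = (lcode x, a, s')" "x \<in> set (labels P)" "lblk x = b" "(a, s') \<in> set (E P x)"
      by (auto simp: the_qdas_def)
    from edge_ok[OF r(2,4)] r show "r \<in> block_states A b \<times> actions A \<times> block_states A b"
      by (auto simp: the_qdas_def)
  qed
  have st: "init_state A b \<in> block_states A b" "final_state A b \<in> block_states A b" if "b \<in> set (blks P)" for b
    using init_final_mem[OF that] by (auto simp: the_qdas_def)
  have disj: "block_states A b \<inter> block_states A b' = {}" if "b \<noteq> b'" for b b'
    using that lcode_eq by (auto simp: the_qdas_def)
  show ?thesis
    unfolding is_qdas_def using fin sub st disj wf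
    by (auto simp: the_qdas_def wf_prog_def blks_def)
qed

lemma synchronous: "synchronous A" and concurrent: "concurrent A"
proof -
  show "synchronous A" unfolding synchronous_def using edge_ok by (blast elim: transE)
  show "concurrent A" by (simp add: concurrent_def the_qdas_def)
qed

sublocale det_qdas A
proof
  show "sqid A = {}" "cqid A = {0}" by (simp_all add: the_qdas_def)
  show "q = 0" if "(s, DispatchS q b', s') \<in> block_trans A b" for b s q b' s'
    using that edge_ok by (blast elim: transE)
  show "(s, DispatchA q b', s') \<notin> block_trans A b" for b s q b' s'
    using edge_ok by (blast elim: transE)
  show "(final_state A b, a, s') \<notin> block_trans A b" for b a s'
  proof
    assume "(final_state A b, a, s') \<in> block_trans A b"
    then obtain x where x: "final_state A b = lcode x" "x \<in> set (labels P)" "lblk x = b" "(a, s') \<in> set (E P x)" by (rule transE)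
    obtain y where y: "y \<in> set (labels P)" "lfinal m b = lcode y" "E P y = []"
      using init_final_mem(2)[of b] lblk_in[OF x(2)] x(3) by blast
    have "final_state A b = lfinal m b" by (simp add: the_qdas_def)
    then have "y = x" using x(1,2) y(1,2) lcode_eq by metis
    then show False using x(4) y(3) by simp
  qed
  show "(a1, s1) = (a2, s2) \<or> (\<exists>g1 g2. a1 = Guard g1 \<and> a2 = Guard g2 \<and>
        (s1 = s2 \<or> (\<forall>\<rho>. \<not> ((\<forall>a\<in>set g1. holds \<rho> a) \<and> (\<forall>a\<in>set g2. holds \<rho> a)))))"
    if "(s, a1, s1) \<in> block_trans A b" "(s, a2, s2) \<in> block_trans A b" for b s a1 s1 a2 s2
  proof -
    note t = that
    obtain x where x: "s = lcode x" "x \<in> set (labels P)" "lblk x = b" "(a1, s1) \<in> set (E P x)" using t(1) by (rule transE)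
    obtain y where y: "s = lcode y" "y \<in> set (labels P)" "lblk y = b" "(a2, s2) \<in> set (E P y)" using t(2) by (rule transE)
    have "y = x" using x y lcode_eq by metis
    from E_det[OF x(2), unfolded det_edges_def, THEN bspec, OF x(4), unfolded prod.case, THEN bspec,
        OF y(4)[unfolded this], unfolded prod.case]
    show ?thesis .
  qed
qed

section \<open>Correctness of the procedures\<close>

definition ex :: "lbl \<Rightarrow> (nat \<Rightarrow> nat) \<Rightarrow> (nat \<Rightarrow> nat) \<Rightarrow> bool" where
  "ex x \<rho> \<rho>' \<longleftrightarrow> exec A (lblk x) (lcode x) \<rho> \<rho>'"

lemma ex_final: "lcode x = lfinal m (lblk x) \<Longrightarrow> ex x \<rho> \<rho>"
  unfolding ex_def by (rule exec_final) (simp add: the_qdas_def)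

lemma ex_call:
  assumes "E P x = callc (lblk z) (lcode y)" "x \<in> set (labels P)" "lblk y = lblk x" "linit (lblk z) = lcode z"
    "ex z \<rho> \<rho>1" "ex y \<rho>1 \<rho>'"
  shows "ex x \<rho> \<rho>'"
proof -
  have "(lcode x, DispatchS 0 (lblk z), lcode y) \<in> block_trans A (lblk x)"
    using trans_iff[OF assms(2)] assms(1) by (simp add: callc_def)
  moreover have "init_state A (lblk z) = lcode z" using assms(4) by (simp add: the_qdas_def)
  ultimately show ?thesis using assms(3,5,6) unfolding ex_def by (metis exec_call)
qed

lemma ex_set:
  assumes "E P x = setc i v (lcode y)" "x \<in> set (labels P)" "lblk y = lblk x" "ex y (\<rho>(i := v)) \<rho>'"
  shows "ex x \<rho> \<rho>'"
proof -
  have "(lcode x, Assign i v, lcode y) \<in> block_trans A (lblk x)"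
    using trans_iff[OF assms(2)] assms(1) by (simp add: setc_def)
  then show ?thesis using assms(3,4) unfolding ex_def by (metis exec_assign)
qed

lemma ex_switch:
  assumes "E P x = switchc i vs" "x \<in> set (labels P)" "(\<rho> i, lcode y) \<in> set vs" "lblk y = lblk x" "ex y \<rho> \<rho>'"
  shows "ex x \<rho> \<rho>'"
proof -
  have "(Guard [VarEq i (\<rho> i)], lcode y) \<in> set (E P x)"
    unfolding assms(1) switchc_def using assms(3) by force
  then have "(lcode x, Guard [VarEq i (\<rho> i)], lcode y) \<in> block_trans A (lblk x)" using trans_iff[OF assms(2)] by simp
  then show ?thesis using assms(4,5) exec_guard[of _ "[VarEq i (\<rho> i)]"] unfolding ex_def by force
qed

lemma ex_test_zero:
  assumes "E P x = testz is (lcode y) s'" "x \<in> set (labels P)" "\<forall>i\<in>set is. \<rho> i = 0" "lblk y = lblk x" "ex y \<rho> \<rho>'"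
  shows "ex x \<rho> \<rho>'"
proof -
  have "(lcode x, Guard (map (\<lambda>x. VarEq x 0) is), lcode y) \<in> block_trans A (lblk x)"
    using trans_iff[OF assms(2)] assms(1) by (simp add: testz_def)
  then show ?thesis using assms(3-) exec_guard[of _ "map (\<lambda>x. VarEq x 0) is"] unfolding ex_def by force
qed

lemma ex_test_nonzero:
  assumes "E P x = testz is s' (lcode y)" "x \<in> set (labels P)" "i \<in> set is" "\<rho> i \<noteq> 0" "lblk y = lblk x" "ex y \<rho> \<rho>'"
  shows "ex x \<rho> \<rho>'"
proof -
  have "(lcode x, Guard [VarNeq i 0], lcode y) \<in> block_trans A (lblk x)"
    using trans_iff[OF assms(2)] assms(1,3) by (simp add: testz_def)
  then show ?thesis using assms(4-) exec_guard[of _ "[VarNeq i 0]"] unfolding ex_def by force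
qed

text \<open>Invariant of the carry: the bits below \<open>l\<close> were ones and have been cleared,
  so the original number was \<open>u * 2 ^ l + (2 ^ l - 1)\<close> and its successor is
  \<open>(u + 1) * 2 ^ l\<close>. The reduction modulo \<open>2 ^ m\<close> covers a carry that runs
  out at \<open>l = m\<close>.\<close>

lemma ex_Cnt_up:
  assumes "c < 2" "v c < 2 ^ m" "l \<le> m" "v c = u * 2 ^ l" "w = (u + 1) * 2 ^ l mod 2 ^ m"
  shows "ex (Cnt c 0 l) (mk m v r) (mk m (v(c := w)) r)"
  using assms(2-)
proof (induction "m - l" arbitrary: l u v)
  case 0
  then have "l = m" "u = 0" by auto
  then have "w = 0" "v(c := w) = v" using 0 by auto
  moreover have "lcode (Cnt c 0 l) = lfinal m (lblk (Cnt c 0 l))" using assms(1) \<open>l = m\<close> by (simp add: lfinal_def)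
  ultimately show ?case using ex_final by metis
next
  case (Suc k)
  then have l: "l < m" by simp
  have bit: "bit (v c) l \<longleftrightarrow> odd u" unfolding Suc.prems by (simp add: bit_iff_odd)
  have c: "c mod 2 = c" "c < 4" using assms(1) by auto
  have E0: "E P (Cnt c 0 l) = switchc (var c l) [(0, lcode (Cnt c 1 l)), (1, lcode (Cnt c 2 l))]" using l c by simp
  have E1: "E P (Cnt c 1 l) = setc (var c l) 1 (lcode (Cnt c 0 m))" using l c assms(1) by simp
  have E2: "E P (Cnt c 2 l) = setc (var c l) 0 (lcode (Cnt c 0 (Suc l)))" using l c assms(1) by simp
  note mem = label_mem(3)[OF c(2) _ less_imp_le[OF l]]
  show ?case
  proof (cases "odd u")
    case False
    then obtain a where a: "u = 2 * a" by (auto elim: evenE)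
    have pm: "(2 :: nat) ^ m = 2 ^ (m - Suc l) * 2 ^ Suc l" using l by (subst power_add[symmetric]) simp
    have "a * 2 ^ Suc l < 2 ^ m" using Suc.prems(1,3) a by (simp add: algebra_simps)
    then have "a < 2 ^ (m - Suc l)" unfolding pm mult_less_cancel2 by blast
    then have "Suc a * 2 ^ Suc l \<le> 2 ^ m" unfolding pm by (intro mult_le_mono1) simp
    moreover have "(u + 1) * 2 ^ l < Suc a * 2 ^ Suc l" using a by (simp add: algebra_simps)
    ultimately have lt: "(u + 1) * 2 ^ l < 2 ^ m" by linarith
    have w: "w = v c + 2 ^ l" unfolding Suc.prems(4) mod_less[OF lt] Suc.prems(3) by simp
    have "ex (Cnt c 0 m) (mk m (v(c := w)) r) (mk m (v(c := w)) r)"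
      by (rule ex_final) (use assms(1) in \<open>simp add: lfinal_def\<close>)
    then have "ex (Cnt c 1 l) (mk m v r) (mk m (v(c := w)) r)"
      using mk_set(1)[OF assms(1) l, of v r] bit False w by (intro ex_set[OF E1 mem]) auto
    then show ?thesis
      by (intro ex_switch[OF E0 mem, of _ "Cnt c 1 l"]) (use mk_var[OF assms(1)] bit False in auto)
  next
    case True
    then obtain a where a: "u = 2 * a + 1" by (auto elim: oddE)
    let ?v = "v(c := v c - 2 ^ l)"
    have "ex (Cnt c 0 (Suc l)) (mk m ?v r) (mk m (?v(c := w)) r)"
    proof (rule Suc.hyps(1)[where u = a])
      show "?v c < 2 ^ m" using Suc.prems(1) by (simp add: less_imp_diff_less)
      show "w = (a + 1) * 2 ^ Suc l mod 2 ^ m" using Suc.prems(4) a by (simp add: algebra_simps)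
    qed (use Suc a l in \<open>auto simp: algebra_simps\<close>)
    then have "ex (Cnt c 2 l) (mk m v r) (mk m (v(c := w)) r)"
      using mk_set(2)[OF assms(1) l, of v r] bit True by (intro ex_set[OF E2 mem]) auto
    then show ?thesis
      by (intro ex_switch[OF E0 mem, of _ "Cnt c 2 l"]) (use mk_var[OF assms(1)] bit True l in auto)
  qed
qed

text \<open>Invariant of the borrow: the bits below \<open>l\<close> were zeros and have been set,
  so \<open>v c - 2 ^ l\<close> is the original number minus one, and \<open>v c < 2 ^ l\<close>
  means that the original number was 0 and wraps round.\<close>

lemma ex_Cnt_down:
  assumes "c < 2" "l \<le> m" "v c < 2 ^ m" "v c mod 2 ^ l = 2 ^ l - 1"
    "w = (if v c < 2 ^ l then 2 ^ m - 1 else v c - 2 ^ l)"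
  shows "ex (Cnt (c + 2) 0 l) (mk m v r) (mk m (v(c := w)) r)"
  using assms(2-)
proof (induction "m - l" arbitrary: l v)
  case 0
  then have "l = m" "w = v c" by auto
  moreover have "lcode (Cnt (c + 2) 0 l) = lfinal m (lblk (Cnt (c + 2) 0 l))" using assms(1) \<open>l = m\<close> by (simp add: lfinal_def)
  ultimately show ?case using ex_final by (metis fun_upd_triv)
next
  case (Suc k)
  then have l: "l < m" by simp
  have c: "(c + 2) mod 2 = c" "c + 2 < 4" using assms(1) by auto
  have E0: "E P (Cnt (c + 2) 0 l) = switchc (var c l) [(0, lcode (Cnt (c + 2) 1 l)), (1, lcode (Cnt (c + 2) 2 l))]" using l c by simp
  have E1: "E P (Cnt (c + 2) 1 l) = setc (var c l) 1 (lcode (Cnt (c + 2) 0 (Suc l)))" using l c assms(1) by simp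
  have E2: "E P (Cnt (c + 2) 2 l) = setc (var c l) 0 (lcode (Cnt (c + 2) 0 m))" using l c assms(1) by simp
  note mem = label_mem(3)[OF c(2) _ less_imp_le[OF l]]
  define u where "u = v c div 2 ^ l"
  have vu: "v c = u * 2 ^ l + (2 ^ l - 1)" using Suc.prems(3) div_mult_mod_eq[of "v c" "2 ^ l"] by (simp add: u_def)
  have bit: "bit (v c) l \<longleftrightarrow> odd u" by (simp add: bit_iff_odd u_def)
  have p: "(1 :: nat) \<le> 2 ^ l" by simp
  show ?case
  proof (cases "odd u")
    case True
    then have "1 \<le> u" by (cases u) auto
    then have "1 * 2 ^ l \<le> u * 2 ^ l" by (intro mult_le_mono) auto
    then have "2 ^ l \<le> v c" unfolding vu mult_1 by linarith
    then have w: "w = v c - 2 ^ l" using Suc.prems by simp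
    have "ex (Cnt (c + 2) 0 m) (mk m (v(c := w)) r) (mk m (v(c := w)) r)"
      by (rule ex_final) (use assms(1) in \<open>simp add: lfinal_def\<close>)
    then have "ex (Cnt (c + 2) 2 l) (mk m v r) (mk m (v(c := w)) r)"
      using mk_set(2)[OF assms(1) l, of v r] bit True w by (intro ex_set[OF E2 mem]) auto
    then show ?thesis
      by (intro ex_switch[OF E0 mem, of _ "Cnt (c + 2) 2 l"]) (use mk_var[OF assms(1)] bit True l in auto)
  next
    case False
    then obtain a where a: "u = 2 * a" by (auto elim: evenE)
    let ?v = "v(c := v c + 2 ^ l)"
    have ua: "u * 2 ^ l = 2 * (a * 2 ^ l)" "a * 2 ^ Suc l = 2 * (a * 2 ^ l)" "(2 :: nat) ^ Suc l = 2 * 2 ^ l" using a by simp_all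
    have v2: "v c + 2 ^ l = a * 2 ^ Suc l + (2 ^ Suc l - 1)" using vu ua p by linarith
    have pm: "(2 :: nat) ^ m = 2 ^ (m - Suc l) * 2 ^ Suc l" using l by (subst power_add[symmetric]) simp
    have "a * 2 ^ Suc l < 2 ^ m" using Suc.prems(2) vu ua by linarith
    then have "a < 2 ^ (m - Suc l)" unfolding pm mult_less_cancel2 by blast
    then have "Suc a * 2 ^ Suc l \<le> 2 ^ m" unfolding pm by (intro mult_le_mono1) simp
    then have lt: "v c + 2 ^ l < 2 ^ m" using v2 ua p unfolding mult_Suc by linarith
    have a_pos: "2 ^ l \<le> a * 2 ^ l" if "a \<noteq> 0" using that by (cases a) auto
    have a0: "v c < 2 ^ l \<longleftrightarrow> a = 0"
    proof
      assume "v c < 2 ^ l"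
      then show "a = 0" using vu ua p a_pos by linarith
    next
      assume "a = 0"
      then have "v c = 2 ^ l - 1" using vu a by simp
      then show "v c < 2 ^ l" using p by linarith
    qed
    have a1: "v c + 2 ^ l < 2 ^ Suc l \<longleftrightarrow> a = 0"
    proof
      assume "v c + 2 ^ l < 2 ^ Suc l"
      then show "a = 0" using v2 ua p a_pos by linarith
    next
      assume "a = 0"
      then have "v c = 2 ^ l - 1" using vu a by simp
      then show "v c + 2 ^ l < 2 ^ Suc l" using p ua(3) by linarith
    qed
    have "ex (Cnt (c + 2) 0 (Suc l)) (mk m ?v r) (mk m (?v(c := w)) r)"
    proof (rule Suc.hyps(1))
      show "?v c < 2 ^ m" using lt by simp
      show "?v c mod 2 ^ Suc l = 2 ^ Suc l - 1" unfolding fun_upd_same v2 mod_mult_self3 by (rule mod_less) simp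
      show "w = (if ?v c < 2 ^ Suc l then 2 ^ m - 1 else ?v c - 2 ^ Suc l)"
        using Suc.prems(4) a0 a1 by simp
    qed (use Suc l in auto)
    then have "ex (Cnt (c + 2) 1 l) (mk m v r) (mk m (v(c := w)) r)"
      using mk_set(1)[OF assms(1) l, of v r] bit False by (intro ex_set[OF E1 mem]) auto
    then show ?thesis
      by (intro ex_switch[OF E0 mem, of _ "Cnt (c + 2) 1 l"]) (use mk_var[OF assms(1)] bit False in auto)
  qed
qed

definition st :: "nat \<Rightarrow> nat \<Rightarrow> nat \<Rightarrow> nat \<Rightarrow> nat" where
  "st t d r = mk m (\<lambda>c. if c = 0 then d else t) r"

abbreviation "R \<equiv> (2 :: nat) ^ pm P"

lemma mk_cong: "(\<And>c. c < 2 \<Longrightarrow> v c = v' c) \<Longrightarrow> mk m v r = mk m v' r"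
  by (simp add: mk_def fun_eq_iff)

lemma st_upd:
  "mk m ((\<lambda>c. if c = 0 then d else t)(0 := n)) r = st t n r"
  "mk m ((\<lambda>c. if c = 0 then d else t)(1 := n)) r = st n d r"
  unfolding st_def by (rule mk_cong, auto)+

lemma ex_inc_d: "d < R \<Longrightarrow> ex (Cnt 0 0 0) (st t d r) (st t ((d + 1) mod R) r)"
  unfolding st_upd(1)[of d t "(d + 1) mod R", symmetric] st_def[of t d] by (rule ex_Cnt_up[where u = d]) simp_all

lemma ex_inc_t: "t < R \<Longrightarrow> ex (Cnt 1 0 0) (st t d r) (st ((t + 1) mod R) d r)"
  unfolding st_upd(2)[of d t "(t + 1) mod R", symmetric] st_def[of t d] by (rule ex_Cnt_up[where u = t]) simp_all

lemma ex_dec_d: "d < R \<Longrightarrow> ex (Cnt 2 0 0) (st t d r) (st t (if d = 0 then R - 1 else d - 1) r)"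
proof -
  assume d: "d < R"
  have "ex (Cnt (0 + 2) 0 0) (mk m (\<lambda>c. if c = 0 then d else t) r)
      (mk m ((\<lambda>c. if c = 0 then d else t)(0 := if d = 0 then R - 1 else d - 1)) r)"
    by (rule ex_Cnt_down) (use d in simp_all)
  then show ?thesis by (simp only: st_upd st_def[of t d] add_0)
qed

lemma ex_dec_t: "t < R \<Longrightarrow> 0 < t \<Longrightarrow> ex (Cnt 3 0 0) (st t d r) (st (t - 1) d r)"
proof -
  assume t: "t < R" "0 < t"
  have "ex (Cnt (1 + 2) 0 0) (mk m (\<lambda>c. if c = 0 then d else t) r) (mk m ((\<lambda>c. if c = 0 then d else t)(1 := t - 1)) r)"
    by (rule ex_Cnt_down) (use t in simp_all)
  moreover have "1 + 2 = (3 :: nat)" by simp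
  ultimately show ?thesis by (simp only: st_upd st_def[of t d])
qed

lemma st_var: "st t d r (var 0 l) = of_bool (l < m \<and> bit d l)" "st t d r (var 1 l) = of_bool (l < m \<and> bit t l)"
  by (simp_all add: st_def mk_var)

lemma st_0 [simp]: "st t d r 0 = r" "(st t d r)(0 := r') = st t d r'"
  by (simp_all add: st_def)

lemma ex_test_d:
  assumes "E P x = testz (map (var 0) [0..<m]) (lcode y) (lcode z)" "x \<in> set (labels P)" "d < R"
    "lblk y = lblk x" "lblk z = lblk x" "d = 0 \<Longrightarrow> ex y (st t d r) \<rho>'" "d \<noteq> 0 \<Longrightarrow> ex z (st t d r) \<rho>'"
  shows "ex x (st t d r) \<rho>'"
proof (cases "d = 0")
  case True
  then show ?thesis using ex_test_zero[OF assms(1,2) _ assms(4)] assms(6) by (simp add: st_var)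
next
  case False
  then obtain l where "l < m" "bit d l" using zero_bits[OF assms(3)] by blast
  then show ?thesis using ex_test_nonzero[OF assms(1,2), of "var 0 l" _ ] assms(5,7) False by (simp add: st_var)
qed

lemma ex_test_t:
  assumes "E P x = testz (map (var 1) [0..<m]) (lcode y) (lcode z)" "x \<in> set (labels P)" "t < R"
    "lblk y = lblk x" "lblk z = lblk x" "t = 0 \<Longrightarrow> ex y (st t d r) \<rho>'" "t \<noteq> 0 \<Longrightarrow> ex z (st t d r) \<rho>'"
  shows "ex x (st t d r) \<rho>'"
proof (cases "t = 0")
  case True
  then show ?thesis using ex_test_zero[OF assms(1,2) _ assms(4)] assms(6) by (simp add: st_var del: One_nat_def)
next
  case False
  then obtain l where "l < m" "bit t l" using zero_bits[OF assms(3)] by blast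
  then show ?thesis using ex_test_nonzero[OF assms(1,2), of "var 1 l"] assms(5,7) False
    by (simp add: st_var del: One_nat_def)
qed

definition base :: "nat \<Rightarrow> nat" where
  "base d = (if d < length (ptab P) then ptab P ! d else pbl P)"

text \<open>The function computed by block 1. The arguments of \<open>pcomb\<close> are the values
  under the heads and at the left neighbour, the offset itself and the right neighbour, with
  wrap-around so that negative offsets occupy the upper end of the range.\<close>

fun val :: "nat \<Rightarrow> nat \<Rightarrow> nat" where
  "val 0 d = base d"
| "val (Suc t) d = pcomb P (val t 0) (val t (if d = 0 then R - 1 else d - 1)) (val t d) (val t ((d + 1) mod R))"

lemma val_less: "val t d < K"
proof (induction t arbitrary: d)
  case 0
  then show ?case using wf nth_mem[of d "ptab P"] by (auto simp: base_def wf_prog_def subset_iff)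
next
  case (Suc t)
  then show ?case using wf by (simp add: wf_prog_def)
qed

lemma linit_simps: "linit (lblk (AS xs)) = lcode (AS [0])" "linit (lblk (ZS j)) = lcode (ZS 0)"
  "c < 4 \<Longrightarrow> linit (lblk (Cnt c j l)) = lcode (Cnt c 0 0)" "linit (lblk (LookS l j)) = lcode (LookS l 0)"
  by (simp_all add: linit_def)

lemma linit_nums [simp]: "linit (Suc 0) = lcode (AS [0])" "linit 2 = lcode (ZS 0)" "linit 3 = lcode (Cnt 0 0 0)"
  "linit 4 = lcode (Cnt 1 0 0)" "linit 5 = lcode (Cnt 2 0 0)" "linit 6 = lcode (Cnt 3 0 0)"
  by (simp_all add: linit_def)

text \<open>At level \<open>l\<close> the register has been counted down \<open>l\<close> times, so
  \<open>d + l\<close> is the offset that was asked for. At level \<open>length (ptab P)\<close>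
  this offset is beyond the table for every \<open>d\<close>.\<close>

lemma ex_Look: "l \<le> length (ptab P) \<Longrightarrow> d < R \<Longrightarrow> ex (LookS l 0) (st t d r) (st t d (base (d + l)))"
proof (induction "length (ptab P) - l" arbitrary: l d r)
  case 0
  then have E: "E P (LookS l 0) = setc 0 (pbl P) (lcode (LookS l 5))" "base (d + l) = pbl P"
    by (simp_all add: base_def)
  show ?case unfolding E(2)
    by (rule ex_set[OF E(1) label_mem(4)]) (use 0 in \<open>auto intro!: ex_final simp: lfinal_def\<close>)
next
  case (Suc k)
  note mem = label_mem(4)[OF _ Suc.prems(1)]
  have l: "l < length (ptab P)" using Suc.hyps(2) by linarith
  have fin: "ex (LookS l 5) \<rho> \<rho>" for \<rho> by (rule ex_final) (simp add: lfinal_def)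
  show ?case
  proof (rule ex_test_d[of "LookS l 0" "LookS l 1" "LookS l 2"])
    show "E P (LookS l 0) = testz (map (var 0) [0..<m]) (lcode (LookS l 1)) (lcode (LookS l 2))"
      using l by simp
    show "ex (LookS l 1) (st t d r) (st t d (base (d + l)))" if "d = 0"
      by (rule ex_set[of _ 0 "ptab P ! l" "LookS l 5"]) (use l that fin mem in \<open>auto simp: base_def\<close>)
    show "ex (LookS l 2) (st t d r) (st t d (base (d + l)))" if "d \<noteq> 0"
    proof (rule ex_call[of _ "Cnt 2 0 0" "LookS l 3"])
      show "ex (Cnt 2 0 0) (st t d r) (st t (d - 1) r)" using ex_dec_d[OF Suc.prems(2), of t r] that by simp
      show "ex (LookS l 3) (st t (d - 1) r) (st t d (base (d + l)))"
      proof (rule ex_call[of _ "LookS (Suc l) 0" "LookS l 4"])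
        show "ex (LookS (Suc l) 0) (st t (d - 1) r) (st t (d - 1) (base (d + l)))"
          using Suc.hyps(1)[of "Suc l" "d - 1" r] Suc.hyps(2) Suc.prems that by simp
        show "ex (LookS l 4) (st t (d - 1) (base (d + l))) (st t d (base (d + l)))"
        proof (rule ex_call[of _ "Cnt 0 0 0" "LookS l 5"])
          show "ex (Cnt 0 0 0) (st t (d - 1) (base (d + l))) (st t d (base (d + l)))"
            using ex_inc_d[of "d - 1" t "base (d + l)"] Suc.prems(2) that by simp
        qed (use fin mem l linit_simps in auto)
      qed (use mem l linit_simps in auto)
    qed (use mem l linit_simps in auto)
  qed (use mem Suc.prems in auto)
qed

lemma mod_inc_dec: "d < R \<Longrightarrow> ((if d = 0 then R - 1 else d - 1) + 1) mod R = d"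
  "d < R \<Longrightarrow> (if (d + 1) mod R = 0 then R - 1 else (d + 1) mod R - 1) = d"
proof -
  assume d: "d < R"
  then have m: "(d + 1) mod R = (if d + 1 = R then 0 else d + 1)" by auto
  show "((if d = 0 then R - 1 else d - 1) + 1) mod R = d" using d by auto
  show "(if (d + 1) mod R = 0 then R - 1 else (d + 1) mod R - 1) = d" unfolding m using d by auto
qed

text \<open>Induction on the number of increments until \<open>d\<close> wraps round to 0. Each
  frame undoes its own increment on return, so \<open>d\<close> is recovered without having been
  stored. Block 1 is called at offset 0 only, hence the form of the first assumption.\<close>

lemma ex_Z:
  assumes "\<And>r. ex (AS [0]) (st t 0 r) (st t 0 (val t 0))" "d < R"
  shows "ex (ZS 0) (st t d r) (st t d (val t 0))"
  using assms(2)
proof (induction "if d = 0 then 0 else R - d" arbitrary: d r rule: less_induct)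
  case less
  have fin: "ex (ZS 5) \<rho> \<rho>" for \<rho> by (rule ex_final) (simp add: lfinal_def)
  show ?case
  proof (rule ex_test_d[of "ZS 0" "ZS 1" "ZS 2"])
    show "ex (ZS 1) (st t d r) (st t d (val t 0))" if "d = 0"
      unfolding that by (rule ex_call[OF _ _ _ _ assms(1) fin]) (use linit_simps in \<open>auto intro!: label_mem\<close>)
    show "ex (ZS 2) (st t d r) (st t d (val t 0))" if "d \<noteq> 0"
    proof (rule ex_call[of _ "Cnt 0 0 0" "ZS 3"])
      show "ex (Cnt 0 0 0) (st t d r) (st t ((d + 1) mod R) r)" by (rule ex_inc_d[OF less.prems])
      show "ex (ZS 3) (st t ((d + 1) mod R) r) (st t d (val t 0))"
      proof (rule ex_call[of _ "ZS 0" "ZS 4"])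
        have "(d + 1) mod R = (if d + 1 = R then 0 else d + 1)" using less.prems by auto
        then show "ex (ZS 0) (st t ((d + 1) mod R) r) (st t ((d + 1) mod R) (val t 0))"
          using less.prems that by (intro less.hyps) auto
        show "ex (ZS 4) (st t ((d + 1) mod R) (val t 0)) (st t d (val t 0))"
        proof (rule ex_call[of _ "Cnt 2 0 0" "ZS 5"])
          show "ex (Cnt 2 0 0) (st t ((d + 1) mod R) (val t 0)) (st t d (val t 0))"
            using ex_dec_d[of "(d + 1) mod R" t "val t 0"] unfolding mod_inc_dec(2)[OF less.prems] by simp
        qed (use fin linit_simps in \<open>auto intro!: label_mem\<close>)
      qed (use linit_simps in \<open>auto intro!: label_mem\<close>)
    qed (use linit_simps in \<open>auto intro!: label_mem\<close>)
  qed (use less.prems in \<open>auto intro!: label_mem\<close>)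
qed

lemma ex_A: "t < R \<Longrightarrow> d < R \<Longrightarrow> ex (AS [0]) (st t d r) (st t d (val t d))"
proof (induction t arbitrary: d r)
  case 0
  have fin: "ex (AS [15]) \<rho> \<rho>" for \<rho> by (rule ex_final) (simp add: lfinal_def)
  have seven: "lblk (LookS 0 0) = 7" by simp
  show ?case
  proof (rule ex_test_t[of "AS [0]" "AS [1]" "AS [2]"])
    show "ex (AS [1]) (st 0 d r) (st 0 d (val 0 d))"
      by (rule ex_call[of _ "LookS 0 0" "AS [15]", OF _ _ _ linit_simps(4) _ fin, unfolded seven])
        (use ex_Look[of 0 d 0 r] 0 in \<open>auto intro!: label_mem\<close>)
  qed (auto intro!: label_mem simp: 0)
next
  case (Suc t)
  have t: "t < R" using Suc.prems by simp
  have fin: "ex (AS [15]) \<rho> \<rho>" for \<rho> by (rule ex_final) (simp add: lfinal_def)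
  define dm where "dm = (if d = 0 then R - 1 else d - 1)"
  define dp where "dp = (d + 1) mod R"
  have dR: "dm < R" "dp < R" using Suc.prems(2) by (auto simp: dm_def dp_def)
  define a b c e where "a = val t 0" and "b = val t dm" and "c = val t d" and "e = val t dp"
  have K: "a < K" "b < K" "c < K" "e < K" by (simp_all add: a_def b_def c_def e_def val_less)
  define f where "f = pcomb P a b c e"
  have f: "f < K" "val (Suc t) d = f"
    using val_less[of "Suc t" d] by (simp_all add: f_def a_def b_def c_def e_def dm_def dp_def)
  note mem = label_mem(5-8)
  have inc: "ex (Cnt 0 0 0) (st t dm r) (st t d r)" "ex (Cnt 0 0 0) (st t d r) (st t dp r)"
    "ex (Cnt 2 0 0) (st t d r) (st t dm r)" "ex (Cnt 2 0 0) (st t dp r) (st t d r)" for r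
    using ex_inc_d[OF dR(1), of t r] ex_inc_d[OF Suc.prems(2), of t r] ex_dec_d[OF Suc.prems(2), of t r]
      ex_dec_d[OF dR(2), of t r] mod_inc_dec[OF Suc.prems(2)] unfolding dm_def dp_def by simp_all
  have inct: "ex (Cnt 1 0 0) (st t d r) (st (Suc t) d r)" "ex (Cnt 3 0 0) (st (Suc t) d r) (st t d r)" for r
    using ex_inc_t[OF t, of d r] ex_dec_t[OF Suc.prems(1), of d r] Suc.prems(1) by simp_all
  have Z: "ex (ZS 0) (st t d r) (st t d a)" for r
    unfolding a_def by (rule ex_Z[OF Suc.IH[OF t] Suc.prems(2)]) simp
  note A = Suc.IH[OF t dR(1), folded b_def] Suc.IH[OF t Suc.prems(2), folded c_def] Suc.IH[OF t dR(2), folded e_def]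
  \<comment> \<open>\<open>ex\<close> describes the run from a location to the end of its block, so
    the body is assembled backwards along the control flow.\<close>
  have s17: "ex (AS [17, f]) (st (Suc t) d r) (st (Suc t) d f)" for r
    by (rule ex_set[of _ 0 f "AS [15]"]) (use fin f(1) in \<open>auto intro!: mem\<close>)
  have s16: "ex (AS [16, f]) (st t d r) (st (Suc t) d f)" for r
    by (rule ex_call[of _ "Cnt 1 0 0" "AS [17, f]", OF _ _ _ _ inct(1) s17]) (use f(1) linit_simps in \<open>auto intro!: mem\<close>)
  have s14: "ex (AS [14, f]) (st t dp r) (st (Suc t) d f)" for r
    by (rule ex_call[of _ "Cnt 2 0 0" "AS [16, f]", OF _ _ _ _ inc(4) s16]) (use f(1) linit_simps in \<open>auto intro!: mem\<close>)
  have s13: "ex (AS [13, a, b, c]) (st t dp e) (st (Suc t) d f)"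
    by (rule ex_switch[of _ 0 "map (\<lambda>e. (e, lcode (AS [14, pcomb P a b c e]))) [0..<K]" _ "AS [14, f]", OF _ _ _ _ s14])
      (use K in \<open>auto intro!: mem simp: f_def simp del: lcode.simps\<close>)
  have s12: "ex (AS [12, a, b, c]) (st t dp r) (st (Suc t) d f)" for r
    by (rule ex_call[of _ "AS [0]" "AS [13, a, b, c]", OF _ _ _ _ A(3) s13]) (use K linit_simps in \<open>auto intro!: mem\<close>)
  have s11: "ex (AS [11, a, b, c]) (st t d r) (st (Suc t) d f)" for r
    by (rule ex_call[of _ "Cnt 0 0 0" "AS [12, a, b, c]", OF _ _ _ _ inc(2) s12]) (use K linit_simps in \<open>auto intro!: mem\<close>)
  have s10: "ex (AS [10, a, b]) (st t d c) (st (Suc t) d f)"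
    by (rule ex_switch[of _ 0 "map (\<lambda>c. (c, lcode (AS [11, a, b, c]))) [0..<K]" _ "AS [11, a, b, c]", OF _ _ _ _ s11])
      (use K in \<open>auto intro!: mem simp del: lcode.simps\<close>)
  have s9: "ex (AS [9, a, b]) (st t d r) (st (Suc t) d f)" for r
    by (rule ex_call[of _ "AS [0]" "AS [10, a, b]", OF _ _ _ _ A(2) s10]) (use K linit_simps in \<open>auto intro!: mem\<close>)
  have s8: "ex (AS [8, a, b]) (st t dm r) (st (Suc t) d f)" for r
    by (rule ex_call[of _ "Cnt 0 0 0" "AS [9, a, b]", OF _ _ _ _ inc(1) s9]) (use K linit_simps in \<open>auto intro!: mem\<close>)
  have s7: "ex (AS [7, a]) (st t dm b) (st (Suc t) d f)"
    by (rule ex_switch[of _ 0 "map (\<lambda>b. (b, lcode (AS [8, a, b]))) [0..<K]" _ "AS [8, a, b]", OF _ _ _ _ s8])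
      (use K in \<open>auto intro!: mem simp del: lcode.simps\<close>)
  have s6: "ex (AS [6, a]) (st t dm r) (st (Suc t) d f)" for r
    by (rule ex_call[of _ "AS [0]" "AS [7, a]", OF _ _ _ _ A(1) s7]) (use K linit_simps in \<open>auto intro!: mem\<close>)
  have s5: "ex (AS [5, a]) (st t d r) (st (Suc t) d f)" for r
    by (rule ex_call[of _ "Cnt 2 0 0" "AS [6, a]", OF _ _ _ _ inc(3) s6]) (use K linit_simps in \<open>auto intro!: mem\<close>)
  have s4: "ex (AS [4]) (st t d a) (st (Suc t) d f)"
    by (rule ex_switch[of _ 0 "map (\<lambda>a. (a, lcode (AS [5, a]))) [0..<K]" _ "AS [5, a]", OF _ _ _ _ s5])
      (use K in \<open>auto intro!: mem simp del: lcode.simps\<close>)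
  have s3: "ex (AS [3]) (st t d r) (st (Suc t) d f)" for r
    by (rule ex_call[of _ "ZS 0" "AS [4]", OF _ _ _ _ Z s4]) (use linit_simps in \<open>auto intro!: mem\<close>)
  have s2: "ex (AS [2]) (st (Suc t) d r) (st (Suc t) d f)" for r
    by (rule ex_call[of _ "Cnt 3 0 0" "AS [3]", OF _ _ _ _ inct(2) s3]) (use linit_simps in \<open>auto intro!: mem\<close>)
  show ?case unfolding f(2)
    by (rule ex_test_t[of "AS [0]" "AS [1]" "AS [2]"]) (use s2 Suc.prems in \<open>auto intro!: mem\<close>)
qed

section \<open>Coverability of the goal\<close>

lemma main_result:
  assumes "summ A U 0 (\<lambda>_. 0) (lcode (MainS 3)) \<rho>"
  shows "val (2 ^ (m - 1)) 0 \<in> set (pacc P)"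
proof -
  have m: "0 < m" using wf by (simp add: wf_prog_def)
  have step: "\<exists>x\<in>set (labels P). lblk x = 0 \<and> s = lcode x \<and> (a, s') \<in> set (E P x)" if "(s, a, s') \<in> block_trans A 0" for s a s'
    using that by (auto simp: the_qdas_def)
  have main: "x \<in> {MainS 0, MainS 1, MainS 2, MainS 3}" if "x \<in> set (labels P)" "lblk x = 0" for x
    using that(1) by (cases rule: label_cases) (use that(2) in auto)
  note simps = setc_def callc_def switchc_def
  \<comment> \<open>The induction follows the four locations of main. From location 2 on it records
    a complete run of block 1, whose result is then identified by \<open>exec_det\<close> with the
    run constructed in \<open>ex_A\<close>.\<close>
  have inv: "(s = lcode (MainS 0) \<longrightarrow> \<rho> = (\<lambda>_. 0)) \<and> (s = lcode (MainS 1) \<longrightarrow> \<rho> = (\<lambda>_. 0)(var 1 (m - 1) := 1)) \<and>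
      (s = lcode (MainS 2) \<longrightarrow> exec A 1 (init_state A 1) ((\<lambda>_. 0)(var 1 (m - 1) := 1)) \<rho>) \<and>
      (s = lcode (MainS 3) \<longrightarrow> exec A 1 (init_state A 1) ((\<lambda>_. 0)(var 1 (m - 1) := 1)) \<rho> \<and> \<rho> 0 \<in> set (pacc P))"
    if "summ A U b \<rho>0 s \<rho>" "b = 0" "\<rho>0 = (\<lambda>_. 0)" for U b \<rho>0 s \<rho>
    using that
  proof (induction rule: summ.induct)
    case (summ_init U b \<rho>)
    then show ?case by (simp add: the_qdas_def linit_def)
  next
    case (summ_guard U b \<rho>0 s \<rho> g s')
    then obtain x where x: "x \<in> {MainS 0, MainS 1, MainS 2, MainS 3}" "s = lcode x" "(Guard g, s') \<in> set (E P x)"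
      using step main by metis
    note IH = summ_guard.IH[OF summ_guard.prems] and h = summ_guard.hyps(3)
    show ?case using x(1) by (elim insertE emptyE) (use x(2,3) IH h in \<open>auto simp: simps\<close>)
  next
    case (summ_assign U b \<rho>0 s \<rho> y d s')
    then obtain x where x: "x \<in> {MainS 0, MainS 1, MainS 2, MainS 3}" "s = lcode x" "(Assign y d, s') \<in> set (E P x)"
      using step main by metis
    note IH = summ_assign.IH[OF summ_assign.prems]
    show ?case using x(1) by (elim insertE emptyE) (use x(2,3) IH in \<open>auto simp: simps\<close>)
  next
    case (summ_call U b \<rho>0 s \<rho> q b' s' \<rho>')
    then obtain x where x: "x \<in> {MainS 0, MainS 1, MainS 2, MainS 3}" "s = lcode x" "(DispatchS q b', s') \<in> set (E P x)"
      using step main by metis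
    note IH = summ_call.IH(1)[OF summ_call.prems] and h = summ_exec[OF summ_call.hyps(4)]
    show ?case using x(1) by (elim insertE emptyE) (use x(2,3) IH h in \<open>auto simp: simps\<close>)
  qed
  have 1: "exec A 1 (init_state A 1) ((\<lambda>_. 0)(var 1 (m - 1) := 1)) \<rho>" "\<rho> 0 \<in> set (pacc P)"
    using inv[OF assms refl refl] by auto
  \<comment> \<open>Setting the top bit of register 1 in the all-zero valuation makes the time
    \<open>2 ^ (m - 1)\<close> and leaves the offset at 0.\<close>
  have z: "(\<lambda>_. 0)(var 1 (m - 1) := 1) = st (2 ^ (m - 1)) 0 0"
  proof -
    have z: "(\<lambda>_. 0) = mk m (\<lambda>_. 0) 0" by (auto simp: mk_def fun_eq_iff)
    have "(mk m (\<lambda>_. 0) 0)(var 1 (m - 1) := 1) = mk m ((\<lambda>_. 0)(1 := 0 + 2 ^ (m - 1))) 0"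
      using mk_set(1)[of 1 "m - 1" m "\<lambda>_. 0" 0] m by simp
    also have "\<dots> = st (2 ^ (m - 1)) 0 0" by (auto simp: st_def mk_def fun_eq_iff)
    finally show ?thesis using z by simp
  qed
  have "ex (AS [0]) (st (2 ^ (m - 1)) 0 0) (st (2 ^ (m - 1)) 0 (val (2 ^ (m - 1)) 0))"
    using m by (intro ex_A) auto
  moreover have "init_state A 1 = lcode (AS [0])" by (simp add: the_qdas_def linit_def)
  ultimately have "exec A 1 (init_state A 1) (st (2 ^ (m - 1)) 0 0) (st (2 ^ (m - 1)) 0 (val (2 ^ (m - 1)) 0))"
    unfolding ex_def lblk.simps by (simp only:)
  then have "\<rho> = st (2 ^ (m - 1)) 0 (val (2 ^ (m - 1)) 0)" by (rule exec_det[OF 1(1)[unfolded z]])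
  then show ?thesis using 1(2) by simp
qed

lemma main_exists:
  assumes "val (2 ^ (m - 1)) 0 \<in> set (pacc P)"
  shows "\<exists>\<rho>. summ A {} 0 (\<lambda>_. 0) (lcode (MainS 3)) \<rho>"
proof -
  have m: "0 < m" using wf by (simp add: wf_prog_def)
  have z: "(\<lambda>_. 0)(var 1 (m - 1) := 1) = st (2 ^ (m - 1)) 0 0"
  proof -
    have z: "(\<lambda>_. 0) = mk m (\<lambda>_. 0) 0" by (auto simp: mk_def fun_eq_iff)
    have "(mk m (\<lambda>_. 0) 0)(var 1 (m - 1) := 1) = mk m ((\<lambda>_. 0)(1 := 0 + 2 ^ (m - 1))) 0"
      using mk_set(1)[of 1 "m - 1" m "\<lambda>_. 0" 0] m by simp
    also have "\<dots> = st (2 ^ (m - 1)) 0 0" by (auto simp: st_def mk_def fun_eq_iff)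
    finally show ?thesis using z by simp
  qed
  let ?r = "val (2 ^ (m - 1)) 0"
  have "ex (MainS 0) (\<lambda>_. 0) (st (2 ^ (m - 1)) 0 ?r)"
  proof (rule ex_set[of _ "var 1 (m - 1)" 1 "MainS 1"])
    show "ex (MainS 1) ((\<lambda>_. 0)(var 1 (m - 1) := 1)) (st (2 ^ (m - 1)) 0 ?r)" unfolding z
    proof (rule ex_call[of _ "AS [0]" "MainS 2"])
      show "ex (AS [0]) (st (2 ^ (m - 1)) 0 0) (st (2 ^ (m - 1)) 0 ?r)" using m by (intro ex_A) auto
      show "ex (MainS 2) (st (2 ^ (m - 1)) 0 ?r) (st (2 ^ (m - 1)) 0 ?r)"
        by (rule ex_switch[of _ 0 "map (\<lambda>v. (v, lcode (MainS 3))) (pacc P)" _ "MainS 3"])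
          (use assms in \<open>auto intro!: label_mem ex_final simp: lfinal_def simp del: lcode.simps\<close>)
    qed (auto intro!: label_mem simp: linit_def)
  qed (auto intro!: label_mem)
  then have "exec A 0 (init_state A 0) (\<lambda>_. 0) (st (2 ^ (m - 1)) 0 ?r)"
    by (simp add: ex_def the_qdas_def linit_def)
  from exec_summ_post[OF this summ_init, of "{}"] show ?thesis
    by (auto simp: the_qdas_def lfinal_def)
qed

text \<open>Control enters the goal location through a guard, so neither a caller nor a fresh call
  vertex carries it. Coverage of \<open>the_goal\<close> therefore speaks about the topmost task
  alone.\<close>

lemma dispatch_target:
  assumes "(s, DispatchS q b', s') \<in> block_trans A b"
  shows "s' \<noteq> lcode (MainS 3)" "b' \<noteq> 0" "b' \<in> set (blks P)" "init_state A b' \<noteq> lcode (MainS 3)"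
proof -
  obtain x where x: "x \<in> set (labels P)" "lblk x = b" "(DispatchS q b', s') \<in> set (E P x)"
    using assms by (rule transE)
  obtain y where y: "y \<in> set (labels P)" "s' = lcode y" "lblk y = lblk x" and a: "DispatchS q b' \<in> actions A"
    using edge_ok[OF x(1,3)] by blast
  show b': "b' \<noteq> 0" "b' \<in> set (blks P)" using a by (auto simp: actions_def the_qdas_def)
  show "s' \<noteq> lcode (MainS 3)"
  proof
    assume "s' = lcode (MainS 3)"
    then have "y = MainS 3" using y(1,2) lcode_eq[OF _ label_mem(1)[of 3]] by simp
    then have "lblk x = 0" using y(3) by simp
    with x(1) obtain j where "x = MainS j" by (cases rule: label_cases) auto
    then show False using x(3) \<open>s' = lcode (MainS 3)\<close>
      by (auto simp: setc_def callc_def switchc_def split: if_splits)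
  qed
  obtain z where z: "z \<in> set (labels P)" "linit b' = lcode z" "lblk z = b'" using init_final_mem(1)[OF b'(2)] by blast
  show "init_state A b' \<noteq> lcode (MainS 3)"
  proof
    assume "init_state A b' = lcode (MainS 3)"
    then have "z = MainS 3" using z(1,2) lcode_eq[OF _ label_mem(1)[of 3]] by (simp add: the_qdas_def)
    then show False using z(3) b'(1) by simp
  qed
qed

lemma summ_state: "summ A U b \<rho>0 s \<rho> \<Longrightarrow> b \<in> set (blks P) \<Longrightarrow> \<exists>x\<in>set (labels P). s = lcode x \<and> lblk x = b"
proof (induction rule: summ.induct)
  case (summ_init U b \<rho>)
  then show ?case using init_final_mem(1) by (simp add: the_qdas_def)
qed (use edge_ok in \<open>metis transE\<close>)+

lemma entry_facts: "entry A b p \<rho>0 U fr \<Longrightarrow> cnt fr (lcode (MainS 3)) = 0 \<and> b \<in> set (blks P) \<and> (b = 0 \<longrightarrow> \<rho>0 = (\<lambda>_. 0))"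
proof (induction rule: entry.induct)
  case entry_main
  then show ?case by (simp add: the_qdas_def blks_def)
next
  case (entry_call b p \<rho>0 U fr s \<rho> q b' s')
  then show ?case using dispatch_target[OF entry_call.hyps(3)] by simp
qed

theorem coverable_iff: "parikh_coverable A the_goal \<longleftrightarrow> val (2 ^ (m - 1)) 0 \<in> set (pacc P)"
proof
  let ?g = "lcode (MainS 3)"
  have "?g \<in> block_states A 0" "0 \<in> blocks A" using label_mem(1)[of 3] by (auto simp: the_qdas_def blks_def)
  then have goal: "?g \<in> all_states A" "the_goal ?g = 1" unfolding all_states_def by (blast, simp add: the_goal_def)
  assume "parikh_coverable A the_goal"
  then obtain b p \<rho>0 U fr s \<rho> where e: "entry A b p \<rho>0 U fr" and s: "summ A U b \<rho>0 s \<rho>" and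
    c: "(\<forall>t\<in>all_states A. the_goal t \<le> cnt ((b, s, p) # fr) t) \<or>
     (\<exists>q b' s'. (s, DispatchS q b', s') \<in> block_trans A b \<and>
        (\<forall>t\<in>all_states A. the_goal t \<le> cnt ((b', init_state A b', Some q) # (b, s', p) # fr) t))"
    unfolding parikh_coverable_iff[OF is_qdas synchronous] by blast
  note ef = entry_facts[OF e]
  from c have "s = ?g"
  proof
    assume "\<forall>t\<in>all_states A. the_goal t \<le> cnt ((b, s, p) # fr) t"
    then have "1 \<le> cnt ((b, s, p) # fr) ?g" using goal by metis
    then show ?thesis using ef by (cases "s = ?g") simp_all
  next
    assume "\<exists>q b' s'. (s, DispatchS q b', s') \<in> block_trans A b \<and>
        (\<forall>t\<in>all_states A. the_goal t \<le> cnt ((b', init_state A b', Some q) # (b, s', p) # fr) t)"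
    then obtain q b' s' where d: "(s, DispatchS q b', s') \<in> block_trans A b"
      "\<forall>t\<in>all_states A. the_goal t \<le> cnt ((b', init_state A b', Some q) # (b, s', p) # fr) t" by blast
    then have "1 \<le> cnt ((b', init_state A b', Some q) # (b, s', p) # fr) ?g" using goal by metis
    then show ?thesis using ef dispatch_target(1,4)[OF d(1)] by simp
  qed
  moreover have "b = 0"
  proof -
    obtain x where x: "x \<in> set (labels P)" "s = lcode x" "lblk x = b" using summ_state[OF s] ef by blast
    have "MainS 3 \<in> set (labels P)" by (rule label_mem) simp
    moreover have "lcode x = ?g" unfolding x(2)[symmetric] by (rule \<open>s = ?g\<close>)
    ultimately have "x = MainS 3" using lcode_eq[OF x(1)] by blast
    then show ?thesis using x(3) by simp
  qed
  ultimately show "val (2 ^ (m - 1)) 0 \<in> set (pacc P)" using main_result s ef by blast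
next
  assume "val (2 ^ (m - 1)) 0 \<in> set (pacc P)"
  then obtain \<rho> where "summ A {} 0 (\<lambda>_. 0) (lcode (MainS 3)) \<rho>" using main_exists by blast
  moreover have "entry A 0 None (\<lambda>_. 0) {} []" using entry_main[of A] by (simp add: the_qdas_def)
  moreover have "\<forall>t\<in>all_states A. the_goal t \<le> cnt [(0, lcode (MainS 3), None)] t" by (simp add: the_goal_def)
  ultimately show "parikh_coverable A the_goal" unfolding parikh_coverable_iff[OF is_qdas synchronous] by blast
qed

end

section \<open>Hardness\<close>

text \<open>A column of a configuration: the control state, one symbol per tape, and a flag for
  offset 0. The state is repeated in every column, so the column under the heads alone determines
  the transition and shows acceptance; the flag tells which column has just been
  overwritten.\<close>

type_synonym hview = "nat \<times> nat list \<times> bool"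

definition hviews :: "tm \<Rightarrow> hview list" where
  "hviews M = List.product [0..<num_states M]
     (List.product (product_lists (replicate (num_tapes M) [0..<num_symbols M])) [False, True])"

definition hidx :: "tm \<Rightarrow> hview \<Rightarrow> nat" where
  "hidx M v = (LEAST i. i < length (hviews M) \<and> hviews M ! i = v)"

lemma hidx: "v \<in> set (hviews M) \<Longrightarrow> hidx M v < length (hviews M) \<and> hviews M ! hidx M v = v"
  unfolding hidx_def by (rule LeastI_ex) (simp add: in_set_conv_nth)

lemma set_hviews:
  "(q, as, z) \<in> set (hviews M) \<longleftrightarrow> q < num_states M \<and> length as = num_tapes M \<and> set as \<subseteq> {..<num_symbols M}"
proof -
  have "list_all2 (\<lambda>x ys. x \<in> set ys) as (replicate n [0..<k]) \<longleftrightarrow> length as = n \<and> (\<forall>i<length as. as ! i < k)" for n k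
    by (auto simp: list_all2_conv_all_nth)
  moreover have "(\<forall>i<length as. as ! i < k) \<longleftrightarrow> set as \<subseteq> {..<k}" for k
    unfolding all_set_conv_all_nth[of as "\<lambda>x. x < k", symmetric] by auto
  ultimately have "list_all2 (\<lambda>x ys. x \<in> set ys) as (replicate n [0..<k]) \<longleftrightarrow> length as = n \<and> set as \<subseteq> {..<k}" for n k
    by simp
  then show ?thesis by (auto simp: hviews_def product_lists_set)
qed

text \<open>In a halting state every cell is rewritten by itself and no head moves. Halted
  configurations then obey the same local rule as all others.\<close>

definition hdelta :: "tm \<Rightarrow> nat \<Rightarrow> nat list \<Rightarrow> nat \<times> (nat \<times> move) list" where
  "hdelta M q as = (if q = accept_state M \<or> q = reject_state M then (q, map (\<lambda>a. (a, Stay)) as) else delta M q as)"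

text \<open>Offsets are relative to the heads, so a head move shifts the tape the opposite way:
  after a left move, offset \<open>d\<close> shows the cell that was at \<open>d - 1\<close>. If the
  source column is the one under the heads, the newly written symbol replaces the old one.\<close>

definition hcomb :: "tm \<Rightarrow> hview \<Rightarrow> hview \<Rightarrow> hview \<Rightarrow> hview \<Rightarrow> hview" where
  "hcomb M v0 vm v vp = (let (q', us) = hdelta M (fst v0) (fst (snd v0)) in
     (q', map (\<lambda>j. let u = (case snd (us ! j) of MoveLeft \<Rightarrow> vm | Stay \<Rightarrow> v | MoveRight \<Rightarrow> vp)
        in if snd (snd u) then fst (us ! j) else fst (snd u) ! j) [0..<num_tapes M], snd (snd v)))"

definition tview :: "tm_conf \<Rightarrow> int \<Rightarrow> hview" where
  "tview c d = (fst c, map (\<lambda>T. fst T (snd T + d)) (snd c), d = 0)"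

definition conf_ok :: "tm \<Rightarrow> tm_conf \<Rightarrow> bool" where
  "conf_ok M c \<longleftrightarrow> fst c < num_states M \<and> length (snd c) = num_tapes M \<and>
     (\<forall>T\<in>set (snd c). \<forall>i. fst T i < num_symbols M)"

lemma tview_in: "conf_ok M c \<Longrightarrow> tview c d \<in> set (hviews M)"
  by (auto simp: tview_def conf_ok_def set_hviews)

lemma tm_step_hdelta:
  assumes "length (snd c) = num_tapes M"
  shows "tm_step M c = (let (q', us) = hdelta M (fst c) (map scan (snd c)) in (q', map2 write_move (snd c) us))"
proof (cases "halted M c")
  case True
  have "map2 write_move ts (map (\<lambda>a. (a, Stay)) (map scan ts)) = ts" for ts
    by (intro nth_equalityI) auto
  then show ?thesis using True by (simp add: tm_step_def hdelta_def halted_def)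
qed (simp add: tm_step_def hdelta_def halted_def)

lemma hdelta_ok:
  assumes "is_tm M" "q < num_states M" "length as = num_tapes M" "set as \<subseteq> {..<num_symbols M}"
  shows "fst (hdelta M q as) < num_states M" "length (snd (hdelta M q as)) = num_tapes M"
    "fst ` set (snd (hdelta M q as)) \<subseteq> {..<num_symbols M}"
  using assms unfolding hdelta_def is_tm_def by auto

lemma conf_ok_step:
  assumes "is_tm M" "conf_ok M c"
  shows "conf_ok M (tm_step M c)"
proof -
  obtain q' us where h: "hdelta M (fst c) (map scan (snd c)) = (q', us)" by fastforce
  have "set (map scan (snd c)) \<subseteq> {..<num_symbols M}" using assms(2) by (auto simp: conf_ok_def scan_def)
  then have us: "q' < num_states M" "length us = num_tapes M" "fst ` set us \<subseteq> {..<num_symbols M}"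
    using hdelta_ok[OF assms(1), of "fst c" "map scan (snd c)"] assms(2) h by (auto simp: conf_ok_def)
  have c: "tm_step M c = (q', map2 write_move (snd c) us)"
    using tm_step_hdelta[of c M] assms(2) h by (simp add: conf_ok_def)
  have "fst (write_move T u) i < num_symbols M" if "(T, u) \<in> set (zip (snd c) us)" for T u i
    using set_zip_leftD[OF that] set_zip_rightD[OF that] us(3) assms(2)
    by (force simp: write_move_def conf_ok_def)
  then show ?thesis using us assms(2) by (auto simp: c conf_ok_def)
qed

lemma tview_step:
  assumes "is_tm M" "conf_ok M c"
  shows "tview (tm_step M c) d = hcomb M (tview c 0) (tview c (d - 1)) (tview c d) (tview c (d + 1))"
proof -
  obtain q' us where h: "hdelta M (fst c) (map scan (snd c)) = (q', us)" by fastforce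
  have sc: "map (\<lambda>T. fst T (snd T)) (snd c) = map scan (snd c)" by (simp add: scan_def)
  have "set (map scan (snd c)) \<subseteq> {..<num_symbols M}" using assms(2) by (auto simp: conf_ok_def scan_def)
  then have us: "length us = num_tapes M"
    using hdelta_ok(2)[OF assms(1), of "fst c" "map scan (snd c)"] assms(2) h by (auto simp: conf_ok_def)
  have len: "length (snd c) = num_tapes M" using assms(2) by (simp add: conf_ok_def)
  have c: "tm_step M c = (q', map2 write_move (snd c) us)" using tm_step_hdelta[OF len] h by simp
  have "map (\<lambda>T. fst T (snd T + d)) (map2 write_move (snd c) us) =
    map (\<lambda>j. let u = (case snd (us ! j) of MoveLeft \<Rightarrow> tview c (d - 1) | Stay \<Rightarrow> tview c d | MoveRight \<Rightarrow> tview c (d + 1))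
        in if snd (snd u) then fst (us ! j) else fst (snd u) ! j) [0..<num_tapes M]"
    by (rule nth_equalityI)
      (auto simp: us len tview_def write_move_def Let_def algebra_simps split: move.split)
  then show ?thesis unfolding hcomb_def c by (simp add: tview_def[of "(q', map2 write_move (snd c) us)"]) (simp add: tview_def sc h)
qed

definition hconf :: "tm \<Rightarrow> bool list \<Rightarrow> nat \<Rightarrow> tm_conf" where
  "hconf M w t = (tm_step M ^^ t) (tm_init M w)"

lemma hconf_ok: "is_tm M \<Longrightarrow> conf_ok M (hconf M w t)"
proof (induction t)
  case 0
  have "word_cells v i < num_symbols M" for v i using 0 by (simp add: word_cells_def is_tm_def)
  then show ?case using 0 by (auto simp: hconf_def conf_ok_def tm_init_def is_tm_def)
qed (simp add: hconf_def conf_ok_step)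

text \<open>The additional bit in \<open>pm\<close> makes room for negative offsets and sets the
  simulated time \<open>2 ^ (pm - 1)\<close> to \<open>2 ^ length (b w)\<close>. The reduction in
  \<open>pcomb\<close> keeps the result in range even for arguments that do not arise from a
  configuration. The entry appended to the table is the blank after the word; for the empty word it
  lies under the heads, hence its flag.\<close>

definition hprog :: "tm \<Rightarrow> (bool list \<Rightarrow> unit list) \<Rightarrow> bool list \<Rightarrow> prog" where
  "hprog M b w = \<lparr>pm = Suc (length (b w)), pK = length (hviews M),
     pacc = filter (\<lambda>i. fst (hviews M ! i) = accept_state M) [0..<length (hviews M)],
     pcomb = (\<lambda>i j k l. hidx M (hcomb M (hviews M ! i) (hviews M ! j) (hviews M ! k) (hviews M ! l)) mod length (hviews M)),
     ptab = map (\<lambda>p. hidx M (0, (if snd p then 2 else 1) # replicate (num_tapes M - 1) 0, fst p)) (zip (True # replicate (length w) False) w) @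
       [hidx M (0, replicate (num_tapes M) 0, w = [])],
     pbl = hidx M (0, replicate (num_tapes M) 0, False)\<rparr>"

lemma hviews_large: "is_tm M \<Longrightarrow> 2 \<le> length (hviews M)"
proof -
  assume "is_tm M"
  then have "(0, replicate (num_tapes M) 0, False) \<in> set (hviews M)" "(0, replicate (num_tapes M) 0, True) \<in> set (hviews M)"
    by (auto simp: set_hviews is_tm_def)
  then have "card {(0 :: nat, replicate (num_tapes M) (0 :: nat), False), (0, replicate (num_tapes M) 0, True)} \<le> card (set (hviews M))"
    by (intro card_mono) auto
  then show ?thesis using card_length[of "hviews M"] by simp
qed

locale tm_reduction =
  fixes M :: tm and b :: "bool list \<Rightarrow> unit list" and w :: "bool list"
  assumes tm: "is_tm M" and large: "length w + 1 \<le> 2 ^ length (b w)"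
begin

abbreviation "H \<equiv> hprog M b w"

lemma zero_views: "(0, replicate (num_tapes M) 0, z) \<in> set (hviews M)"
  "x < 3 \<Longrightarrow> (0, x # replicate (num_tapes M - 1) 0, z) \<in> set (hviews M)"
  using tm by (auto simp: set_hviews is_tm_def)

lemma ptab_nth:
  assumes "i \<le> length w"
  shows "ptab H ! i = hidx M (tview (hconf M w 0) (int i))"
proof -
  have k: "num_tapes M = Suc (num_tapes M - 1)" using tm by (simp add: is_tm_def)
  have v: "tview (hconf M w 0) (int i) = (0, word_cells w (int i) # replicate (num_tapes M - 1) 0, i = 0)"
    by (simp add: tview_def hconf_def tm_init_def word_cells_def map_replicate_const)
  show ?thesis
  proof (cases "i < length w")
    case True
    have "(True # replicate (length w) False) ! i = (i = 0)" using True by (cases i) auto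
    then show ?thesis using True by (simp add: v hprog_def nth_append word_cells_def)
  next
    case False
    then have i: "i = length w" using assms by simp
    have "(0 :: nat) # replicate (num_tapes M - 1) 0 = replicate (num_tapes M) 0" by (subst (2) k) simp
    then show ?thesis unfolding i by (simp add: v[unfolded i] hprog_def nth_append word_cells_def)
  qed
qed

lemma length_ptab: "length (ptab H) = Suc (length w)"
  by (simp add: hprog_def)

lemma wf_H: "wf_prog H"
proof -
  have "(0 :: nat) < 2 ^ length (b w)" by simp
  then have lt: "Suc (length w) < 2 ^ Suc (length (b w))" using large unfolding power_Suc by linarith
  have pos: "0 < length (hviews M)" using hviews_large[OF tm] by linarith
  have e: "hidx M (0, (if z then 2 else 1) # replicate (num_tapes M - 1) 0, y) < length (hviews M)" for y z
    using hidx[OF zero_views(2)[of "if z then 2 else 1" y]] by (cases z) simp_all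
  have tab: "set (ptab H) \<subseteq> {0..<length (hviews M)}"
    using e[of True] e[of False] hidx[OF zero_views(1)] by (auto simp: hprog_def)
  show ?thesis
    unfolding wf_prog_def
  proof (intro conjI)
    show "length (ptab H) < 2 ^ pm H" unfolding length_ptab using lt by (simp add: hprog_def)
    show "set (ptab H) \<subseteq> {0..<pK H}" using tab by (simp add: hprog_def)
    show "pbl H < pK H" using hidx[OF zero_views(1)] by (simp add: hprog_def)
  qed (use hviews_large[OF tm] pos in \<open>auto simp: hprog_def\<close>)
qed

sublocale tm_prog H by unfold_locales (rule wf_H)

text \<open>A column at time \<open>t + 1\<close> depends on columns one offset away at time
  \<open>t\<close>, which explains the bound on \<open>\<bar>d\<bar> + int t\<close>: inside this
  cone the residues of negative offsets stay clear of the table of the input word.\<close>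

lemma val_tview:
  "\<bar>d\<bar> + int t \<le> 2 ^ length (b w) \<Longrightarrow> val t (nat (d mod int (2 ^ pm H))) = hidx M (tview (hconf M w t) d)"
proof (induction t arbitrary: d)
  case 0
  let ?h = "2 ^ length (b w) :: int"
  have N: "int (2 ^ pm H) = 2 * ?h" by (simp add: hprog_def)
  have "int (length w + 1) \<le> int (2 ^ length (b w))" using large by (rule of_nat_mono)
  then have h: "int (length w) + 1 \<le> ?h" by simp
  show ?case
  proof (cases "0 \<le> d \<and> d \<le> int (length w)")
    case True
    then have "d mod int (2 ^ pm H) = d" unfolding N using h by (intro mod_pos_pos_trivial) auto
    moreover have n: "nat d \<le> length w" using True by linarith
    ultimately show ?thesis using True ptab_nth[OF n] by (simp add: base_def length_ptab less_Suc_eq_le)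
  next
    case False
    \<comment> \<open>A negative offset is at least \<open>- (2 ^ length (b w))\<close>, so its
      residue lies in the upper half of the range, beyond the table.\<close>
    have "int (length w) < d mod int (2 ^ pm H)"
    proof (cases "d < 0")
      case True
      then have "- d \<le> ?h" using 0 by simp
      then have le: "?h \<le> d + 2 * ?h" by linarith
      have "d mod (2 * ?h) = (d + 2 * ?h) mod (2 * ?h)" by simp
      also have "\<dots> = d + 2 * ?h" using True h le by (intro mod_pos_pos_trivial) linarith+
      finally show ?thesis unfolding N using h le by linarith
    next
      case d: False
      have "d mod (2 * ?h) = d" using 0 d h by (intro mod_pos_pos_trivial) auto
      then show ?thesis unfolding N using False d by linarith
    qed
    then have "\<not> nat (d mod int (2 ^ pm H)) < length (ptab H)" by (simp add: length_ptab nat_less_iff)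
    moreover have "tview (hconf M w 0) d = (0, replicate (num_tapes M) 0, False)"
    proof -
      have k: "num_tapes M = Suc (num_tapes M - 1)" using tm by (simp add: is_tm_def)
      have "word_cells w d = 0" "d \<noteq> 0" using False by (auto simp: word_cells_def)
      then show ?thesis by (subst k) (simp add: tview_def hconf_def tm_init_def word_cells_def map_replicate_const)
    qed
    ultimately show ?thesis by (simp add: base_def) (simp add: hprog_def)
  qed
next
  case (Suc t)
  let ?N = "int (2 ^ pm H)" and ?c = "hconf M w t"
  have pos: "0 < ?N" by simp
  have m0: "nat (d mod ?N) < 2 ^ pm H" using pos by (simp add: nat_less_iff)
  have dm: "(if nat (d mod ?N) = 0 then 2 ^ pm H - 1 else nat (d mod ?N) - 1) = nat ((d - 1) mod ?N)"
  proof (cases "d mod ?N = 0")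
    case True
    have "(d - 1) mod ?N = (d mod ?N - 1) mod ?N" by (simp add: mod_diff_left_eq)
    also have "\<dots> = ?N - 1" unfolding True using pos by (simp add: zmod_minus1)
    also have "\<dots> = int (2 ^ pm H - 1)" by (simp add: of_nat_diff)
    finally have e: "(d - 1) mod ?N = int (2 ^ pm H - 1)" .
    show ?thesis unfolding e True nat_int by simp
  next
    case False
    have "0 \<le> d mod ?N" by (rule pos_mod_sign[OF pos])
    then have p: "0 < d mod ?N" using False by linarith
    have "(d - 1) mod ?N = (d mod ?N - 1) mod ?N" by (simp add: mod_diff_left_eq)
    also have "\<dots> = d mod ?N - 1" using p pos_mod_bound[OF pos, of d] by (intro mod_pos_pos_trivial) linarith+
    finally have e: "(d - 1) mod ?N = d mod ?N - 1" .
    have "(if nat x = 0 then y else nat x - 1) = nat (x - 1)" if "0 < x" for x :: int and y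
      using that by (simp add: nat_diff_distrib)
    from this[OF p] show ?thesis unfolding e .
  qed
  have dp: "(nat (d mod ?N) + 1) mod 2 ^ pm H = nat ((d + 1) mod ?N)"
  proof -
    have "int ((nat (d mod ?N) + 1) mod 2 ^ pm H) = (d + 1) mod ?N"
      unfolding zmod_int of_nat_add of_nat_1 nat_0_le[OF pos_mod_sign[OF pos]] by (rule mod_add_left_eq)
    then show ?thesis by (metis nat_int)
  qed
  \<comment> \<open>Going back one time step widens the admissible offsets by one, so all four
    columns used by \<open>hcomb\<close> lie within the range of the induction hypothesis.\<close>
  have a: "\<bar>0\<bar> + int t \<le> 2 ^ length (b w)" "\<bar>d - 1\<bar> + int t \<le> 2 ^ length (b w)" "\<bar>d\<bar> + int t \<le> 2 ^ length (b w)"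
    "\<bar>d + 1\<bar> + int t \<le> 2 ^ length (b w)" using Suc.prems by linarith+
  have "val t 0 = hidx M (tview ?c 0)" using Suc.IH[OF a(1)] by simp
  note IH = this Suc.IH[OF a(2)] Suc.IH[OF a(3)] Suc.IH[OF a(4)]
  note V = hidx[OF tview_in[OF hconf_ok[OF tm]], THEN conjunct1] hidx[OF tview_in[OF hconf_ok[OF tm]], THEN conjunct2]
  have "hconf M w (Suc t) = tm_step M ?c" by (simp add: hconf_def)
  then have tv: "tview (hconf M w (Suc t)) d = hcomb M (tview ?c 0) (tview ?c (d - 1)) (tview ?c d) (tview ?c (d + 1))"
    using tview_step[OF tm hconf_ok[OF tm]] by simp
  have pc: "pcomb H i j k l = hidx M (hcomb M (hviews M ! i) (hviews M ! j) (hviews M ! k) (hviews M ! l)) mod length (hviews M)" for i j k l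
    by (simp add: hprog_def)
  have "val (Suc t) (nat (d mod ?N)) = pcomb H (hidx M (tview ?c 0)) (hidx M (tview ?c (d - 1)))
      (hidx M (tview ?c d)) (hidx M (tview ?c (d + 1)))" by (simp only: val.simps dm dp IH)
  also have "\<dots> = hidx M (tview (hconf M w (Suc t)) d) mod length (hviews M)" by (simp only: pc V(2) tv)
  also have "\<dots> = hidx M (tview (hconf M w (Suc t)) d)" by (rule mod_less[OF V(1)])
  finally show ?case .
qed

lemma coverable_accept:
  "parikh_coverable (the_qdas H) the_goal \<longleftrightarrow> fst (hconf M w (2 ^ length (b w))) = accept_state M"
proof -
  have "val (2 ^ length (b w)) 0 = hidx M (tview (hconf M w (2 ^ length (b w))) 0)"
    using val_tview[of 0 "2 ^ length (b w)"] by simp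
  moreover have "pm H - 1 = length (b w)" by (simp add: hprog_def)
  moreover note hidx[OF tview_in[OF hconf_ok[OF tm]], of w "2 ^ length (b w)" 0]
  ultimately show ?thesis unfolding coverable_iff by (simp add: hprog_def) (simp add: tview_def)
qed

end

subsection \<open>Writing the instance in polynomial time\<close>

text \<open>The instance is written directly as bits, bottom up. This avoids showing that
  \<open>tree_bits\<close>, a recursion over trees, is itself computable in polynomial time.\<close>

definition num_bits :: "nat \<Rightarrow> bool list" where "num_bits n = tree_bits (Num n)"
definition node_bits :: "bool list list \<Rightarrow> bool list" where "node_bits bs = [True, True] @ concat bs @ [True, False]"

lemma tree_bits_eqs: "tree_bits (Num n) = num_bits n" "tree_bits (Node ts) = node_bits (map tree_bits ts)"
  by (simp_all add: num_bits_def node_bits_def)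

lemma PT_num_bits [PT_intros]: "PT f \<Longrightarrow> PT (\<lambda>x. num_bits (f x))"
  unfolding num_bits_def tree_bits.simps by (intro PT_intros)

lemma PT_node_bits [PT_intros]: "PT f \<Longrightarrow> PT (\<lambda>x. node_bits (f x))"
  unfolding node_bits_def by (intro PT_intros)

lemma PT_length [PT_intros]: "PT f \<Longrightarrow> PT (\<lambda>x. length (f x))"
proof -
  assume "PT f"
  then have "PT (\<lambda>x. case rev [0..<length (() # units (length (f x)))] of [] \<Rightarrow> 0 | y # ys \<Rightarrow> y)" by (intro PT_intros)
  then show ?thesis by simp
qed

lemma PT_add_const [PT_intros]: "PT f \<Longrightarrow> PT (\<lambda>x. (c :: nat) + f x)"
proof (induction c)
  case (Suc c)
  then show ?case using PT_Suc[of "\<lambda>x. c + f x"] by simp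
qed simp

lemma PT_mult_8_64 [PT_intros]:
  fixes f :: "'a :: enc \<Rightarrow> nat"
  assumes "PT f"
  shows "PT (\<lambda>x. 8 * f x)" "PT (\<lambda>x. 64 * f x)"
proof -
  have "PT (\<lambda>x. 2 * (2 * (2 * f x)))" "PT (\<lambda>x. 2 * (2 * (2 * (2 * (2 * (2 * f x))))))" by (intro PT_intros assms)+
  moreover have "2 * (2 * (2 * n)) = 8 * n" "2 * (2 * (2 * (2 * (2 * (2 * n))))) = 64 * n" for n :: nat by simp_all
  ultimately show "PT (\<lambda>x. 8 * f x)" "PT (\<lambda>x. 64 * f x)" by simp_all
qed

lemma PT_var [PT_intros]: "PT f \<Longrightarrow> PT (\<lambda>x. var c (f x))"
  unfolding var_def by (intro PT_intros)

lemma PT_lcode [PT_intros]: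
  "PT f \<Longrightarrow> PT (\<lambda>x. lcode (Cnt c j (f x)))" "PT f \<Longrightarrow> PT (\<lambda>x. lcode (LookS (f x) j))"
  unfolding lcode.simps by (intro PT_intros; assumption)+

lemma PT_lblk [PT_intros]: "PT f \<Longrightarrow> PT (\<lambda>x. lblk (LookS (f x) j))"
  unfolding lblk.simps by (intro PT_intros)

lemma PT_zip:
  assumes "PT f" "PT g"
  shows "PT (\<lambda>x. zip (f x) (g x))"
proof -
  let ?F = "\<lambda>p. case fst p of [] \<Rightarrow> p | y # ys \<Rightarrow> (case fst (snd p) of [] \<Rightarrow> p | z # zs \<Rightarrow> (ys, zs, (y, z) # snd (snd p)))"
  have it: "fst (snd ((?F ^^ i) (ys, zs, r))) = drop (min i (length ys)) zs \<and> fst ((?F ^^ i) (ys, zs, r)) = drop (min i (length zs)) ys \<and>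
      snd (snd ((?F ^^ i) (ys, zs, r))) = rev (take i (zip ys zs)) @ r"
    for i and ys :: "'b list" and zs :: "'c list" and r
  proof (induction i arbitrary: ys zs r)
    case (Suc i)
    show ?case
    proof (cases "ys = [] \<or> zs = []")
      case True
      have stuck: "(?F ^^ k) (ys, zs, r) = (ys, zs, r)" for k
        by (induction k) (use True in \<open>auto split: list.split\<close>)
      show ?thesis unfolding stuck using True by auto
    next
      case False
      then obtain y ys' z zs' where yz: "ys = y # ys'" "zs = z # zs'" by (meson neq_Nil_conv)
      show ?thesis unfolding yz using Suc[of ys' zs' "(y, z) # r"] by (simp add: funpow_Suc_right del: funpow.simps)
    qed
  qed simp
  have "PT (\<lambda>x. (?F ^^ length (f x)) (f x, g x, []))"
  proof (rule PT_iter[where B = "\<lambda>x. 3 * (siz (f x) + siz (g x)) + 10"])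
    show "PT (\<lambda>p :: 'a \<times> 'b list \<times> 'c list \<times> ('b \<times> 'c) list. ?F (snd p))" by (intro PT_intros)
    show "siz ((?F ^^ i) (f x, g x, [])) \<le> 3 * (siz (f x) + siz (g x)) + 10" for x i
    proof -
      define F :: "'b list \<times> 'c list \<times> ('b \<times> 'c) list \<Rightarrow> _" where "F = ?F"
      have step: "siz (F p) \<le> siz p" for p by (cases p) (auto simp: F_def split: list.split)
      have "siz ((F ^^ i) p) \<le> siz p" for p by (induction i) (auto intro: order_trans[OF step])
      from this[of "(f x, g x, [])"] show ?thesis unfolding F_def by simp
    qed
  qed (intro PT_intros pbd_intros PT_size assms)+
  from PT_rev[OF PT_snd[OF PT_snd[OF this]]]
  have "PT (\<lambda>x. rev (snd (snd ((?F ^^ length (f x)) (f x, g x, [])))))" .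
  moreover have "(\<lambda>x. rev (snd (snd ((?F ^^ length (f x)) (f x, g x, []))))) = (\<lambda>x. zip (f x) (g x))"
    using it[of "length (f x)" "f x" "g x" "[]" for x] by (intro ext) simp
  ultimately show ?thesis by (rule back_subst)
qed

definition edge_bits :: "nat \<Rightarrow> nat \<Rightarrow> edge list \<Rightarrow> bool list list" where
  "edge_bits b s es = map (\<lambda>e. tree_bits (Node [Num b, Num s, action_tree (fst e), Num (snd e)])) es"

lemma PT_edge_bits:
  assumes "PT b" "PT s"
  shows "PT (\<lambda>x. edge_bits (b x) (s x) [])"
    and "PT c \<Longrightarrow> PT s' \<Longrightarrow> PT (\<lambda>x. edge_bits (b x) (s x) (callc (c x) (s' x)))"
    and "PT i \<Longrightarrow> PT v \<Longrightarrow> PT s' \<Longrightarrow> PT (\<lambda>x. edge_bits (b x) (s x) (setc (i x) (v x) (s' x)))"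
    and "PT i \<Longrightarrow> PT vs \<Longrightarrow> PT (\<lambda>x. edge_bits (b x) (s x) (switchc (i x) (vs x)))"
    and "PT is \<Longrightarrow> PT s1 \<Longrightarrow> PT s2 \<Longrightarrow> PT (\<lambda>x. edge_bits (b x) (s x) (testz (is x) (s1 x) (s2 x)))"
proof -
  note defs = edge_bits_def callc_def setc_def switchc_def testz_def list.map map_map o_def action_tree.simps
    atom_tree.simps tree_bits_eqs fst_conv snd_conv
  note lift = PT_comp[OF assms(1) PT_fst[OF PT_id]] PT_comp[OF assms(2) PT_fst[OF PT_id]]
  show "PT (\<lambda>x. edge_bits (b x) (s x) [])" unfolding defs by (intro PT_intros)
  show "PT c \<Longrightarrow> PT s' \<Longrightarrow> PT (\<lambda>x. edge_bits (b x) (s x) (callc (c x) (s' x)))"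
    unfolding defs by (intro PT_intros assms)
  show "PT i \<Longrightarrow> PT v \<Longrightarrow> PT s' \<Longrightarrow> PT (\<lambda>x. edge_bits (b x) (s x) (setc (i x) (v x) (s' x)))"
    unfolding defs by (intro PT_intros assms)
  show "PT (\<lambda>x. edge_bits (b x) (s x) (switchc (i x) (vs x)))" if "PT i" "PT vs"
    unfolding defs by (intro PT_intros that lift PT_comp[OF that(1) PT_fst[OF PT_id]])
  show "PT (\<lambda>x. edge_bits (b x) (s x) (testz (is x) (s1 x) (s2 x)))" if "PT is" "PT s1" "PT s2"
    unfolding defs by (intro PT_intros assms that lift PT_comp[OF that(3) PT_fst[OF PT_id]])
qed

lemma PT_concat_const:
  assumes "\<And>x. x \<in> set xs \<Longrightarrow> PT (\<lambda>w. F w x)"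
  shows "PT (\<lambda>w. concat (map (F w) xs))"
  using assms
proof (induction xs)
  case Nil
  show ?case by (simp add: PT_const)
next
  case (Cons x xs)
  then show ?case using PT_append[of "\<lambda>w. F w x" "\<lambda>w. concat (map (F w) xs)"] by simp
qed

text \<open>A function of the labels is handled family by family: the labels of block A do not depend on the
  input, the others are indexed by an initial segment of the naturals.\<close>

lemma PT_labels:
  assumes "PT b"
    and "\<And>j. j < 4 \<Longrightarrow> PT (\<lambda>w. F w (MainS j))" "\<And>j. j < 6 \<Longrightarrow> PT (\<lambda>w. F w (ZS j))"
    and "\<And>x. x \<in> set (a_labels (length (hviews M))) \<Longrightarrow> PT (\<lambda>w. F w x)"
    and "\<And>c j. c < 4 \<Longrightarrow> j < 3 \<Longrightarrow> PT (\<lambda>p. F (fst p) (Cnt c j (snd p)))"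
    and "\<And>j. j < 6 \<Longrightarrow> PT (\<lambda>p. F (fst p) (LookS (snd p) j))"
  shows "PT (\<lambda>w. concat (map (F w) (labels (hprog M b w))))"
proof -
  have [simp]: "pm (hprog M b w) = Suc (length (b w))" "pK (hprog M b w) = length (hviews M)"
    "length (ptab (hprog M b w)) = Suc (length w)" for w by (simp_all add: hprog_def)
  have cc: "concat (map G (concat (map g xs))) = concat (map (\<lambda>x. concat (map G (g x))) xs)"
    for G :: "lbl \<Rightarrow> _" and g and xs :: "nat list" by (induction xs) auto
  have eq: "concat (map (F w) (labels (hprog M b w))) =
     concat (map (F w) (map MainS [0..<4] @ map ZS [0..<6] @ a_labels (length (hviews M)))) @
     concat (map (\<lambda>c. concat (map (\<lambda>j. concat (map (\<lambda>l. F w (Cnt c j l)) [0..<length (() # () # b w)])) [0..<3])) [0..<4]) @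
     concat (map (\<lambda>j. concat (map (\<lambda>l. F w (LookS l j)) [0..<length (() # () # units (length w))])) [0..<6])" for w
    by (simp add: labels_def o_def cc del: upt_Suc)
  show ?thesis
    unfolding eq
  proof (intro PT_append PT_concat_const)
    fix x assume "x \<in> set (map MainS [0..<4] @ map ZS [0..<6] @ a_labels (length (hviews M)))"
    then show "PT (\<lambda>w. F w x)" using assms(2-4) by auto
  next
    fix c j assume "c \<in> set [0..<4]" "j \<in> set [0..<3 :: nat]"
    then have "PT (\<lambda>p. F (fst p) (Cnt c j (snd p)))" using assms(5) by simp
    then show "PT (\<lambda>w. concat (map (\<lambda>l. F w (Cnt c j l)) [0..<length (() # () # b w)]))"
      by (intro PT_intros assms(1))
  next
    fix j assume "j \<in> set [0..<6 :: nat]"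
    then have "PT (\<lambda>p. F (fst p) (LookS (snd p) j))" using assms(6) by simp
    then show "PT (\<lambda>w. concat (map (\<lambda>l. F w (LookS l j)) [0..<length (() # () # units (length w))]))"
      by (intro PT_intros)
  qed
qed

section \<open>The code of the constructed instance\<close>

definition instance_tree :: "prog \<Rightarrow> tree" where
  "instance_tree P = Node [Num 0, Num 0, Node (map Num [0..<pK P]),
     Node (map Num (0 # map (var 0) [0..<pm P] @ map (var 1) [0..<pm P])), Node [Num 0], Node [],
     Node (map Num (blks P)),
     Node (concat (map (\<lambda>x. [Node [Num (lblk x), Num (lcode x)]]) (labels P))),
     Node (map (\<lambda>b. Node [Num b, Num (linit b)]) (blks P)),
     Node (map (\<lambda>b. Node [Num b, Num (lfinal (pm P) b)]) (blks P)),
     Node (concat (map (\<lambda>x. map (\<lambda>e. Node [Num (lblk x), Num (lcode x), action_tree (fst e), Num (snd e)]) (E P x)) (labels P))),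
     Node (concat (map (\<lambda>x. [Node [Num (lcode x), Num (the_goal (lcode x))]]) (labels P)))]"

lemma (in tm_prog) encodes: "encodes_instance A the_goal (tree_bits (instance_tree P))"
proof -
  have bl: "lblk x \<in> blocks A" if "x \<in> set (labels P)" for x using lblk_in[OF that] by (simp add: the_qdas_def)
  have B: "(b \<in> blocks A \<and> s \<in> block_states A b) \<longleftrightarrow> (\<exists>x\<in>set (labels P). b = lblk x \<and> s = lcode x)" for b s
    using bl by (auto simp: the_qdas_def)
  have S: "s \<in> all_states A \<longleftrightarrow> (\<exists>x\<in>set (labels P). s = lcode x)" for s
    unfolding all_states_iff using B by blast
  have T: "(b \<in> blocks A \<and> (s, a, s') \<in> block_trans A b) \<longleftrightarrow>
      (\<exists>x\<in>set (labels P). b = lblk x \<and> s = lcode x \<and> (a, s') \<in> set (E P x))" for b s a s'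
    using bl by (auto simp: the_qdas_def)
  show ?thesis
    unfolding encodes_instance_def instance_tree_def
  proof (intro exI conjI)
    show "tree_bits (Node [Num 0, Num 0, n1, n2, n3, n4, n5, n6, n7, n8, n9, n10]) =
      tree_bits (Node (Num (init_value A) # Num (main_block A) # [n1, n2, n3, n4, n5, n6, n7, n8, n9, n10]))"
      for n1 n2 n3 n4 n5 n6 n7 n8 n9 n10 by (simp add: the_qdas_def)
    have l: "lists_set X (Node us)" if "set us = X" for X us using that by (auto simp: lists_set_def)
    show "list_all2 lists_set
        [Num ` data_values A, Num ` variables A, Num ` cqid A, Num ` sqid A, Num ` blocks A,
         {Node [Num b, Num s] | b s. b \<in> blocks A \<and> s \<in> block_states A b},
         {Node [Num b, Num (init_state A b)] | b. b \<in> blocks A},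
         {Node [Num b, Num (final_state A b)] | b. b \<in> blocks A},
         {Node [Num b, Num s, action_tree a, Num s'] | b s a s'. b \<in> blocks A \<and> (s, a, s') \<in> block_trans A b},
         {Node [Num s, Num (the_goal s)] | s. s \<in> all_states A}]
        [Node (map Num [0..<pK P]), Node (map Num (0 # map (var 0) [0..<pm P] @ map (var 1) [0..<pm P])), Node [Num 0],
         Node [], Node (map Num (blks P)), Node (concat (map (\<lambda>x. [Node [Num (lblk x), Num (lcode x)]]) (labels P))),
     Node (map (\<lambda>b. Node [Num b, Num (linit b)]) (blks P)),
     Node (map (\<lambda>b. Node [Num b, Num (lfinal (pm P) b)]) (blks P)),
     Node (concat (map (\<lambda>x. map (\<lambda>e. Node [Num (lblk x), Num (lcode x), action_tree (fst e), Num (snd e)]) (E P x)) (labels P))),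
     Node (concat (map (\<lambda>x. [Node [Num (lcode x), Num (the_goal (lcode x))]]) (labels P)))]"
      unfolding list_all2_Cons list_all2_Nil
    proof (intro conjI TrueI l)
      show "set (concat (map (\<lambda>x. [Node [Num (lblk x), Num (lcode x)]]) (labels P))) =
         {Node [Num b, Num s] | b s. b \<in> blocks A \<and> s \<in> block_states A b}" unfolding B by auto
      show "set (concat (map (\<lambda>x. [Node [Num (lcode x), Num (the_goal (lcode x))]]) (labels P))) =
         {Node [Num s, Num (the_goal s)] | s. s \<in> all_states A}" unfolding S by auto
      show "set (concat (map (\<lambda>x. map (\<lambda>e. Node [Num (lblk x), Num (lcode x), action_tree (fst e), Num (snd e)]) (E P x)) (labels P))) =
         {Node [Num b, Num s, action_tree a, Num s'] | b s a s'. b \<in> blocks A \<and> (s, a, s') \<in> block_trans A b}"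
        unfolding T by force
    qed (auto simp: the_qdas_def)
  qed
qed

lemma edge_bits_if: "edge_bits b s (if c then es else es') = (if c then edge_bits b s es else edge_bits b s es')"
  by simp

lemma tree_bits_instance:
  "tree_bits (instance_tree P) = node_bits [num_bits 0, num_bits 0, node_bits (map num_bits [0..<pK P]),
     node_bits (num_bits 0 # map (\<lambda>l. num_bits (var 0 l)) [0..<pm P] @ map (\<lambda>l. num_bits (var 1 l)) [0..<pm P]),
     node_bits [num_bits 0], node_bits [], node_bits (map num_bits (blks P)),
     node_bits (concat (map (\<lambda>x. [node_bits [num_bits (lblk x), num_bits (lcode x)]]) (labels P))),
     node_bits (map (\<lambda>b. node_bits [num_bits b, num_bits (linit b)]) (blks P)),
     node_bits (map (\<lambda>b. node_bits [num_bits b, num_bits (lfinal (pm P) b)]) (blks P)),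
     node_bits (concat (map (\<lambda>x. edge_bits (lblk x) (lcode x) (E P x)) (labels P))),
     node_bits (concat (map (\<lambda>x. [node_bits [num_bits (lcode x), num_bits (the_goal (lcode x))]]) (labels P)))]"
  unfolding instance_tree_def tree_bits_eqs edge_bits_def
  by (simp add: tree_bits_eqs map_concat o_def del: tree_bits.simps)

text \<open>List access in terms of operations already known to be in \<open>PT\<close>: the
  numbered list is searched for the index, with 0 as default.\<close>

definition nth0 :: "nat list \<Rightarrow> nat \<Rightarrow> nat" where
  "nth0 xs i = (case filter (\<lambda>p. fst p = i) (zip [0..<length xs] xs) of [] \<Rightarrow> 0 | p # ps \<Rightarrow> snd p)"

lemma nth0: "i < length xs \<Longrightarrow> nth0 xs i = xs ! i"
proof -
  assume i: "i < length xs"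
  let ?f = "filter (\<lambda>p. fst p = i) (zip [0..<length xs] xs)"
  have "(i, xs ! i) \<in> set (zip [0..<length xs] xs)" unfolding in_set_zip by (rule exI[of _ i]) (simp add: i)
  then have m: "(i, xs ! i) \<in> set ?f" by simp
  have p: "p = (i, xs ! i)" if "p \<in> set ?f" for p
  proof -
    have "p \<in> set (zip [0..<length xs] xs)" "fst p = i" using that by simp_all
    then obtain k where "[0..<length xs] ! k = i" "xs ! k = snd p" "k < length xs" unfolding in_set_zip by blast
    then show ?thesis using \<open>fst p = i\<close> by (simp add: prod_eq_iff)
  qed
  show ?thesis
  proof (cases ?f)
    case Nil
    then show ?thesis using m unfolding Nil by simp
  next
    case (Cons q ps)
    have "q \<in> set ?f" unfolding Cons by simp
    then have "snd q = xs ! i" using p by (metis snd_conv)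
    then show ?thesis unfolding nth0_def Cons by simp
  qed
qed

lemma PT_nth0:
  assumes "PT f" "PT g"
  shows "PT (\<lambda>x. nth0 (f x) (g x))"
  unfolding nth0_def by (intro PT_intros PT_zip PT_comp[OF assms(2) PT_fst[OF PT_id]] assms)

context
  fixes M :: tm and b :: "bool list \<Rightarrow> unit list"
  assumes b: "PT b"
begin

abbreviation "HP w \<equiv> hprog M b w"

lemma HP_sel: "pm (HP w) = length (() # b w)" "pK (HP w) = length (hviews M)"
   "length (ptab (HP w)) = length (() # units (length w))"
  by (simp_all add: hprog_def)

text \<open>These components depend on the machine alone. Evaluating them at the empty word exhibits
  them as constants with respect to the input.\<close>

definition "HP_acc = pacc (HP [])"
definition "HP_comb = pcomb (HP [])"
definition "HP_bl = pbl (HP [])"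

lemma HP_const: "pacc (HP w) = HP_acc" "pcomb (HP w) = HP_comb" "pbl (HP w) = HP_bl"
  by (simp_all add: HP_acc_def HP_comb_def HP_bl_def hprog_def)

lemma PT_ptab: "PT (\<lambda>w. ptab (HP w))"
proof -
  let ?r = "replicate (num_tapes M - 1) (0 :: nat)" and ?a = "\<lambda>z. hidx M (0, replicate (num_tapes M) 0, z)"
  let ?h = "\<lambda>p. hidx M (0, (if snd p then 2 else 1) # ?r, fst p)"
  let ?g = "\<lambda>p. if fst p then (if snd p then hidx M (0, 2 # ?r, True) else hidx M (0, 1 # ?r, True))
      else (if snd p then hidx M (0, 2 # ?r, False) else hidx M (0, 1 # ?r, False))"
  have "ptab (HP w) = map ?g (zip (True # map (\<lambda>_. False) w) w) @ [if w = [] then ?a True else ?a False]" for w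
  proof -
    have 1: "map ?h zs = map ?g zs" for zs by (intro map_cong refl) auto
    have 2: "replicate (length w) False = map (\<lambda>_. False) w" by (simp add: map_replicate_const)
    have 3: "?a (w = []) = (if w = [] then ?a True else ?a False)" by simp
    have "ptab (HP w) = map ?h (zip (True # replicate (length w) False) w) @ [?a (w = [])]" by (simp only: hprog_def prog.select_convs)
    then show ?thesis unfolding 1 2 3 .
  qed
  then show ?thesis by (simp only:) (intro PT_intros PT_zip)
qed

lemma PT_pm: "PT (\<lambda>w. pm (HP w))" unfolding HP_sel by (intro PT_intros b)

lemma PT_upt_pm: "PT (\<lambda>w. [0..<pm (HP w)])" unfolding HP_sel by (intro PT_intros b)

lemma PT_upt_tab: "PT (\<lambda>w. [0..<length (ptab (HP w))])" unfolding HP_sel by (intro PT_intros)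

lemmas PT_upt_fst = PT_comp[OF PT_upt_pm PT_fst[OF PT_id]] PT_comp[OF PT_upt_tab PT_fst[OF PT_id]]

lemma PT_vars: "PT (\<lambda>w. map (var c) [0..<pm (HP w)])" by (intro PT_intros PT_upt_pm)

lemma PT_edges_MainS: "PT (\<lambda>w. edge_bits (lblk (MainS j)) (lcode (MainS j)) (E (HP w) (MainS j)))"
proof -
  have "PT (\<lambda>w. length (() # b w) - 1)" by simp (intro PT_intros b)
  then show ?thesis unfolding E.simps edge_bits_if HP_sel HP_const
    by (intro PT_if PT_edge_bits PT_const PT_var)
qed

lemma PT_edges_ZS: "PT (\<lambda>w. edge_bits (lblk (ZS j)) (lcode (ZS j)) (E (HP w) (ZS j)))"
  unfolding E.simps edge_bits_if by (intro PT_if PT_edge_bits PT_const PT_vars)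

lemma PT_edges_AS:
  assumes "x \<in> set (a_labels (length (hviews M)))"
  shows "PT (\<lambda>w. edge_bits (lblk x) (lcode x) (E (HP w) x))"
proof (cases "x = AS [0]")
  case True
  have "E (HP w) (AS [0]) = testz (map (var 1) [0..<pm (HP w)]) (lcode (AS [1])) (lcode (AS [2]))" for w by simp
  then show ?thesis unfolding True by (simp only:) (intro PT_edge_bits PT_const PT_vars)
next
  case False
  obtain ys where ys: "x = AS ys" using assms by (auto simp: a_labels_def)
  \<comment> \<open>Among the labels of block 1 only \<open>AS [0]\<close> refers to the number of
    bits; the edges of all others are the same for every input.\<close>
  have "E (HP w) x = E (HP []) x" for w
    using False unfolding ys E.simps HP_sel(2) HP_const by (auto split: list.split)
  then have "(\<lambda>w. edge_bits (lblk x) (lcode x) (E (HP w) x)) = (\<lambda>w. edge_bits (lblk x) (lcode x) (E (HP []) x))" by metis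
  then show ?thesis using PT_const by metis
qed

lemma mem_upt: "l \<in> {0..<n} \<longleftrightarrow> l \<in> set [0..<n]" for l n :: nat
  by simp

lemma PT_edges_Cnt:
  "PT (\<lambda>p. edge_bits (lblk (Cnt c j (snd p))) (lcode (Cnt c j (snd p))) (E (HP (fst p)) (Cnt c j (snd p))))"
  unfolding E.simps edge_bits_if lblk.simps mem_upt
  by (intro PT_if PT_edge_bits PT_not PT_member PT_const PT_lcode PT_var PT_snd PT_id PT_Cons PT_Pair PT_Suc
      PT_upt_fst PT_comp[OF PT_pm PT_fst[OF PT_id]])

lemma PT_edges_LookS:
  "PT (\<lambda>p. edge_bits (lblk (LookS (snd p) j)) (lcode (LookS (snd p) j)) (E (HP (fst p)) (LookS (snd p) j)))"
proof -
  have eq: "edge_bits (lblk (LookS l j)) (lcode (LookS l j)) (E (HP w) (LookS l j)) =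
    (if l \<notin> set [0..<length (ptab (HP w))] then
       (if j = 0 then edge_bits (lblk (LookS l j)) (lcode (LookS l j)) (setc 0 HP_bl (lcode (LookS l 5)))
        else edge_bits (lblk (LookS l j)) (lcode (LookS l j)) [])
     else if j = 0 then edge_bits (lblk (LookS l j)) (lcode (LookS l j)) (testz (map (var 0) [0..<pm (HP w)]) (lcode (LookS l 1)) (lcode (LookS l 2)))
     else if j = 1 then edge_bits (lblk (LookS l j)) (lcode (LookS l j)) (setc 0 (nth0 (ptab (HP w)) l) (lcode (LookS l 5)))
     else if j = 2 then edge_bits (lblk (LookS l j)) (lcode (LookS l j)) (callc 5 (lcode (LookS l 3)))
     else if j = 3 then edge_bits (lblk (LookS l j)) (lcode (LookS l j)) (callc (lblk (LookS (Suc l) 0)) (lcode (LookS l 4)))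
     else if j = 4 then edge_bits (lblk (LookS l j)) (lcode (LookS l j)) (callc 3 (lcode (LookS l 5)))
     else edge_bits (lblk (LookS l j)) (lcode (LookS l j)) [])" for l w
    unfolding E.simps edge_bits_if HP_const by (simp add: nth0 del: lblk.simps)
  show ?thesis unfolding eq
    by (intro PT_if PT_edge_bits PT_not PT_member PT_const PT_lcode PT_lblk PT_snd PT_id PT_Suc PT_nth0
      PT_comp[OF PT_ptab PT_fst[OF PT_id]] PT_comp[OF PT_vars PT_fst[OF PT_id]] PT_upt_fst)
qed

lemma PT_edges: "PT (\<lambda>w. concat (map (\<lambda>x. edge_bits (lblk x) (lcode x) (E (HP w) x)) (labels (HP w))))"
  by (rule PT_labels[OF b PT_edges_MainS PT_edges_ZS PT_edges_AS PT_edges_Cnt PT_edges_LookS])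

lemma PT_names: "PT (\<lambda>w. concat (map (\<lambda>x. [node_bits [num_bits (lblk x), num_bits (lcode x)]]) (labels (HP w))))"
  by (rule PT_labels[OF b]; (unfold lblk.simps(4))?; intro PT_intros)

lemma PT_goals: "PT (\<lambda>w. concat (map (\<lambda>x. [node_bits [num_bits (lcode x), num_bits (the_goal (lcode x))]]) (labels (HP w))))"
proof -
  have tg: "the_goal s = (if s = lcode (MainS 3) then 1 else 0)" for s by (simp add: the_goal_def)
  show ?thesis unfolding tg by (rule PT_labels[OF b]; intro PT_intros)
qed

lemma map_blks: "map h (blks (HP w)) = [h 0, h 1, h 2, h 3, h 4, h 5, h 6] @
    map (\<lambda>l. h (lblk (LookS l 0))) [0..<length (() # () # units (length w))]"
  by (simp add: blks_def HP_sel o_def del: upt_Suc lblk.simps)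

lemma lfinal_eqs: "lfinal k 0 = lcode (MainS 3)" "lfinal k 1 = lcode (AS [15])" "lfinal k 2 = lcode (ZS 5)"
  "lfinal k 3 = lcode (Cnt 0 0 k)" "lfinal k 4 = lcode (Cnt 1 0 k)" "lfinal k 5 = lcode (Cnt 2 0 k)"
  "lfinal k 6 = lcode (Cnt 3 0 k)" "lfinal k (lblk (LookS l 0)) = lcode (LookS l 5)"
  "linit (lblk (LookS l 0)) = lcode (LookS l 0)"
  by (simp_all add: lfinal_def linit_def)

lemma PT_blks: "PT (\<lambda>w. map num_bits (blks (HP w)))"
  "PT (\<lambda>w. map (\<lambda>b. node_bits [num_bits b, num_bits (linit b)]) (blks (HP w)))"
  "PT (\<lambda>w. map (\<lambda>b. node_bits [num_bits b, num_bits (lfinal (pm (HP w)) b)]) (blks (HP w)))"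
  unfolding map_blks lfinal_eqs by (intro PT_intros PT_pm)+

lemma PT_instance: "PT (\<lambda>w. tree_bits (instance_tree (HP w)))"
proof -
  have vars: "PT (\<lambda>w. map (\<lambda>l. num_bits (var c l)) [0..<pm (HP w)])" for c by (intro PT_intros PT_upt_pm)
  show ?thesis
    unfolding tree_bits_instance HP_sel(2)
    by (intro PT_node_bits PT_Cons PT_const PT_append PT_num_bits vars PT_edges PT_names PT_goals PT_blks)
qed

end

section \<open>The reduction\<close>

lemma tree_bits_inj: "tree_bits s = tree_bits t \<longleftrightarrow> s = t"
  using parse_tree_bits by (metis option.inject)

lemma poly_le_power: "\<exists>k. \<forall>n. poly (p :: nat poly) n \<le> (n + 2) ^ k"
proof -
  have "pbd (\<lambda>n. n) (poly p)"
  proof (induction p)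
    case 0
    then show ?case using pbd_const[of "\<lambda>n. n" 0] by (simp add: fun_eq_iff)
  next
    case (pCons a p)
    then have "pbd (\<lambda>n. n) (\<lambda>n. a + n * poly p n)" by (intro pbd_intros)
    then show ?case by (simp add: poly_pCons[abs_def] fun_eq_iff)
  qed
  then show ?thesis by (simp add: pbd_def)
qed

lemma PT_units_power: "PT (\<lambda>w :: bool list. units ((length w + 2) ^ k))"
proof (induction k)
  case (Suc k)
  have "PT (\<lambda>w :: bool list. units (length (List.product (() # () # units (length w)) (units ((length w + 2) ^ k)))))"
    by (intro PT_intros Suc)
  then show ?case by simp
qed (simp add: PT_const)

text \<open>The constructed systems are synchronous and concurrent, so one reduction serves every
  class between these systems and all synchronous ones; both claims of the theorem are
  instances.\<close>

lemma EXPTIME_hard: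
  assumes C: "\<And>A :: nat_qdas. synchronous A \<and> concurrent A \<Longrightarrow> C A" "\<And>A. C A \<Longrightarrow> synchronous A"
  shows "EXPTIME_hard (parikh_coverability C)"
  unfolding EXPTIME_hard_def
proof
  fix L assume "L \<in> EXPTIME"
  then obtain M p where M: "is_tm M" "decides_in_time M L (\<lambda>n. 2 ^ poly p n)" unfolding EXPTIME_def by blast
  obtain k where k: "\<And>n. poly p n \<le> (n + 2) ^ k" using poly_le_power by blast
  \<comment> \<open>The first block makes \<open>2 ^ length (b w)\<close> exceed the running time of
    \<open>M\<close>; the second keeps \<open>length w + 1\<close> below that power, so that the
    table of the input fits.\<close>
  define b where "b w = units ((length w + 2) ^ k) @ units (length w)" for w :: "bool list"
  have "PT b" unfolding b_def by (intro PT_intros PT_units_power)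
  define g where "g w = tree_bits (instance_tree (hprog M b w))" for w
  have "w \<in> L \<longleftrightarrow> g w \<in> parikh_coverability C" for w
  proof -
    have lb: "length (b w) = (length w + 2) ^ k + length w" by (simp add: b_def)
    have "length w + 1 \<le> length (b w)" unfolding lb by simp
    then have large: "length w + 1 \<le> 2 ^ length (b w)" using less_exp[of "length (b w)"] by linarith
    interpret tm_reduction M b w by unfold_locales (rule M(1), rule large)
    obtain t where t: "t \<le> 2 ^ poly p (length w)" "halted M (hconf M w t)" "fst (hconf M w t) = accept_state M \<longleftrightarrow> w \<in> L"
      using M(2) unfolding decides_in_time_def Let_def hconf_def by blast
    have stay: "hconf M w (t + i) = hconf M w t" for i
      using t(2) by (induction i) (auto simp: hconf_def tm_step_def)
    have "(2 :: nat) ^ poly p (length w) \<le> 2 ^ length (b w)"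
      using k[of "length w"] lb by (intro power_increasing) auto
    then have "t \<le> 2 ^ length (b w)" using t(1) by linarith
    then have "hconf M w (2 ^ length (b w)) = hconf M w t" using stay[of "2 ^ length (b w) - t"] by simp
    then have cov: "parikh_coverable (the_qdas H) the_goal \<longleftrightarrow> w \<in> L" using coverable_accept t(3) by simp
    have enc: "encodes_instance (the_qdas H) the_goal (g w)" unfolding g_def by (rule encodes)
    show ?thesis
    proof
      assume "w \<in> L"
      then show "g w \<in> parikh_coverability C"
        unfolding parikh_coverability_def using cov enc is_qdas C(1) synchronous concurrent by blast
    next
      assume "g w \<in> parikh_coverability C"
      then obtain B f where B: "is_qdas B" "C B" "encodes_instance B f (g w)" "parikh_coverable B f"
        unfolding parikh_coverability_def by blast
      obtain t1 where t1: "g w = tree_bits t1" "shape t1" "view t1 B f" using view_encodes[OF B(3)] by blast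
      obtain t2 where t2: "g w = tree_bits t2" "shape t2" "view t2 (the_qdas H) the_goal" using view_encodes[OF enc] by blast
      \<comment> \<open>The system \<open>B\<close> behind the word need not be the constructed one,
        but both have the same tree. As \<open>decide\<close> looks only at the tree, they agree on
        coverability.\<close>
      have "t2 = t1" using t1(1) t2(1) tree_bits_inj by simp
      then show "w \<in> L"
        using instance_view.decide_iff[OF instance_view_tree[OF B(1) C(2)[OF B(2)] t1(2,3)]] B(4)
          instance_view.decide_iff[OF instance_view_tree[OF is_qdas synchronous t2(2,3)]] cov by simp
    qed
  qed
  moreover have "polytime_computable g" unfolding g_def[abs_def] by (rule PT_polytime_computable[OF PT_instance[OF \<open>PT b\<close>]])
  ultimately show "polytime_reducible L (parikh_coverability C)" unfolding polytime_reducible_def by blast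
qed

theorem theorem1:
  "EXPTIME_complete (parikh_coverability synchronous) \<and>
   EXPTIME_complete (parikh_coverability (\<lambda>A. synchronous A \<and> concurrent A))"
proof -
  have "EXPTIME_hard (parikh_coverability synchronous)"
    "EXPTIME_hard (parikh_coverability (\<lambda>A. synchronous A \<and> concurrent A))" by (rule EXPTIME_hard; simp)+
  then show ?thesis
    unfolding EXPTIME_complete_def using synchronous_EXPTIME synchronous_concurrent_EXPTIME by simp
qed

end
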